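(* Let $A=kQ/I$ be a monomial algebra. Then there is a bijection $$\{\text{perfect paths in }A\}\;\stackrel{1:1}{\longleftrightarrow}\;\mathrm{ind}\,A\text{-}\underline{\mathrm{Gproj}}$$ sending a perfect path $p$ to (the isomorphism class of) the $A$-module $Ap$.
   Context: Let $k$ be a field and $Q$ a finite quiver. Paths are written from right to left: a path of length $n$ is $p=\alpha_n\cdots\alpha_2\alpha_1$ with arrows satisfying $s(\alpha_i)=t(\alpha_{i-1})$, and $s(p)$, $t(p)$ denote its starting and terminating vertices; $e_i$ is the trivial path at vertex $i$; a path is nontrivial if its length is at least one; $pq$ is the concatenation when $s(p)=t(q)$ (and $0$ in the path algebra $kQ$ otherwise). A two-sided ideal $I$ of $kQ$ is admissible if $J^d\subseteq I\subseteq J^2$ for some $d\ge 2$, where $J$ is the ideal generated by all arrows. An admissible ideal is monomial if it is generated by some paths of length at least two; then $A=kQ/I$ is called a monomial algebra (it is finite-dimensional). A path $p$ is a nonzero path in $A$ if $p\notin I$; it is identified with its image in $A$. If a path $p$ lies in $I$ one writes $p=0$ in $A$. $Ap$ denotes the left ideal of $A$ generated by $p$. A pair $(p,q)$ of nonzero paths in $A$ is perfect if: (P1) both $p$ and $q$ are nontrivial, $s(p)=t(q)$ and $pq=0$ in $A$; (P2) if $pq'=0$ in $A$ for a nonzero path $q'$ with $t(q')=s(p)$, then $q'=qq''$ for some path $q''$; (P3) if $p'q=0$ in $A$ for a nonzero path $p'$ with $s(p')=t(q)$, then $p'=p''p$ for some path $p''$. A nonzero path $p$ in $A$ is a perfect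 path if there is a sequence $p=p_1,p_2,\dots,p_n,p_{n+1}=p$ ($n\ge 1$) of nonzero paths such that $(p_i,p_{i+1})$ is a perfect pair for all $1\le i\le n$. Modules are finite-dimensional left modules. A module $M$ is Gorenstein-projective if it is isomorphic to a cocycle $Z^i(P^\bullet)$ of an acyclic complex $P^\bullet$ of (finite-dimensional) projective $A$-modules such that $\mathrm{Hom}_A(P^\bullet,A)$ is also acyclic. $A\text{-}\underline{\mathrm{Gproj}}$ is the stable category of Gorenstein-projective modules: its objects are the Gorenstein-projective modules and its morphism spaces are $\underline{\mathrm{Hom}}_A(X,Y)=\mathrm{Hom}_A(X,Y)/P(X,Y)$, where $P(X,Y)$ consists of the homomorphisms factoring through a projective module. $\mathrm{ind}\,A\text{-}\underline{\mathrm{Gproj}}$ is the set of isomorphism classes of indecomposable objects of this (Krull-Schmidt) category, which is identified with the set of isomorphism classes of indecomposable non-projective Gorenstein-projective $A$-modules. *)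

theory Defs
  imports
    "HOL-Algebra.Module"
    "HOL-Algebra.QuotRing"
    "HOL-Algebra.Ideal_Product"
    "Graph_Theory.Digraph"
    "Graph_Theory.Arc_Walk"
begin

section \<open>Left modules over a not necessarily commutative ring\<close>

text \<open>
  The locale \<^locale>\<open>module\<close> requires a commutative ring. Its record type is reused here; the
  ring-multiplication fields of a module record play no role.
\<close>

locale left_module = R?: ring R + M?: abelian_group M
  for R :: "('a, 'r) ring_scheme" (structure) and M :: "('a, 'm, 'x) module_scheme" (structure) +
  assumes smult_closed [simp, intro]:
      "\<lbrakk>a \<in> carrier R; x \<in> carrier M\<rbrakk> \<Longrightarrow> a \<odot>\<^bsub>M\<^esub> x \<in> carrier M"
    and smult_l_distr:
      "\<lbrakk>a \<in> carrier R; b \<in> carrier R; x \<in> carrier M\<rbrakk> \<Longrightarrow>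
        (a \<oplus> b) \<odot>\<^bsub>M\<^esub> x = a \<odot>\<^bsub>M\<^esub> x \<oplus>\<^bsub>M\<^esub> b \<odot>\<^bsub>M\<^esub> x"
    and smult_r_distr:
      "\<lbrakk>a \<in> carrier R; x \<in> carrier M; y \<in> carrier M\<rbrakk> \<Longrightarrow>
        a \<odot>\<^bsub>M\<^esub> (x \<oplus>\<^bsub>M\<^esub> y) = a \<odot>\<^bsub>M\<^esub> x \<oplus>\<^bsub>M\<^esub> a \<odot>\<^bsub>M\<^esub> y"
    and smult_assoc:
      "\<lbrakk>a \<in> carrier R; b \<in> carrier R; x \<in> carrier M\<rbrakk> \<Longrightarrow>
        (a \<otimes> b) \<odot>\<^bsub>M\<^esub> x = a \<odot>\<^bsub>M\<^esub> (b \<odot>\<^bsub>M\<^esub> x)"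
    and smult_one [simp]: "x \<in> carrier M \<Longrightarrow> \<one> \<odot>\<^bsub>M\<^esub> x = x"

definition regular_module :: "('a, 'r) ring_scheme \<Rightarrow> ('a, 'a) module" where
  "regular_module A = \<lparr>carrier = carrier A, monoid.mult = monoid.mult A, one = \<one>\<^bsub>A\<^esub>,
     ring.zero = \<zero>\<^bsub>A\<^esub>, add = add A, module.smult = monoid.mult A\<rparr>"

definition left_ideal_gen :: "('a, 'r) ring_scheme \<Rightarrow> 'a \<Rightarrow> ('a, 'a) module" where
  "left_ideal_gen A x = (regular_module A)\<lparr>carrier := (\<lambda>a. a \<otimes>\<^bsub>A\<^esub> x) ` carrier A\<rparr>"

text \<open>
  Homomorphisms are extensional functions, so that equality of homomorphisms is equality in HOL.
\<close>

definition lhom :: "('a, 'r) ring_scheme \<Rightarrow> ('a, 'm) module \<Rightarrow> ('a, 'n) module \<Rightarrow> ('m \<Rightarrow> 'n) set"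
  where "lhom A M N = {f \<in> carrier M \<rightarrow>\<^sub>E carrier N.
    (\<forall>x\<in>carrier M. \<forall>y\<in>carrier M. f (x \<oplus>\<^bsub>M\<^esub> y) = f x \<oplus>\<^bsub>N\<^esub> f y) \<and>
    (\<forall>a\<in>carrier A. \<forall>x\<in>carrier M. f (a \<odot>\<^bsub>M\<^esub> x) = a \<odot>\<^bsub>N\<^esub> f x)}"

definition id_hom :: "('a, 'm) module \<Rightarrow> 'm \<Rightarrow> 'm" where
  "id_hom M = (\<lambda>x\<in>carrier M. x)"

definition zero_hom :: "('a, 'm) module \<Rightarrow> ('a, 'n) module \<Rightarrow> 'm \<Rightarrow> 'n" where
  "zero_hom M N = (\<lambda>x\<in>carrier M. \<zero>\<^bsub>N\<^esub>)"

definition add_hom :: "('a, 'm) module \<Rightarrow> ('a, 'n) module \<Rightarrow> ('m \<Rightarrow> 'n) \<Rightarrow> ('m \<Rightarrow> 'n) \<Rightarrow> 'm \<Rightarrow> 'n" where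
  "add_hom M N f g = (\<lambda>x\<in>carrier M. f x \<oplus>\<^bsub>N\<^esub> g x)"

definition diff_hom :: "('a, 'm) module \<Rightarrow> ('a, 'n) module \<Rightarrow> ('m \<Rightarrow> 'n) \<Rightarrow> ('m \<Rightarrow> 'n) \<Rightarrow> 'm \<Rightarrow> 'n" where
  "diff_hom M N f g = (\<lambda>x\<in>carrier M. f x \<ominus>\<^bsub>N\<^esub> g x)"

definition liso :: "('a, 'r) ring_scheme \<Rightarrow> ('a, 'm) module \<Rightarrow> ('a, 'n) module \<Rightarrow> bool" where
  "liso A M N \<longleftrightarrow> (\<exists>f\<in>lhom A M N. bij_betw f (carrier M) (carrier N))"

definition kernel_module :: "('a, 'm) module \<Rightarrow> ('a, 'n) module \<Rightarrow> ('m \<Rightarrow> 'n) \<Rightarrow> ('a, 'm) module" where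
  "kernel_module M N f = M\<lparr>carrier := {x \<in> carrier M. f x = \<zero>\<^bsub>N\<^esub>}\<rparr>"

definition indecomposable_module :: "('a, 'r) ring_scheme \<Rightarrow> ('a, 'm) module \<Rightarrow> bool" where
  "indecomposable_module A M \<longleftrightarrow> carrier M \<noteq> {\<zero>\<^bsub>M\<^esub>} \<and>
    (\<forall>X Y. submodule X A M \<and> submodule Y A M \<and>
       X \<inter> Y = {\<zero>\<^bsub>M\<^esub>} \<and> X <+>\<^bsub>M\<^esub> Y = carrier M \<longrightarrow> X = {\<zero>\<^bsub>M\<^esub>} \<or> Y = {\<zero>\<^bsub>M\<^esub>})"


section \<open>Finite-dimensional modules\<close>

text \<open>
  An algebra over the field \<open>'k\<close> is a ring \<open>A\<close> together with its structure map \<open>\<eta>\<close> from \<open>'k\<close> to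
  (the centre of) \<open>A\<close>; a scalar \<open>c\<close> acts on an \<open>A\<close>-module as \<open>\<eta> c\<close>.
\<close>

definition fd_module :: "('a, 'r) ring_scheme \<Rightarrow> ('k::field \<Rightarrow> 'a) \<Rightarrow> ('a, 'm) module \<Rightarrow> bool" where
  "fd_module A \<eta> M \<longleftrightarrow> left_module A M \<and>
    (\<exists>B. finite B \<and> B \<subseteq> carrier M \<and>
      (\<forall>x\<in>carrier M. \<exists>c. x = (\<Oplus>\<^bsub>M\<^esub>b\<in>B. \<eta> (c b) \<odot>\<^bsub>M\<^esub> b)))"

text \<open>
  Quantification over "all finite-dimensional modules" needs one fixed carrier type. The infinite
  sequences over \<open>'k\<close> contain a copy of every \<open>'k\<^sup>n\<close>, so every finite-dimensional module is
  isomorphic to one whose carrier is a subset of this type (with arbitrary operations).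
\<close>

type_synonym ('a, 'k) fmod = "('a, nat \<Rightarrow> 'k) module"

definition iso_class :: "('a, 'r) ring_scheme \<Rightarrow> ('k::field \<Rightarrow> 'a) \<Rightarrow> ('a, 'm) module \<Rightarrow> ('a, 'k) fmod set"
  where "iso_class A \<eta> M = {N. fd_module A \<eta> N \<and> liso A M N}"

definition projective :: "('a, 'r) ring_scheme \<Rightarrow> ('k::field \<Rightarrow> 'a) \<Rightarrow> ('a, 'm) module \<Rightarrow> bool" where
  "projective A \<eta> P \<longleftrightarrow> fd_module A \<eta> P \<and>
    (\<forall>(X :: ('a, 'k) fmod) (Y :: ('a, 'k) fmod) g f.
       fd_module A \<eta> X \<and> fd_module A \<eta> Y \<and>
       g \<in> lhom A X Y \<and> g ` carrier X = carrier Y \<and> f \<in> lhom A P Y \<longrightarrow>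
       (\<exists>h\<in>lhom A P X. compose (carrier P) g h = f))"


section \<open>Gorenstein-projective modules\<close>

definition acyclic_complex ::
  "('a, 'r) ring_scheme \<Rightarrow> (int \<Rightarrow> ('a, 'm) module) \<Rightarrow> (int \<Rightarrow> 'm \<Rightarrow> 'm) \<Rightarrow> bool" where
  "acyclic_complex A P d \<longleftrightarrow>
    (\<forall>i. d i \<in> lhom A (P i) (P (i + 1))) \<and>
    (\<forall>i. d i ` carrier (P i) = {x \<in> carrier (P (i + 1)). d (i + 1) x = \<zero>\<^bsub>P (i + 2)\<^esub>})"

text \<open>
  Acyclicity of the complex with terms \<open>Hom(P\<^sup>i, N)\<close>, whose differentials
  \<open>Hom(P\<^sup>i\<^sup>+\<^sup>1, N) \<rightarrow> Hom(P\<^sup>i, N)\<close> are precomposition with \<open>d\<^sup>i\<close>, stated at the term \<open>Hom(P\<^sup>i\<^sup>+\<^sup>1, N)\<close>.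
\<close>

definition Hom_acyclic ::
  "('a, 'r) ring_scheme \<Rightarrow> (int \<Rightarrow> ('a, 'm) module) \<Rightarrow> (int \<Rightarrow> 'm \<Rightarrow> 'm) \<Rightarrow> ('a, 'n) module \<Rightarrow> bool" where
  "Hom_acyclic A P d N \<longleftrightarrow>
    (\<forall>i. (\<lambda>g. compose (carrier (P (i + 1))) g (d (i + 1))) ` lhom A (P (i + 2)) N =
         {f \<in> lhom A (P (i + 1)) N. compose (carrier (P i)) f (d i) = zero_hom (P i) N})"

definition gorenstein_projective ::
  "('a, 'r) ring_scheme \<Rightarrow> ('k::field \<Rightarrow> 'a) \<Rightarrow> ('a, 'm) module \<Rightarrow> bool" where
  "gorenstein_projective A \<eta> M \<longleftrightarrow> fd_module A \<eta> M \<and>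
    (\<exists>(P :: int \<Rightarrow> ('a, 'k) fmod) d i.
       (\<forall>j. projective A \<eta> (P j)) \<and> acyclic_complex A P d \<and>
       Hom_acyclic A P d (regular_module A) \<and>
       liso A M (kernel_module (P i) (P (i + 1)) (d i)))"

definition ind_nonproj_Gproj :: "('a, 'r) ring_scheme \<Rightarrow> ('k::field \<Rightarrow> 'a) \<Rightarrow> ('a, 'k) fmod set set" where
  "ind_nonproj_Gproj A \<eta> = {iso_class A \<eta> M | M :: ('a, 'k) fmod.
     gorenstein_projective A \<eta> M \<and> indecomposable_module A M \<and> \<not> projective A \<eta> M}"


section \<open>The stable category\<close>

definition proj_homs ::
  "('a, 'r) ring_scheme \<Rightarrow> ('k::field \<Rightarrow> 'a) \<Rightarrow> ('a, 'm) module \<Rightarrow> ('a, 'n) module \<Rightarrow> ('m \<Rightarrow> 'n) set" where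
  "proj_homs A \<eta> X Y = {f \<in> lhom A X Y. \<exists>P :: ('a, 'k) fmod. projective A \<eta> P \<and>
     (\<exists>g\<in>lhom A X P. \<exists>h\<in>lhom A P Y. f = compose (carrier X) h g)}"

text \<open>Equality of the classes of \<open>f\<close> and \<open>g\<close> in the stable morphism space \<open>Hom(X, Y) / P(X, Y)\<close>.\<close>

definition stable_eq ::
  "('a, 'r) ring_scheme \<Rightarrow> ('k::field \<Rightarrow> 'a) \<Rightarrow> ('a, 'm) module \<Rightarrow> ('a, 'n) module \<Rightarrow>
    ('m \<Rightarrow> 'n) \<Rightarrow> ('m \<Rightarrow> 'n) \<Rightarrow> bool" where
  "stable_eq A \<eta> X Y f g \<longleftrightarrow>
     f \<in> lhom A X Y \<and> g \<in> lhom A X Y \<and> diff_hom X Y f g \<in> proj_homs A \<eta> X Y"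

definition stable_iso ::
  "('a, 'r) ring_scheme \<Rightarrow> ('k::field \<Rightarrow> 'a) \<Rightarrow> ('a, 'm) module \<Rightarrow> ('a, 'n) module \<Rightarrow> bool" where
  "stable_iso A \<eta> X Y \<longleftrightarrow> (\<exists>f\<in>lhom A X Y. \<exists>g\<in>lhom A Y X.
     stable_eq A \<eta> X X (compose (carrier X) g f) (id_hom X) \<and>
     stable_eq A \<eta> Y Y (compose (carrier Y) f g) (id_hom Y))"

definition stable_zero ::
  "('a, 'r) ring_scheme \<Rightarrow> ('k::field \<Rightarrow> 'a) \<Rightarrow> ('a, 'm) module \<Rightarrow> bool" where
  "stable_zero A \<eta> X \<longleftrightarrow> stable_eq A \<eta> X X (id_hom X) (zero_hom X X)"

text \<open>\<open>X\<close> is a direct sum (biproduct) of \<open>Y\<close> and \<open>Z\<close> in the stable category.\<close>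

definition stable_direct_sum ::
  "('a, 'r) ring_scheme \<Rightarrow> ('k::field \<Rightarrow> 'a) \<Rightarrow> ('a, 'm) module \<Rightarrow> ('a, 'n) module \<Rightarrow> ('a, 'l) module \<Rightarrow> bool"
  where "stable_direct_sum A \<eta> X Y Z \<longleftrightarrow>
    (\<exists>i\<in>lhom A Y X. \<exists>j\<in>lhom A Z X. \<exists>p\<in>lhom A X Y. \<exists>q\<in>lhom A X Z.
       stable_eq A \<eta> Y Y (compose (carrier Y) p i) (id_hom Y) \<and>
       stable_eq A \<eta> Z Z (compose (carrier Z) q j) (id_hom Z) \<and>
       stable_eq A \<eta> Z Y (compose (carrier Z) p j) (zero_hom Z Y) \<and>
       stable_eq A \<eta> Y Z (compose (carrier Y) q i) (zero_hom Y Z) \<and>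
       stable_eq A \<eta> X X
         (add_hom X X (compose (carrier X) i p) (compose (carrier X) j q)) (id_hom X))"

definition stable_indecomposable ::
  "('a, 'r) ring_scheme \<Rightarrow> ('k::field \<Rightarrow> 'a) \<Rightarrow> ('a, 'm) module \<Rightarrow> bool" where
  "stable_indecomposable A \<eta> X \<longleftrightarrow> \<not> stable_zero A \<eta> X \<and>
    (\<forall>(Y :: ('a, 'k) fmod) (Z :: ('a, 'k) fmod).
       gorenstein_projective A \<eta> Y \<and> gorenstein_projective A \<eta> Z \<and> stable_direct_sum A \<eta> X Y Z \<longrightarrow>
       stable_zero A \<eta> Y \<or> stable_zero A \<eta> Z)"

definition stable_class ::
  "('a, 'r) ring_scheme \<Rightarrow> ('k::field \<Rightarrow> 'a) \<Rightarrow> ('a, 'm) module \<Rightarrow> ('a, 'k) fmod set" where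
  "stable_class A \<eta> M = {N. gorenstein_projective A \<eta> N \<and> stable_iso A \<eta> M N}"

definition ind_stable_Gproj :: "('a, 'r) ring_scheme \<Rightarrow> ('k::field \<Rightarrow> 'a) \<Rightarrow> ('a, 'k) fmod set set" where
  "ind_stable_Gproj A \<eta> = {stable_class A \<eta> M | M :: ('a, 'k) fmod.
     gorenstein_projective A \<eta> M \<and> stable_indecomposable A \<eta> M}"


section \<open>Paths and path algebras\<close>

text \<open>
  A finite quiver is a \<^locale>\<open>fin_digraph\<close> (loops and parallel arrows are allowed). A path is its
  starting vertex together with the list of its arrows in the order in which they are traversed:
  \<open>\<alpha>\<^sub>n \<dots> \<alpha>\<^sub>2 \<alpha>\<^sub>1\<close> is \<open>(s(\<alpha>\<^sub>1), [\<alpha>\<^sub>1, \<alpha>\<^sub>2, \<dots>, \<alpha>\<^sub>n])\<close>. Hence \<open>pcomp p q\<close>, the concatenation \<open>pq\<close>,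
  lists the arrows of \<open>q\<close> first.
\<close>

type_synonym ('v, 'e) qpath = "'v \<times> 'e list"

definition psrc :: "('v, 'e) qpath \<Rightarrow> 'v" where
  "psrc p = fst p"

definition ptgt :: "('v, 'e) pre_digraph \<Rightarrow> ('v, 'e) qpath \<Rightarrow> 'v" where
  "ptgt Q p = pre_digraph.awlast Q (fst p) (snd p)"

definition qpaths :: "('v, 'e) pre_digraph \<Rightarrow> ('v, 'e) qpath set" where
  "qpaths Q = {p. pre_digraph.awalk Q (psrc p) (snd p) (ptgt Q p)}"

definition plength :: "('v, 'e) qpath \<Rightarrow> nat" where
  "plength p = length (snd p)"

definition pcomp :: "('v, 'e) qpath \<Rightarrow> ('v, 'e) qpath \<Rightarrow> ('v, 'e) qpath" where
  "pcomp p q = (psrc q, snd q @ snd p)"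

definition path_algebra :: "('v, 'e) pre_digraph \<Rightarrow> (('v, 'e) qpath \<Rightarrow> 'k::field) ring" where
  "path_algebra Q = \<lparr>
     carrier = {f. finite {p. f p \<noteq> 0} \<and> {p. f p \<noteq> 0} \<subseteq> qpaths Q},
     monoid.mult = (\<lambda>f g r. \<Sum>(p, q) | p \<in> qpaths Q \<and> q \<in> qpaths Q \<and> psrc p = ptgt Q q \<and> pcomp p q = r.
       f p * g q),
     one = (\<lambda>p. if p \<in> qpaths Q \<and> plength p = 0 then 1 else 0),
     ring.zero = (\<lambda>p. 0),
     add = (\<lambda>f g p. f p + g p)\<rparr>"

definition path_vec :: "('v, 'e) qpath \<Rightarrow> ('v, 'e) qpath \<Rightarrow> 'k::field" where
  "path_vec p = (\<lambda>r. if r = p then 1 else 0)"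


section \<open>Monomial algebras and perfect paths\<close>

definition arrow_ideal :: "('v, 'e) pre_digraph \<Rightarrow> (('v, 'e) qpath \<Rightarrow> 'k::field) set" where
  "arrow_ideal Q = Idl\<^bsub>path_algebra Q\<^esub> {path_vec (tail Q a, [a]) | a. a \<in> arcs Q}"

definition admissible_ideal ::
  "('v, 'e) pre_digraph \<Rightarrow> (('v, 'e) qpath \<Rightarrow> 'k::field) set \<Rightarrow> bool" where
  "admissible_ideal Q I \<longleftrightarrow> ideal I (path_algebra Q) \<and>
    (\<exists>d::nat. d \<ge> 2 \<and> arrow_ideal Q [^]\<^bsub>ideals_set (path_algebra Q)\<^esub> d \<subseteq> I) \<and>
    I \<subseteq> arrow_ideal Q [^]\<^bsub>ideals_set (path_algebra Q)\<^esub> (2::nat)"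

definition monomial_ideal ::
  "('v, 'e) pre_digraph \<Rightarrow> (('v, 'e) qpath \<Rightarrow> 'k::field) set \<Rightarrow> bool" where
  "monomial_ideal Q I \<longleftrightarrow> admissible_ideal Q I \<and>
    (\<exists>S \<subseteq> qpaths Q. (\<forall>p\<in>S. plength p \<ge> 2) \<and> I = Idl\<^bsub>path_algebra Q\<^esub> (path_vec ` S))"

definition quiver_algebra ::
  "('v, 'e) pre_digraph \<Rightarrow> (('v, 'e) qpath \<Rightarrow> 'k::field) set \<Rightarrow> (('v, 'e) qpath \<Rightarrow> 'k) set ring" where
  "quiver_algebra Q I = path_algebra Q Quot I"

definition quiver_algebra_scalar ::
  "('v, 'e) pre_digraph \<Rightarrow> (('v, 'e) qpath \<Rightarrow> 'k::field) set \<Rightarrow> 'k \<Rightarrow> (('v, 'e) qpath \<Rightarrow> 'k) set" where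
  "quiver_algebra_scalar Q I c = I +>\<^bsub>path_algebra Q\<^esub> (\<lambda>p. c * \<one>\<^bsub>path_algebra Q\<^esub> p)"

definition path_class ::
  "('v, 'e) pre_digraph \<Rightarrow> (('v, 'e) qpath \<Rightarrow> 'k::field) set \<Rightarrow> ('v, 'e) qpath \<Rightarrow> (('v, 'e) qpath \<Rightarrow> 'k) set" where
  "path_class Q I p = I +>\<^bsub>path_algebra Q\<^esub> path_vec p"

definition zero_path ::
  "('v, 'e) pre_digraph \<Rightarrow> (('v, 'e) qpath \<Rightarrow> 'k::field) set \<Rightarrow> ('v, 'e) qpath \<Rightarrow> bool" where
  "zero_path Q I p \<longleftrightarrow> p \<in> qpaths Q \<and> path_vec p \<in> I"

definition nonzero_path ::
  "('v, 'e) pre_digraph \<Rightarrow> (('v, 'e) qpath \<Rightarrow> 'k::field) set \<Rightarrow> ('v, 'e) qpath \<Rightarrow> bool" where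
  "nonzero_path Q I p \<longleftrightarrow> p \<in> qpaths Q \<and> path_vec p \<notin> I"

definition perfect_pair ::
  "('v, 'e) pre_digraph \<Rightarrow> (('v, 'e) qpath \<Rightarrow> 'k::field) set \<Rightarrow> ('v, 'e) qpath \<Rightarrow> ('v, 'e) qpath \<Rightarrow> bool" where
  "perfect_pair Q I p q \<longleftrightarrow> nonzero_path Q I p \<and> nonzero_path Q I q \<and>
    plength p \<ge> 1 \<and> plength q \<ge> 1 \<and> psrc p = ptgt Q q \<and> zero_path Q I (pcomp p q) \<and>
    (\<forall>q'. nonzero_path Q I q' \<and> ptgt Q q' = psrc p \<and> zero_path Q I (pcomp p q') \<longrightarrow>
      (\<exists>q''\<in>qpaths Q. psrc q = ptgt Q q'' \<and> q' = pcomp q q'')) \<and>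
    (\<forall>p'. nonzero_path Q I p' \<and> psrc p' = ptgt Q q \<and> zero_path Q I (pcomp p' q) \<longrightarrow>
      (\<exists>p''\<in>qpaths Q. psrc p'' = ptgt Q p \<and> p' = pcomp p'' p))"

definition perfect_path ::
  "('v, 'e) pre_digraph \<Rightarrow> (('v, 'e) qpath \<Rightarrow> 'k::field) set \<Rightarrow> ('v, 'e) qpath \<Rightarrow> bool" where
  "perfect_path Q I p \<longleftrightarrow> nonzero_path Q I p \<and>
    (\<exists>(n::nat) ps. n \<ge> 1 \<and> ps 1 = p \<and> ps (n + 1) = p \<and>
       (\<forall>i\<in>{1..n + 1}. nonzero_path Q I (ps i)) \<and>
       (\<forall>i\<in>{1..n}. perfect_pair Q I (ps i) (ps (i + 1))))"

text \<open>The left module \<open>Ap\<close> over \<open>A = kQ/I\<close>.\<close>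

definition path_module ::
  "('v, 'e) pre_digraph \<Rightarrow> (('v, 'e) qpath \<Rightarrow> 'k::field) set \<Rightarrow> ('v, 'e) qpath \<Rightarrow>
    ((('v, 'e) qpath \<Rightarrow> 'k) set, (('v, 'e) qpath \<Rightarrow> 'k) set) module" where
  "path_module Q I p = left_ideal_gen (quiver_algebra Q I) (path_class Q I p)"

end

theory Submission
  imports Defs "HOL-Library.Function_Algebras"
begin

text \<open>
  Let \<open>B\<close> be the set of nonzero paths, a basis of \<open>A\<close>. For a nonzero path \<open>p\<close> the annihilator of \<open>p\<close> in
  \<open>Ae\<close>, where \<open>e\<close> is the trivial path at \<open>t(p)\<close>, is spanned by the paths \<open>u\<close> with \<open>up = 0\<close>; they are
  called dead for \<open>p\<close> below. The module \<open>Ap\<close> depends up to isomorphism only on \<open>t(p)\<close> and on the dead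
  paths (\<open>similar_liso\<close>), and it is projective exactly if there are none.

  The coefficient at \<open>p\<close> of elements of \<open>Ap\<close> controls the homomorphisms between such modules. An
  endomorphism of \<open>Ap\<close> whose value at \<open>p\<close> involves \<open>p\<close> is bijective (\<open>bij_betw_mult_generator\<close>), whereas
  the value of a map that factors through a projective module does not involve \<open>p\<close> at an element
  killed by some path starting at \<open>t(p)\<close> (\<open>finite_rank_cf_generator\<close>). Hence \<open>Ap\<close> is indecomposable, also in
  the stable category if it is not projective, and stably isomorphic nonprojective modules \<open>Ap\<close> and
  \<open>Aq\<close> have the same end point and the same dead paths (\<open>stable_iso_similar\<close>). For perfect
  paths this forces \<open>p = q\<close>: the predecessor of \<open>p\<close> in a chain of perfect pairs generates the
  annihilator of \<open>p\<close>, so it is determined, and it determines \<open>p\<close> (\<open>perfect_similar_eq\<close>).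

  If \<open>(p, q)\<close> is a perfect pair, the annihilator of \<open>q\<close> is \<open>Ap\<close>, so that \<open>Ap\<close> is the first syzygy of \<open>Aq\<close>.
  The minimality of \<open>q\<close> in a perfect pair gives the dual statement, that the elements killed by \<open>p\<close>
  from the left are the multiples of \<open>q\<close>. A perfect path therefore closes up to a periodic complex of projective
  modules \<open>Ae\<close> whose differentials are right multiplications by the paths of the cycle, and this
  complex stays acyclic after applying \<open>Hom(-, A)\<close> (\<open>perfect_gorenstein_projective\<close>).

  Conversely, kernels of maps between projective modules are direct sums of modules \<open>Aq\<close>
  (\<open>kernel_decomposition\<close>). So all cocycles of a totally acyclic complex have this form. Total
  acyclicity gives \<open>Ext\<^sup>1(Aq, A) = 0\<close> for every summand (\<open>step_ext_vanishing\<close>), which forces the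
  annihilator of \<open>q\<close> to be generated by a single path (\<open>ext_vanishing_min_dead_unique\<close>); and every
  nonprojective summand of a cocycle is the syzygy of a summand of the next one (\<open>step_summand\<close>).
  Following a summand along the complex produces an infinite chain in which consecutive
  paths form perfect pairs (\<open>ppair_if_ext_vanishing\<close>). As there are finitely many nonzero paths and
  each entry of a perfect pair determines the other, the chain is a cycle
  (\<open>perfect_if_infinite_chain\<close>). Hence every nonprojective summand is isomorphic to \<open>Ap\<close>
  with \<open>p\<close> perfect (\<open>gorenstein_projective_decomposition\<close>), and the classification follows.

  The argument is carried out for rings described by coefficients with respect to a basis of
  paths; the quotient of the path algebra is shown to be of this kind at the end.
\<close>


section \<open>Left modules and their homomorphisms\<close>

context left_module
begin

lemma smult_r_null [simp]: "a \<in> carrier R \<Longrightarrow> a \<odot>\<^bsub>M\<^esub> \<zero>\<^bsub>M\<^esub> = \<zero>\<^bsub>M\<^esub>"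
  using smult_r_distr[of a "\<zero>\<^bsub>M\<^esub>" "\<zero>\<^bsub>M\<^esub>"]
  by (metis M.add.l_cancel_one' M.l_zero M.zero_closed smult_closed)

lemma smult_l_null [simp]: "x \<in> carrier M \<Longrightarrow> \<zero> \<odot>\<^bsub>M\<^esub> x = \<zero>\<^bsub>M\<^esub>"
  using smult_l_distr[of \<zero> \<zero> x]
  by (metis M.add.l_cancel_one' R.l_zero R.zero_closed smult_closed)

lemma smult_r_minus: "\<lbrakk>a \<in> carrier R; x \<in> carrier M\<rbrakk> \<Longrightarrow> a \<odot>\<^bsub>M\<^esub> (\<ominus>\<^bsub>M\<^esub> x) = \<ominus>\<^bsub>M\<^esub> (a \<odot>\<^bsub>M\<^esub> x)"
  using smult_r_distr[of a x "\<ominus>\<^bsub>M\<^esub> x"]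
  by (metis M.a_inv_closed M.minus_equality M.r_neg M.a_comm smult_closed smult_r_null)

lemma smult_l_minus: "\<lbrakk>a \<in> carrier R; x \<in> carrier M\<rbrakk> \<Longrightarrow> (\<ominus> a) \<odot>\<^bsub>M\<^esub> x = \<ominus>\<^bsub>M\<^esub> (a \<odot>\<^bsub>M\<^esub> x)"
  using smult_l_distr[of a "\<ominus> a" x]
  by (metis R.a_inv_closed M.minus_equality R.r_neg M.a_comm smult_closed smult_l_null)

lemma smult_finsum:
  assumes "finite J" "a \<in> carrier R" "f \<in> J \<rightarrow> carrier M"
  shows "a \<odot>\<^bsub>M\<^esub> (\<Oplus>\<^bsub>M\<^esub>j\<in>J. f j) = (\<Oplus>\<^bsub>M\<^esub>j\<in>J. a \<odot>\<^bsub>M\<^esub> f j)"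
  using assms by (induction J rule: finite_induct) (simp_all add: Pi_def smult_r_distr)

lemma finsum_smult:
  assumes "finite J" "x \<in> carrier M" "f \<in> J \<rightarrow> carrier R"
  shows "(\<Oplus>\<^bsub>R\<^esub>j\<in>J. f j) \<odot>\<^bsub>M\<^esub> x = (\<Oplus>\<^bsub>M\<^esub>j\<in>J. f j \<odot>\<^bsub>M\<^esub> x)"
  using assms by (induction J rule: finite_induct) (simp_all add: Pi_def smult_l_distr)

end

lemma left_moduleI:
  assumes "ring A" "abelian_group M"
    and "\<And>a x. \<lbrakk>a \<in> carrier A; x \<in> carrier M\<rbrakk> \<Longrightarrow> a \<odot>\<^bsub>M\<^esub> x \<in> carrier M"
    and "\<And>a b x. \<lbrakk>a \<in> carrier A; b \<in> carrier A; x \<in> carrier M\<rbrakk> \<Longrightarrow>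
        (a \<oplus>\<^bsub>A\<^esub> b) \<odot>\<^bsub>M\<^esub> x = a \<odot>\<^bsub>M\<^esub> x \<oplus>\<^bsub>M\<^esub> b \<odot>\<^bsub>M\<^esub> x"
    and "\<And>a x y. \<lbrakk>a \<in> carrier A; x \<in> carrier M; y \<in> carrier M\<rbrakk> \<Longrightarrow>
        a \<odot>\<^bsub>M\<^esub> (x \<oplus>\<^bsub>M\<^esub> y) = a \<odot>\<^bsub>M\<^esub> x \<oplus>\<^bsub>M\<^esub> a \<odot>\<^bsub>M\<^esub> y"
    and "\<And>a b x. \<lbrakk>a \<in> carrier A; b \<in> carrier A; x \<in> carrier M\<rbrakk> \<Longrightarrow>
        (a \<otimes>\<^bsub>A\<^esub> b) \<odot>\<^bsub>M\<^esub> x = a \<odot>\<^bsub>M\<^esub> (b \<odot>\<^bsub>M\<^esub> x)"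
    and "\<And>x. x \<in> carrier M \<Longrightarrow> \<one>\<^bsub>A\<^esub> \<odot>\<^bsub>M\<^esub> x = x"
  shows "left_module A M"
  using assms by (intro left_module.intro left_module_axioms.intro) auto

lemma left_module_abelian_group: "left_module A M \<Longrightarrow> abelian_group M"
  by (rule left_module.axioms(2))

lemma left_module_zero_closed [simp]: "left_module A M \<Longrightarrow> \<zero>\<^bsub>M\<^esub> \<in> carrier M"
  by (simp add: abelian_group.axioms(1) abelian_monoid.zero_closed left_module_abelian_group)

lemma left_module_add_closed [simp]:
  "\<lbrakk>left_module A M; x \<in> carrier M; y \<in> carrier M\<rbrakk> \<Longrightarrow> x \<oplus>\<^bsub>M\<^esub> y \<in> carrier M"
  by (simp add: abelian_group.axioms(1) abelian_monoid.a_closed left_module_abelian_group)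

lemma left_module_smult_closed [simp]:
  "\<lbrakk>left_module A M; a \<in> carrier A; x \<in> carrier M\<rbrakk> \<Longrightarrow> a \<odot>\<^bsub>M\<^esub> x \<in> carrier M"
  by (rule left_module.smult_closed)

lemma regular_module_simps [simp]:
  "carrier (regular_module A) = carrier A"
  "\<zero>\<^bsub>regular_module A\<^esub> = \<zero>\<^bsub>A\<^esub>"
  "add (regular_module A) = add A"
  "module.smult (regular_module A) = monoid.mult A"
  by (simp_all add: regular_module_def)

lemma left_ideal_gen_simps [simp]:
  "carrier (left_ideal_gen A x) = (\<lambda>a. a \<otimes>\<^bsub>A\<^esub> x) ` carrier A"
  "\<zero>\<^bsub>left_ideal_gen A x\<^esub> = \<zero>\<^bsub>A\<^esub>"
  "add (left_ideal_gen A x) = add A"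
  "module.smult (left_ideal_gen A x) = monoid.mult A"
  by (simp_all add: left_ideal_gen_def)

lemma left_module_regular:
  assumes "ring A"
  shows "left_module A (regular_module A)"
proof -
  interpret ring A by fact
  have "abelian_group (regular_module A)"
    by (rule abelian_groupI) (auto simp: a_assoc intro: a_comm l_neg)
  then show ?thesis
    by (intro left_moduleI assms) (auto simp: l_distr r_distr m_assoc)
qed

lemma left_module_submodule:
  assumes M: "left_module A M" and "S \<subseteq> carrier M" "\<zero>\<^bsub>M\<^esub> \<in> S"
    and add: "\<And>x y. \<lbrakk>x \<in> S; y \<in> S\<rbrakk> \<Longrightarrow> x \<oplus>\<^bsub>M\<^esub> y \<in> S"
    and smult: "\<And>a x. \<lbrakk>a \<in> carrier A; x \<in> S\<rbrakk> \<Longrightarrow> a \<odot>\<^bsub>M\<^esub> x \<in> S"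
  shows "left_module A (M\<lparr>carrier := S\<rparr>)"
proof -
  interpret M: left_module A M by fact
  have c: "x \<in> S \<Longrightarrow> x \<in> carrier M" for x using assms(2) by auto
  have neg: "\<exists>y\<in>S. y \<oplus>\<^bsub>M\<^esub> x = \<zero>\<^bsub>M\<^esub>" if "x \<in> S" for x
  proof
    show "(\<ominus>\<^bsub>A\<^esub> \<one>\<^bsub>A\<^esub>) \<odot>\<^bsub>M\<^esub> x \<in> S" using smult that by simp
    show "(\<ominus>\<^bsub>A\<^esub> \<one>\<^bsub>A\<^esub>) \<odot>\<^bsub>M\<^esub> x \<oplus>\<^bsub>M\<^esub> x = \<zero>\<^bsub>M\<^esub>"
      using c[OF that] by (simp add: M.smult_l_minus M.l_neg)
  qed
  have "abelian_group (M\<lparr>carrier := S\<rparr>)"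
    by (rule abelian_groupI) (use assms(3) add c neg in \<open>auto simp: M.a_assoc intro: M.a_comm\<close>)
  then show ?thesis
    by (intro left_moduleI)
      (use smult c in \<open>auto simp: M.smult_l_distr M.smult_r_distr M.smult_assoc M.R.ring_axioms\<close>)
qed

lemma left_module_left_ideal_gen:
  assumes "ring A" "x \<in> carrier A"
  shows "left_module A (left_ideal_gen A x)"
proof -
  interpret ring A by fact
  show ?thesis unfolding left_ideal_gen_def
  proof (rule left_module_submodule[OF left_module_regular[OF assms(1)]])
    fix y z assume "y \<in> (\<lambda>a. a \<otimes>\<^bsub>A\<^esub> x) ` carrier A" "z \<in> (\<lambda>a. a \<otimes>\<^bsub>A\<^esub> x) ` carrier A"
    then show "y \<oplus>\<^bsub>regular_module A\<^esub> z \<in> (\<lambda>a. a \<otimes>\<^bsub>A\<^esub> x) ` carrier A"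
      using assms(2) by (auto simp: l_distr[symmetric])
  next
    fix a y assume "a \<in> carrier A" "y \<in> (\<lambda>a. a \<otimes>\<^bsub>A\<^esub> x) ` carrier A"
    then show "a \<odot>\<^bsub>regular_module A\<^esub> y \<in> (\<lambda>a. a \<otimes>\<^bsub>A\<^esub> x) ` carrier A"
      using assms(2) by (auto simp: m_assoc[symmetric])
  qed (use assms(2) in \<open>auto intro!: image_eqI[of _ _ "\<zero>\<^bsub>A\<^esub>"]\<close>)
qed

lemma lhomI:
  assumes "\<And>x. x \<in> carrier M \<Longrightarrow> f x \<in> carrier N"
    and "\<And>x y. \<lbrakk>x \<in> carrier M; y \<in> carrier M\<rbrakk> \<Longrightarrow> f (x \<oplus>\<^bsub>M\<^esub> y) = f x \<oplus>\<^bsub>N\<^esub> f y"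
    and "\<And>a x. \<lbrakk>a \<in> carrier A; x \<in> carrier M\<rbrakk> \<Longrightarrow> f (a \<odot>\<^bsub>M\<^esub> x) = a \<odot>\<^bsub>N\<^esub> f x"
    and "\<And>x. x \<notin> carrier M \<Longrightarrow> f x = undefined"
  shows "f \<in> lhom A M N"
  using assms by (auto simp: lhom_def intro!: PiE_I)

lemma lhom_restrictI:
  assumes "left_module A M"
    and "\<And>x. x \<in> carrier M \<Longrightarrow> f x \<in> carrier N"
    and "\<And>x y. \<lbrakk>x \<in> carrier M; y \<in> carrier M\<rbrakk> \<Longrightarrow> f (x \<oplus>\<^bsub>M\<^esub> y) = f x \<oplus>\<^bsub>N\<^esub> f y"
    and "\<And>a x. \<lbrakk>a \<in> carrier A; x \<in> carrier M\<rbrakk> \<Longrightarrow> f (a \<odot>\<^bsub>M\<^esub> x) = a \<odot>\<^bsub>N\<^esub> f x"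
  shows "(\<lambda>x\<in>carrier M. f x) \<in> lhom A M N"
  using assms by (intro lhomI) auto

lemma lhom_closed: "\<lbrakk>f \<in> lhom A M N; x \<in> carrier M\<rbrakk> \<Longrightarrow> f x \<in> carrier N"
  by (auto simp: lhom_def)

lemma lhom_add:
  "\<lbrakk>f \<in> lhom A M N; x \<in> carrier M; y \<in> carrier M\<rbrakk> \<Longrightarrow> f (x \<oplus>\<^bsub>M\<^esub> y) = f x \<oplus>\<^bsub>N\<^esub> f y"
  by (auto simp: lhom_def)

lemma lhom_smult: "\<lbrakk>f \<in> lhom A M N; a \<in> carrier A; x \<in> carrier M\<rbrakk> \<Longrightarrow> f (a \<odot>\<^bsub>M\<^esub> x) = a \<odot>\<^bsub>N\<^esub> f x"
  by (auto simp: lhom_def)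

lemma lhom_undefined: "\<lbrakk>f \<in> lhom A M N; x \<notin> carrier M\<rbrakk> \<Longrightarrow> f x = undefined"
  by (auto simp: lhom_def)

lemma lhom_eqI:
  assumes "f \<in> lhom A M N" "g \<in> lhom A M N'" "\<And>x. x \<in> carrier M \<Longrightarrow> f x = g x"
  shows "f = g"
  using assms by (metis ext lhom_undefined)

lemma lhom_zero:
  assumes "left_module A M" "left_module A N" "f \<in> lhom A M N"
  shows "f \<zero>\<^bsub>M\<^esub> = \<zero>\<^bsub>N\<^esub>"
proof -
  interpret M: left_module A M by fact
  interpret N: left_module A N by fact
  have "f \<zero>\<^bsub>M\<^esub> \<oplus>\<^bsub>N\<^esub> f \<zero>\<^bsub>M\<^esub> = f \<zero>\<^bsub>M\<^esub>"
    by (simp flip: lhom_add[OF assms(3)])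
  then show ?thesis using lhom_closed[OF assms(3)] by simp
qed

lemma lhom_minus:
  assumes "left_module A M" "left_module A N" "f \<in> lhom A M N" "x \<in> carrier M"
  shows "f (\<ominus>\<^bsub>M\<^esub> x) = \<ominus>\<^bsub>N\<^esub> f x"
proof -
  interpret M: left_module A M by fact
  interpret N: left_module A N by fact
  have "f (\<ominus>\<^bsub>M\<^esub> x) \<oplus>\<^bsub>N\<^esub> f x = \<zero>\<^bsub>N\<^esub>"
    using lhom_add[OF assms(3), of "\<ominus>\<^bsub>M\<^esub> x" x] assms lhom_zero[OF assms(1-3)] by (simp add: M.l_neg)
  then show ?thesis using lhom_closed[OF assms(3)] assms(4) by (metis M.a_inv_closed N.minus_equality)
qed

lemma lhom_diff:
  assumes "left_module A M" "left_module A N" "f \<in> lhom A M N" "x \<in> carrier M" "y \<in> carrier M"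
  shows "f (x \<ominus>\<^bsub>M\<^esub> y) = f x \<ominus>\<^bsub>N\<^esub> f y"
proof -
  interpret M: left_module A M by fact
  interpret N: left_module A N by fact
  show ?thesis using assms by (simp add: a_minus_def lhom_add lhom_minus)
qed

lemma lhom_finsum:
  assumes "left_module A M" "left_module A N" "f \<in> lhom A M N" "finite J" "g \<in> J \<rightarrow> carrier M"
  shows "f (\<Oplus>\<^bsub>M\<^esub>j\<in>J. g j) = (\<Oplus>\<^bsub>N\<^esub>j\<in>J. f (g j))"
proof -
  interpret M: left_module A M by fact
  interpret N: left_module A N by fact
  show ?thesis using assms(4,5)
  proof (induction J rule: finite_induct)
    case empty
    then show ?case using lhom_zero[OF assms(1-3)] by simp
  next
    case (insert j J)
    then show ?case using assms(3)
      by (simp add: lhom_add lhom_closed Pi_def M.finsum_closed)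
  qed
qed

lemma lhom_compose:
  assumes "f \<in> lhom A L M" "g \<in> lhom A M N" "left_module A L"
  shows "compose (carrier L) g f \<in> lhom A L N"
  unfolding compose_def using assms
  by (intro lhom_restrictI) (auto simp: lhom_closed lhom_add lhom_smult)

lemma lhom_id: "left_module A M \<Longrightarrow> id_hom M \<in> lhom A M M"
  unfolding id_hom_def by (intro lhom_restrictI) auto

lemma lhom_zero_hom: "left_module A M \<Longrightarrow> left_module A N \<Longrightarrow> zero_hom M N \<in> lhom A M N"
proof -
  assume M: "left_module A M" and N: "left_module A N"
  interpret M: left_module A M by fact
  interpret N: left_module A N by fact
  show ?thesis unfolding zero_hom_def by (intro lhom_restrictI M) auto
qed

lemma lhom_plus:
  assumes "left_module A M" "left_module A N" "f \<in> lhom A M N" "g \<in> lhom A M N"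
  shows "(\<lambda>x\<in>carrier M. f x \<oplus>\<^bsub>N\<^esub> g x) \<in> lhom A M N"
proof -
  interpret M: left_module A M by fact
  interpret N: left_module A N by fact
  show ?thesis using assms
    by (intro lhom_restrictI)
      (auto simp: lhom_closed lhom_add lhom_smult N.smult_r_distr N.a_ac)
qed

lemma lhom_add_hom:
  "\<lbrakk>left_module A M; left_module A N; f \<in> lhom A M N; g \<in> lhom A M N\<rbrakk> \<Longrightarrow> add_hom M N f g \<in> lhom A M N"
  unfolding add_hom_def by (rule lhom_plus)

lemma lhom_uminus:
  assumes "left_module A M" "left_module A N" "f \<in> lhom A M N"
  shows "(\<lambda>x\<in>carrier M. \<ominus>\<^bsub>N\<^esub> f x) \<in> lhom A M N"
proof -
  interpret M: left_module A M by fact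
  interpret N: left_module A N by fact
  show ?thesis using assms
    by (intro lhom_restrictI) (auto simp: lhom_closed lhom_add lhom_smult N.smult_r_minus N.minus_add)
qed

lemma lhom_diff_hom:
  assumes "left_module A M" "left_module A N" "f \<in> lhom A M N" "g \<in> lhom A M N"
  shows "diff_hom M N f g \<in> lhom A M N"
proof -
  have "diff_hom M N f g = (\<lambda>x\<in>carrier M. f x \<oplus>\<^bsub>N\<^esub> (\<lambda>x\<in>carrier M. \<ominus>\<^bsub>N\<^esub> g x) x)"
    unfolding diff_hom_def by (rule restrict_ext) (simp add: a_minus_def)
  then show ?thesis using lhom_plus[OF assms(1-3) lhom_uminus[OF assms(1,2,4)]] by (simp only:)
qed

lemma lhom_times:
  assumes "left_module A M" "left_module A N" "f \<in> lhom A M (regular_module A)" "y \<in> carrier N"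
  shows "(\<lambda>x\<in>carrier M. f x \<odot>\<^bsub>N\<^esub> y) \<in> lhom A M N"
proof -
  interpret M: left_module A M by fact
  interpret N: left_module A N by fact
  show ?thesis using assms lhom_closed[OF assms(3)]
    by (intro lhom_restrictI)
      (auto simp: lhom_add[OF assms(3)] lhom_smult[OF assms(3)] N.smult_l_distr N.smult_assoc)
qed

subsection \<open>Isomorphisms\<close>

text \<open>
  The inverse of a bijective homomorphism is a homomorphism once it is made extensional.
\<close>

lemma liso_iff_inverse:
  assumes M: "left_module A M"
  shows "liso A M N \<longleftrightarrow> (\<exists>f\<in>lhom A M N. \<exists>g\<in>lhom A N M.
    (\<forall>x\<in>carrier M. g (f x) = x) \<and> (\<forall>y\<in>carrier N. f (g y) = y))" (is "_ \<longleftrightarrow> ?R")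
proof
  assume "liso A M N"
  then obtain f where f: "f \<in> lhom A M N" "bij_betw f (carrier M) (carrier N)"
    by (auto simp: liso_def)
  define g where "g = (\<lambda>y\<in>carrier N. inv_into (carrier M) f y)"
  have gf: "g (f x) = x" if "x \<in> carrier M" for x
    using that f by (simp add: g_def bij_betw_inv_into_left lhom_closed)
  have fg: "f (g y) = y" if "y \<in> carrier N" for y
    using that f by (simp add: g_def bij_betw_inv_into_right)
  have gc: "g y \<in> carrier M" if "y \<in> carrier N" for y
    using that f unfolding g_def by (simp add: bij_betw_def inv_into_into)
  have "g \<in> lhom A N M"
  proof (rule lhomI)
    fix x y assume xy: "x \<in> carrier N" "y \<in> carrier N"
    have "g (x \<oplus>\<^bsub>N\<^esub> y) = g (f (g x \<oplus>\<^bsub>M\<^esub> g y))"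
      using xy gc f by (simp add: lhom_add fg)
    then show "g (x \<oplus>\<^bsub>N\<^esub> y) = g x \<oplus>\<^bsub>M\<^esub> g y"
      using gf gc xy M by simp
  next
    fix a y assume xy: "a \<in> carrier A" "y \<in> carrier N"
    have "g (a \<odot>\<^bsub>N\<^esub> y) = g (f (a \<odot>\<^bsub>M\<^esub> g y))"
      using xy gc f by (simp add: lhom_smult fg)
    then show "g (a \<odot>\<^bsub>N\<^esub> y) = a \<odot>\<^bsub>M\<^esub> g y"
      using gf gc xy M by simp
  qed (auto simp: gc, simp add: g_def)
  then show ?R using f gf fg by blast
next
  assume ?R
  then obtain f g where *: "f \<in> lhom A M N" "g \<in> lhom A N M"
    "\<forall>x\<in>carrier M. g (f x) = x" "\<forall>y\<in>carrier N. f (g y) = y" by blast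
  then have "bij_betw f (carrier M) (carrier N)"
    by (intro bij_betw_byWitness[where f' = g]) (auto simp: lhom_closed)
  then show "liso A M N" using * by (auto simp: liso_def)
qed

lemma liso_refl: "left_module A M \<Longrightarrow> liso A M M"
  by (auto simp: liso_iff_inverse id_hom_def intro!: bexI[OF _ lhom_id])

lemma liso_sym: "left_module A M \<Longrightarrow> left_module A N \<Longrightarrow> liso A M N \<Longrightarrow> liso A N M"
  by (auto simp: liso_iff_inverse)

lemma liso_trans:
  assumes "left_module A L" "liso A L M" "liso A M N"
  shows "liso A L N"
proof -
  obtain f g where f: "f \<in> lhom A L M" "bij_betw f (carrier L) (carrier M)"
    and g: "g \<in> lhom A M N" "bij_betw g (carrier M) (carrier N)"
    using assms by (auto simp: liso_def)
  have "bij_betw (compose (carrier L) g f) (carrier L) (carrier N)"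
    using bij_betw_trans[OF f(2) g(2)]
    by (subst bij_betw_cong[of _ _ "g \<circ> f"]) (auto simp: compose_def)
  then show ?thesis using lhom_compose[OF f(1) g(1) assms(1)] by (auto simp: liso_def)
qed

subsection \<open>Products\<close>

section \<open>Finite direct sums\<close>

text \<open>
  Direct sums; all index sets that occur are finite, and elements are extensional functions, so
  that the copies of the summands are the functions that vanish outside one index.
\<close>

definition prod_mod :: "'i set \<Rightarrow> ('i \<Rightarrow> ('a, 'm) module) \<Rightarrow> ('a, 'i \<Rightarrow> 'm) module" where
  "prod_mod J M = \<lparr>carrier = (\<Pi>\<^sub>E j\<in>J. carrier (M j)), monoid.mult = undefined, one = undefined,
     ring.zero = (\<lambda>j\<in>J. \<zero>\<^bsub>M j\<^esub>), add = (\<lambda>f g. \<lambda>j\<in>J. f j \<oplus>\<^bsub>M j\<^esub> g j),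
     module.smult = (\<lambda>a f. \<lambda>j\<in>J. a \<odot>\<^bsub>M j\<^esub> f j)\<rparr>"

lemma prod_mod_simps [simp]:
  "carrier (prod_mod J M) = (\<Pi>\<^sub>E j\<in>J. carrier (M j))"
  "\<zero>\<^bsub>prod_mod J M\<^esub> = (\<lambda>j\<in>J. \<zero>\<^bsub>M j\<^esub>)"
  "f \<oplus>\<^bsub>prod_mod J M\<^esub> g = (\<lambda>j\<in>J. f j \<oplus>\<^bsub>M j\<^esub> g j)"
  "a \<odot>\<^bsub>prod_mod J M\<^esub> f = (\<lambda>j\<in>J. a \<odot>\<^bsub>M j\<^esub> f j)"
  by (simp_all add: prod_mod_def)

lemma left_module_prod_mod:
  assumes "ring A" "\<And>j. j \<in> J \<Longrightarrow> left_module A (M j)"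
  shows "left_module A (prod_mod J M)"
proof -
  note ag = left_module_abelian_group[OF assms(2)]
  note cl = left_module_zero_closed[OF assms(2)] left_module_add_closed[OF assms(2)]
    left_module_smult_closed[OF assms(2)]
  have pm: "f j \<in> carrier (M j)" if "f \<in> (\<Pi>\<^sub>E j\<in>J. carrier (M j))" "j \<in> J" for f j
    using that by auto
  have "abelian_group (prod_mod J M)"
  proof (rule abelian_groupI)
    fix f assume f: "f \<in> carrier (prod_mod J M)"
    have fc: "f j \<in> carrier (M j)" if "j \<in> J" for j using f that by auto
    show "\<exists>g\<in>carrier (prod_mod J M). g \<oplus>\<^bsub>prod_mod J M\<^esub> f = \<zero>\<^bsub>prod_mod J M\<^esub>"
      by (rule bexI[of _ "\<lambda>j\<in>J. \<ominus>\<^bsub>M j\<^esub> f j"])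
        (use fc ag in \<open>auto simp: abelian_group.l_neg intro!: restrict_ext abelian_group.a_inv_closed\<close>)
    show "\<zero>\<^bsub>prod_mod J M\<^esub> \<oplus>\<^bsub>prod_mod J M\<^esub> f = f"
      using f by (auto simp: abelian_monoid.l_zero[OF abelian_group.axioms(1)[OF ag]] fc
          intro!: PiE_ext[of _ J "\<lambda>j. carrier (M j)"])
    fix g assume g: "g \<in> carrier (prod_mod J M)"
    show "f \<oplus>\<^bsub>prod_mod J M\<^esub> g = g \<oplus>\<^bsub>prod_mod J M\<^esub> f"
      using f g ag by (auto simp: PiE_mem intro!: restrict_ext abelian_monoid.a_comm[OF abelian_group.axioms(1)])
    show "f \<oplus>\<^bsub>prod_mod J M\<^esub> g \<in> carrier (prod_mod J M)"
      using f g by (auto intro!: cl)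
    fix h assume h: "h \<in> carrier (prod_mod J M)"
    show "f \<oplus>\<^bsub>prod_mod J M\<^esub> g \<oplus>\<^bsub>prod_mod J M\<^esub> h = f \<oplus>\<^bsub>prod_mod J M\<^esub> (g \<oplus>\<^bsub>prod_mod J M\<^esub> h)"
      using f g h ag by (auto simp: PiE_mem intro!: restrict_ext abelian_monoid.a_assoc[OF abelian_group.axioms(1)])
  qed (auto simp: cl)
  then show ?thesis
    by (intro left_moduleI assms(1))
      (auto simp: pm cl left_module.smult_l_distr[OF assms(2)] left_module.smult_r_distr[OF assms(2)]
        left_module.smult_assoc[OF assms(2)] left_module.smult_one[OF assms(2)] intro!: restrict_ext PiE_ext[of _ J "\<lambda>j. carrier (M j)"])
qed

definition proj_hom :: "'i set \<Rightarrow> ('i \<Rightarrow> ('a, 'm) module) \<Rightarrow> 'i \<Rightarrow> ('i \<Rightarrow> 'm) \<Rightarrow> 'm" where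
  "proj_hom J M j = (\<lambda>f\<in>carrier (prod_mod J M). f j)"

definition inj_hom :: "'i set \<Rightarrow> ('i \<Rightarrow> ('a, 'm) module) \<Rightarrow> 'i \<Rightarrow> 'm \<Rightarrow> 'i \<Rightarrow> 'm" where
  "inj_hom J M j = (\<lambda>x\<in>carrier (M j). \<lambda>i\<in>J. if i = j then x else \<zero>\<^bsub>M i\<^esub>)"

lemma lhom_proj_hom:
  assumes "ring A" "\<And>j. j \<in> J \<Longrightarrow> left_module A (M j)" "j \<in> J"
  shows "proj_hom J M j \<in> lhom A (prod_mod J M) (M j)"
  unfolding proj_hom_def
  using assms by (intro lhom_restrictI left_module_prod_mod) (auto simp: PiE_mem)

lemma lhom_inj_hom:
  assumes "\<And>j. j \<in> J \<Longrightarrow> left_module A (M j)" "j \<in> J"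
  shows "inj_hom J M j \<in> lhom A (M j) (prod_mod J M)"
  unfolding inj_hom_def
proof (rule lhom_restrictI)
  show "left_module A (M j)" using assms by auto
  fix x assume x: "x \<in> carrier (M j)"
  show "(\<lambda>i\<in>J. if i = j then x else \<zero>\<^bsub>M i\<^esub>) \<in> carrier (prod_mod J M)"
    using x by (auto simp: left_module_zero_closed[OF assms(1)])
  {
    fix y assume y: "y \<in> carrier (M j)"
    have "i \<in> J \<Longrightarrow> \<zero>\<^bsub>M i\<^esub> = \<zero>\<^bsub>M i\<^esub> \<oplus>\<^bsub>M i\<^esub> \<zero>\<^bsub>M i\<^esub>" for i
      using left_module_abelian_group[OF assms(1)[of i]]
      by (metis abelian_group.axioms(1) abelian_monoid.l_zero abelian_monoid.zero_closed)
    then show "(\<lambda>i\<in>J. if i = j then x \<oplus>\<^bsub>M j\<^esub> y else \<zero>\<^bsub>M i\<^esub>) =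
        (\<lambda>i\<in>J. if i = j then x else \<zero>\<^bsub>M i\<^esub>) \<oplus>\<^bsub>prod_mod J M\<^esub> (\<lambda>i\<in>J. if i = j then y else \<zero>\<^bsub>M i\<^esub>)"
      by (auto intro!: restrict_ext)
  }
  fix a assume "a \<in> carrier A"
  then show "(\<lambda>i\<in>J. if i = j then a \<odot>\<^bsub>M j\<^esub> x else \<zero>\<^bsub>M i\<^esub>) =
      a \<odot>\<^bsub>prod_mod J M\<^esub> (\<lambda>i\<in>J. if i = j then x else \<zero>\<^bsub>M i\<^esub>)"
    by (auto intro!: restrict_ext simp: left_module.smult_r_null[OF assms(1)])
qed

lemma finsum_prod_mod:
  assumes "ring A" "\<And>j. j \<in> J \<Longrightarrow> left_module A (M j)" "j \<in> J" "finite I"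
    "g \<in> I \<rightarrow> carrier (prod_mod J M)"
  shows "(\<Oplus>\<^bsub>prod_mod J M\<^esub>i\<in>I. g i) j = (\<Oplus>\<^bsub>M j\<^esub>i\<in>I. g i j)"
proof -
  interpret P: left_module A "prod_mod J M" using left_module_prod_mod assms by blast
  interpret Mj: left_module A "M j" using assms by blast
  have "proj_hom J M j (\<Oplus>\<^bsub>prod_mod J M\<^esub>i\<in>I. g i) = (\<Oplus>\<^bsub>M j\<^esub>i\<in>I. proj_hom J M j (g i))"
    by (rule lhom_finsum[OF P.left_module_axioms Mj.left_module_axioms _ assms(4,5)])
      (rule lhom_proj_hom; fact assms)
  also have "\<dots> = (\<Oplus>\<^bsub>M j\<^esub>i\<in>I. g i j)"
    using assms(3,5) by (intro Mj.finsum_cong') (fastforce simp: proj_hom_def Pi_iff)+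
  moreover have "(\<Oplus>\<^bsub>prod_mod J M\<^esub>i\<in>I. g i) \<in> carrier (prod_mod J M)"
    using assms(5) by (rule P.finsum_closed)
  ultimately show ?thesis unfolding proj_hom_def by simp
qed

lemma finsum_inj_hom:
  assumes "ring A" "\<And>j. j \<in> J \<Longrightarrow> left_module A (M j)" "finite J" "D \<subseteq> J" "f \<in> carrier (prod_mod J M)"
  shows "(\<Oplus>\<^bsub>prod_mod J M\<^esub>j\<in>D. inj_hom J M j (f j)) = (\<lambda>j\<in>J. if j \<in> D then f j else \<zero>\<^bsub>M j\<^esub>)"
proof -
  interpret P: left_module A "prod_mod J M" using left_module_prod_mod assms by blast
  have cl: "(\<lambda>j. inj_hom J M j (f j)) \<in> D \<rightarrow> carrier (prod_mod J M)"
    using assms(4,5) by (intro Pi_I lhom_closed[OF lhom_inj_hom[OF assms(2)]]) auto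
  have finD: "finite D" using assms finite_subset by blast
  show ?thesis
  proof (rule PiE_ext[of _ J "\<lambda>j. carrier (M j)"])
    show "(\<lambda>j\<in>J. if j \<in> D then f j else \<zero>\<^bsub>M j\<^esub>) \<in> (\<Pi>\<^sub>E j\<in>J. carrier (M j))"
      using assms(5) left_module_zero_closed[OF assms(2)] by auto
    show "(\<Oplus>\<^bsub>prod_mod J M\<^esub>j\<in>D. inj_hom J M j (f j)) \<in> (\<Pi>\<^sub>E j\<in>J. carrier (M j))"
      using P.finsum_closed[OF cl] by simp
    fix i assume i: "i \<in> J"
    interpret Mi: left_module A "M i" using assms i by blast
    have fi: "f i \<in> carrier (M i)" using assms(5) i by auto
    have "(\<Oplus>\<^bsub>prod_mod J M\<^esub>j\<in>D. inj_hom J M j (f j)) i = (\<Oplus>\<^bsub>M i\<^esub>j\<in>D. inj_hom J M j (f j) i)"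
      by (rule finsum_prod_mod[OF assms(1,2) i finD cl])
    also have "\<dots> = (\<Oplus>\<^bsub>M i\<^esub>j\<in>D. if i = j then f i else \<zero>\<^bsub>M i\<^esub>)"
      using i fi assms(4,5) by (intro Mi.finsum_cong') (auto simp: inj_hom_def PiE_mem)
    also have "\<dots> = (if i \<in> D then f i else \<zero>\<^bsub>M i\<^esub>)"
    proof (cases "i \<in> D")
      case True
      then show ?thesis using fi finD by (simp add: Mi.add.finprod_singleton)
    next
      case False
      then have "(\<Oplus>\<^bsub>M i\<^esub>j\<in>D. if i = j then f i else \<zero>\<^bsub>M i\<^esub>) = (\<Oplus>\<^bsub>M i\<^esub>j\<in>D. \<zero>\<^bsub>M i\<^esub>)"
        by (intro Mi.finsum_cong') auto
      then show ?thesis using False by simp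
    qed
    finally show "(\<Oplus>\<^bsub>prod_mod J M\<^esub>j\<in>D. inj_hom J M j (f j)) i = (\<lambda>j\<in>J. if j \<in> D then f j else \<zero>\<^bsub>M j\<^esub>) i"
      using i by simp
  qed
qed

lemma prod_mod_decomp:
  assumes "ring A" "\<And>j. j \<in> J \<Longrightarrow> left_module A (M j)" "finite J" "f \<in> carrier (prod_mod J M)"
  shows "f = (\<Oplus>\<^bsub>prod_mod J M\<^esub>j\<in>J. inj_hom J M j (f j))"
proof -
  have "(\<Oplus>\<^bsub>prod_mod J M\<^esub>j\<in>J. inj_hom J M j (f j)) = (\<lambda>j\<in>J. if j \<in> J then f j else \<zero>\<^bsub>M j\<^esub>)"
    by (rule finsum_inj_hom[OF assms(1,2,3) subset_refl assms(4)])
  also have "\<dots> = f" using assms(4) by (auto simp: PiE_def extensional_def fun_eq_iff)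
  finally show ?thesis by simp
qed

text \<open>
  Puts a module structure on coordinate vectors: the axioms need only be checked through the
  bijection.
\<close>

lemma left_module_transfer:
  assumes M: "left_module A M" and bij: "bij_betw f (carrier M) (carrier N)"
    and zero: "f \<zero>\<^bsub>M\<^esub> = \<zero>\<^bsub>N\<^esub>"
    and add: "\<And>x y. \<lbrakk>x \<in> carrier M; y \<in> carrier M\<rbrakk> \<Longrightarrow> f (x \<oplus>\<^bsub>M\<^esub> y) = f x \<oplus>\<^bsub>N\<^esub> f y"
    and smult: "\<And>a x. \<lbrakk>a \<in> carrier A; x \<in> carrier M\<rbrakk> \<Longrightarrow> f (a \<odot>\<^bsub>M\<^esub> x) = a \<odot>\<^bsub>N\<^esub> f x"
  shows "left_module A N"
proof -
  interpret M: left_module A M by fact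
  have N: "carrier N = f ` carrier M" using bij by (simp add: bij_betw_def)
  have "abelian_group N"
  proof (rule abelian_groupI)
    fix y assume "y \<in> carrier N"
    then obtain x where x: "x \<in> carrier M" "y = f x" using N by auto
    show "\<exists>z\<in>carrier N. z \<oplus>\<^bsub>N\<^esub> y = \<zero>\<^bsub>N\<^esub>"
      by (rule bexI[of _ "f (\<ominus>\<^bsub>M\<^esub> x)"]) (use x N in \<open>auto simp: M.l_neg zero simp flip: add\<close>)
  qed (auto simp: N M.a_ac simp flip: add zero)
  then show ?thesis
    by (intro left_moduleI)
      (auto simp: N M.smult_l_distr M.smult_r_distr M.smult_assoc M.R.ring_axioms simp flip: add smult)
qed

section \<open>Finite-dimensional modules over a finite-dimensional algebra\<close>

locale fd_algebra = ring A for A :: "('a, 'r) ring_scheme" (structure) +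
  fixes \<eta> :: "'k::field \<Rightarrow> 'a"
  assumes scalar_closed [simp]: "\<eta> c \<in> carrier A"
    and scalar_add: "\<eta> (c + d) = \<eta> c \<oplus> \<eta> d"
    and scalar_one [simp]: "\<eta> 1 = \<one>"
    and fd_regular: "fd_module A \<eta> (regular_module A)"

lemma left_module_free: "ring A \<Longrightarrow> left_module A (prod_mod J (\<lambda>_. regular_module A))"
  by (rule left_module_prod_mod[OF _ left_module_regular])

lemma fd_module_left_module: "fd_module A \<eta> M \<Longrightarrow> left_module A M"
  by (simp add: fd_module_def)

lemma projective_fd_module: "projective A \<eta> M \<Longrightarrow> fd_module A \<eta> M"
  by (simp add: projective_def)

lemma gorenstein_projective_fd_module: "gorenstein_projective A \<eta> M \<Longrightarrow> fd_module A \<eta> M"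
  by (simp add: gorenstein_projective_def)

inductive_set lspan :: "('a, 'r) ring_scheme \<Rightarrow> ('a, 'm) module \<Rightarrow> 'm set \<Rightarrow> 'm set"
  for A :: "('a, 'r) ring_scheme" and M :: "('a, 'm) module" and Y :: "'m set" where
  zero: "\<zero>\<^bsub>M\<^esub> \<in> lspan A M Y"
| step: "\<lbrakk>x \<in> lspan A M Y; a \<in> carrier A; y \<in> Y\<rbrakk> \<Longrightarrow> x \<oplus>\<^bsub>M\<^esub> a \<odot>\<^bsub>M\<^esub> y \<in> lspan A M Y"

lemma lspan_closed:
  assumes "left_module A M" "Y \<subseteq> carrier M" "x \<in> lspan A M Y"
  shows "x \<in> carrier M"
proof -
  interpret left_module A M by fact
  show ?thesis using assms(3)
    by induction (use assms(2) in auto)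
qed

lemma lspan_add:
  assumes "left_module A M" "Y \<subseteq> carrier M" "x \<in> lspan A M Y" "y \<in> lspan A M Y"
  shows "x \<oplus>\<^bsub>M\<^esub> y \<in> lspan A M Y"
proof -
  interpret left_module A M by fact
  have x: "x \<in> carrier M" by (rule lspan_closed[OF assms(1-3)])
  show ?thesis using assms(4)
  proof induction
    case zero
    then show ?case using assms(3) x by simp
  next
    case (step z a y)
    have "x \<oplus>\<^bsub>M\<^esub> (z \<oplus>\<^bsub>M\<^esub> a \<odot>\<^bsub>M\<^esub> y) = (x \<oplus>\<^bsub>M\<^esub> z) \<oplus>\<^bsub>M\<^esub> a \<odot>\<^bsub>M\<^esub> y"
      using x step assms(2) lspan_closed[OF assms(1,2) step(1)] by (simp add: M.a_assoc subsetD)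
    then show ?case using step by (simp add: lspan.step)
  qed
qed

lemma lspan_smult_base:
  assumes "left_module A M" "Y \<subseteq> carrier M" "y \<in> Y" "a \<in> carrier A"
  shows "a \<odot>\<^bsub>M\<^esub> y \<in> lspan A M Y"
proof -
  interpret left_module A M by fact
  show ?thesis using lspan.step[OF lspan.zero[of M A Y] assms(4,3)] assms by (simp add: subsetD)
qed

lemma lspan_mono: "x \<in> lspan A M Y \<Longrightarrow> Y \<subseteq> Z \<Longrightarrow> x \<in> lspan A M Z"
  by (induction rule: lspan.induct) (auto intro: lspan.intros)

lemma lspan_finsum:
  assumes "left_module A M" "Y \<subseteq> carrier M" "finite J" "f \<in> J \<rightarrow> lspan A M Y"
  shows "(\<Oplus>\<^bsub>M\<^esub>j\<in>J. f j) \<in> lspan A M Y"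
proof -
  interpret left_module A M by fact
  show ?thesis using assms(3,4)
  proof (induction J)
    case empty
    then show ?case by (simp add: lspan.zero)
  next
    case (insert j J)
    have "f \<in> insert j J \<rightarrow> carrier M" using insert.prems lspan_closed[OF assms(1,2)] by auto
    then show ?case using insert by (simp add: lspan_add[OF assms(1,2)])
  qed
qed

lemma (in fd_algebra) scalar_zero [simp]: "\<eta> 0 = \<zero>"
  using scalar_add[of 0 0] by (simp add: add.l_cancel_one')

text \<open>
  The products of a finite basis of the algebra with finitely many module generators span the module.
\<close>

lemma (in fd_algebra) fd_moduleI:
  assumes M: "left_module A M" and fin: "finite Y" and Y: "Y \<subseteq> carrier M" and gen: "carrier M \<subseteq> lspan A M Y"
  shows "fd_module A \<eta> M"
proof -
  interpret M: left_module A M by fact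
  obtain B0 where B0: "finite B0" "B0 \<subseteq> carrier A"
    and B0': "\<And>a. a \<in> carrier A \<Longrightarrow> \<exists>c. a = (\<Oplus>b\<in>B0. \<eta> (c b) \<otimes> b)"
  proof -
    have *: "finsum (regular_module A) f B = finsum A f B" for f :: "'a \<Rightarrow> 'a" and B
      by (simp add: finsum_def finprod_def)
    show ?thesis using that fd_regular unfolding fd_module_def * by auto
  qed
  define B where "B = (\<lambda>(b, y). b \<odot>\<^bsub>M\<^esub> y) ` (B0 \<times> Y)"
  have B: "finite B" "B \<subseteq> carrier M" using fin B0 Y by (auto simp: B_def)
  define S where "S = {\<Oplus>\<^bsub>M\<^esub>b\<in>B. \<eta> (c b) \<odot>\<^bsub>M\<^esub> b | c. True}"
  have cl: "(\<lambda>b. \<eta> (c b) \<odot>\<^bsub>M\<^esub> b) \<in> B \<rightarrow> carrier M" for c using B by auto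
  have S_closed: "x \<in> carrier M" if "x \<in> S" for x
    using that cl by (auto simp: S_def intro!: M.finsum_closed)
  have S_I: "(\<Oplus>\<^bsub>M\<^esub>b\<in>B. \<eta> (c b) \<odot>\<^bsub>M\<^esub> b) \<in> S" for c
    unfolding S_def by blast
  have S_zero: "\<zero>\<^bsub>M\<^esub> \<in> S"
  proof -
    have "(\<Oplus>\<^bsub>M\<^esub>b\<in>B. \<eta> 0 \<odot>\<^bsub>M\<^esub> b) = (\<Oplus>\<^bsub>M\<^esub>b\<in>B. \<zero>\<^bsub>M\<^esub>)"
      by (intro M.finsum_cong') (use B in auto)
    then show ?thesis by (auto simp: S_def intro!: exI[of _ "\<lambda>_. 0"])
  qed
  have S_add: "x \<oplus>\<^bsub>M\<^esub> y \<in> S" if xy: "x \<in> S" "y \<in> S" for x y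
  proof -
    obtain c d where cd: "x = (\<Oplus>\<^bsub>M\<^esub>b\<in>B. \<eta> (c b) \<odot>\<^bsub>M\<^esub> b)" "y = (\<Oplus>\<^bsub>M\<^esub>b\<in>B. \<eta> (d b) \<odot>\<^bsub>M\<^esub> b)"
      using xy by (auto simp: S_def)
    have "x \<oplus>\<^bsub>M\<^esub> y = (\<Oplus>\<^bsub>M\<^esub>b\<in>B. \<eta> (c b) \<odot>\<^bsub>M\<^esub> b \<oplus>\<^bsub>M\<^esub> \<eta> (d b) \<odot>\<^bsub>M\<^esub> b)"
      unfolding cd by (rule M.finsum_addf[symmetric]) (use cl in auto)
    also have "\<dots> = (\<Oplus>\<^bsub>M\<^esub>b\<in>B. \<eta> (c b + d b) \<odot>\<^bsub>M\<^esub> b)"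
      by (intro M.finsum_cong') (use B in \<open>auto simp: scalar_add M.smult_l_distr subsetD\<close>)
    finally show ?thesis by (auto simp: S_def)
  qed
  have S_base: "\<eta> c \<odot>\<^bsub>M\<^esub> b \<in> S" if b: "b \<in> B" for c b
  proof -
    have "(\<Oplus>\<^bsub>M\<^esub>b'\<in>B. \<eta> (if b = b' then c else 0) \<odot>\<^bsub>M\<^esub> b') =
        (\<Oplus>\<^bsub>M\<^esub>b'\<in>B. if b = b' then \<eta> c \<odot>\<^bsub>M\<^esub> b' else \<zero>\<^bsub>M\<^esub>)"
      by (intro M.finsum_cong') (use B in auto)
    also have "\<dots> = \<eta> c \<odot>\<^bsub>M\<^esub> b"
      using b B by (intro M.add.finprod_singleton) auto
    finally show ?thesis using S_I[of "\<lambda>b'. if b = b' then c else 0"] by simp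
  qed
  have S_finsum: "(\<Oplus>\<^bsub>M\<^esub>j\<in>J. f j) \<in> S" if "finite J" "f \<in> J \<rightarrow> S" for f :: "'a \<Rightarrow> _" and J
    using that
  proof (induction J)
    case empty
    then show ?case by (simp add: S_zero)
  next
    case (insert j J)
    have "f \<in> insert j J \<rightarrow> carrier M" using insert.prems S_closed by auto
    then show ?case using insert by (simp add: S_add)
  qed
  have "x \<in> S" if "x \<in> lspan A M Y" for x
    using that
  proof induction
    case zero
    then show ?case by (rule S_zero)
  next
    case (step x a y)
    obtain c where c: "a = (\<Oplus>b\<in>B0. \<eta> (c b) \<otimes> b)" using B0' step by blast
    have yM: "y \<in> carrier M" using step Y by auto
    have "a \<odot>\<^bsub>M\<^esub> y = (\<Oplus>\<^bsub>M\<^esub>b\<in>B0. (\<eta> (c b) \<otimes> b) \<odot>\<^bsub>M\<^esub> y)"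
      unfolding c by (rule M.finsum_smult) (use B0 yM in auto)
    also have "\<dots> = (\<Oplus>\<^bsub>M\<^esub>b\<in>B0. \<eta> (c b) \<odot>\<^bsub>M\<^esub> (b \<odot>\<^bsub>M\<^esub> y))"
      by (intro M.finsum_cong') (use B0 yM in \<open>auto simp: M.smult_assoc subsetD\<close>)
    also have "\<dots> \<in> S"
      by (intro S_finsum B0 Pi_I S_base) (use step in \<open>auto simp: B_def\<close>)
    finally show ?case by (rule S_add[OF step.IH])
  qed
  then have "\<forall>x\<in>carrier M. \<exists>c. x = (\<Oplus>\<^bsub>M\<^esub>b\<in>B. \<eta> (c b) \<odot>\<^bsub>M\<^esub> b)"
    using gen by (fastforce simp: S_def)
  then show ?thesis unfolding fd_module_def using M B by blast
qed

lemma (in fd_algebra) fd_module_generators: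
  assumes "fd_module A \<eta> M"
  obtains Y where "finite Y" "Y \<subseteq> carrier M" "carrier M \<subseteq> lspan A M Y"
proof -
  obtain B where B: "finite B" "B \<subseteq> carrier M"
    "\<And>x. x \<in> carrier M \<Longrightarrow> \<exists>c. x = (\<Oplus>\<^bsub>M\<^esub>b\<in>B. \<eta> (c b) \<odot>\<^bsub>M\<^esub> b)"
    using assms by (auto simp: fd_module_def)
  have M: "left_module A M" using assms by (rule fd_module_left_module)
  have "carrier M \<subseteq> lspan A M B"
  proof
    fix x assume "x \<in> carrier M"
    then obtain c where "x = (\<Oplus>\<^bsub>M\<^esub>b\<in>B. \<eta> (c b) \<odot>\<^bsub>M\<^esub> b)" using B by blast
    then show "x \<in> lspan A M B"
      using M B by (auto intro!: lspan_finsum lspan_smult_base)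
  qed
  then show ?thesis using that B by blast
qed

lemma lspan_image:
  assumes "left_module A M" "left_module A N" "f \<in> lhom A M N" "Y \<subseteq> carrier M" "x \<in> lspan A M Y"
  shows "f x \<in> lspan A N (f ` Y)"
  using assms(5)
proof induction
  case zero
  then show ?case using lhom_zero[OF assms(1-3)] by (simp add: lspan.zero)
next
  case (step x a y)
  then have "f (x \<oplus>\<^bsub>M\<^esub> a \<odot>\<^bsub>M\<^esub> y) = f x \<oplus>\<^bsub>N\<^esub> a \<odot>\<^bsub>N\<^esub> f y"
    using assms lspan_closed[OF assms(1,4) step(1)]
    by (simp add: lhom_add[OF assms(3)] lhom_smult[OF assms(3)] subsetD)
  then show ?case using step by (simp add: lspan.step)
qed

lemma (in fd_algebra) fd_module_image:
  assumes "fd_module A \<eta> M" "left_module A N" "f \<in> lhom A M N" "f ` carrier M = carrier N"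
  shows "fd_module A \<eta> N"
proof -
  obtain Y where Y: "finite Y" "Y \<subseteq> carrier M" "carrier M \<subseteq> lspan A M Y"
    using fd_module_generators[OF assms(1)] .
  show ?thesis
  proof (rule fd_moduleI[OF assms(2)])
    show "finite (f ` Y)" using Y by simp
    show "f ` Y \<subseteq> carrier N" using Y assms(4) by blast
    show "carrier N \<subseteq> lspan A N (f ` Y)"
      unfolding assms(4)[symmetric] using Y(3) lspan_image[OF fd_module_left_module[OF assms(1)] assms(2,3) Y(2)] by blast
  qed
qed

lemma (in fd_algebra) fd_module_liso:
  assumes "fd_module A \<eta> M" "left_module A N" "liso A M N"
  shows "fd_module A \<eta> N"
  using assms fd_module_image by (auto simp: liso_def bij_betw_def)

lemma (in fd_algebra) fd_module_prod_mod:
  assumes fin: "finite J" and fd: "\<And>j. j \<in> J \<Longrightarrow> fd_module A \<eta> (M j)"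
  shows "fd_module A \<eta> (prod_mod J M)"
proof -
  have lm: "\<And>j. j \<in> J \<Longrightarrow> left_module A (M j)" by (rule fd_module_left_module[OF fd])
  have P: "left_module A (prod_mod J M)" by (rule left_module_prod_mod[OF ring_axioms lm])
  have "\<forall>j\<in>J. \<exists>Y. finite Y \<and> Y \<subseteq> carrier (M j) \<and> carrier (M j) \<subseteq> lspan A (M j) Y"
    using fd_module_generators[OF fd] by metis
  then obtain Y where Y: "\<And>j. j \<in> J \<Longrightarrow> finite (Y j) \<and> Y j \<subseteq> carrier (M j) \<and> carrier (M j) \<subseteq> lspan A (M j) (Y j)"
    by metis
  have inj: "inj_hom J M j \<in> lhom A (M j) (prod_mod J M)" if "j \<in> J" for j
    by (rule lhom_inj_hom[OF lm that])
  define Z where "Z = (\<Union>j\<in>J. inj_hom J M j ` Y j)"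
  have Z: "Z \<subseteq> carrier (prod_mod J M)"
  proof
    fix z assume "z \<in> Z"
    then obtain j y where jy: "j \<in> J" "y \<in> Y j" "z = inj_hom J M j y" by (auto simp: Z_def)
    then have "y \<in> carrier (M j)" using Y by blast
    then show "z \<in> carrier (prod_mod J M)"
      unfolding jy(3) by (rule lhom_closed[OF inj[OF jy(1)]])
  qed
  show ?thesis
  proof (rule fd_moduleI[OF P])
    show "finite Z" using fin Y by (auto simp: Z_def)
    show "carrier (prod_mod J M) \<subseteq> lspan A (prod_mod J M) Z"
    proof
      fix f assume f: "f \<in> carrier (prod_mod J M)"
      have "inj_hom J M j (f j) \<in> lspan A (prod_mod J M) Z" if j: "j \<in> J" for j
      proof (rule lspan_mono)
        show "inj_hom J M j (f j) \<in> lspan A (prod_mod J M) (inj_hom J M j ` Y j)"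
          by (rule lspan_image[OF lm[OF j] P inj[OF j]]) (use Y j f in auto)
      qed (use j in \<open>auto simp: Z_def\<close>)
      then have "(\<Oplus>\<^bsub>prod_mod J M\<^esub>j\<in>J. inj_hom J M j (f j)) \<in> lspan A (prod_mod J M) Z"
        by (intro lspan_finsum[OF P Z fin]) auto
      then show "f \<in> lspan A (prod_mod J M) Z"
        using prod_mod_decomp[OF ring_axioms _ fin f] lm by simp
    qed
  qed (fact Z)
qed

text \<open>
  The coordinates of the elements with respect to a finite spanning family embed a
  finite-dimensional module into the sequences over the field, which makes room for the copy.
\<close>

lemma (in fd_algebra) fd_module_copy:
  fixes M :: "('a, 'm) module"
  assumes fd: "fd_module A \<eta> M"
  obtains N :: "('a, 'k) fmod" where "left_module A N" "liso A M N"
proof -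
  interpret M: left_module A M using fd by (rule fd_module_left_module)
  obtain B where B: "finite B" "B \<subseteq> carrier M"
    "\<And>x. x \<in> carrier M \<Longrightarrow> \<exists>c. x = (\<Oplus>\<^bsub>M\<^esub>b\<in>B. \<eta> (c b) \<odot>\<^bsub>M\<^esub> b)"
    using fd by (auto simp: fd_module_def)
  obtain c where c: "\<And>x. x \<in> carrier M \<Longrightarrow> x = (\<Oplus>\<^bsub>M\<^esub>b\<in>B. \<eta> (c x b) \<odot>\<^bsub>M\<^esub> b)"
    using B(3) by metis
  obtain e where e: "bij_betw e {0..<card B} B"
    using B(1) ex_bij_betw_nat_finite by blast
  define \<iota> where "\<iota> x = (\<lambda>i. if i < card B then c x (e i) else 0)" for x
  have inj: "inj_on \<iota> (carrier M)"
  proof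
    fix x y assume xy: "x \<in> carrier M" "y \<in> carrier M" "\<iota> x = \<iota> y"
    have "c x b = c y b" if "b \<in> B" for b
    proof -
      have "b \<in> e ` {0..<card B}" using e that by (simp add: bij_betw_def)
      then obtain i where "i < card B" "b = e i" by auto
      then show ?thesis using fun_cong[OF xy(3), of i] by (simp add: \<iota>_def)
    qed
    then have "(\<Oplus>\<^bsub>M\<^esub>b\<in>B. \<eta> (c x b) \<odot>\<^bsub>M\<^esub> b) = (\<Oplus>\<^bsub>M\<^esub>b\<in>B. \<eta> (c y b) \<odot>\<^bsub>M\<^esub> b)"
      using B(2) by (intro M.finsum_cong') auto
    then show "x = y" using c xy by metis
  qed
  define r where "r = inv_into (carrier M) \<iota>"
  have r: "r (\<iota> x) = x" if "x \<in> carrier M" for x using inj that by (simp add: r_def)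
  define N :: "('a, 'k) fmod" where "N = \<lparr>carrier = \<iota> ` carrier M, monoid.mult = undefined, one = undefined,
    ring.zero = \<iota> \<zero>\<^bsub>M\<^esub>, add = (\<lambda>x y. \<iota> (r x \<oplus>\<^bsub>M\<^esub> r y)), module.smult = (\<lambda>a x. \<iota> (a \<odot>\<^bsub>M\<^esub> r x))\<rparr>"
  have bij: "bij_betw \<iota> (carrier M) (carrier N)" using inj by (simp add: N_def bij_betw_def)
  have N: "left_module A N"
    by (rule left_module_transfer[OF M.left_module_axioms bij]) (auto simp: N_def r)
  have "(\<lambda>x\<in>carrier M. \<iota> x) \<in> lhom A M N"
    by (rule lhom_restrictI[OF M.left_module_axioms]) (auto simp: N_def r)
  moreover have "bij_betw (\<lambda>x\<in>carrier M. \<iota> x) (carrier M) (carrier N)"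
    using bij by (simp cong: bij_betw_cong)
  ultimately have "liso A M N" unfolding liso_def by (intro bexI)
  then show ?thesis using that N by blast
qed

section \<open>Homomorphisms of finite rank and projective modules\<close>

text \<open>
  A homomorphism factors through a finitely generated free module exactly if it is a finite sum of
  maps \<open>x \<mapsto> \<phi>(x) y\<close> with \<open>\<phi>\<close> a homomorphism to the ring and \<open>y\<close> a fixed element. This form
  needs no auxiliary module, so that closure under sums and composition is immediate. The identity
  has it exactly for the finitely generated projective modules (a dual basis).
\<close>

inductive_set finite_rank_homs :: "('a, 'r) ring_scheme \<Rightarrow> ('a, 'm) module \<Rightarrow> ('a, 'n) module \<Rightarrow> ('m \<Rightarrow> 'n) set"
  for A :: "('a, 'r) ring_scheme" and M :: "('a, 'm) module" and N :: "('a, 'n) module" where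
  zero: "zero_hom M N \<in> finite_rank_homs A M N"
| step: "\<lbrakk>f \<in> finite_rank_homs A M N; \<phi> \<in> lhom A M (regular_module A); y \<in> carrier N\<rbrakk> \<Longrightarrow>
    (\<lambda>x\<in>carrier M. f x \<oplus>\<^bsub>N\<^esub> \<phi> x \<odot>\<^bsub>N\<^esub> y) \<in> finite_rank_homs A M N"

lemma finite_rank_lhom:
  assumes "left_module A M" "left_module A N" "f \<in> finite_rank_homs A M N"
  shows "f \<in> lhom A M N"
  using assms(3)
proof induction
  case zero
  show ?case by (rule lhom_zero_hom[OF assms(1,2)])
next
  case (step f \<phi> y)
  have "(\<lambda>x\<in>carrier M. f x \<oplus>\<^bsub>N\<^esub> \<phi> x \<odot>\<^bsub>N\<^esub> y) = (\<lambda>x\<in>carrier M. f x \<oplus>\<^bsub>N\<^esub> (\<lambda>x\<in>carrier M. \<phi> x \<odot>\<^bsub>N\<^esub> y) x)"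
    by (rule restrict_ext) simp
  then show ?case
    using lhom_plus[OF assms(1,2) step.IH lhom_times[OF assms(1,2) step(2,3)]] by (simp only:)
qed

lemma finite_rank_add:
  assumes M: "left_module A M" and N: "left_module A N"
    and f: "f \<in> finite_rank_homs A M N" and g: "g \<in> finite_rank_homs A M N"
  shows "(\<lambda>x\<in>carrier M. f x \<oplus>\<^bsub>N\<^esub> g x) \<in> finite_rank_homs A M N"
proof -
  interpret N: left_module A N by fact
  have fl: "f \<in> lhom A M N" by (rule finite_rank_lhom[OF M N f])
  show ?thesis using g
  proof induction
    case zero
    have "(\<lambda>x\<in>carrier M. f x \<oplus>\<^bsub>N\<^esub> zero_hom M N x) = f"
      by (auto simp: zero_hom_def fun_eq_iff lhom_closed[OF fl] lhom_undefined[OF fl])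
    then show ?case using f by (simp only:)
  next
    case (step g \<phi> y)
    have gl: "g \<in> lhom A M N" by (rule finite_rank_lhom[OF M N step(1)])
    have "(\<lambda>x\<in>carrier M. f x \<oplus>\<^bsub>N\<^esub> (\<lambda>x\<in>carrier M. g x \<oplus>\<^bsub>N\<^esub> \<phi> x \<odot>\<^bsub>N\<^esub> y) x) =
        (\<lambda>x\<in>carrier M. (\<lambda>x\<in>carrier M. f x \<oplus>\<^bsub>N\<^esub> g x) x \<oplus>\<^bsub>N\<^esub> \<phi> x \<odot>\<^bsub>N\<^esub> y)"
      using lhom_closed[OF fl] lhom_closed[OF gl] lhom_closed[OF step(2)] step(3)
      by (intro restrict_ext) (simp add: N.a_assoc)
    then show ?case using finite_rank_homs.step[OF step.IH step(2,3)] by (simp only:)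
  qed
qed

lemma finite_rank_uminus:
  assumes M: "left_module A M" and N: "left_module A N" and f: "f \<in> finite_rank_homs A M N"
  shows "(\<lambda>x\<in>carrier M. \<ominus>\<^bsub>N\<^esub> f x) \<in> finite_rank_homs A M N"
proof -
  interpret N: left_module A N by fact
  show ?thesis using f
  proof induction
    case zero
    have "(\<lambda>x\<in>carrier M. \<ominus>\<^bsub>N\<^esub> zero_hom M N x) = zero_hom M N"
      by (auto simp: zero_hom_def fun_eq_iff)
    then show ?case by (simp add: finite_rank_homs.zero)
  next
    case (step g \<phi> y)
    have gl: "g \<in> lhom A M N" by (rule finite_rank_lhom[OF M N step(1)])
    have "(\<lambda>x\<in>carrier M. \<ominus>\<^bsub>N\<^esub> (\<lambda>x\<in>carrier M. g x \<oplus>\<^bsub>N\<^esub> \<phi> x \<odot>\<^bsub>N\<^esub> y) x) =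
        (\<lambda>x\<in>carrier M. (\<lambda>x\<in>carrier M. \<ominus>\<^bsub>N\<^esub> g x) x \<oplus>\<^bsub>N\<^esub> \<phi> x \<odot>\<^bsub>N\<^esub> (\<ominus>\<^bsub>N\<^esub> y))"
      using lhom_closed[OF gl] lhom_closed[OF step(2)] step(3)
      by (intro restrict_ext) (simp add: N.minus_add N.smult_r_minus)
    then show ?case using finite_rank_homs.step[OF step.IH step(2) N.a_inv_closed[OF step(3)]] by (simp only:)
  qed
qed

lemma finite_rank_comp_left:
  assumes M: "left_module A M" and N: "left_module A N" and L: "left_module A L"
    and f: "f \<in> finite_rank_homs A M N" and g: "g \<in> lhom A N L"
  shows "compose (carrier M) g f \<in> finite_rank_homs A M L"
  using f
proof induction
  case zero
  have "compose (carrier M) g (zero_hom M N) = zero_hom M L"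
    using lhom_zero[OF N L g] by (auto simp: zero_hom_def compose_def fun_eq_iff)
  then show ?case by (simp add: finite_rank_homs.zero)
next
  case (step f \<phi> y)
  have fl: "f \<in> lhom A M N" by (rule finite_rank_lhom[OF M N step(1)])
  have "compose (carrier M) g (\<lambda>x\<in>carrier M. f x \<oplus>\<^bsub>N\<^esub> \<phi> x \<odot>\<^bsub>N\<^esub> y) =
      (\<lambda>x\<in>carrier M. compose (carrier M) g f x \<oplus>\<^bsub>L\<^esub> \<phi> x \<odot>\<^bsub>L\<^esub> g y)"
    using lhom_closed[OF fl] lhom_closed[OF step(2)] step(3) N
    by (auto simp: compose_def fun_eq_iff lhom_add[OF g] lhom_smult[OF g])
  then show ?case using finite_rank_homs.step[OF step.IH step(2) lhom_closed[OF g step(3)]] by (simp only:)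
qed

lemma finite_rank_comp_right:
  assumes M: "left_module A M" and N: "left_module A N" and L: "left_module A L"
    and f: "f \<in> finite_rank_homs A M N" and g: "g \<in> lhom A L M"
  shows "compose (carrier L) f g \<in> finite_rank_homs A L N"
  using f
proof induction
  case zero
  have "compose (carrier L) (zero_hom M N) g = zero_hom L N"
    using lhom_closed[OF g] by (auto simp: zero_hom_def compose_def fun_eq_iff)
  then show ?case by (simp add: finite_rank_homs.zero)
next
  case (step f \<phi> y)
  have "compose (carrier L) (\<lambda>x\<in>carrier M. f x \<oplus>\<^bsub>N\<^esub> \<phi> x \<odot>\<^bsub>N\<^esub> y) g =
      (\<lambda>x\<in>carrier L. compose (carrier L) f g x \<oplus>\<^bsub>N\<^esub> compose (carrier L) \<phi> g x \<odot>\<^bsub>N\<^esub> y)"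
    using lhom_closed[OF g] by (auto simp: compose_def fun_eq_iff)
  then show ?case
    using finite_rank_homs.step[OF step.IH lhom_compose[OF g step(2) L] step(3)] by (simp only:)
qed

lemma finite_rank_finsum:
  assumes M: "left_module A M" and N: "left_module A N" and fin: "finite J"
    and f: "\<And>j. j \<in> J \<Longrightarrow> f j \<in> finite_rank_homs A M N"
  shows "(\<lambda>x\<in>carrier M. \<Oplus>\<^bsub>N\<^esub>j\<in>J. f j x) \<in> finite_rank_homs A M N"
proof -
  interpret N: left_module A N by fact
  show ?thesis using fin f
  proof (induction J)
    case empty
    then show ?case using finite_rank_homs.zero[of M N A] by (simp only: zero_hom_def N.finsum_empty)
  next
    case (insert j J)
    have l: "f i \<in> lhom A M N" if "i \<in> insert j J" for i
      by (rule finite_rank_lhom[OF M N insert.prems[OF that]])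
    have "(\<lambda>x\<in>carrier M. \<Oplus>\<^bsub>N\<^esub>i\<in>insert j J. f i x) =
        (\<lambda>x\<in>carrier M. f j x \<oplus>\<^bsub>N\<^esub> (\<lambda>x\<in>carrier M. \<Oplus>\<^bsub>N\<^esub>i\<in>J. f i x) x)"
      using insert.hyps lhom_closed[OF l] by (intro restrict_ext) (simp add: Pi_def)
    moreover have "f j \<in> finite_rank_homs A M N"
      "(\<lambda>x\<in>carrier M. \<Oplus>\<^bsub>N\<^esub>i\<in>J. f i x) \<in> finite_rank_homs A M N"
      using insert by blast+
    ultimately show ?case using finite_rank_add[OF M N] by (simp only:)
  qed
qed

lemma finite_rank_times:
  assumes M: "left_module A M" and N: "left_module A N" and \<phi>: "\<phi> \<in> lhom A M (regular_module A)"
    and y: "y \<in> carrier N"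
  shows "(\<lambda>x\<in>carrier M. \<phi> x \<odot>\<^bsub>N\<^esub> y) \<in> finite_rank_homs A M N"
proof -
  interpret N: left_module A N by fact
  have "(\<lambda>x\<in>carrier M. zero_hom M N x \<oplus>\<^bsub>N\<^esub> \<phi> x \<odot>\<^bsub>N\<^esub> y) = (\<lambda>x\<in>carrier M. \<phi> x \<odot>\<^bsub>N\<^esub> y)"
    using lhom_closed[OF \<phi>] y by (intro restrict_ext) (simp add: zero_hom_def)
  then show ?thesis using finite_rank_homs.step[OF finite_rank_homs.zero \<phi> y] by simp
qed

text \<open>
  A family of linear forms and elements instead of the inductive description; for the identity it is a dual basis.
\<close>

lemma finite_rank_explicit:
  assumes M: "left_module A M" and N: "left_module A N" and f: "f \<in> finite_rank_homs A M N"
  obtains n :: nat and \<phi> y where "\<And>i. i < n \<Longrightarrow> \<phi> i \<in> lhom A M (regular_module A)"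
    "\<And>i. i < n \<Longrightarrow> y i \<in> carrier N" "\<And>x. x \<in> carrier M \<Longrightarrow> f x = (\<Oplus>\<^bsub>N\<^esub>i\<in>{..<n}. \<phi> i x \<odot>\<^bsub>N\<^esub> y i)"
proof -
  interpret N: left_module A N by fact
  have "\<exists>(n :: nat) \<phi> y. (\<forall>i<n. \<phi> i \<in> lhom A M (regular_module A)) \<and> (\<forall>i<n. y i \<in> carrier N) \<and>
     (\<forall>x\<in>carrier M. f x = (\<Oplus>\<^bsub>N\<^esub>i\<in>{..<n}. \<phi> i x \<odot>\<^bsub>N\<^esub> y i))"
    using f
  proof induction
    case zero
    show ?case by (rule exI[of _ 0]) (auto simp: zero_hom_def)
  next
    case (step f \<psi> z)
    then obtain n :: nat and \<phi> y where IH: "\<And>i. i < n \<Longrightarrow> \<phi> i \<in> lhom A M (regular_module A)"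
      "\<And>i. i < n \<Longrightarrow> y i \<in> carrier N"
      "\<And>x. x \<in> carrier M \<Longrightarrow> f x = (\<Oplus>\<^bsub>N\<^esub>i\<in>{..<n}. \<phi> i x \<odot>\<^bsub>N\<^esub> y i)" by blast
    have c: "\<phi> i x \<odot>\<^bsub>N\<^esub> y i \<in> carrier N" if "i < n" "x \<in> carrier M" for i x
      using lhom_closed[OF IH(1)] IH(2) that by simp
    have c': "\<psi> x \<odot>\<^bsub>N\<^esub> z \<in> carrier N" if "x \<in> carrier M" for x
      using lhom_closed[OF step(2)] step(3) that by simp
    have "(\<lambda>x\<in>carrier M. f x \<oplus>\<^bsub>N\<^esub> \<psi> x \<odot>\<^bsub>N\<^esub> z) x =
        (\<Oplus>\<^bsub>N\<^esub>i\<in>{..<Suc n}. (\<phi>(n := \<psi>)) i x \<odot>\<^bsub>N\<^esub> (y(n := z)) i)" if x: "x \<in> carrier M" for x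
    proof -
      have "(\<Oplus>\<^bsub>N\<^esub>i\<in>{..<Suc n}. (\<phi>(n := \<psi>)) i x \<odot>\<^bsub>N\<^esub> (y(n := z)) i) =
          \<psi> x \<odot>\<^bsub>N\<^esub> z \<oplus>\<^bsub>N\<^esub> (\<Oplus>\<^bsub>N\<^esub>i\<in>{..<n}. (\<phi>(n := \<psi>)) i x \<odot>\<^bsub>N\<^esub> (y(n := z)) i)"
        using c c' x by (simp add: lessThan_Suc)
      also have "(\<Oplus>\<^bsub>N\<^esub>i\<in>{..<n}. (\<phi>(n := \<psi>)) i x \<odot>\<^bsub>N\<^esub> (y(n := z)) i) =
          (\<Oplus>\<^bsub>N\<^esub>i\<in>{..<n}. \<phi> i x \<odot>\<^bsub>N\<^esub> y i)"
        by (intro N.finsum_cong') (use c x in auto)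
      finally show ?thesis using x IH(3)[OF x] c c'
        by (simp add: N.a_comm N.finsum_closed Pi_def)
    qed
    then show ?case
      by (intro exI[of _ "Suc n"] exI[of _ "\<phi>(n := \<psi>)"] exI[of _ "y(n := z)"])
        (use IH(1,2) step(2,3) in auto)
  qed
  then show ?thesis using that by blast
qed

text \<open>
  Only the finitely many fixed elements of the target have to be lifted.
\<close>

lemma finite_rank_lift:
  assumes P: "left_module A P" and X: "left_module A X" and Y: "left_module A Y"
    and f: "f \<in> finite_rank_homs A P Y" and g: "g \<in> lhom A X Y" and surj: "carrier Y \<subseteq> g ` carrier X"
  shows "\<exists>h\<in>finite_rank_homs A P X. compose (carrier P) g h = f"
  using f
proof induction
  case zero
  have "compose (carrier P) g (zero_hom P X) = zero_hom P Y"
    using lhom_zero[OF X Y g] by (auto simp: zero_hom_def compose_def fun_eq_iff)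
  then show ?case using finite_rank_homs.zero by blast
next
  case (step f \<phi> y)
  then obtain h where h: "h \<in> finite_rank_homs A P X" "compose (carrier P) g h = f" by blast
  obtain x where x: "x \<in> carrier X" "y = g x" using surj step(3) by auto
  have hl: "h \<in> lhom A P X" using finite_rank_lhom[OF P X h(1)] .
  have gh: "g (h p) = f p" if "p \<in> carrier P" for p
    using fun_cong[OF h(2), of p] that by (simp add: compose_def)
  have "compose (carrier P) g (\<lambda>p\<in>carrier P. h p \<oplus>\<^bsub>X\<^esub> \<phi> p \<odot>\<^bsub>X\<^esub> x) =
      (\<lambda>p\<in>carrier P. f p \<oplus>\<^bsub>Y\<^esub> \<phi> p \<odot>\<^bsub>Y\<^esub> y)"
    using lhom_closed[OF hl] lhom_closed[OF step(2)] x X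
    by (auto simp: gh compose_def fun_eq_iff lhom_add[OF g] lhom_smult[OF g])
  then show ?case using finite_rank_homs.step[OF h(1) step(2) x(1)] by blast
qed

lemma finite_rank_id_liso:
  assumes M: "left_module A M" and N: "left_module A N" and iso: "liso A M N"
    and id: "id_hom M \<in> finite_rank_homs A M M"
  shows "id_hom N \<in> finite_rank_homs A N N"
proof -
  obtain f g where fg: "f \<in> lhom A M N" "g \<in> lhom A N M" "\<And>y. y \<in> carrier N \<Longrightarrow> f (g y) = y"
    using iso by (auto simp: liso_iff_inverse[OF M])
  have "compose (carrier N) f (compose (carrier N) (id_hom M) g) = id_hom N"
    using fg lhom_closed[OF fg(2)] by (auto simp: compose_def id_hom_def fun_eq_iff)
  then show ?thesis
    using finite_rank_comp_left[OF N M N finite_rank_comp_right[OF M M N id fg(2)] fg(1)] by simp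
qed

lemma finite_rank_partial_id_prod_mod:
  assumes A: "ring A" and lm: "\<And>j. j \<in> J \<Longrightarrow> left_module A (M j)" and fin: "finite J" and D: "D \<subseteq> J"
    and id: "\<And>j. j \<in> D \<Longrightarrow> id_hom (M j) \<in> finite_rank_homs A (M j) (M j)"
  shows "(\<lambda>f\<in>carrier (prod_mod J M). \<lambda>j\<in>J. if j \<in> D then f j else \<zero>\<^bsub>M j\<^esub>)
    \<in> finite_rank_homs A (prod_mod J M) (prod_mod J M)"
proof -
  have P: "left_module A (prod_mod J M)" by (rule left_module_prod_mod[OF A lm])
  have inj: "inj_hom J M j \<in> lhom A (M j) (prod_mod J M)" if "j \<in> J" for j
    by (rule lhom_inj_hom[OF lm that])
  have prj: "proj_hom J M j \<in> lhom A (prod_mod J M) (M j)" if "j \<in> J" for j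
    by (rule lhom_proj_hom[OF A lm that])
  let ?h = "\<lambda>j. compose (carrier (prod_mod J M)) (inj_hom J M j)
      (compose (carrier (prod_mod J M)) (id_hom (M j)) (proj_hom J M j))"
  have "?h j \<in> finite_rank_homs A (prod_mod J M) (prod_mod J M)" if "j \<in> D" for j
  proof -
    have j: "j \<in> J" using that D by auto
    show ?thesis
      by (rule finite_rank_comp_left[OF P lm[OF j] P
            finite_rank_comp_right[OF lm[OF j] lm[OF j] P id[OF that] prj[OF j]]
            inj[OF j]])
  qed
  then have "(\<lambda>f\<in>carrier (prod_mod J M). \<Oplus>\<^bsub>prod_mod J M\<^esub>j\<in>D. ?h j f)
      \<in> finite_rank_homs A (prod_mod J M) (prod_mod J M)"
    using finite_subset[OF D fin] by (intro finite_rank_finsum[OF P P])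
  moreover have "(\<lambda>f\<in>carrier (prod_mod J M). \<Oplus>\<^bsub>prod_mod J M\<^esub>j\<in>D. ?h j f) =
      (\<lambda>f\<in>carrier (prod_mod J M). \<lambda>j\<in>J. if j \<in> D then f j else \<zero>\<^bsub>M j\<^esub>)"
  proof (rule restrict_ext)
    fix f assume f: "f \<in> carrier (prod_mod J M)"
    interpret P: left_module A "prod_mod J M" by fact
    have fj: "f j \<in> carrier (M j)" if "j \<in> D" for j using f D that by auto
    have "(\<Oplus>\<^bsub>prod_mod J M\<^esub>j\<in>D. ?h j f) = (\<Oplus>\<^bsub>prod_mod J M\<^esub>j\<in>D. inj_hom J M j (f j))"
      using f D fj lhom_closed[OF inj]
      by (intro P.finsum_cong' Pi_I) (auto simp: compose_def id_hom_def proj_hom_def simp del: prod_mod_simps)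
    then show "(\<Oplus>\<^bsub>prod_mod J M\<^esub>j\<in>D. ?h j f) = (\<lambda>j\<in>J. if j \<in> D then f j else \<zero>\<^bsub>M j\<^esub>)"
      using finsum_inj_hom[OF A _ fin D f] lm by simp
  qed
  ultimately show ?thesis by simp
qed

lemma finite_rank_id_prod_mod:
  assumes "ring A" "\<And>j. j \<in> J \<Longrightarrow> left_module A (M j)" "finite J"
    and "\<And>j. j \<in> J \<Longrightarrow> id_hom (M j) \<in> finite_rank_homs A (M j) (M j)"
  shows "id_hom (prod_mod J M) \<in> finite_rank_homs A (prod_mod J M) (prod_mod J M)"
proof -
  have "id_hom (prod_mod J M) = (\<lambda>f\<in>carrier (prod_mod J M). \<lambda>j\<in>J. if j \<in> J then f j else \<zero>\<^bsub>M j\<^esub>)"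
    unfolding id_hom_def by (intro restrict_ext) (auto simp: PiE_def extensional_def fun_eq_iff)
  then show ?thesis using finite_rank_partial_id_prod_mod[OF assms(1-3) subset_refl assms(4)] by simp
qed

lemma finite_rank_id_regular:
  assumes "ring A"
  shows "id_hom (regular_module A) \<in> finite_rank_homs A (regular_module A) (regular_module A)"
proof -
  interpret ring A by fact
  have "(\<lambda>x\<in>carrier (regular_module A). id_hom (regular_module A) x \<odot>\<^bsub>regular_module A\<^esub> \<one>\<^bsub>A\<^esub>) = id_hom (regular_module A)"
    by (auto simp: id_hom_def fun_eq_iff)
  then show ?thesis
    using finite_rank_times[OF left_module_regular left_module_regular lhom_id[OF left_module_regular], OF assms assms assms, of "\<one>\<^bsub>A\<^esub>"]
    by (simp only: regular_module_simps one_closed)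
qed

lemma finite_rank_id_free:
  assumes "ring A" "finite J"
  shows "id_hom (prod_mod J (\<lambda>_. regular_module A)) \<in>
    finite_rank_homs A (prod_mod J (\<lambda>_. regular_module A)) (prod_mod J (\<lambda>_. regular_module A))"
  by (rule finite_rank_id_prod_mod[OF assms(1) left_module_regular[OF assms(1)] assms(2) finite_rank_id_regular[OF assms(1)]])

text \<open>The universal property of a free module.\<close>

lemma lhom_linear_combination:
  assumes N: "left_module A N" and fin: "finite J" and y: "\<And>j. j \<in> J \<Longrightarrow> y j \<in> carrier N"
  shows "(\<lambda>f\<in>carrier (prod_mod J (\<lambda>_. regular_module A)). \<Oplus>\<^bsub>N\<^esub>j\<in>J. f j \<odot>\<^bsub>N\<^esub> y j)
    \<in> lhom A (prod_mod J (\<lambda>_. regular_module A)) N"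
proof -
  interpret N: left_module A N by fact
  have A: "ring A" by (rule N.R.ring_axioms)
  have cl: "f j \<odot>\<^bsub>N\<^esub> y j \<in> carrier N" if "f \<in> J \<rightarrow>\<^sub>E carrier A" "j \<in> J" for f j
    using that y by auto
  show ?thesis
  proof (rule lhom_restrictI)
    show "left_module A (prod_mod J (\<lambda>_. regular_module A))"
      by (rule left_module_free[OF A])
    fix f assume f: "f \<in> carrier (prod_mod J (\<lambda>_. regular_module A))"
    have mem: "f j \<in> carrier A" if "f \<in> J \<rightarrow>\<^sub>E carrier A" "j \<in> J" for f j using that by auto
    show "(\<Oplus>\<^bsub>N\<^esub>j\<in>J. f j \<odot>\<^bsub>N\<^esub> y j) \<in> carrier N"
      using f cl by (intro N.finsum_closed Pi_I) auto
    {
      fix g assume g: "g \<in> carrier (prod_mod J (\<lambda>_. regular_module A))"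
      have "(\<Oplus>\<^bsub>N\<^esub>j\<in>J. f j \<odot>\<^bsub>N\<^esub> y j) \<oplus>\<^bsub>N\<^esub> (\<Oplus>\<^bsub>N\<^esub>j\<in>J. g j \<odot>\<^bsub>N\<^esub> y j) =
          (\<Oplus>\<^bsub>N\<^esub>j\<in>J. f j \<odot>\<^bsub>N\<^esub> y j \<oplus>\<^bsub>N\<^esub> g j \<odot>\<^bsub>N\<^esub> y j)"
        using f g cl by (intro N.finsum_addf[symmetric] Pi_I) auto
      also have "\<dots> = (\<Oplus>\<^bsub>N\<^esub>j\<in>J. (f \<oplus>\<^bsub>prod_mod J (\<lambda>_. regular_module A)\<^esub> g) j \<odot>\<^bsub>N\<^esub> y j)"
        using f g y by (intro N.finsum_cong') (auto simp: N.smult_l_distr mem)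
      finally show "(\<Oplus>\<^bsub>N\<^esub>j\<in>J. (f \<oplus>\<^bsub>prod_mod J (\<lambda>_. regular_module A)\<^esub> g) j \<odot>\<^bsub>N\<^esub> y j) =
          (\<Oplus>\<^bsub>N\<^esub>j\<in>J. f j \<odot>\<^bsub>N\<^esub> y j) \<oplus>\<^bsub>N\<^esub> (\<Oplus>\<^bsub>N\<^esub>j\<in>J. g j \<odot>\<^bsub>N\<^esub> y j)" by simp
    }
    fix a assume a: "a \<in> carrier A"
    have "a \<odot>\<^bsub>N\<^esub> (\<Oplus>\<^bsub>N\<^esub>j\<in>J. f j \<odot>\<^bsub>N\<^esub> y j) = (\<Oplus>\<^bsub>N\<^esub>j\<in>J. a \<odot>\<^bsub>N\<^esub> (f j \<odot>\<^bsub>N\<^esub> y j))"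
      using f cl by (intro N.smult_finsum fin a Pi_I) auto
    also have "\<dots> = (\<Oplus>\<^bsub>N\<^esub>j\<in>J. (a \<odot>\<^bsub>prod_mod J (\<lambda>_. regular_module A)\<^esub> f) j \<odot>\<^bsub>N\<^esub> y j)"
      using f y a by (intro N.finsum_cong') (auto simp: N.smult_assoc mem)
    finally show "(\<Oplus>\<^bsub>N\<^esub>j\<in>J. (a \<odot>\<^bsub>prod_mod J (\<lambda>_. regular_module A)\<^esub> f) j \<odot>\<^bsub>N\<^esub> y j) =
        a \<odot>\<^bsub>N\<^esub> (\<Oplus>\<^bsub>N\<^esub>j\<in>J. f j \<odot>\<^bsub>N\<^esub> y j)" by simp
  qed
qed

lemma (in fd_algebra) projective_if_finite_rank_id:
  assumes fd: "fd_module A \<eta> P" and id: "id_hom P \<in> finite_rank_homs A P P"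
  shows "projective A \<eta> P"
  unfolding projective_def
proof (intro conjI fd allI impI)
  fix X Y :: "('a, 'k) fmod" and g f
  assume *: "fd_module A \<eta> X \<and> fd_module A \<eta> Y \<and> g \<in> lhom A X Y \<and> g ` carrier X = carrier Y \<and> f \<in> lhom A P Y"
  note P = fd_module_left_module[OF fd]
  have X: "left_module A X" and Y: "left_module A Y" using * fd_module_left_module by blast+
  have "compose (carrier P) f (id_hom P) = f"
    using * by (auto simp: compose_def id_hom_def fun_eq_iff lhom_undefined[of f A P Y])
  then have "f \<in> finite_rank_homs A P Y"
    using finite_rank_comp_left[OF P P Y id, of f] * by simp
  then obtain h where "h \<in> finite_rank_homs A P X" "compose (carrier P) g h = f"
    using finite_rank_lift[OF P X Y] * by blast
  then show "\<exists>h\<in>lhom A P X. compose (carrier P) g h = f"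
    by (intro bexI[of _ h] finite_rank_lhom[OF P X])
qed

text \<open>
  A projective module is a direct summand of a free module \<open>F\<close>, hence its identity factors through the
  identity of \<open>F\<close>. Projectivity speaks about modules on one fixed carrier type, so the surjection from
  \<open>F\<close> is first moved to isomorphic copies on that type.
\<close>

lemma (in fd_algebra) finite_rank_id_if_projective:
  fixes P :: "('a, 'm) module"
  assumes proj: "projective A \<eta> P"
  shows "id_hom P \<in> finite_rank_homs A P P"
proof -
  have fd: "fd_module A \<eta> P" using proj by (rule projective_fd_module)
  interpret P: left_module A P using fd by (rule fd_module_left_module)
  note Pm = P.left_module_axioms
  obtain B where B: "finite B" "B \<subseteq> carrier P"
    "\<And>x. x \<in> carrier P \<Longrightarrow> \<exists>c. x = (\<Oplus>\<^bsub>P\<^esub>b\<in>B. \<eta> (c b) \<odot>\<^bsub>P\<^esub> b)"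
    using fd by (auto simp: fd_module_def)
  let ?F = "prod_mod B (\<lambda>_. regular_module A)"
  define e where "e = (\<lambda>f\<in>carrier ?F. \<Oplus>\<^bsub>P\<^esub>b\<in>B. f b \<odot>\<^bsub>P\<^esub> b)"
  have F: "left_module A ?F" by (rule left_module_free[OF ring_axioms])
  have fdF: "fd_module A \<eta> ?F" by (rule fd_module_prod_mod[OF B(1) fd_regular])
  have e: "e \<in> lhom A ?F P" unfolding e_def using lhom_linear_combination[OF Pm B(1), of id] B(2) by auto
  have esurj: "carrier P \<subseteq> e ` carrier ?F"
  proof
    fix x assume "x \<in> carrier P"
    then obtain c where c: "x = (\<Oplus>\<^bsub>P\<^esub>b\<in>B. \<eta> (c b) \<odot>\<^bsub>P\<^esub> b)" using B by blast
    have "x = e (\<lambda>b\<in>B. \<eta> (c b))"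
      unfolding c e_def using B by (auto intro!: P.finsum_cong')
    then show "x \<in> e ` carrier ?F" by auto
  qed
  obtain F' :: "('a, 'k) fmod" where F': "left_module A F'" "liso A ?F F'" using fd_module_copy[OF fdF] .
  obtain P' :: "('a, 'k) fmod" where P': "left_module A P'" "liso A P P'" using fd_module_copy[OF fd] .
  obtain u v where uv: "u \<in> lhom A ?F F'" "v \<in> lhom A F' ?F" "\<And>x. x \<in> carrier ?F \<Longrightarrow> v (u x) = x"
    using F' by (auto simp: liso_iff_inverse[OF F])
  obtain s t where st: "s \<in> lhom A P P'" "t \<in> lhom A P' P" "\<And>x. x \<in> carrier P \<Longrightarrow> t (s x) = x"
    "\<And>x. x \<in> carrier P' \<Longrightarrow> s (t x) = x"
    using P' by (auto simp: liso_iff_inverse[OF Pm])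
  define g where "g = compose (carrier F') s (compose (carrier F') e v)"
  have g: "g \<in> lhom A F' P'" unfolding g_def by (rule lhom_compose[OF lhom_compose[OF uv(2) e F'(1)] st(1) F'(1)])
  have gsurj: "g ` carrier F' = carrier P'"
  proof
    show "carrier P' \<subseteq> g ` carrier F'"
    proof
      fix y assume y: "y \<in> carrier P'"
      then have "t y \<in> carrier P" using lhom_closed[OF st(2)] by simp
      then obtain z where z: "z \<in> carrier ?F" "t y = e z" using esurj by blast
      have "y = g (u z)" unfolding g_def compose_def using z(1) lhom_closed[OF uv(1) z(1)] uv(3)[OF z(1)] st(4)[OF y]
        by (simp add: z(2)[symmetric])
      then show "y \<in> g ` carrier F'" using lhom_closed[OF uv(1) z(1)] by blast
    qed
  qed (use lhom_closed[OF g] in auto)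
  have "fd_module A \<eta> F'" "fd_module A \<eta> P'"
    by (rule fd_module_liso[OF fdF F'], rule fd_module_liso[OF fd P'])
  then obtain h where h: "h \<in> lhom A P F'" "compose (carrier P) g h = s"
    using proj g gsurj st(1) unfolding projective_def by blast
  have eq: "e (v (h x)) = x" if x: "x \<in> carrier P" for x
  proof -
    have hx: "h x \<in> carrier F'" using lhom_closed[OF h(1) x] .
    have "s (e (v (h x))) = s x" using fun_cong[OF h(2), of x] x hx by (simp add: g_def compose_def)
    then show ?thesis using st(3) lhom_closed[OF e lhom_closed[OF uv(2) hx]] x by metis
  qed
  have id: "id_hom ?F \<in> finite_rank_homs A ?F ?F"
    by (rule finite_rank_id_free[OF ring_axioms B(1)])
  define w where "w = compose (carrier P) v h"
  have w: "w \<in> lhom A P ?F" unfolding w_def by (rule lhom_compose[OF h(1) uv(2) Pm])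
  have "compose (carrier P) e (compose (carrier P) (id_hom ?F) w) = id_hom P"
  proof -
    have "w x \<in> carrier ?F" "e (w x) = x" if "x \<in> carrier P" for x
      using lhom_closed[OF w that] eq[OF that] that by (auto simp: w_def compose_def)
    then show ?thesis by (auto simp: compose_def id_hom_def fun_eq_iff simp del: prod_mod_simps)
  qed
  then show ?thesis
    using finite_rank_comp_left[OF Pm F Pm finite_rank_comp_right[OF F F Pm id w] e] by simp
qed

text \<open>
  A projective module has an identity of finite rank, and conversely a sum of \<open>n\<close> maps \<open>x \<mapsto> \<phi>(x) y\<close>
  factors through the free module of rank \<open>n\<close>.
\<close>

lemma (in fd_algebra) proj_homs_eq_finite_rank:
  assumes X: "left_module A X" and Y: "left_module A Y"
  shows "proj_homs A \<eta> X Y = finite_rank_homs A X Y"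
proof (intro subset_antisym subsetI)
  fix f assume "f \<in> proj_homs A \<eta> X Y"
  then obtain P :: "('a, 'k) fmod" and g h where P: "projective A \<eta> P" and gh: "g \<in> lhom A X P" "h \<in> lhom A P Y"
    and f: "f = compose (carrier X) h g" by (auto simp: proj_homs_def)
  have Pm: "left_module A P" by (rule fd_module_left_module[OF projective_fd_module[OF P]])
  have "compose (carrier X) h (compose (carrier X) (id_hom P) g) = f"
    unfolding f using lhom_closed[OF gh(1)] by (auto simp: compose_def id_hom_def fun_eq_iff)
  then show "f \<in> finite_rank_homs A X Y"
    using finite_rank_comp_left[OF X Pm Y finite_rank_comp_right[OF Pm Pm X finite_rank_id_if_projective[OF P] gh(1)] gh(2)]
    by simp
next
  interpret Y: left_module A Y by fact
  fix f assume f: "f \<in> finite_rank_homs A X Y"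
  obtain n :: nat and \<phi> y where *: "\<And>i. i < n \<Longrightarrow> \<phi> i \<in> lhom A X (regular_module A)"
    "\<And>i. i < n \<Longrightarrow> y i \<in> carrier Y" "\<And>x. x \<in> carrier X \<Longrightarrow> f x = (\<Oplus>\<^bsub>Y\<^esub>i\<in>{..<n}. \<phi> i x \<odot>\<^bsub>Y\<^esub> y i)"
    using finite_rank_explicit[OF X Y f] by blast
  let ?F = "prod_mod {..<n} (\<lambda>_. regular_module A)"
  have F: "left_module A ?F" by (rule left_module_free[OF ring_axioms])
  have fdF: "fd_module A \<eta> ?F" by (rule fd_module_prod_mod[OF finite_lessThan fd_regular])
  have idF: "id_hom ?F \<in> finite_rank_homs A ?F ?F"
    by (rule finite_rank_id_free[OF ring_axioms finite_lessThan])
  define g where "g = (\<lambda>x\<in>carrier X. \<lambda>i\<in>{..<n}. \<phi> i x)"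
  have g: "g \<in> lhom A X ?F" unfolding g_def
    using lhom_closed[OF *(1)] lhom_add[OF *(1)] lhom_smult[OF *(1)]
    by (intro lhom_restrictI[OF X]) (auto intro!: restrict_ext)
  define h where "h = (\<lambda>f\<in>carrier ?F. \<Oplus>\<^bsub>Y\<^esub>i\<in>{..<n}. f i \<odot>\<^bsub>Y\<^esub> y i)"
  have h: "h \<in> lhom A ?F Y" unfolding h_def using lhom_linear_combination[OF Y] *(2) by blast
  have hg: "f x = h (g x)" if "x \<in> carrier X" for x
    using *(3)[OF that] lhom_closed[OF g that] that lhom_closed[OF *(1) that] *(2)
    by (auto simp: h_def g_def intro!: Y.finsum_cong')
  obtain P :: "('a, 'k) fmod" where P: "left_module A P" "liso A ?F P" using fd_module_copy[OF fdF] .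
  obtain u v where uv: "u \<in> lhom A ?F P" "v \<in> lhom A P ?F" "\<And>x. x \<in> carrier ?F \<Longrightarrow> v (u x) = x"
    using P by (auto simp: liso_iff_inverse[OF F])
  have proj: "projective A \<eta> P"
    by (rule projective_if_finite_rank_id[OF fd_module_liso[OF fdF P] finite_rank_id_liso[OF F P idF]])
  have "f = compose (carrier X) (compose (carrier P) h v) (compose (carrier X) u g)"
    using hg lhom_closed[OF g] lhom_closed[OF uv(1)] uv(3) lhom_undefined[OF finite_rank_lhom[OF X Y f]]
    by (intro ext) (auto simp: compose_def simp del: prod_mod_simps)
  then show "f \<in> proj_homs A \<eta> X Y"
    unfolding proj_homs_def
    using proj lhom_compose[OF g uv(1) X] lhom_compose[OF uv(2) h P(1)] finite_rank_lhom[OF X Y f] by blast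
qed

section \<open>Gorenstein-projective modules\<close>

lemma gorenstein_projective_liso:
  assumes M: "gorenstein_projective A \<eta> M" and N: "fd_module A \<eta> N" and iso: "liso A N M"
  shows "gorenstein_projective A \<eta> N"
  using assms liso_trans[OF fd_module_left_module[OF N] iso] unfolding gorenstein_projective_def by blast

lemma left_module_kernel:
  assumes M: "left_module A M" and N: "left_module A N" and f: "f \<in> lhom A M N"
  shows "left_module A (kernel_module M N f)"
proof -
  interpret M: left_module A M by fact
  interpret N: left_module A N by fact
  show ?thesis unfolding kernel_module_def
    by (rule left_module_submodule[OF M]) (auto simp: lhom_zero[OF M N f] lhom_add[OF f] lhom_smult[OF f])
qed

lemma kernel_module_simps [simp]:
  "carrier (kernel_module M N f) = {x \<in> carrier M. f x = \<zero>\<^bsub>N\<^esub>}"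
  "\<zero>\<^bsub>kernel_module M N f\<^esub> = \<zero>\<^bsub>M\<^esub>"
  "add (kernel_module M N f) = add M"
  "module.smult (kernel_module M N f) = module.smult M"
  by (simp_all add: kernel_module_def)

text \<open>
  The terms of the complex may be taken from any type: replacing each of them by an isomorphic copy
  transports the differentials, both kinds of acyclicity and the kernels.
\<close>

lemma (in fd_algebra) gorenstein_projectiveI:
  fixes P :: "int \<Rightarrow> ('a, 'm) module" and M :: "('a, 'n) module"
  assumes M: "fd_module A \<eta> M" and proj: "\<And>j. projective A \<eta> (P j)"
    and acyclic: "acyclic_complex A P d" and hom_acyclic: "Hom_acyclic A P d (regular_module A)"
    and iso: "liso A M (kernel_module (P i) (P (i + 1)) (d i))"
  shows "gorenstein_projective A \<eta> M"
proof -
  have fd: "fd_module A \<eta> (P j)" for j using proj by (rule projective_fd_module)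
  have lm: "left_module A (P j)" for j using fd by (rule fd_module_left_module)
  have "\<exists>N :: ('a, 'k) fmod. left_module A N \<and> liso A (P j) N" for j
    using fd_module_copy[OF fd[of j]] by metis
  then obtain N :: "int \<Rightarrow> ('a, 'k) fmod" where N: "\<And>j. left_module A (N j)" "\<And>j. liso A (P j) (N j)"
    by metis
  have "\<exists>u v. u \<in> lhom A (P j) (N j) \<and> v \<in> lhom A (N j) (P j) \<and> (\<forall>x\<in>carrier (P j). v (u x) = x) \<and>
      (\<forall>y\<in>carrier (N j). u (v y) = y)" for j
    using N(2)[of j] unfolding liso_iff_inverse[OF lm[of j]] by blast
  then obtain u v where u: "\<And>j. u j \<in> lhom A (P j) (N j)" and v: "\<And>j. v j \<in> lhom A (N j) (P j)"
    and vu: "\<And>j x. x \<in> carrier (P j) \<Longrightarrow> v j (u j x) = x" and uv: "\<And>j y. y \<in> carrier (N j) \<Longrightarrow> u j (v j y) = y"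
    by metis
  note uc = lhom_closed[OF u] and vc = lhom_closed[OF v]
  have d: "d j \<in> lhom A (P j) (P (j + 1))" for j using acyclic by (simp add: acyclic_complex_def)
  have exact: "d j ` carrier (P j) = {x \<in> carrier (P (j + 1)). d (j + 1) x = \<zero>\<^bsub>P (j + 2)\<^esub>}" for j
    using acyclic by (simp add: acyclic_complex_def)
  note dc = lhom_closed[OF d]
  define d' where "d' j = compose (carrier (N j)) (u (j + 1)) (compose (carrier (N j)) (d j) (v j))" for j
  have d': "d' j \<in> lhom A (N j) (N (j + 1))" for j
    unfolding d'_def by (rule lhom_compose[OF lhom_compose[OF v d N(1)] u N(1)])
  have d'_app: "d' j y = u (j + 1) (d j (v j y))" if "y \<in> carrier (N j)" for j y
    using that by (simp add: d'_def compose_def)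
  have u_zero: "u j x = \<zero>\<^bsub>N j\<^esub> \<longleftrightarrow> x = \<zero>\<^bsub>P j\<^esub>" if "x \<in> carrier (P j)" for j x
    using vu[OF that] lhom_zero[OF lm N(1) u, of j] lhom_zero[OF N(1) lm v, of j] by auto
  have d'_zero: "d' j y = \<zero>\<^bsub>N (j + 1)\<^esub> \<longleftrightarrow> d j (v j y) = \<zero>\<^bsub>P (j + 1)\<^esub>" if "y \<in> carrier (N j)" for j y
    unfolding d'_app[OF that] by (rule u_zero[OF dc[OF vc[OF that]]])
  have two: "j + 1 + 1 = j + 2" for j :: int by simp
  have proj': "projective A \<eta> (N j)" for j
    by (rule projective_if_finite_rank_id[OF fd_module_liso[OF fd N]
          finite_rank_id_liso[OF lm N finite_rank_id_if_projective[OF proj]]])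
  have acyclic': "acyclic_complex A N d'"
    unfolding acyclic_complex_def
  proof (intro conjI allI d')
    fix j
    show "d' j ` carrier (N j) = {y \<in> carrier (N (j + 1)). d' (j + 1) y = \<zero>\<^bsub>N (j + 2)\<^esub>}"
    proof (intro subset_antisym subsetI)
      fix y assume "y \<in> d' j ` carrier (N j)"
      then obtain x where x: "x \<in> carrier (N j)" "y = d' j x" by blast
      have "d j (v j x) \<in> d j ` carrier (P j)" using vc[OF x(1)] by blast
      then have "d (j + 1) (d j (v j x)) = \<zero>\<^bsub>P (j + 2)\<^esub>" unfolding exact by simp
      moreover have "v (j + 1) y = d j (v j x)" unfolding x(2) d'_app[OF x(1)] by (rule vu[OF dc[OF vc[OF x(1)]]])
      moreover have y: "y \<in> carrier (N (j + 1))" unfolding x(2) by (rule lhom_closed[OF d' x(1)])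
      ultimately show "y \<in> {y \<in> carrier (N (j + 1)). d' (j + 1) y = \<zero>\<^bsub>N (j + 2)\<^esub>}"
        using d'_zero[OF y] by (simp add: two)
    next
      fix y assume "y \<in> {y \<in> carrier (N (j + 1)). d' (j + 1) y = \<zero>\<^bsub>N (j + 2)\<^esub>}"
      then have y: "y \<in> carrier (N (j + 1))" "d' (j + 1) y = \<zero>\<^bsub>N (j + 2)\<^esub>" by auto
      have "d (j + 1) (v (j + 1) y) = \<zero>\<^bsub>P (j + 2)\<^esub>" using d'_zero[OF y(1)] y(2) by (simp add: two)
      then have "v (j + 1) y \<in> d j ` carrier (P j)" unfolding exact using vc[OF y(1)] by blast
      then obtain x where x: "x \<in> carrier (P j)" "v (j + 1) y = d j x" by blast
      have "d' j (u j x) = y" using d'_app[OF uc[OF x(1)]] vu[OF x(1)] x(2) uv[OF y(1)] by simp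
      then show "y \<in> d' j ` carrier (N j)" using uc[OF x(1)] by blast
    qed
  qed
  let ?R = "regular_module A"
  have hom_acyclic': "Hom_acyclic A N d' ?R"
    unfolding Hom_acyclic_def
  proof (intro allI subset_antisym subsetI)
    fix j f assume "f \<in> (\<lambda>g. compose (carrier (N (j + 1))) g (d' (j + 1))) ` lhom A (N (j + 2)) ?R"
    then obtain g where g: "g \<in> lhom A (N (j + 2)) ?R" "f = compose (carrier (N (j + 1))) g (d' (j + 1))"
      by blast
    have "d' (j + 1) \<in> lhom A (N (j + 1)) (N (j + 2))" using d'[of "j + 1"] by (simp add: two)
    then have f: "f \<in> lhom A (N (j + 1)) ?R" unfolding g(2) by (rule lhom_compose[OF _ g(1) N(1)])
    moreover have "compose (carrier (N j)) f (d' j) = zero_hom (N j) ?R"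
    proof (rule ext)
      fix x
      show "compose (carrier (N j)) f (d' j) x = zero_hom (N j) ?R x"
      proof (cases "x \<in> carrier (N j)")
        case True
        then have "d' j x \<in> d' j ` carrier (N j)" by blast
        then have "d' j x \<in> carrier (N (j + 1))" "d' (j + 1) (d' j x) = \<zero>\<^bsub>N (j + 2)\<^esub>"
          using acyclic' unfolding acyclic_complex_def by auto
        then show ?thesis
          using True lhom_zero[OF N(1) left_module_regular[OF ring_axioms] g(1)]
          by (simp add: g(2) compose_def zero_hom_def)
      qed (simp add: compose_def zero_hom_def)
    qed
    ultimately show "f \<in> {f \<in> lhom A (N (j + 1)) ?R. compose (carrier (N j)) f (d' j) = zero_hom (N j) ?R}"
      by blast
  next
    fix j f assume "f \<in> {f \<in> lhom A (N (j + 1)) ?R. compose (carrier (N j)) f (d' j) = zero_hom (N j) ?R}"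
    then have f: "f \<in> lhom A (N (j + 1)) ?R" and f0: "compose (carrier (N j)) f (d' j) = zero_hom (N j) ?R"
      by auto
    define h where "h = compose (carrier (P (j + 1))) f (u (j + 1))"
    have h: "h \<in> lhom A (P (j + 1)) ?R" unfolding h_def by (rule lhom_compose[OF u f lm])
    have "compose (carrier (P j)) h (d j) = zero_hom (P j) ?R"
    proof (rule ext)
      fix x
      show "compose (carrier (P j)) h (d j) x = zero_hom (P j) ?R x"
      proof (cases "x \<in> carrier (P j)")
        case True
        have "f (d' j (u j x)) = \<zero>"
          using fun_cong[OF f0, of "u j x"] uc[OF True] by (simp add: compose_def zero_hom_def)
        then show ?thesis
          using True dc[OF True] vu[OF True] d'_app[OF uc[OF True]] by (simp add: h_def compose_def zero_hom_def)
      qed (simp add: compose_def zero_hom_def)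
    qed
    then have "h \<in> (\<lambda>g. compose (carrier (P (j + 1))) g (d (j + 1))) ` lhom A (P (j + 2)) ?R"
      using h hom_acyclic unfolding Hom_acyclic_def by blast
    then obtain g where g: "g \<in> lhom A (P (j + 2)) ?R" "h = compose (carrier (P (j + 1))) g (d (j + 1))"
      by blast
    define g' where "g' = compose (carrier (N (j + 2))) g (v (j + 2))"
    have g': "g' \<in> lhom A (N (j + 2)) ?R" unfolding g'_def by (rule lhom_compose[OF v g(1) N(1)])
    have "f = compose (carrier (N (j + 1))) g' (d' (j + 1))"
    proof (rule ext)
      fix y
      show "f y = compose (carrier (N (j + 1))) g' (d' (j + 1)) y"
      proof (cases "y \<in> carrier (N (j + 1))")
        case True
        have c: "d (j + 1) (v (j + 1) y) \<in> carrier (P (j + 2))" using dc[OF vc[OF True]] by (simp add: two)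
        have "f y = h (v (j + 1) y)" using uv[OF True] vc[OF True] by (simp add: h_def compose_def)
        also have "\<dots> = g (d (j + 1) (v (j + 1) y))" unfolding g(2) using vc[OF True] by (simp add: compose_def)
        also have "\<dots> = g' (d' (j + 1) y)"
          using d'_app[OF True] vu[OF c] uc[OF c] by (simp add: g'_def compose_def two)
        finally show ?thesis using True by (simp add: compose_def)
      qed (simp add: compose_def lhom_undefined[OF f])
    qed
    then show "f \<in> (\<lambda>g. compose (carrier (N (j + 1))) g (d' (j + 1))) ` lhom A (N (j + 2)) ?R"
      using g' by blast
  qed
  have "liso A (kernel_module (P i) (P (i + 1)) (d i)) (kernel_module (N i) (N (i + 1)) (d' i))"
  proof -
    let ?K = "kernel_module (P i) (P (i + 1)) (d i)" and ?K' = "kernel_module (N i) (N (i + 1)) (d' i)"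
    note K = left_module_kernel[OF lm lm d, of i] and K' = left_module_kernel[OF N(1) N(1) d', of i]
    have 1: "(\<lambda>x\<in>carrier ?K. u i x) \<in> lhom A ?K ?K'"
      by (rule lhom_restrictI[OF K]) (auto simp: d'_zero[OF uc] uc vu lhom_add[OF u] lhom_smult[OF u])
    have 2: "(\<lambda>x\<in>carrier ?K'. v i x) \<in> lhom A ?K' ?K"
      by (rule lhom_restrictI[OF K']) (auto simp: d'_zero vc lhom_add[OF v] lhom_smult[OF v])
    show ?thesis unfolding liso_iff_inverse[OF K]
      by (intro bexI[OF _ 1] bexI[OF _ 2]) (auto simp: d'_zero uc vc uv vu)
  qed
  then have "liso A M (kernel_module (N i) (N (i + 1)) (d' i))"
    by (rule liso_trans[OF fd_module_left_module[OF M] iso])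
  then show ?thesis
    unfolding gorenstein_projective_def using M proj' acyclic' hom_acyclic' by blast
qed

lemma gorenstein_projectiveE:
  fixes \<eta> :: "'k::field \<Rightarrow> 'a"
  assumes "gorenstein_projective A \<eta> M"
  obtains P :: "int \<Rightarrow> ('a, 'k) fmod" and d where "\<And>j. projective A \<eta> (P j)" "acyclic_complex A P d"
    "Hom_acyclic A P d (regular_module A)" "liso A M (kernel_module (P 0) (P 1) (d 0))"
proof -
  obtain P :: "int \<Rightarrow> ('a, 'k) fmod" and d i where P: "\<And>j. projective A \<eta> (P j)" "acyclic_complex A P d"
    "Hom_acyclic A P d (regular_module A)" "liso A M (kernel_module (P i) (P (i + 1)) (d i))"
    using assms unfolding gorenstein_projective_def by blast
  define P' where "P' j = P (i + j)" for j
  define d' where "d' j = d (i + j)" for j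
  have e: "i + (j + 1) = i + j + 1" "i + (j + 2) = i + j + 2" for j by simp_all
  have "acyclic_complex A P' d'"
    using P(2) unfolding acyclic_complex_def P'_def d'_def e by blast
  moreover have "Hom_acyclic A P' d' (regular_module A)"
    using P(3) unfolding Hom_acyclic_def P'_def d'_def e by blast
  ultimately show ?thesis using that[of P' d'] P(1,4) by (simp add: P'_def d'_def)
qed

text \<open>Products of complexes are taken term by term.\<close>

lemma (in fd_algebra) gorenstein_projective_prod_mod:
  assumes fin: "finite J" and gp: "\<And>j. j \<in> J \<Longrightarrow> gorenstein_projective A \<eta> (M j)"
  shows "gorenstein_projective A \<eta> (prod_mod J M)"
proof -
  let ?R = "regular_module A"
  have "\<exists>(P :: int \<Rightarrow> ('a, 'k) fmod) d. (\<forall>l. projective A \<eta> (P l)) \<and> acyclic_complex A P d \<and>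
    Hom_acyclic A P d ?R \<and> liso A (M j) (kernel_module (P 0) (P 1) (d 0))" if "j \<in> J" for j
    using gorenstein_projectiveE[OF gp[OF that]] by metis
  then obtain P :: "'b \<Rightarrow> int \<Rightarrow> ('a, 'k) fmod" and d where
    P: "\<And>j l. j \<in> J \<Longrightarrow> projective A \<eta> (P j l)" and ac: "\<And>j. j \<in> J \<Longrightarrow> acyclic_complex A (P j) (d j)"
    and hac: "\<And>j. j \<in> J \<Longrightarrow> Hom_acyclic A (P j) (d j) ?R"
    and iso: "\<And>j. j \<in> J \<Longrightarrow> liso A (M j) (kernel_module (P j 0) (P j 1) (d j 0))"
    by metis
  have fdP: "fd_module A \<eta> (P j l)" if "j \<in> J" for j l by (rule projective_fd_module[OF P[OF that]])
  have lmP: "left_module A (P j l)" if "j \<in> J" for j l by (rule fd_module_left_module[OF fdP[OF that]])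
  have fdM: "fd_module A \<eta> (M j)" if "j \<in> J" for j by (rule gorenstein_projective_fd_module[OF gp[OF that]])
  have lmM: "left_module A (M j)" if "j \<in> J" for j by (rule fd_module_left_module[OF fdM[OF that]])
  have dl: "d j l \<in> lhom A (P j l) (P j (l + 1))" if "j \<in> J" for j l
    using ac[OF that] by (simp add: acyclic_complex_def)
  have exact: "d j l ` carrier (P j l) = {x \<in> carrier (P j (l + 1)). d j (l + 1) x = \<zero>\<^bsub>P j (l + 2)\<^esub>}"
    if "j \<in> J" for j l using ac[OF that] by (simp add: acyclic_complex_def)
  define PP where "PP l = prod_mod J (\<lambda>j. P j l)" for l
  define dd where "dd l = (\<lambda>f\<in>carrier (PP l). \<lambda>j\<in>J. d j l (f j))" for l
  have fdPP: "fd_module A \<eta> (PP l)" for l unfolding PP_def by (rule fd_module_prod_mod[OF fin fdP])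
  have lmPP: "left_module A (PP l)" for l using fdPP by (rule fd_module_left_module)
  have projPP: "projective A \<eta> (PP l)" for l
    by (rule projective_if_finite_rank_id[OF fdPP])
      (unfold PP_def, rule finite_rank_id_prod_mod[OF ring_axioms lmP fin finite_rank_id_if_projective[OF P]])
  have PPmem: "f j \<in> carrier (P j l)" if "f \<in> carrier (PP l)" "j \<in> J" for f j l
    using that by (auto simp: PP_def)
  have PPI: "(\<lambda>j\<in>J. f j) \<in> carrier (PP l)" if "\<And>j. j \<in> J \<Longrightarrow> f j \<in> carrier (P j l)" for f l
    using that by (auto simp: PP_def)
  have PPeq: "f = g" if "f \<in> carrier (PP l)" "g \<in> carrier (PP l)" "\<And>j. j \<in> J \<Longrightarrow> f j = g j" for f g l
    using that by (auto simp: PP_def intro: PiE_ext)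
  have PP0: "\<zero>\<^bsub>PP l\<^esub> = (\<lambda>j\<in>J. \<zero>\<^bsub>P j l\<^esub>)" for l by (simp add: PP_def)
  have ddl: "dd l \<in> lhom A (PP l) (PP (l + 1))" for l
    unfolding dd_def
  proof (rule lhom_restrictI[OF lmPP])
    fix f assume f: "f \<in> carrier (PP l)"
    show "(\<lambda>j\<in>J. d j l (f j)) \<in> carrier (PP (l + 1))"
      by (rule PPI[OF lhom_closed[OF dl PPmem[OF f]]])
    {
      fix g assume g: "g \<in> carrier (PP l)"
      show "(\<lambda>j\<in>J. d j l ((f \<oplus>\<^bsub>PP l\<^esub> g) j)) = (\<lambda>j\<in>J. d j l (f j)) \<oplus>\<^bsub>PP (l + 1)\<^esub> (\<lambda>j\<in>J. d j l (g j))"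
        unfolding PP_def prod_mod_simps
        by (rule restrict_ext) (simp add: lhom_add[OF dl PPmem[OF f] PPmem[OF g]])
    }
    fix a assume a: "a \<in> carrier A"
    show "(\<lambda>j\<in>J. d j l ((a \<odot>\<^bsub>PP l\<^esub> f) j)) = a \<odot>\<^bsub>PP (l + 1)\<^esub> (\<lambda>j\<in>J. d j l (f j))"
      unfolding PP_def prod_mod_simps
      by (rule restrict_ext) (simp add: lhom_smult[OF dl a PPmem[OF f]])
  qed
  have dd_app: "dd l f j = d j l (f j)" if "f \<in> carrier (PP l)" "j \<in> J" for l f j
    using that by (simp add: dd_def)
  have two: "l + 1 + 1 = l + 2" for l :: int by simp
  have dd_zero: "dd l f = \<zero>\<^bsub>PP (l + 1)\<^esub> \<longleftrightarrow> (\<forall>j\<in>J. d j l (f j) = \<zero>\<^bsub>P j (l + 1)\<^esub>)" if f: "f \<in> carrier (PP l)" for l f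
  proof
    assume "dd l f = \<zero>\<^bsub>PP (l + 1)\<^esub>"
    then show "\<forall>j\<in>J. d j l (f j) = \<zero>\<^bsub>P j (l + 1)\<^esub>"
      using dd_app[OF f] by (simp add: PP0)
  next
    assume *: "\<forall>j\<in>J. d j l (f j) = \<zero>\<^bsub>P j (l + 1)\<^esub>"
    show "dd l f = \<zero>\<^bsub>PP (l + 1)\<^esub>"
      by (rule PPeq[OF lhom_closed[OF ddl f] left_module_zero_closed[OF lmPP]])
        (use * dd_app[OF f] in \<open>simp add: PP0\<close>)
  qed
  have acyclic: "acyclic_complex A PP dd"
    unfolding acyclic_complex_def
  proof (intro conjI allI ddl subset_antisym subsetI)
    fix l g assume "g \<in> dd l ` carrier (PP l)"
    then obtain f where f: "f \<in> carrier (PP l)" "g = dd l f" by blast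
    have g: "g \<in> carrier (PP (l + 1))" unfolding f(2) by (rule lhom_closed[OF ddl f(1)])
    have "d j (l + 1) (g j) = \<zero>\<^bsub>P j (l + 2)\<^esub>" if j: "j \<in> J" for j
    proof -
      have "g j \<in> d j l ` carrier (P j l)" using dd_app[OF f(1) j] PPmem[OF f(1) j] f(2) by simp
      then show ?thesis unfolding exact[OF j] by simp
    qed
    then show "g \<in> {x \<in> carrier (PP (l + 1)). dd (l + 1) x = \<zero>\<^bsub>PP (l + 2)\<^esub>}"
      using dd_zero[OF g] g by (simp add: two)
  next
    fix l g assume "g \<in> {x \<in> carrier (PP (l + 1)). dd (l + 1) x = \<zero>\<^bsub>PP (l + 2)\<^esub>}"
    then have g: "g \<in> carrier (PP (l + 1))" "dd (l + 1) g = \<zero>\<^bsub>PP (l + 2)\<^esub>" by auto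
    have "g j \<in> d j l ` carrier (P j l)" if j: "j \<in> J" for j
      unfolding exact[OF j] using dd_zero[OF g(1)] g(2) PPmem[OF g(1) j] j by (simp add: two)
    then have "\<exists>x. x \<in> carrier (P j l) \<and> g j = d j l x" if "j \<in> J" for j
      using that by blast
    then obtain f where f: "\<And>j. j \<in> J \<Longrightarrow> f j \<in> carrier (P j l)" "\<And>j. j \<in> J \<Longrightarrow> g j = d j l (f j)"
      by metis
    note F = PPI[OF f(1)]
    have "g = dd l (\<lambda>j\<in>J. f j)"
    proof (rule PPeq[OF g(1) lhom_closed[OF ddl F]])
      fix j assume "j \<in> J"
      then show "g j = dd l (\<lambda>j\<in>J. f j) j" using dd_app[OF F] f(2) by simp
    qed
    then show "g \<in> dd l ` carrier (PP l)" using F by blast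
  qed
  have inj: "inj_hom J (\<lambda>j. P j l) j \<in> lhom A (P j l) (PP l)" if "j \<in> J" for j l
    unfolding PP_def by (rule lhom_inj_hom[of J A "\<lambda>j. P j l", OF lmP that])
  have hom_acyclic: "Hom_acyclic A PP dd ?R"
    unfolding Hom_acyclic_def
  proof (intro allI subset_antisym subsetI)
    fix l f assume "f \<in> (\<lambda>g. compose (carrier (PP (l + 1))) g (dd (l + 1))) ` lhom A (PP (l + 2)) ?R"
    then obtain g where g: "g \<in> lhom A (PP (l + 2)) ?R" "f = compose (carrier (PP (l + 1))) g (dd (l + 1))"
      by blast
    have "dd (l + 1) \<in> lhom A (PP (l + 1)) (PP (l + 2))" using ddl[of "l + 1"] by (simp add: two)
    then have f: "f \<in> lhom A (PP (l + 1)) ?R" unfolding g(2) by (rule lhom_compose[OF _ g(1) lmPP])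
    moreover have "compose (carrier (PP l)) f (dd l) = zero_hom (PP l) ?R"
    proof (rule ext)
      fix x
      show "compose (carrier (PP l)) f (dd l) x = zero_hom (PP l) ?R x"
      proof (cases "x \<in> carrier (PP l)")
        case True
        then have "dd l x \<in> dd l ` carrier (PP l)" by blast
        then have "dd l x \<in> carrier (PP (l + 1))" "dd (l + 1) (dd l x) = \<zero>\<^bsub>PP (l + 2)\<^esub>"
          using acyclic unfolding acyclic_complex_def by auto
        then show ?thesis
          using True lhom_zero[OF lmPP left_module_regular[OF ring_axioms] g(1)]
          by (simp add: g(2) compose_def zero_hom_def)
      qed (simp add: compose_def zero_hom_def)
    qed
    ultimately show "f \<in> {f \<in> lhom A (PP (l + 1)) ?R. compose (carrier (PP l)) f (dd l) = zero_hom (PP l) ?R}"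
      by blast
  next
    fix l f assume "f \<in> {f \<in> lhom A (PP (l + 1)) ?R. compose (carrier (PP l)) f (dd l) = zero_hom (PP l) ?R}"
    then have f: "f \<in> lhom A (PP (l + 1)) ?R" and f0: "compose (carrier (PP l)) f (dd l) = zero_hom (PP l) ?R"
      by auto
    have f_dd: "f (dd l x) = \<zero>" if "x \<in> carrier (PP l)" for x
      using fun_cong[OF f0, of x] that by (simp add: compose_def zero_hom_def)
    define h where "h j = compose (carrier (P j (l + 1))) f (inj_hom J (\<lambda>j. P j (l + 1)) j)" for j
    have h: "h j \<in> lhom A (P j (l + 1)) ?R" if "j \<in> J" for j
      unfolding h_def by (rule lhom_compose[OF inj[OF that] f lmP[OF that]])
    have "compose (carrier (P j l)) (h j) (d j l) = zero_hom (P j l) ?R" if j: "j \<in> J" for j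
    proof (rule ext)
      fix x
      show "compose (carrier (P j l)) (h j) (d j l) x = zero_hom (P j l) ?R x"
      proof (cases "x \<in> carrier (P j l)")
        case True
        note ix = lhom_closed[OF inj[OF j] True] and dx = lhom_closed[OF dl[OF j] True]
        have "inj_hom J (\<lambda>j. P j (l + 1)) j (d j l x) = dd l (inj_hom J (\<lambda>j. P j l) j x)"
        proof (rule PPeq[OF lhom_closed[OF inj[OF j] dx] lhom_closed[OF ddl ix]])
          fix i assume i: "i \<in> J"
          show "inj_hom J (\<lambda>j. P j (l + 1)) j (d j l x) i = dd l (inj_hom J (\<lambda>j. P j l) j x) i"
            using True dx i lhom_zero[OF lmP[OF i] lmP[OF i] dl[OF i]]
            by (simp add: dd_app[OF ix i]) (simp add: inj_hom_def)
        qed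
        then show ?thesis using True dx f_dd[OF ix] by (simp add: h_def compose_def zero_hom_def)
      qed (simp add: compose_def zero_hom_def)
    qed
    then have "h j \<in> (\<lambda>g. compose (carrier (P j (l + 1))) g (d j (l + 1))) ` lhom A (P j (l + 2)) ?R" if "j \<in> J" for j
      using h[OF that] hac[OF that] that unfolding Hom_acyclic_def by blast
    then have "\<exists>g. g \<in> lhom A (P j (l + 2)) ?R \<and> h j = compose (carrier (P j (l + 1))) g (d j (l + 1))" if "j \<in> J" for j
      using that by blast
    then obtain g where g: "\<And>j. j \<in> J \<Longrightarrow> g j \<in> lhom A (P j (l + 2)) ?R"
      and hg: "\<And>j. j \<in> J \<Longrightarrow> h j = compose (carrier (P j (l + 1))) (g j) (d j (l + 1))"
      by metis
    define G where "G = (\<lambda>x\<in>carrier (PP (l + 2)). \<Oplus>j\<in>J. g j (x j))"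
    have gc: "(\<lambda>j. g j (x j)) \<in> J \<rightarrow> carrier A" if "x \<in> carrier (PP (l + 2))" for x
      using lhom_closed[OF g PPmem[OF that]] by auto
    have G: "G \<in> lhom A (PP (l + 2)) ?R"
      unfolding G_def
    proof (rule lhom_restrictI[OF lmPP])
      fix x assume x: "x \<in> carrier (PP (l + 2))"
      show "(\<Oplus>j\<in>J. g j (x j)) \<in> carrier ?R" using finsum_closed[OF gc[OF x]] by simp
      {
        fix y assume y: "y \<in> carrier (PP (l + 2))"
        have "(\<Oplus>j\<in>J. g j ((x \<oplus>\<^bsub>PP (l + 2)\<^esub> y) j)) = (\<Oplus>j\<in>J. g j (x j) \<oplus> g j (y j))"
          using gc[OF x] gc[OF y]
          by (intro finsum_cong') (auto simp: PP_def lhom_add[OF g PPmem[OF x] PPmem[OF y]])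
        also have "\<dots> = (\<Oplus>j\<in>J. g j (x j)) \<oplus> (\<Oplus>j\<in>J. g j (y j))"
          by (rule finsum_addf[OF gc[OF x] gc[OF y]])
        finally show "(\<Oplus>j\<in>J. g j ((x \<oplus>\<^bsub>PP (l + 2)\<^esub> y) j)) = (\<Oplus>j\<in>J. g j (x j)) \<oplus>\<^bsub>?R\<^esub> (\<Oplus>j\<in>J. g j (y j))"
          by simp
      }
      fix a assume a: "a \<in> carrier A"
      have "(\<Oplus>j\<in>J. g j ((a \<odot>\<^bsub>PP (l + 2)\<^esub> x) j)) = (\<Oplus>j\<in>J. a \<otimes> g j (x j))"
        using gc[OF x] a
        by (intro finsum_cong') (auto simp: PP_def lhom_smult[OF g a PPmem[OF x]])
      also have "\<dots> = a \<otimes> (\<Oplus>j\<in>J. g j (x j))"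
        by (rule finsum_rdistr[OF fin a gc[OF x], symmetric])
      finally show "(\<Oplus>j\<in>J. g j ((a \<odot>\<^bsub>PP (l + 2)\<^esub> x) j)) = a \<odot>\<^bsub>?R\<^esub> (\<Oplus>j\<in>J. g j (x j))" by simp
    qed
    have "f = compose (carrier (PP (l + 1))) G (dd (l + 1))"
    proof (rule ext)
      fix x
      show "f x = compose (carrier (PP (l + 1))) G (dd (l + 1)) x"
      proof (cases "x \<in> carrier (PP (l + 1))")
        case True
        have ddx: "dd (l + 1) x \<in> carrier (PP (l + 2))" using lhom_closed[OF ddl True] by (simp add: two)
        have cl: "(\<lambda>j. inj_hom J (\<lambda>j. P j (l + 1)) j (x j)) \<in> J \<rightarrow> carrier (PP (l + 1))"
          using lhom_closed[OF inj PPmem[OF True]] by auto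
        have xd: "x = (\<Oplus>\<^bsub>PP (l + 1)\<^esub>j\<in>J. inj_hom J (\<lambda>j. P j (l + 1)) j (x j))"
          unfolding PP_def
          by (rule prod_mod_decomp[OF ring_axioms, of J "\<lambda>j. P j (l + 1)", OF lmP fin]) (use True in \<open>simp_all add: PP_def\<close>)
        have "f x = (\<Oplus>\<^bsub>?R\<^esub>j\<in>J. f (inj_hom J (\<lambda>j. P j (l + 1)) j (x j)))"
          by (subst xd) (rule lhom_finsum[OF lmPP left_module_regular[OF ring_axioms] f fin cl])
        also have "\<dots> = (\<Oplus>j\<in>J. f (inj_hom J (\<lambda>j. P j (l + 1)) j (x j)))"
          by (simp add: finsum_def finprod_def)
        also have "\<dots> = (\<Oplus>j\<in>J. g j (dd (l + 1) x j))"
        proof (rule finsum_cong'[OF refl gc[OF ddx]])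
          fix j assume j: "j \<in> J"
          have "f (inj_hom J (\<lambda>j. P j (l + 1)) j (x j)) = h j (x j)"
            using PPmem[OF True j] by (simp add: h_def compose_def)
          also have "\<dots> = g j (dd (l + 1) x j)"
            using PPmem[OF True j] dd_app[OF True j] by (simp add: hg[OF j] compose_def)
          finally show "f (inj_hom J (\<lambda>j. P j (l + 1)) j (x j)) = g j (dd (l + 1) x j)" .
        qed
        finally show ?thesis using True ddx by (simp add: G_def compose_def)
      qed (simp add: compose_def lhom_undefined[OF f])
    qed
    then show "f \<in> (\<lambda>g. compose (carrier (PP (l + 1))) g (dd (l + 1))) ` lhom A (PP (l + 2)) ?R"
      using G by blast
  qed
  have "\<exists>u v. u \<in> lhom A (M j) (kernel_module (P j 0) (P j 1) (d j 0)) \<and>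
      v \<in> lhom A (kernel_module (P j 0) (P j 1) (d j 0)) (M j) \<and> (\<forall>x\<in>carrier (M j). v (u x) = x) \<and>
      (\<forall>y\<in>carrier (kernel_module (P j 0) (P j 1) (d j 0)). u (v y) = y)" if "j \<in> J" for j
    using iso[OF that] unfolding liso_iff_inverse[OF lmM[OF that]] by blast
  then obtain u v where u: "\<And>j. j \<in> J \<Longrightarrow> u j \<in> lhom A (M j) (kernel_module (P j 0) (P j 1) (d j 0))"
    and v: "\<And>j. j \<in> J \<Longrightarrow> v j \<in> lhom A (kernel_module (P j 0) (P j 1) (d j 0)) (M j)"
    and vu: "\<And>j x. j \<in> J \<Longrightarrow> x \<in> carrier (M j) \<Longrightarrow> v j (u j x) = x"
    and uv: "\<And>j y. j \<in> J \<Longrightarrow> y \<in> carrier (kernel_module (P j 0) (P j 1) (d j 0)) \<Longrightarrow> u j (v j y) = y"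
    by metis
  let ?K = "kernel_module (PP 0) (PP (0 + 1)) (dd 0)"
  have K: "left_module A ?K" by (rule left_module_kernel[OF lmPP lmPP ddl])
  have PM: "left_module A (prod_mod J M)" by (rule left_module_prod_mod[OF ring_axioms lmM])
  have Kmem: "f \<in> carrier ?K \<longleftrightarrow> f \<in> carrier (PP 0) \<and> (\<forall>j\<in>J. f j \<in> carrier (kernel_module (P j 0) (P j 1) (d j 0)))" for f
    using dd_zero[of f 0] PPmem[of f 0] by auto
  have Mmem: "f j \<in> carrier (M j)" if "f \<in> carrier (prod_mod J M)" "j \<in> J" for f j using that by auto
  have 1: "(\<lambda>f\<in>carrier (prod_mod J M). \<lambda>j\<in>J. u j (f j)) \<in> lhom A (prod_mod J M) ?K"
  proof (rule lhom_restrictI[OF PM])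
    fix f assume f: "f \<in> carrier (prod_mod J M)"
    note uf = lhom_closed[OF u Mmem[OF f]]
    show "(\<lambda>j\<in>J. u j (f j)) \<in> carrier ?K"
      unfolding Kmem using uf by (auto intro!: PPI)
    {
      fix g assume g: "g \<in> carrier (prod_mod J M)"
      show "(\<lambda>j\<in>J. u j ((f \<oplus>\<^bsub>prod_mod J M\<^esub> g) j)) = (\<lambda>j\<in>J. u j (f j)) \<oplus>\<^bsub>?K\<^esub> (\<lambda>j\<in>J. u j (g j))"
        unfolding PP_def kernel_module_simps prod_mod_simps
        by (rule restrict_ext) (simp add: lhom_add[OF u Mmem[OF f] Mmem[OF g]])
    }
    fix a assume a: "a \<in> carrier A"
    show "(\<lambda>j\<in>J. u j ((a \<odot>\<^bsub>prod_mod J M\<^esub> f) j)) = a \<odot>\<^bsub>?K\<^esub> (\<lambda>j\<in>J. u j (f j))"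
      unfolding PP_def kernel_module_simps prod_mod_simps
      by (rule restrict_ext) (simp add: lhom_smult[OF u a Mmem[OF f]])
  qed
  have 2: "(\<lambda>f\<in>carrier ?K. \<lambda>j\<in>J. v j (f j)) \<in> lhom A ?K (prod_mod J M)"
  proof (rule lhom_restrictI[OF K])
    fix f assume f: "f \<in> carrier ?K"
    have fK: "f j \<in> carrier (kernel_module (P j 0) (P j 1) (d j 0))" if "j \<in> J" for j
      using f that unfolding Kmem by blast
    show "(\<lambda>j\<in>J. v j (f j)) \<in> carrier (prod_mod J M)"
      using lhom_closed[OF v fK] by auto
    {
      fix g assume g: "g \<in> carrier ?K"
      have gK: "g j \<in> carrier (kernel_module (P j 0) (P j 1) (d j 0))" if "j \<in> J" for j
        using g that unfolding Kmem by blast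
      have "v j (f j \<oplus>\<^bsub>P j 0\<^esub> g j) = v j (f j) \<oplus>\<^bsub>M j\<^esub> v j (g j)" if "j \<in> J" for j
        using lhom_add[OF v fK gK, OF that that that] by simp
      then show "(\<lambda>j\<in>J. v j ((f \<oplus>\<^bsub>?K\<^esub> g) j)) = (\<lambda>j\<in>J. v j (f j)) \<oplus>\<^bsub>prod_mod J M\<^esub> (\<lambda>j\<in>J. v j (g j))"
        unfolding PP_def kernel_module_simps prod_mod_simps
        by (intro restrict_ext) simp
    }
    fix a assume a: "a \<in> carrier A"
    have "v j (a \<odot>\<^bsub>P j 0\<^esub> f j) = a \<odot>\<^bsub>M j\<^esub> v j (f j)" if "j \<in> J" for j
      using lhom_smult[OF v a fK, OF that that] by simp
    then show "(\<lambda>j\<in>J. v j ((a \<odot>\<^bsub>?K\<^esub> f) j)) = a \<odot>\<^bsub>prod_mod J M\<^esub> (\<lambda>j\<in>J. v j (f j))"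
      unfolding PP_def kernel_module_simps prod_mod_simps
      by (intro restrict_ext) simp
  qed
  have fdPM: "fd_module A \<eta> (prod_mod J M)" by (rule fd_module_prod_mod[OF fin fdM])
  have iso_PM: "liso A (prod_mod J M) ?K"
    unfolding liso_iff_inverse[OF PM]
  proof (intro bexI[OF _ 1] bexI[OF _ 2] conjI ballI)
    fix f assume f: "f \<in> carrier (prod_mod J M)"
    have "(\<lambda>j\<in>J. u j (f j)) \<in> carrier ?K"
      using lhom_closed[OF 1 f] f by simp
    then show "(\<lambda>f\<in>carrier ?K. \<lambda>j\<in>J. v j (f j)) ((\<lambda>f\<in>carrier (prod_mod J M). \<lambda>j\<in>J. u j (f j)) f) = f"
      using f vu[OF _ Mmem[OF f]] by (auto simp del: kernel_module_simps simp: PiE_def extensional_def fun_eq_iff)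
  next
    fix f assume f: "f \<in> carrier ?K"
    have fK: "f j \<in> carrier (kernel_module (P j 0) (P j 1) (d j 0))" if "j \<in> J" for j
      using f that unfolding Kmem by blast
    have vf: "(\<lambda>j\<in>J. v j (f j)) \<in> carrier (prod_mod J M)"
      using lhom_closed[OF 2 f] f by (simp del: prod_mod_simps kernel_module_simps)
    have "(\<lambda>j\<in>J. u j (v j (f j))) = f"
    proof (rule PPeq[of _ 0])
      show f0: "f \<in> carrier (PP 0)" using f unfolding Kmem by blast
      show "(\<lambda>j\<in>J. u j (v j (f j))) \<in> carrier (PP 0)"
        by (rule PPI) (simp add: uv[OF _ fK] PPmem[OF f0])
    qed (simp add: uv[OF _ fK])
    then show "(\<lambda>f\<in>carrier (prod_mod J M). \<lambda>j\<in>J. u j (f j)) ((\<lambda>f\<in>carrier ?K. \<lambda>j\<in>J. v j (f j)) f) = f"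
      using f vf by (simp del: prod_mod_simps kernel_module_simps cong: restrict_cong)
  qed
  show ?thesis
    by (rule gorenstein_projectiveI[OF fdPM projPP acyclic hom_acyclic iso_PM])
qed

section \<open>The stable category\<close>

context fd_algebra
begin

text \<open>
  The working form of stable equality: a difference of finite rank, written additively so that no
  subtraction occurs in calculations.
\<close>

lemma stable_eq_iff:
  assumes X: "left_module A X" and Y: "left_module A Y"
  shows "stable_eq A \<eta> X Y f g \<longleftrightarrow> f \<in> lhom A X Y \<and> g \<in> lhom A X Y \<and>
    (\<exists>r\<in>finite_rank_homs A X Y. \<forall>x\<in>carrier X. f x = g x \<oplus>\<^bsub>Y\<^esub> r x)"
proof -
  interpret Y: left_module A Y by fact
  have "diff_hom X Y f g \<in> finite_rank_homs A X Y \<longleftrightarrow>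
      (\<exists>r\<in>finite_rank_homs A X Y. \<forall>x\<in>carrier X. f x = g x \<oplus>\<^bsub>Y\<^esub> r x)" (is "?L \<longleftrightarrow> ?R")
    if f: "f \<in> lhom A X Y" and g: "g \<in> lhom A X Y"
  proof
    assume ?L
    moreover have "f x = g x \<oplus>\<^bsub>Y\<^esub> diff_hom X Y f g x" if "x \<in> carrier X" for x
      using lhom_closed[OF f that] lhom_closed[OF g that] that
      by (simp add: diff_hom_def a_minus_def Y.a_lcomm[of "g x"] Y.r_neg)
    ultimately show ?R by blast
  next
    assume ?R
    then obtain r where r: "r \<in> finite_rank_homs A X Y" "\<forall>x\<in>carrier X. f x = g x \<oplus>\<^bsub>Y\<^esub> r x" by blast
    have rl: "r \<in> lhom A X Y" by (rule finite_rank_lhom[OF X Y r(1)])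
    have "diff_hom X Y f g = r"
    proof (rule lhom_eqI[OF lhom_diff_hom[OF X Y f g] rl])
      fix x assume x: "x \<in> carrier X"
      show "diff_hom X Y f g x = r x"
        using x r(2) lhom_closed[OF g x] lhom_closed[OF rl x]
        by (simp add: diff_hom_def a_minus_def Y.a_comm[of "g x" "r x"] Y.a_assoc Y.r_neg)
    qed
    then show ?L using r(1) by simp
  qed
  then show ?thesis
    unfolding stable_eq_def proj_homs_eq_finite_rank[OF X Y] by blast
qed

lemma stable_eqI:
  assumes X: "left_module A X" and Y: "left_module A Y" and f: "f \<in> lhom A X Y" and g: "g \<in> lhom A X Y"
    and r: "r \<in> finite_rank_homs A X Y" and eq: "\<And>x. x \<in> carrier X \<Longrightarrow> f x = g x \<oplus>\<^bsub>Y\<^esub> r x"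
  shows "stable_eq A \<eta> X Y f g"
  unfolding stable_eq_iff[OF X Y] using f g r eq by blast

lemma stable_eqE:
  assumes X: "left_module A X" and Y: "left_module A Y" and eq: "stable_eq A \<eta> X Y f g"
  obtains r where "f \<in> lhom A X Y" "g \<in> lhom A X Y" "r \<in> finite_rank_homs A X Y"
    "\<And>x. x \<in> carrier X \<Longrightarrow> f x = g x \<oplus>\<^bsub>Y\<^esub> r x"
  using eq that unfolding stable_eq_iff[OF X Y] by blast

lemma stable_eq_refl:
  assumes X: "left_module A X" and Y: "left_module A Y" and f: "f \<in> lhom A X Y"
  shows "stable_eq A \<eta> X Y f f"
proof -
  interpret Y: left_module A Y by fact
  show ?thesis
    by (rule stable_eqI[OF X Y f f finite_rank_homs.zero]) (use lhom_closed[OF f] in \<open>simp add: zero_hom_def\<close>)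
qed

lemma stable_eq_sym:
  assumes X: "left_module A X" and Y: "left_module A Y" and fg: "stable_eq A \<eta> X Y f g"
  shows "stable_eq A \<eta> X Y g f"
proof -
  interpret Y: left_module A Y by fact
  obtain r where r: "f \<in> lhom A X Y" "g \<in> lhom A X Y" "r \<in> finite_rank_homs A X Y"
    "\<And>x. x \<in> carrier X \<Longrightarrow> f x = g x \<oplus>\<^bsub>Y\<^esub> r x" using stable_eqE[OF X Y fg] by blast
  have rl: "r \<in> lhom A X Y" by (rule finite_rank_lhom[OF X Y r(3)])
  show ?thesis
  proof (rule stable_eqI[OF X Y r(2,1) finite_rank_uminus[OF X Y r(3)]])
    fix x assume x: "x \<in> carrier X"
    show "g x = f x \<oplus>\<^bsub>Y\<^esub> (\<lambda>x\<in>carrier X. \<ominus>\<^bsub>Y\<^esub> r x) x"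
      using x lhom_closed[OF r(2) x] lhom_closed[OF rl x] by (simp add: r(4) Y.a_assoc Y.r_neg)
  qed
qed

lemma stable_eq_trans:
  assumes X: "left_module A X" and Y: "left_module A Y"
    and fg: "stable_eq A \<eta> X Y f g" and gh: "stable_eq A \<eta> X Y g h"
  shows "stable_eq A \<eta> X Y f h"
proof -
  interpret Y: left_module A Y by fact
  obtain r where r: "f \<in> lhom A X Y" "g \<in> lhom A X Y" "r \<in> finite_rank_homs A X Y"
    "\<And>x. x \<in> carrier X \<Longrightarrow> f x = g x \<oplus>\<^bsub>Y\<^esub> r x" using stable_eqE[OF X Y fg] by blast
  obtain s where s: "g \<in> lhom A X Y" "h \<in> lhom A X Y" "s \<in> finite_rank_homs A X Y"
    "\<And>x. x \<in> carrier X \<Longrightarrow> g x = h x \<oplus>\<^bsub>Y\<^esub> s x" using stable_eqE[OF X Y gh] by blast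
  have rl: "r \<in> lhom A X Y" "s \<in> lhom A X Y" by (rule finite_rank_lhom[OF X Y r(3)], rule finite_rank_lhom[OF X Y s(3)])
  show ?thesis
  proof (rule stable_eqI[OF X Y r(1) s(2) finite_rank_add[OF X Y s(3) r(3)]])
    fix x assume x: "x \<in> carrier X"
    show "f x = h x \<oplus>\<^bsub>Y\<^esub> (\<lambda>x\<in>carrier X. s x \<oplus>\<^bsub>Y\<^esub> r x) x"
      using x lhom_closed[OF s(2) x] lhom_closed[OF rl(1) x] lhom_closed[OF rl(2) x]
      by (simp add: r(4) s(4) Y.a_assoc)
  qed
qed

lemma stable_eq_compose_left:
  assumes X: "left_module A X" and Y: "left_module A Y" and Z: "left_module A Z"
    and fg: "stable_eq A \<eta> X Y f g" and h: "h \<in> lhom A Y Z"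
  shows "stable_eq A \<eta> X Z (compose (carrier X) h f) (compose (carrier X) h g)"
proof -
  obtain r where r: "f \<in> lhom A X Y" "g \<in> lhom A X Y" "r \<in> finite_rank_homs A X Y"
    "\<And>x. x \<in> carrier X \<Longrightarrow> f x = g x \<oplus>\<^bsub>Y\<^esub> r x" using stable_eqE[OF X Y fg] by blast
  have rl: "r \<in> lhom A X Y" by (rule finite_rank_lhom[OF X Y r(3)])
  show ?thesis
  proof (rule stable_eqI[OF X Z lhom_compose[OF r(1) h X] lhom_compose[OF r(2) h X] finite_rank_comp_left[OF X Y Z r(3) h]])
    fix x assume x: "x \<in> carrier X"
    show "compose (carrier X) h f x = compose (carrier X) h g x \<oplus>\<^bsub>Z\<^esub> compose (carrier X) h r x"
      using x by (simp add: compose_def r(4) lhom_add[OF h lhom_closed[OF r(2) x] lhom_closed[OF rl x]])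
  qed
qed

lemma stable_eq_compose_right:
  assumes X: "left_module A X" and Y: "left_module A Y" and Z: "left_module A Z"
    and fg: "stable_eq A \<eta> X Y f g" and h: "h \<in> lhom A Z X"
  shows "stable_eq A \<eta> Z Y (compose (carrier Z) f h) (compose (carrier Z) g h)"
proof -
  obtain r where r: "f \<in> lhom A X Y" "g \<in> lhom A X Y" "r \<in> finite_rank_homs A X Y"
    "\<And>x. x \<in> carrier X \<Longrightarrow> f x = g x \<oplus>\<^bsub>Y\<^esub> r x" using stable_eqE[OF X Y fg] by blast
  show ?thesis
  proof (rule stable_eqI[OF Z Y lhom_compose[OF h r(1) Z] lhom_compose[OF h r(2) Z] finite_rank_comp_right[OF X Y Z r(3) h]])
    fix x assume x: "x \<in> carrier Z"
    show "compose (carrier Z) f h x = compose (carrier Z) g h x \<oplus>\<^bsub>Y\<^esub> compose (carrier Z) r h x"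
      using x by (simp add: compose_def r(4)[OF lhom_closed[OF h x]])
  qed
qed

text \<open>
  The zero objects of the stable category are the projective modules.
\<close>

lemma stable_zero_iff:
  assumes X: "left_module A X"
  shows "stable_zero A \<eta> X \<longleftrightarrow> id_hom X \<in> finite_rank_homs A X X"
proof
  interpret X: left_module A X by fact
  assume "stable_zero A \<eta> X"
  then obtain r where r: "r \<in> finite_rank_homs A X X"
    "\<And>x. x \<in> carrier X \<Longrightarrow> id_hom X x = zero_hom X X x \<oplus>\<^bsub>X\<^esub> r x"
    using stable_eqE[OF X X] unfolding stable_zero_def by blast
  have rl: "r \<in> lhom A X X" by (rule finite_rank_lhom[OF X X r(1)])
  have "id_hom X = r"
    by (rule lhom_eqI[OF lhom_id[OF X] rl]) (use r(2) lhom_closed[OF rl] in \<open>simp add: zero_hom_def\<close>)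
  then show "id_hom X \<in> finite_rank_homs A X X" using r(1) by simp
next
  interpret X: left_module A X by fact
  assume "id_hom X \<in> finite_rank_homs A X X"
  then show "stable_zero A \<eta> X" unfolding stable_zero_def
    by (rule stable_eqI[OF X X lhom_id[OF X] lhom_zero_hom[OF X X]]) (simp add: id_hom_def zero_hom_def)
qed

lemma stable_zero_liso:
  assumes "left_module A X" "left_module A Y" "liso A X Y" "stable_zero A \<eta> X"
  shows "stable_zero A \<eta> Y"
  using assms finite_rank_id_liso[OF assms(1-3)] by (simp add: stable_zero_iff)

lemma compose_id_left: "f \<in> lhom A X Y \<Longrightarrow> compose (carrier X) (id_hom Y) f = f"
  by (intro ext) (simp add: compose_def id_hom_def lhom_closed[of f A X Y] lhom_undefined[of f A X Y])

lemma compose_id_right: "f \<in> lhom A X Y \<Longrightarrow> compose (carrier X) f (id_hom X) = f"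
  by (intro ext) (simp add: compose_def id_hom_def lhom_undefined[of f A X Y])

lemma stable_iso_liso:
  assumes X: "left_module A X" and Y: "left_module A Y" and iso: "liso A X Y"
  shows "stable_iso A \<eta> X Y"
proof -
  obtain f g where fg: "f \<in> lhom A X Y" "g \<in> lhom A Y X" "\<And>x. x \<in> carrier X \<Longrightarrow> g (f x) = x"
    "\<And>y. y \<in> carrier Y \<Longrightarrow> f (g y) = y" using iso unfolding liso_iff_inverse[OF X] by blast
  have "compose (carrier X) g f = id_hom X" "compose (carrier Y) f g = id_hom Y"
    using fg(3,4) by (auto simp: compose_def id_hom_def)
  then show ?thesis
    unfolding stable_iso_def
    using fg(1,2) stable_eq_refl[OF X X lhom_id[OF X]] stable_eq_refl[OF Y Y lhom_id[OF Y]]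
    by (intro bexI[OF _ fg(1)] bexI[OF _ fg(2)]) simp
qed

lemma stable_iso_sym: "stable_iso A \<eta> X Y \<Longrightarrow> stable_iso A \<eta> Y X"
  unfolding stable_iso_def by blast

lemma stable_eq_compose_cancel:
  assumes X: "left_module A X" and Y: "left_module A Y" and Z: "left_module A Z"
    and f: "f \<in> lhom A X Y" "g \<in> lhom A Y X" "f' \<in> lhom A Y Z" "g' \<in> lhom A Z Y"
    and gf: "stable_eq A \<eta> X X (compose (carrier X) g f) (id_hom X)"
    and gf': "stable_eq A \<eta> Y Y (compose (carrier Y) g' f') (id_hom Y)"
  shows "stable_eq A \<eta> X X (compose (carrier X) (compose (carrier Z) g g') (compose (carrier X) f' f)) (id_hom X)"
proof -
  have "compose (carrier X) (compose (carrier Z) g g') (compose (carrier X) f' f) =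
      compose (carrier X) g (compose (carrier X) (compose (carrier Y) g' f') f)"
    using lhom_closed[OF f(1)] lhom_closed[OF f(3)] by (intro ext) (simp add: compose_def)
  moreover have "stable_eq A \<eta> X X (compose (carrier X) g (compose (carrier X) (compose (carrier Y) g' f') f))
      (compose (carrier X) g (compose (carrier X) (id_hom Y) f))"
    by (rule stable_eq_compose_left[OF X Y X stable_eq_compose_right[OF Y Y X gf' f(1)] f(2)])
  ultimately show ?thesis
    using stable_eq_trans[OF X X _ gf] by (simp add: compose_id_left[OF f(1)])
qed

lemma stable_iso_trans:
  assumes X: "left_module A X" and Y: "left_module A Y" and Z: "left_module A Z"
    and "stable_iso A \<eta> X Y" "stable_iso A \<eta> Y Z"
  shows "stable_iso A \<eta> X Z"
proof -
  obtain f g where fg: "f \<in> lhom A X Y" "g \<in> lhom A Y X"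
    "stable_eq A \<eta> X X (compose (carrier X) g f) (id_hom X)"
    "stable_eq A \<eta> Y Y (compose (carrier Y) f g) (id_hom Y)"
    using assms(4) unfolding stable_iso_def by blast
  obtain f' g' where fg': "f' \<in> lhom A Y Z" "g' \<in> lhom A Z Y"
    "stable_eq A \<eta> Y Y (compose (carrier Y) g' f') (id_hom Y)"
    "stable_eq A \<eta> Z Z (compose (carrier Z) f' g') (id_hom Z)"
    using assms(5) unfolding stable_iso_def by blast
  show ?thesis unfolding stable_iso_def
    using stable_eq_compose_cancel[OF X Y Z fg(1,2) fg'(1,2) fg(3) fg'(3)]
      stable_eq_compose_cancel[OF Z Y X fg'(2,1) fg(2,1) fg'(4) fg(4)]
      lhom_compose[OF fg(1) fg'(1) X] lhom_compose[OF fg'(2) fg(2) Z] by blast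
qed

lemma stable_direct_sum_liso:
  assumes X: "left_module A X" and Y: "left_module A Y" and Z: "left_module A Z"
    and X': "left_module A X'" and Y': "left_module A Y'" and Z': "left_module A Z'"
    and iX: "liso A X X'" and iY: "liso A Y Y'" and iZ: "liso A Z Z'"
    and sum: "stable_direct_sum A \<eta> X Y Z"
  shows "stable_direct_sum A \<eta> X' Y' Z'"
proof -
  obtain a a' where a: "a \<in> lhom A X X'" "a' \<in> lhom A X' X" "\<And>x. x \<in> carrier X \<Longrightarrow> a' (a x) = x"
    "\<And>y. y \<in> carrier X' \<Longrightarrow> a (a' y) = y" using iX unfolding liso_iff_inverse[OF X] by blast
  obtain b b' where b: "b \<in> lhom A Y Y'" "b' \<in> lhom A Y' Y" "\<And>x. x \<in> carrier Y \<Longrightarrow> b' (b x) = x"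
    "\<And>y. y \<in> carrier Y' \<Longrightarrow> b (b' y) = y" using iY unfolding liso_iff_inverse[OF Y] by blast
  obtain c c' where c: "c \<in> lhom A Z Z'" "c' \<in> lhom A Z' Z" "\<And>x. x \<in> carrier Z \<Longrightarrow> c' (c x) = x"
    "\<And>y. y \<in> carrier Z' \<Longrightarrow> c (c' y) = y" using iZ unfolding liso_iff_inverse[OF Z] by blast
  obtain i j p q where i: "i \<in> lhom A Y X" and j: "j \<in> lhom A Z X" and p: "p \<in> lhom A X Y" and q: "q \<in> lhom A X Z"
    and pi: "stable_eq A \<eta> Y Y (compose (carrier Y) p i) (id_hom Y)"
    and qj: "stable_eq A \<eta> Z Z (compose (carrier Z) q j) (id_hom Z)"
    and pj: "stable_eq A \<eta> Z Y (compose (carrier Z) p j) (zero_hom Z Y)"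
    and qi: "stable_eq A \<eta> Y Z (compose (carrier Y) q i) (zero_hom Y Z)"
    and ip: "stable_eq A \<eta> X X (add_hom X X (compose (carrier X) i p) (compose (carrier X) j q)) (id_hom X)"
    using sum unfolding stable_direct_sum_def by blast
  note cl = lhom_closed[OF a(1)] lhom_closed[OF a(2)] lhom_closed[OF b(1)] lhom_closed[OF b(2)]
    lhom_closed[OF c(1)] lhom_closed[OF c(2)] lhom_closed[OF i] lhom_closed[OF j] lhom_closed[OF p] lhom_closed[OF q]
  define i' where "i' = compose (carrier Y') a (compose (carrier Y') i b')"
  define j' where "j' = compose (carrier Z') a (compose (carrier Z') j c')"
  define p' where "p' = compose (carrier X') b (compose (carrier X') p a')"
  define q' where "q' = compose (carrier X') c (compose (carrier X') q a')"
  have l: "i' \<in> lhom A Y' X'" "j' \<in> lhom A Z' X'" "p' \<in> lhom A X' Y'" "q' \<in> lhom A X' Z'"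
    unfolding i'_def j'_def p'_def q'_def
    by (rule lhom_compose[OF lhom_compose[OF b(2) i Y'] a(1) Y'] lhom_compose[OF lhom_compose[OF c(2) j Z'] a(1) Z']
        lhom_compose[OF lhom_compose[OF a(2) p X'] b(1) X'] lhom_compose[OF lhom_compose[OF a(2) q X'] c(1) X'])+
  have 1: "compose (carrier Y') p' i' = compose (carrier Y') b (compose (carrier Y') (compose (carrier Y) p i) b')"
    "compose (carrier Y') b (compose (carrier Y') (id_hom Y) b') = id_hom Y'"
    by (intro ext; simp add: compose_def id_hom_def p'_def i'_def a b c cl)+
  have 2: "compose (carrier Z') q' j' = compose (carrier Z') c (compose (carrier Z') (compose (carrier Z) q j) c')"
    "compose (carrier Z') c (compose (carrier Z') (id_hom Z) c') = id_hom Z'"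
    by (intro ext; simp add: compose_def id_hom_def q'_def j'_def a b c cl)+
  have 3: "compose (carrier Z') p' j' = compose (carrier Z') b (compose (carrier Z') (compose (carrier Z) p j) c')"
    "compose (carrier Z') b (compose (carrier Z') (zero_hom Z Y) c') = zero_hom Z' Y'"
    by (intro ext; simp add: compose_def zero_hom_def p'_def j'_def a b c cl lhom_zero[OF Y Y' b(1)])+
  have 4: "compose (carrier Y') q' i' = compose (carrier Y') c (compose (carrier Y') (compose (carrier Y) q i) b')"
    "compose (carrier Y') c (compose (carrier Y') (zero_hom Y Z) b') = zero_hom Y' Z'"
    by (intro ext; simp add: compose_def zero_hom_def q'_def i'_def a b c cl lhom_zero[OF Z Z' c(1)])+
  have 5: "add_hom X' X' (compose (carrier X') i' p') (compose (carrier X') j' q') =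
      compose (carrier X') a (compose (carrier X') (add_hom X X (compose (carrier X) i p) (compose (carrier X) j q)) a')"
    "compose (carrier X') a (compose (carrier X') (id_hom X) a') = id_hom X'"
    by (intro ext; simp add: compose_def id_hom_def add_hom_def p'_def j'_def q'_def i'_def a b c cl lhom_add[OF a(1)])+
  have "stable_eq A \<eta> Y' Y' (compose (carrier Y') p' i') (id_hom Y')"
    using stable_eq_compose_left[OF Y' Y Y' stable_eq_compose_right[OF Y Y Y' pi b(2)] b(1)] by (simp only: 1)
  moreover have "stable_eq A \<eta> Z' Z' (compose (carrier Z') q' j') (id_hom Z')"
    using stable_eq_compose_left[OF Z' Z Z' stable_eq_compose_right[OF Z Z Z' qj c(2)] c(1)] by (simp only: 2)
  moreover have "stable_eq A \<eta> Z' Y' (compose (carrier Z') p' j') (zero_hom Z' Y')"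
    using stable_eq_compose_left[OF Z' Y Y' stable_eq_compose_right[OF Z Y Z' pj c(2)] b(1)] by (simp only: 3)
  moreover have "stable_eq A \<eta> Y' Z' (compose (carrier Y') q' i') (zero_hom Y' Z')"
    using stable_eq_compose_left[OF Y' Z Z' stable_eq_compose_right[OF Y Z Y' qi b(2)] c(1)] by (simp only: 4)
  moreover have "stable_eq A \<eta> X' X' (add_hom X' X' (compose (carrier X') i' p') (compose (carrier X') j' q')) (id_hom X')"
    using stable_eq_compose_left[OF X' X X' stable_eq_compose_right[OF X X X' ip a(2)] a(1)] by (simp only: 5)
  ultimately show ?thesis unfolding stable_direct_sum_def using l by blast
qed

lemma stable_indecomposable_liso:
  fixes X :: "('a, 'm) module" and X' :: "('a, 'n) module"
  assumes X: "left_module A X" and X': "left_module A X'" and iso: "liso A X X'"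
    and ind: "stable_indecomposable A \<eta> X"
  shows "stable_indecomposable A \<eta> X'"
  unfolding stable_indecomposable_def
proof (intro conjI allI impI)
  note iso' = liso_sym[OF X X' iso]
  show "\<not> stable_zero A \<eta> X'"
    using stable_zero_liso[OF X' X iso'] ind unfolding stable_indecomposable_def by blast
  fix Y Z :: "('a, 'k) fmod"
  assume *: "gorenstein_projective A \<eta> Y \<and> gorenstein_projective A \<eta> Z \<and> stable_direct_sum A \<eta> X' Y Z"
  have Y: "left_module A Y" and Z: "left_module A Z"
    using * by (auto intro: fd_module_left_module[OF gorenstein_projective_fd_module])
  have "stable_direct_sum A \<eta> X Y Z"
    by (rule stable_direct_sum_liso[OF X' Y Z X Y Z iso' liso_refl[OF Y] liso_refl[OF Z]]) (use * in blast)
  then show "stable_zero A \<eta> Y \<or> stable_zero A \<eta> Z"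
    using ind * unfolding stable_indecomposable_def by blast
qed

text \<open>
  The composition through a stably trivial summand has finite rank, so the other projection and inclusion are inverse.
\<close>

lemma stable_direct_sum_zero:
  assumes X: "left_module A X" and Y: "left_module A Y" and Z: "left_module A Z"
    and sum: "stable_direct_sum A \<eta> X Y Z" and zero: "stable_zero A \<eta> Z"
  shows "stable_iso A \<eta> Y X"
proof -
  interpret X: left_module A X by fact
  obtain i j p q where i: "i \<in> lhom A Y X" and j: "j \<in> lhom A Z X" and p: "p \<in> lhom A X Y" and q: "q \<in> lhom A X Z"
    and pi: "stable_eq A \<eta> Y Y (compose (carrier Y) p i) (id_hom Y)"
    and ip: "stable_eq A \<eta> X X (add_hom X X (compose (carrier X) i p) (compose (carrier X) j q)) (id_hom X)"
    using sum unfolding stable_direct_sum_def by blast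
  note lip = lhom_compose[OF p i X] and ljq = lhom_compose[OF q j X]
  have id: "id_hom Z \<in> finite_rank_homs A Z Z" using zero unfolding stable_zero_iff[OF Z] .
  have "compose (carrier X) j (compose (carrier X) (id_hom Z) q) \<in> finite_rank_homs A X X"
    by (rule finite_rank_comp_left[OF X Z X finite_rank_comp_right[OF Z Z X id q] j])
  then have fr: "compose (carrier X) j q \<in> finite_rank_homs A X X" unfolding compose_id_left[OF q] .
  have "stable_eq A \<eta> X X (add_hom X X (compose (carrier X) i p) (compose (carrier X) j q)) (compose (carrier X) i p)"
    by (rule stable_eqI[OF X X lhom_add_hom[OF X X lip ljq] lip fr]) (simp add: add_hom_def)
  then have "stable_eq A \<eta> X X (compose (carrier X) i p) (id_hom X)"
    by (rule stable_eq_trans[OF X X stable_eq_sym[OF X X] ip])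
  then show ?thesis unfolding stable_iso_def using i p pi by blast
qed

end

text \<open>
  Submodules are pulled back along the isomorphism; their sum and intersection are preserved.
\<close>

lemma indecomposable_module_liso:
  assumes X: "left_module A X" and Y: "left_module A Y" and iso: "liso A X Y" and ind: "indecomposable_module A X"
  shows "indecomposable_module A Y"
proof -
  interpret X: left_module A X by fact
  interpret Y: left_module A Y by fact
  obtain f g where fg: "f \<in> lhom A X Y" "g \<in> lhom A Y X" "\<And>x. x \<in> carrier X \<Longrightarrow> g (f x) = x"
    "\<And>y. y \<in> carrier Y \<Longrightarrow> f (g y) = y" using iso unfolding liso_iff_inverse[OF X] by blast
  note fc = lhom_closed[OF fg(1)] and gc = lhom_closed[OF fg(2)]
  have g0: "g y = \<zero>\<^bsub>X\<^esub> \<longleftrightarrow> y = \<zero>\<^bsub>Y\<^esub>" if "y \<in> carrier Y" for y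
    using lhom_zero[OF X Y fg(1)] lhom_zero[OF Y X fg(2)] fg(4)[OF that] by auto
  have sub: "submodule (g ` U) A X" if U: "submodule U A Y" for U
  proof -
    interpret U: subgroup U "add_monoid Y" using U by (rule submodule.axioms)
    have Uc: "U \<subseteq> carrier Y" using U.subset by simp
    show ?thesis
    proof (intro submodule.intro submodule_axioms.intro subgroup.intro)
      show "g ` U \<subseteq> carrier (add_monoid X)" using Uc gc by auto
      show "\<one>\<^bsub>add_monoid X\<^esub> \<in> g ` U"
        using U.one_closed lhom_zero[OF Y X fg(2)] by (auto intro!: image_eqI[of _ _ "\<zero>\<^bsub>Y\<^esub>"])
      fix x y assume "x \<in> g ` U" "y \<in> g ` U"
      then obtain x' y' where xy: "x' \<in> U" "x = g x'" "y' \<in> U" "y = g y'" by auto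
      have "g (x' \<oplus>\<^bsub>Y\<^esub> y') = g x' \<oplus>\<^bsub>X\<^esub> g y'" using xy Uc by (intro lhom_add[OF fg(2)]) auto
      moreover have "x' \<oplus>\<^bsub>Y\<^esub> y' \<in> U" using U.m_closed[OF xy(1,3)] by simp
      ultimately have "g x' \<oplus>\<^bsub>X\<^esub> g y' \<in> g ` U" by (metis image_eqI)
      then show "x \<otimes>\<^bsub>add_monoid X\<^esub> y \<in> g ` U" by (simp add: xy(2,4))
    next
      fix x assume "x \<in> g ` U"
      then obtain x' where x: "x' \<in> U" "x = g x'" by auto
      have "g (\<ominus>\<^bsub>Y\<^esub> x') = \<ominus>\<^bsub>X\<^esub> g x'" using x Uc by (intro lhom_minus[OF Y X fg(2)]) auto
      moreover have "\<ominus>\<^bsub>Y\<^esub> x' \<in> U" using U.m_inv_closed[OF x(1)] by (simp add: a_inv_def)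
      ultimately show "inv\<^bsub>add_monoid X\<^esub> x \<in> g ` U" unfolding x(2) by (metis a_inv_def image_eqI)
    next
      fix a x assume "a \<in> carrier A" "x \<in> g ` U"
      then obtain x' where x: "x' \<in> U" "x = g x'" "a \<in> carrier A" by auto
      have "g (a \<odot>\<^bsub>Y\<^esub> x') = a \<odot>\<^bsub>X\<^esub> g x'" using x Uc by (intro lhom_smult[OF fg(2)]) auto
      then show "a \<odot>\<^bsub>X\<^esub> x \<in> g ` U" using x submodule.smult_closed[OF U x(3,1)] by (metis image_eqI)
    qed
  qed
  show ?thesis
    unfolding indecomposable_module_def
  proof (intro conjI allI impI)
    show "carrier Y \<noteq> {\<zero>\<^bsub>Y\<^esub>}"
    proof
      assume "carrier Y = {\<zero>\<^bsub>Y\<^esub>}"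
      then have "x = \<zero>\<^bsub>X\<^esub>" if "x \<in> carrier X" for x
        using fc[OF that] fg(3)[OF that] lhom_zero[OF Y X fg(2)] by auto
      then have "carrier X = {\<zero>\<^bsub>X\<^esub>}" by auto
      then show False using ind by (simp add: indecomposable_module_def)
    qed
    fix U V
    assume *: "submodule U A Y \<and> submodule V A Y \<and> U \<inter> V = {\<zero>\<^bsub>Y\<^esub>} \<and> U <+>\<^bsub>Y\<^esub> V = carrier Y"
    have Uc: "U \<subseteq> carrier Y" "V \<subseteq> carrier Y"
      using subgroup.subset[OF submodule.axioms(1)[of U A Y]] subgroup.subset[OF submodule.axioms(1)[of V A Y]] * by auto
    have "g ` U \<inter> g ` V = {\<zero>\<^bsub>X\<^esub>}"
    proof -
      have "inj_on g (carrier Y)" using fg(4) by (metis inj_onI)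
      then have "g ` (U \<inter> V) = g ` U \<inter> g ` V" using Uc by (rule inj_on_image_Int)
      then show ?thesis using * lhom_zero[OF Y X fg(2)] by auto
    qed
    moreover have "g ` U <+>\<^bsub>X\<^esub> g ` V = carrier X"
    proof (intro subset_antisym subsetI)
      fix x assume "x \<in> g ` U <+>\<^bsub>X\<^esub> g ` V"
      then show "x \<in> carrier X" using Uc gc by (auto simp: set_add_def' subsetD)
    next
      fix x assume x: "x \<in> carrier X"
      then have "f x \<in> U <+>\<^bsub>Y\<^esub> V" using fc * by simp
      then obtain y z where yz: "y \<in> U" "z \<in> V" "f x = y \<oplus>\<^bsub>Y\<^esub> z" by (auto simp: set_add_def')
      have "x = g y \<oplus>\<^bsub>X\<^esub> g z"
        using fg(3)[OF x] yz Uc lhom_add[OF fg(2), of y z] by auto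
      then show "x \<in> g ` U <+>\<^bsub>X\<^esub> g ` V" using yz by (auto simp: set_add_def')
    qed
    ultimately have "g ` U = {\<zero>\<^bsub>X\<^esub>} \<or> g ` V = {\<zero>\<^bsub>X\<^esub>}"
      using ind * sub unfolding indecomposable_module_def by blast
    moreover have "W = {\<zero>\<^bsub>Y\<^esub>}" if "g ` W = {\<zero>\<^bsub>X\<^esub>}" "W \<subseteq> carrier Y" for W
    proof -
      have "w = \<zero>\<^bsub>Y\<^esub>" if "w \<in> W" for w using g0[of w] \<open>g ` W = _\<close> \<open>W \<subseteq> _\<close> that by blast
      moreover have "W \<noteq> {}" using \<open>g ` W = _\<close> by auto
      ultimately show ?thesis by auto
    qed
    ultimately show "U = {\<zero>\<^bsub>Y\<^esub>} \<or> V = {\<zero>\<^bsub>Y\<^esub>}" using Uc by blast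
  qed
qed

section \<open>Monomial algebras by their structure constants\<close>

text \<open>
  The nonzero paths form a basis. All computations use the coefficients \<open>cf\<close> with respect to this
  basis, the set \<open>B\<close> of nonzero paths, which is closed under subpaths, and the end point \<open>T v as\<close> of
  the path with starting vertex \<open>v\<close> and list of arrows \<open>as\<close>. Multiplication is convolution: the
  coefficient at a path is a sum over its factorisations, one for each length of the right factor.
\<close>

locale monomial_algebra = ring A for A :: "('a, 'r) ring_scheme" (structure) +
  fixes \<eta> :: "'k::field \<Rightarrow> 'a" and B :: "('v \<times> 'e list) set" and T :: "'v \<Rightarrow> 'e list \<Rightarrow> 'v"
    and cf :: "'a \<Rightarrow> 'v \<times> 'e list \<Rightarrow> 'k"
  assumes finite_B: "finite B"
    and T_Nil [simp]: "T v [] = v"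
    and T_append [simp]: "T v (as @ bs) = T (T v as) bs"
    and B_append: "(v, as @ bs) \<in> B \<Longrightarrow> (v, as) \<in> B \<and> (T v as, bs) \<in> B"
    and cf_notin: "r \<notin> B \<Longrightarrow> cf x r = 0"
    and cf_inj: "\<lbrakk>x \<in> carrier A; y \<in> carrier A; cf x = cf y\<rbrakk> \<Longrightarrow> x = y"
    and cf_surj: "(\<And>r. r \<notin> B \<Longrightarrow> g r = 0) \<Longrightarrow> \<exists>x\<in>carrier A. cf x = g"
    and cf_add: "\<lbrakk>x \<in> carrier A; y \<in> carrier A\<rbrakk> \<Longrightarrow> cf (x \<oplus> y) r = cf x r + cf y r"
    and cf_mult: "\<lbrakk>x \<in> carrier A; y \<in> carrier A; (v, as) \<in> B\<rbrakk> \<Longrightarrow>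
      cf (x \<otimes> y) (v, as) = (\<Sum>k\<le>length as. cf x (T v (take k as), drop k as) * cf y (v, take k as))"
    and cf_one: "cf \<one> r = (if r \<in> B \<and> snd r = [] then 1 else 0)"
    and scalar_in_carrier: "\<eta> c \<in> carrier A"
    and cf_scalar: "cf (\<eta> c) r = (if r \<in> B \<and> snd r = [] then c else 0)"
begin

definition mk :: "('v \<times> 'e list \<Rightarrow> 'k) \<Rightarrow> 'a" where
  "mk g = (SOME x. x \<in> carrier A \<and> cf x = (\<lambda>r. if r \<in> B then g r else 0))"

definition pv :: "'v \<times> 'e list \<Rightarrow> 'a" where
  "pv p = mk (\<lambda>r. if r = p then 1 else 0)"

definition tgt :: "'v \<times> 'e list \<Rightarrow> 'v" where
  "tgt p = T (fst p) (snd p)"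

lemma mk: "mk g \<in> carrier A \<and> cf (mk g) = (\<lambda>r. if r \<in> B then g r else 0)"
proof -
  have "\<exists>x\<in>carrier A. cf x = (\<lambda>r. if r \<in> B then g r else 0)" by (rule cf_surj) simp
  then show ?thesis unfolding mk_def by (intro someI_ex[of "\<lambda>x. x \<in> carrier A \<and> cf x = _"]) blast
qed

lemma mk_closed [simp]: "mk g \<in> carrier A" using mk by blast

lemma cf_mk: "cf (mk g) r = (if r \<in> B then g r else 0)" using mk[of g] by simp

lemma pv_closed [simp]: "pv p \<in> carrier A" by (simp add: pv_def)

lemma cf_pv: "cf (pv p) r = (if r = p \<and> p \<in> B then 1 else 0)" by (auto simp: pv_def cf_mk)

lemma cf_eqI: "\<lbrakk>x \<in> carrier A; y \<in> carrier A; \<And>r. r \<in> B \<Longrightarrow> cf x r = cf y r\<rbrakk> \<Longrightarrow> x = y"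
  by (rule cf_inj) (assumption+, rule ext, metis cf_notin)

lemma cf_zero [simp]: "cf \<zero> r = 0"
  by (metis add_cancel_right_right cf_add l_zero zero_closed)

lemma cf_uminus: "x \<in> carrier A \<Longrightarrow> cf (\<ominus> x) r = - cf x r"
  using cf_add[of "\<ominus> x" x r] by (simp add: l_neg eq_neg_iff_add_eq_0)

lemma cf_minus: "\<lbrakk>x \<in> carrier A; y \<in> carrier A\<rbrakk> \<Longrightarrow> cf (x \<ominus> y) r = cf x r - cf y r"
  by (simp add: a_minus_def cf_add cf_uminus)

lemma cf_finsum: "\<lbrakk>finite J; f \<in> J \<rightarrow> carrier A\<rbrakk> \<Longrightarrow> cf (\<Oplus>j\<in>J. f j) r = (\<Sum>j\<in>J. cf (f j) r)"
  by (induction J rule: finite_induct) (simp_all add: cf_add Pi_def)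

lemma B_Nil: "(v, as) \<in> B \<Longrightarrow> (T v as, []) \<in> B" "(v, as) \<in> B \<Longrightarrow> (v, []) \<in> B"
  using B_append[of v as "[]"] B_append[of v "[]" as] by auto

lemma B_tgt: "p \<in> B \<Longrightarrow> (tgt p, []) \<in> B"
  using B_Nil(1)[of "fst p" "snd p"] by (simp add: tgt_def)

lemma B_prolong: "(fst p, snd p @ bs) \<in> B \<Longrightarrow> (tgt p, bs) \<in> B"
  using B_append by (simp add: tgt_def)

lemma B_prolong': "(fst p, snd p @ bs) \<in> B \<Longrightarrow> p \<in> B"
  using B_append by fastforce

lemma cf_pv_mult:
  assumes y: "y \<in> carrier A" and r: "(v, as @ snd w) \<in> B" "T v as = fst w"
  shows "cf (pv w \<otimes> y) (v, as @ snd w) = cf y (v, as)"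
proof -
  let ?l = "as @ snd w"
  have w: "w \<in> B" using B_append[OF r(1)] r(2) by simp
  have "cf (pv w) (T v (take k ?l), drop k ?l) * cf y (v, take k ?l) = (if k = length as then cf y (v, as) else 0)"
    if "k \<le> length ?l" for k
  proof (cases "k = length as")
    case True
    then show ?thesis using w r(2) by (simp add: cf_pv)
  next
    case False
    then have "length (drop k ?l) \<noteq> length (snd w)" using that by auto
    then have "(T v (take k ?l), drop k ?l) \<noteq> w" by (metis snd_conv)
    then show ?thesis using False by (simp add: cf_pv)
  qed
  then have "cf (pv w \<otimes> y) (v, ?l) = (\<Sum>k\<le>length ?l. if k = length as then cf y (v, as) else 0)"
    unfolding cf_mult[OF pv_closed y r(1)] by (intro sum.cong) auto
  then show ?thesis by simp
qed

lemma cf_pv_mult_eq_0: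
  assumes y: "y \<in> carrier A" and no: "\<And>as. bs = as @ snd w \<Longrightarrow> T v as \<noteq> fst w"
  shows "cf (pv w \<otimes> y) (v, bs) = 0"
proof (cases "(v, bs) \<in> B")
  case True
  have "(T v (take k bs), drop k bs) \<noteq> w" for k
    using no[of "take k bs"] append_take_drop_id[of k bs] by auto
  then show ?thesis unfolding cf_mult[OF pv_closed y True] by (simp add: cf_pv)
qed (simp add: cf_notin)

lemma cf_mult_pv:
  assumes x: "x \<in> carrier A" and r: "(fst p, snd p @ bs) \<in> B"
  shows "cf (x \<otimes> pv p) (fst p, snd p @ bs) = cf x (tgt p, bs)"
proof -
  let ?l = "snd p @ bs"
  have "cf x (T (fst p) (take k ?l), drop k ?l) * cf (pv p) (fst p, take k ?l) =
      (if k = length (snd p) then cf x (tgt p, bs) else 0)" if "k \<le> length ?l" for k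
  proof (cases "k = length (snd p)")
    case True
    then show ?thesis using B_prolong'[OF r] by (simp add: cf_pv tgt_def)
  next
    case False
    then have "length (take k ?l) \<noteq> length (snd p)" using that by auto
    then have "(fst p, take k ?l) \<noteq> p" by (metis snd_conv)
    then show ?thesis using False by (simp add: cf_pv)
  qed
  then have "cf (x \<otimes> pv p) (fst p, ?l) = (\<Sum>k\<le>length ?l. if k = length (snd p) then cf x (tgt p, bs) else 0)"
    unfolding cf_mult[OF x pv_closed r] by (intro sum.cong) auto
  then show ?thesis by simp
qed

lemma cf_mult_pv_eq_0:
  assumes x: "x \<in> carrier A" and no: "\<And>bs. r \<noteq> (fst p, snd p @ bs)"
  shows "cf (x \<otimes> pv p) r = 0"
proof (cases "r \<in> B")
  case True
  obtain v as where r: "r = (v, as)" by (cases r)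
  have "(v, take k as) \<noteq> p" for k
    using no[of "drop k as"] append_take_drop_id[of k as] r by auto
  then show ?thesis using True unfolding r by (subst cf_mult[OF x pv_closed]) (simp_all add: cf_pv)
qed (simp add: cf_notin)

lemma pv_tgt_mult: "p \<in> B \<Longrightarrow> pv (tgt p, []) \<otimes> pv p = pv p"
proof (rule cf_eqI)
  fix r assume p: "p \<in> B" and r: "r \<in> B"
  show "cf (pv (tgt p, []) \<otimes> pv p) r = cf (pv p) r"
  proof (cases "\<exists>bs. r = (fst p, snd p @ bs)")
    case True
    then obtain bs where bs: "r = (fst p, snd p @ bs)" by blast
    have "cf (pv (tgt p, []) \<otimes> pv p) r = (if bs = [] then 1 else 0)"
      unfolding bs using r bs B_tgt[OF p] by (simp add: cf_mult_pv cf_pv)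
    moreover have "bs = [] \<longleftrightarrow> r = p" unfolding bs by (auto simp: prod_eq_iff)
    ultimately show ?thesis using p by (simp add: cf_pv)
  next
    case False
    then have "r \<noteq> p" by (metis append_Nil2 prod.collapse)
    then show ?thesis using False by (simp add: cf_mult_pv_eq_0 cf_pv)
  qed
qed simp_all

abbreviation path_mod :: "'v \<times> 'e list \<Rightarrow> ('a, 'a) module" where
  "path_mod p \<equiv> left_ideal_gen A (pv p)"

lemma left_module_path_mod: "left_module A (path_mod p)"
  by (rule left_module_left_ideal_gen[OF ring_axioms pv_closed])

text \<open>
  The cofactor: for \<open>x\<close> in \<open>Ap\<close> the element \<open>a\<close> with \<open>x = ap\<close> that only involves paths starting at \<open>t(p)\<close>.
\<close>

definition strip :: "'v \<times> 'e list \<Rightarrow> 'a \<Rightarrow> 'a" where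
  "strip p x = mk (\<lambda>r. if fst r = tgt p then cf x (fst p, snd p @ snd r) else 0)"

lemma strip_closed [simp]: "strip p x \<in> carrier A" by (simp add: strip_def)

lemma cf_strip: "cf (strip p x) r = (if fst r = tgt p then cf x (fst p, snd p @ snd r) else 0)"
  using B_prolong[of p "snd r"] cf_notin[of "(fst p, snd p @ snd r)"]
  by (auto simp: strip_def cf_mk) (metis prod.collapse)

lemma path_mod_iff:
  "x \<in> carrier (path_mod p) \<longleftrightarrow> x \<in> carrier A \<and> (\<forall>r. cf x r \<noteq> 0 \<longrightarrow> (\<exists>bs. r = (fst p, snd p @ bs)))"
    (is "_ \<longleftrightarrow> ?R")
proof
  assume "x \<in> carrier (path_mod p)"
  then obtain a where a: "a \<in> carrier A" "x = a \<otimes> pv p" by auto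
  then show ?R using cf_mult_pv_eq_0[OF a(1)] by (metis m_closed pv_closed)
next
  assume R: ?R
  have "strip p x \<otimes> pv p = x"
  proof (rule cf_eqI)
    fix r assume r: "r \<in> B"
    show "cf (strip p x \<otimes> pv p) r = cf x r"
    proof (cases "\<exists>bs. r = (fst p, snd p @ bs)")
      case True
      then show ?thesis using r by (auto simp: cf_mult_pv cf_strip)
    next
      case False
      then have "cf x r = 0" using R by blast
      then show ?thesis using False by (simp add: cf_mult_pv_eq_0)
    qed
  qed (use R in auto)
  then show "x \<in> carrier (path_mod p)" by (auto intro!: image_eqI[of _ _ "strip p x"])
qed

lemma strip_mult_pv: "x \<in> carrier (path_mod p) \<Longrightarrow> strip p x \<otimes> pv p = x"
proof (rule cf_eqI)
  assume x: "x \<in> carrier (path_mod p)"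
  then show "x \<in> carrier A" unfolding path_mod_iff by blast
  fix r assume r: "r \<in> B"
  show "cf (strip p x \<otimes> pv p) r = cf x r"
  proof (cases "\<exists>bs. r = (fst p, snd p @ bs)")
    case True
    then show ?thesis using r by (auto simp: cf_mult_pv cf_strip)
  next
    case False
    then have "cf x r = 0" using x unfolding path_mod_iff by blast
    then show ?thesis using False by (simp add: cf_mult_pv_eq_0)
  qed
qed simp

lemma path_mod_closed: "x \<in> carrier (path_mod p) \<Longrightarrow> x \<in> carrier A"
  unfolding path_mod_iff by blast

lemma pv_in_path_mod [simp]: "pv p \<in> carrier (path_mod p)"
  by (auto intro!: image_eqI[of _ _ \<one>])

text \<open>A path \<open>w\<close> with \<open>s(w) = t(p)\<close> and \<open>wp = 0\<close> is recorded by its list of arrows.\<close>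

definition dead :: "'v \<times> 'e list \<Rightarrow> 'e list \<Rightarrow> bool" where
  "dead p bs \<longleftrightarrow> (tgt p, bs) \<in> B \<and> (fst p, snd p @ bs) \<notin> B"

lemma mult_pv_eq_0_iff:
  assumes a: "a \<in> carrier A"
  shows "a \<otimes> pv p = \<zero> \<longleftrightarrow> (\<forall>bs. cf a (tgt p, bs) \<noteq> 0 \<longrightarrow> dead p bs)"
proof
  assume 0: "a \<otimes> pv p = \<zero>"
  show "\<forall>bs. cf a (tgt p, bs) \<noteq> 0 \<longrightarrow> dead p bs"
  proof (intro allI impI)
    fix bs assume bs: "cf a (tgt p, bs) \<noteq> 0"
    then have "(tgt p, bs) \<in> B" using cf_notin by blast
    moreover have "(fst p, snd p @ bs) \<notin> B" using cf_mult_pv[OF a, of p bs] 0 bs by auto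
    ultimately show "dead p bs" by (simp add: dead_def)
  qed
next
  assume *: "\<forall>bs. cf a (tgt p, bs) \<noteq> 0 \<longrightarrow> dead p bs"
  show "a \<otimes> pv p = \<zero>"
  proof (rule cf_eqI)
    fix r assume r: "r \<in> B"
    show "cf (a \<otimes> pv p) r = cf \<zero> r"
    proof (cases "\<exists>bs. r = (fst p, snd p @ bs)")
      case True
      then show ?thesis using r * by (auto simp: cf_mult_pv[OF a] dead_def)
    qed (simp add: cf_mult_pv_eq_0[OF a])
  qed (use a in simp_all)
qed

definition similar :: "'v \<times> 'e list \<Rightarrow> 'v \<times> 'e list \<Rightarrow> bool" where
  "similar p q \<longleftrightarrow> p \<in> B \<and> q \<in> B \<and> tgt p = tgt q \<and> (\<forall>bs. dead p bs \<longleftrightarrow> dead q bs)"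

lemma finsum_regular_module: "finsum (regular_module A) f S = finsum A f S"
  by (simp add: finsum_def finprod_def)

text \<open>
  The universal property of a cyclic module.
\<close>

lemma cyclic_hom:
  assumes x: "x \<in> carrier A" and N: "left_module A N" and y: "y \<in> carrier N"
    and ann: "\<And>a. a \<in> carrier A \<Longrightarrow> a \<otimes> x = \<zero> \<Longrightarrow> a \<odot>\<^bsub>N\<^esub> y = \<zero>\<^bsub>N\<^esub>"
  shows "\<exists>f\<in>lhom A (left_ideal_gen A x) N. \<forall>a\<in>carrier A. f (a \<otimes> x) = a \<odot>\<^bsub>N\<^esub> y"
proof -
  interpret N: left_module A N by fact
  have wd: "a \<odot>\<^bsub>N\<^esub> y = b \<odot>\<^bsub>N\<^esub> y" if ab: "a \<in> carrier A" "b \<in> carrier A" "a \<otimes> x = b \<otimes> x" for a b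
  proof -
    have "(a \<ominus> b) \<otimes> x = \<zero>"
      using ab x by (simp add: a_minus_def l_distr l_minus r_neg)
    then have "(a \<ominus> b) \<odot>\<^bsub>N\<^esub> y = \<zero>\<^bsub>N\<^esub>" using ann ab by simp
    then have "a \<odot>\<^bsub>N\<^esub> y \<oplus>\<^bsub>N\<^esub> \<ominus>\<^bsub>N\<^esub> (b \<odot>\<^bsub>N\<^esub> y) = \<zero>\<^bsub>N\<^esub>"
      using ab y by (simp add: a_minus_def N.smult_l_distr N.smult_l_minus)
    then show ?thesis using ab y by (metis N.minus_equality N.minus_minus N.a_inv_closed N.smult_closed)
  qed
  define f where "f = (\<lambda>z\<in>carrier (left_ideal_gen A x). (SOME a. a \<in> carrier A \<and> z = a \<otimes> x) \<odot>\<^bsub>N\<^esub> y)"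
  have f: "f (a \<otimes> x) = a \<odot>\<^bsub>N\<^esub> y" if a: "a \<in> carrier A" for a
  proof -
    let ?b = "SOME b. b \<in> carrier A \<and> a \<otimes> x = b \<otimes> x"
    have "?b \<in> carrier A \<and> a \<otimes> x = ?b \<otimes> x" by (rule someI[of _ a]) (use a in simp)
    then show ?thesis using wd[OF a, of ?b] a by (auto simp: f_def)
  qed
  have "f \<in> lhom A (left_ideal_gen A x) N"
  proof (rule lhomI)
    fix z assume "z \<in> carrier (left_ideal_gen A x)"
    then obtain a where a: "a \<in> carrier A" "z = a \<otimes> x" by auto
    then show "f z \<in> carrier N" using f y by simp
    {
      fix w assume "w \<in> carrier (left_ideal_gen A x)"
      then obtain b where b: "b \<in> carrier A" "w = b \<otimes> x" by auto
      have "z \<oplus> w = (a \<oplus> b) \<otimes> x" using a b x by (simp add: l_distr)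
      then show "f (z \<oplus>\<^bsub>left_ideal_gen A x\<^esub> w) = f z \<oplus>\<^bsub>N\<^esub> f w"
        using f a b y by (simp add: N.smult_l_distr)
    }
    fix b assume b: "b \<in> carrier A"
    have "b \<otimes> z = (b \<otimes> a) \<otimes> x" using a b x by (simp add: m_assoc)
    then show "f (b \<odot>\<^bsub>left_ideal_gen A x\<^esub> z) = b \<odot>\<^bsub>N\<^esub> f z"
      using f a b y by (simp add: N.smult_assoc)
  qed (simp add: f_def)
  then show ?thesis using f by blast
qed

text \<open>
  Paths with the same end point and the same dead paths have the same left annihilator, so each
  generator can be sent to the other.
\<close>

lemma similar_liso:
  assumes "similar p q"
  shows "liso A (path_mod p) (path_mod q)"
proof -
  have *: "\<exists>f\<in>lhom A (path_mod p) (path_mod q). \<forall>a\<in>carrier A. f (a \<otimes> pv p) = a \<odot>\<^bsub>path_mod q\<^esub> pv q"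
    if "similar p q" for p q
    by (rule cyclic_hom[OF pv_closed left_module_path_mod pv_in_path_mod])
      (use that in \<open>auto simp: mult_pv_eq_0_iff similar_def\<close>)
  have "similar q p" using assms by (simp add: similar_def)
  then obtain f g where fg: "f \<in> lhom A (path_mod p) (path_mod q)" "g \<in> lhom A (path_mod q) (path_mod p)"
    "\<And>a. a \<in> carrier A \<Longrightarrow> f (a \<otimes> pv p) = a \<otimes> pv q" "\<And>a. a \<in> carrier A \<Longrightarrow> g (a \<otimes> pv q) = a \<otimes> pv p"
    using *[OF assms] *[of q p] by auto
  show ?thesis unfolding liso_iff_inverse[OF left_module_path_mod]
    by (intro bexI[OF _ fg(1)] bexI[OF _ fg(2)]) (auto simp: fg(3,4))
qed

text \<open>
  The nonzero paths span the regular module.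
\<close>

lemma is_fd_algebra: "fd_algebra A \<eta>"
proof
  fix c d
  show "\<eta> c \<in> carrier A" by (rule scalar_in_carrier)
  show "\<eta> (c + d) = \<eta> c \<oplus> \<eta> d"
    by (rule cf_eqI) (simp_all add: scalar_in_carrier cf_add cf_scalar)
next
  show "\<eta> 1 = \<one>" by (rule cf_eqI) (simp_all add: scalar_in_carrier cf_one cf_scalar)
  have inj: "inj_on pv B"
  proof
    fix p q assume "p \<in> B" "q \<in> B" "pv p = pv q"
    then show "p = q" using cf_pv[of p p] cf_pv[of q p] by (auto split: if_splits)
  qed
  show "fd_module A \<eta> (regular_module A)"
    unfolding fd_module_def
  proof (intro conjI left_module_regular ring_axioms exI[of _ "pv ` B"] ballI)
    show "finite (pv ` B)" using finite_B by simp
    fix x assume "x \<in> carrier (regular_module A)"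
    then have x: "x \<in> carrier A" by simp
    let ?c = "\<lambda>y. cf x (inv_into B pv y)"
    have "cf (\<eta> c \<otimes> pv p) r = (if r = p then c else 0)" if p: "p \<in> B" for c p r
    proof (cases "\<exists>bs. r = (fst p, snd p @ bs)")
      case True
      then obtain bs where bs: "r = (fst p, snd p @ bs)" by blast
      show ?thesis
      proof (cases "r \<in> B")
        case True
        then have "cf (\<eta> c \<otimes> pv p) r = (if bs = [] then c else 0)"
          using bs B_tgt[OF p] by (simp add: cf_mult_pv scalar_in_carrier cf_scalar)
        moreover have "bs = [] \<longleftrightarrow> r = p" unfolding bs by (auto simp: prod_eq_iff)
        ultimately show ?thesis by simp
      qed (use p in \<open>auto simp: cf_notin\<close>)
    next
      case False
      then have "r \<noteq> p" by (metis append_Nil2 prod.collapse)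
      then show ?thesis using False by (simp add: cf_mult_pv_eq_0 scalar_in_carrier)
    qed
    then have cf: "cf (\<Oplus>p\<in>B. \<eta> (cf x p) \<otimes> pv p) r = (if r \<in> B then cf x r else 0)" for r
      using finite_B by (subst cf_finsum) (auto simp: scalar_in_carrier)
    have "(\<Oplus>y\<in>pv ` B. \<eta> (?c y) \<otimes> y) = (\<Oplus>p\<in>B. \<eta> (?c (pv p)) \<otimes> pv p)"
      using inj by (intro finsum_reindex) (auto simp: scalar_in_carrier)
    also have "\<dots> = (\<Oplus>p\<in>B. \<eta> (cf x p) \<otimes> pv p)"
      using inj by (intro finsum_cong') (auto simp: scalar_in_carrier)
    also have "\<dots> = x"
      by (rule cf_eqI) (auto simp: cf x scalar_in_carrier intro!: finsum_closed)
    finally have "x = (\<Oplus>y\<in>pv ` B. \<eta> (?c y) \<otimes> y)" by simp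
    then show "\<exists>c. x = (\<Oplus>\<^bsub>regular_module A\<^esub>b\<in>pv ` B. \<eta> (c b) \<odot>\<^bsub>regular_module A\<^esub> b)"
      by (intro exI[of _ ?c]) (simp only: finsum_regular_module regular_module_simps)
  qed auto
qed

end

sublocale monomial_algebra \<subseteq> fd_algebra A \<eta>
  by (rule is_fd_algebra)

context monomial_algebra
begin

lemma fd_module_path_mod: "fd_module A \<eta> (path_mod p)"
proof -
  have "(\<lambda>a\<in>carrier (regular_module A). a \<otimes> pv p) \<in> lhom A (regular_module A) (path_mod p)"
    by (rule lhom_restrictI[OF left_module_regular[OF ring_axioms]]) (auto simp: l_distr m_assoc)
  then show ?thesis
    by (rule fd_module_image[OF fd_regular left_module_path_mod]) auto
qed

subsection \<open>Cyclic modules generated by paths\<close>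

text \<open>
  The only factorisation of \<open>p\<close> whose right factor occurs in an element of \<open>Ap\<close> is the trivial one.
\<close>

lemma cf_mult_at_generator:
  assumes a: "a \<in> carrier A" and y: "y \<in> carrier (path_mod p)" and p: "p \<in> B"
  shows "cf (a \<otimes> y) p = cf a (tgt p, []) * cf y p"
proof -
  have yA: "y \<in> carrier A" using y by (rule path_mod_closed)
  have "cf a (T (fst p) (take k (snd p)), drop k (snd p)) * cf y (fst p, take k (snd p)) =
      (if k = length (snd p) then cf a (tgt p, []) * cf y p else 0)" if "k \<le> length (snd p)" for k
  proof (cases "k = length (snd p)")
    case False
    then have "length (take k (snd p)) < length (snd p)" using that by simp
    then have "cf y (fst p, take k (snd p)) = 0" using y unfolding path_mod_iff by fastforce
    then show ?thesis using False by simp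
  qed (simp add: tgt_def)
  then have "cf (a \<otimes> y) (fst p, snd p) = (\<Sum>k\<le>length (snd p). if k = length (snd p) then cf a (tgt p, []) * cf y p else 0)"
    using p by (subst cf_mult[OF a yA]) (auto intro!: sum.cong)
  then show ?thesis by simp
qed

lemma cf_pv_mult_start:
  assumes "y \<in> carrier A" "(v, bs) \<in> B"
  shows "cf (pv (v, bs) \<otimes> y) (v, bs) = cf y (v, [])"
  using cf_pv_mult[OF assms(1), of v "[]" "(v, bs)"] assms(2) by simp

text \<open>
  Consider \<open>x \<mapsto> \<phi>(x) y\<close> with \<open>y\<close> in \<open>Ap\<close>. A path that starts at \<open>t(p)\<close> and kills \<open>x\<close> also kills \<open>\<phi>(x)\<close>, so
  \<open>\<phi>(x)\<close> does not involve the trivial path at \<open>t(p)\<close>, and then \<open>\<phi>(x) y\<close> does not involve \<open>p\<close>.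
\<close>

lemma finite_rank_cf_generator:
  assumes M: "left_module A M" and p: "p \<in> B" and f: "f \<in> finite_rank_homs A M (path_mod p)"
    and x: "x \<in> carrier M" and bs: "(tgt p, bs) \<in> B" "pv (tgt p, bs) \<odot>\<^bsub>M\<^esub> x = \<zero>\<^bsub>M\<^esub>"
  shows "cf (f x) p = 0"
  using f
proof induction
  case zero
  then show ?case using x by (simp add: zero_hom_def)
next
  case (step f \<phi> y)
  have fx: "f x \<in> carrier A"
    by (rule path_mod_closed[OF lhom_closed[OF finite_rank_lhom[OF M left_module_path_mod step(1)] x]])
  have \<phi>x: "\<phi> x \<in> carrier A" using lhom_closed[OF step(2) x] by simp
  have "pv (tgt p, bs) \<otimes> \<phi> x = \<zero>"
    using lhom_smult[OF step(2) pv_closed x, of "(tgt p, bs)"] bs(2)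
      lhom_zero[OF M left_module_regular[OF ring_axioms] step(2)] by simp
  then have "cf (\<phi> x) (tgt p, []) = 0" using cf_pv_mult_start[OF \<phi>x bs(1)] by simp
  then have "cf (\<phi> x \<otimes> y) p = 0" using cf_mult_at_generator[OF \<phi>x step(3) p] by simp
  then show ?case using x step.IH fx \<phi>x path_mod_closed[OF step(3)] by (simp add: cf_add)
qed

text \<open>
  If no path kills \<open>p\<close>, then \<open>Ap\<close> is isomorphic to the projective module \<open>Ae\<close> with \<open>e\<close> the trivial path at \<open>t(p)\<close>.
\<close>

lemma finite_rank_id_path_mod:
  assumes p: "p \<in> B" and no: "\<And>bs. \<not> dead p bs"
  shows "id_hom (path_mod p) \<in> finite_rank_homs A (path_mod p) (path_mod p)"
proof -
  have "\<exists>f\<in>lhom A (path_mod p) (regular_module A). \<forall>a\<in>carrier A. f (a \<otimes> pv p) = a \<odot>\<^bsub>regular_module A\<^esub> pv (tgt p, [])"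
  proof (rule cyclic_hom[OF pv_closed left_module_regular[OF ring_axioms]])
    fix a assume a: "a \<in> carrier A" "a \<otimes> pv p = \<zero>"
    then have "cf a (tgt p, bs) = 0" for bs using mult_pv_eq_0_iff[OF a(1), of p] no by blast
    then have "a \<otimes> pv (tgt p, []) = \<zero>" using mult_pv_eq_0_iff[OF a(1), of "(tgt p, [])"] by (simp add: tgt_def)
    then show "a \<odot>\<^bsub>regular_module A\<^esub> pv (tgt p, []) = \<zero>\<^bsub>regular_module A\<^esub>" by simp
  qed simp
  then obtain f where f: "f \<in> lhom A (path_mod p) (regular_module A)"
    "\<And>a. a \<in> carrier A \<Longrightarrow> f (a \<otimes> pv p) = a \<otimes> pv (tgt p, [])" by auto
  have "(\<lambda>x\<in>carrier (path_mod p). f x \<odot>\<^bsub>path_mod p\<^esub> pv p) = id_hom (path_mod p)"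
    unfolding id_hom_def
  proof (rule restrict_ext)
    fix x assume "x \<in> carrier (path_mod p)"
    then obtain a where a: "a \<in> carrier A" "x = a \<otimes> pv p" by auto
    then show "f x \<odot>\<^bsub>path_mod p\<^esub> pv p = x" using f(2) pv_tgt_mult[OF p] by (simp add: m_assoc)
  qed
  then show ?thesis
    using finite_rank_times[OF left_module_path_mod left_module_path_mod f(1) pv_in_path_mod[of p]] by (simp only:)
qed

text \<open>
  The identity has coefficient 1 at the generator \<open>p\<close>, which a dead path kills.
\<close>

lemma not_finite_rank_id_path_mod:
  assumes p: "p \<in> B" and d: "dead p bs"
  shows "id_hom (path_mod p) \<notin> finite_rank_homs A (path_mod p) (path_mod p)"
proof
  assume *: "id_hom (path_mod p) \<in> finite_rank_homs A (path_mod p) (path_mod p)"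
  have 0: "pv (tgt p, bs) \<otimes> pv p = \<zero>"
    using d by (subst mult_pv_eq_0_iff) (auto simp: cf_pv split: if_splits)
  have "cf (id_hom (path_mod p) (pv p)) p = 0"
    by (rule finite_rank_cf_generator[OF left_module_path_mod p * pv_in_path_mod, of bs])
      (use d 0 in \<open>auto simp: dead_def\<close>)
  moreover have "id_hom (path_mod p) (pv p) = pv p" unfolding id_hom_def by (simp del: left_ideal_gen_simps)
  ultimately show False using p by (simp add: cf_pv)
qed

text \<open>
  An endomorphism of \<open>Ap\<close> is bijective as soon as the image of \<open>p\<close> involves \<open>p\<close>: with respect to
  the filtration of \<open>Ap\<close> by the length of paths it is this coefficient times the identity plus a
  map that raises the length.
\<close>

lemma cf_mult_leading:
  assumes p: "p \<in> B" and a: "a \<in> carrier A" and y: "y \<in> carrier (path_mod p)"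
    and lead: "\<And>cs. length cs < length bs \<Longrightarrow> cf a (tgt p, cs) = 0"
    and start: "\<And>v cs. v \<noteq> tgt p \<Longrightarrow> cf a (v, cs) = 0"
    and r: "(fst p, snd p @ bs) \<in> B"
  shows "cf (a \<otimes> y) (fst p, snd p @ bs) = cf a (tgt p, bs) * cf y p"
proof -
  let ?l = "snd p @ bs"
  have yA: "y \<in> carrier A" using y by (rule path_mod_closed)
  have "cf a (T (fst p) (take k ?l), drop k ?l) * cf y (fst p, take k ?l) =
      (if k = length (snd p) then cf a (tgt p, bs) * cf y p else 0)" if k: "k \<le> length ?l" for k
  proof (cases k "length (snd p)" rule: linorder_cases)
    case less
    then have "length (take k ?l) < length (snd p)" by simp
    then have "cf y (fst p, take k ?l) = 0" using y unfolding path_mod_iff by fastforce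
    then show ?thesis using less by simp
  next
    case greater
    then have "length (drop k ?l) < length bs" using k by simp
    then have "cf a (T (fst p) (take k ?l), drop k ?l) = 0" using lead start by metis
    then show ?thesis using greater by simp
  qed (simp add: tgt_def)
  then have "cf (a \<otimes> y) (fst p, ?l) = (\<Sum>k\<le>length ?l. if k = length (snd p) then cf a (tgt p, bs) * cf y p else 0)"
    by (subst cf_mult[OF a yA r]) (auto intro!: sum.cong)
  then show ?thesis by simp
qed

lemma cf_mult_low:
  assumes p: "p \<in> B" and a: "a \<in> carrier A" and y: "y \<in> carrier (path_mod p)"
    and lead: "\<And>cs. length cs < n \<Longrightarrow> cf a (tgt p, cs) = 0"
    and start: "\<And>v cs. v \<noteq> tgt p \<Longrightarrow> cf a (v, cs) = 0"
    and bs: "length bs < n"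
  shows "cf (a \<otimes> y) (fst p, snd p @ bs) = 0"
proof (cases "(fst p, snd p @ bs) \<in> B")
  case True
  then show ?thesis using cf_mult_leading[OF p a y _ start True] lead bs by simp
qed (simp add: cf_notin)

lemma finite_length_bound: obtains N where "\<And>r. r \<in> B \<Longrightarrow> length (snd r) < N"
  using finite_B by (metis finite_imageI finite_nat_set_iff_bounded imageI)

text \<open>
  Successive approximation: subtract multiples of \<open>y\<close> to cancel the terms of lowest length, which are
  bounded since there are finitely many nonzero paths.
\<close>

lemma generator_mult_surj:
  assumes p: "p \<in> B" and y: "y \<in> carrier (path_mod p)" and c: "cf y p \<noteq> 0"
    and x: "x \<in> carrier (path_mod p)"
  shows "\<exists>a\<in>carrier A. x = a \<otimes> y"
proof -
  obtain N where N: "\<And>r. r \<in> B \<Longrightarrow> length (snd r) < N" using finite_length_bound by blast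
  have yA: "y \<in> carrier A" using y by (rule path_mod_closed)
  have "\<exists>a\<in>carrier A. x = a \<otimes> y"
    if "x \<in> carrier (path_mod p)" "\<And>cs. length cs < n \<Longrightarrow> cf x (fst p, snd p @ cs) = 0" for x n
    using that
  proof (induction "N - n" arbitrary: n x rule: less_induct)
    case less
    note x = less.prems(1)
    have xA: "x \<in> carrier A" using x by (rule path_mod_closed)
    show ?case
    proof (cases "n < N")
      case False
      have "x = \<zero>"
      proof (rule cf_eqI[OF xA zero_closed])
        fix r assume r: "r \<in> B"
        show "cf x r = cf \<zero> r"
        proof (rule ccontr)
          assume "cf x r \<noteq> cf \<zero> r"
          then have "cf x r \<noteq> 0" by simp
          then obtain cs where cs: "r = (fst p, snd p @ cs)" using x unfolding path_mod_iff by blast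
          have "length cs < n" using N[OF r] False cs by simp
          then show False using less.prems(2) cs \<open>cf x r \<noteq> 0\<close> by blast
        qed
      qed
      then show ?thesis using yA by (intro bexI[of _ \<zero>]) simp_all
    next
      case True
      define a where "a = mk (\<lambda>(v, bs). if v = tgt p \<and> length bs = n then cf x (fst p, snd p @ bs) / cf y p else 0)"
      have a: "a \<in> carrier A" by (simp add: a_def)
      have a_low: "cf a (tgt p, cs) = 0" if "length cs < n" for cs using that by (simp add: a_def cf_mk)
      have a_start: "cf a (v, cs) = 0" if "v \<noteq> tgt p" for v cs using that by (simp add: a_def cf_mk)
      have ay: "a \<otimes> y \<in> carrier (path_mod p)"
        using left_module_smult_closed[OF left_module_path_mod a y] by simp
      have ayA: "a \<otimes> y \<in> carrier A" using ay by (rule path_mod_closed)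
      have low: "cf (x \<ominus> a \<otimes> y) (fst p, snd p @ cs) = 0" if "length cs < Suc n" for cs
      proof (cases "length cs < n")
        case True
        then show ?thesis using less.prems(2) cf_mult_low[OF p a y a_low a_start True] xA ayA
          by (simp add: cf_minus)
      next
        case False
        then have n: "length cs = n" using that by simp
        show ?thesis
        proof (cases "(fst p, snd p @ cs) \<in> B")
          case True
          have "cf (a \<otimes> y) (fst p, snd p @ cs) = cf a (tgt p, cs) * cf y p"
            by (rule cf_mult_leading[OF p a y _ a_start True]) (simp add: n a_low)
          also have "cf a (tgt p, cs) = cf x (fst p, snd p @ cs) / cf y p"
            using B_prolong[OF True] n by (simp add: a_def cf_mk)
          finally show ?thesis using c xA ayA by (simp add: cf_minus)
        qed (simp add: cf_notin)
      qed
      have mem: "x \<ominus> a \<otimes> y \<in> carrier (path_mod p)"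
        unfolding path_mod_iff
      proof (intro conjI allI impI)
        fix r assume "cf (x \<ominus> a \<otimes> y) r \<noteq> 0"
        then have "cf x r \<noteq> 0 \<or> cf (a \<otimes> y) r \<noteq> 0" using xA ayA by (auto simp: cf_minus)
        then show "\<exists>bs. r = (fst p, snd p @ bs)" using x ay unfolding path_mod_iff by blast
      qed (use xA ayA in simp)
      have "\<exists>b\<in>carrier A. x \<ominus> a \<otimes> y = b \<otimes> y"
        by (rule less.hyps[OF _ mem low]) (use True in auto)
      then obtain b where b: "b \<in> carrier A" "x \<ominus> a \<otimes> y = b \<otimes> y" by blast
      have "x = (x \<ominus> a \<otimes> y) \<oplus> a \<otimes> y" using xA ayA by (simp add: a_minus_def a_assoc l_neg)
      also have "\<dots> = (b \<oplus> a) \<otimes> y" unfolding b(2) using a b(1) yA by (simp add: l_distr)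
      finally show ?thesis using a b(1) by blast
    qed
  qed
  from this[OF x, of 0] show ?thesis by simp
qed

lemma bij_betw_mult_generator:
  assumes p: "p \<in> B" and f: "f \<in> lhom A (path_mod p) (path_mod p)" and c: "cf (f (pv p)) p \<noteq> 0"
  shows "bij_betw f (carrier (path_mod p)) (carrier (path_mod p))"
proof -
  define y where "y = f (pv p)"
  have y: "y \<in> carrier (path_mod p)" unfolding y_def by (rule lhom_closed[OF f pv_in_path_mod])
  have fa: "f (a \<otimes> pv p) = a \<otimes> y" if "a \<in> carrier A" for a
    using lhom_smult[OF f that pv_in_path_mod] by (simp add: y_def)
  have start: "cf (strip p x) (v, cs) = 0" if "v \<noteq> tgt p" for x v cs using that by (simp add: cf_strip)
  have inj0: "x = \<zero>" if x: "x \<in> carrier (path_mod p)" and fx: "f x = \<zero>" for x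
  proof (rule ccontr)
    assume "x \<noteq> \<zero>"
    then obtain r where "r \<in> B" "cf x r \<noteq> 0" using cf_eqI[of x \<zero>] path_mod_closed[OF x] by auto
    then have "\<exists>bs. cf x (fst p, snd p @ bs) \<noteq> 0" using x unfolding path_mod_iff by metis
    then obtain bs where bs: "cf x (fst p, snd p @ bs) \<noteq> 0"
      "\<forall>cs. cf x (fst p, snd p @ cs) \<noteq> 0 \<longrightarrow> length bs \<le> length cs"
      using ex_has_least_nat[of "\<lambda>bs. cf x (fst p, snd p @ bs) \<noteq> 0" _ length] by blast
    then have "cf x (fst p, snd p @ cs) = 0" if "length cs < length bs" for cs using that by (meson not_le)
    note bs = bs(1) this
    have "cf (strip p x \<otimes> y) (fst p, snd p @ bs) = cf (strip p x) (tgt p, bs) * cf y p"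
      by (rule cf_mult_leading[OF p strip_closed y _ start]) (use bs cf_notin in \<open>auto simp: cf_strip\<close>)
    moreover have "strip p x \<otimes> y = \<zero>" using fa[of "strip p x"] fx strip_mult_pv[OF x] by simp
    ultimately show False using bs(1) c by (simp add: cf_strip y_def)
  qed
  have "inj_on f (carrier (path_mod p))"
  proof
    fix u v assume uv: "u \<in> carrier (path_mod p)" "v \<in> carrier (path_mod p)" "f u = f v"
    interpret P: left_module A "path_mod p" by (rule left_module_path_mod)
    have "f (u \<ominus>\<^bsub>path_mod p\<^esub> v) = f u \<ominus>\<^bsub>path_mod p\<^esub> f v"
      by (rule lhom_diff[OF left_module_path_mod left_module_path_mod f uv(1,2)])
    also have "\<dots> = \<zero>\<^bsub>path_mod p\<^esub>" unfolding uv(3) using lhom_closed[OF f uv(2)]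
      by (simp add: a_minus_def P.r_neg del: left_ideal_gen_simps)
    finally have "u \<ominus>\<^bsub>path_mod p\<^esub> v = \<zero>\<^bsub>path_mod p\<^esub>"
      using inj0[OF P.minus_closed[OF uv(1,2)]] by simp
    then show "u = v" using uv(1,2)
      unfolding a_minus_def by (metis P.minus_equality P.minus_minus P.a_inv_closed)
  qed
  moreover have "f ` carrier (path_mod p) = carrier (path_mod p)"
  proof
    show "f ` carrier (path_mod p) \<subseteq> carrier (path_mod p)" using lhom_closed[OF f] by blast
    show "carrier (path_mod p) \<subseteq> f ` carrier (path_mod p)"
    proof
      fix x assume "x \<in> carrier (path_mod p)"
      then obtain a where a: "a \<in> carrier A" "x = a \<otimes> y"
        using generator_mult_surj[OF p y] c by (auto simp: y_def simp del: left_ideal_gen_simps)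
      have "a \<otimes> pv p \<in> carrier (path_mod p)" using a(1) by auto
      moreover have "x = f (a \<otimes> pv p)" using a(2) fa[OF a(1)] by simp
      ultimately show "x \<in> f ` carrier (path_mod p)" by blast
    qed
  qed
  ultimately show ?thesis by (simp add: bij_betw_def)
qed

end

section \<open>Kernels of maps between projective modules\<close>

text \<open>
  A kernel \<open>N\<close> of a map between free modules consists of the families \<open>x\<close> over \<open>J\<close> with
  \<open>\<Sum>\<^sub>j x\<^sub>j G\<^sub>j = 0\<close> for all \<open>G\<close> in a given set. It is a direct sum of modules \<open>Aq\<close>, for the following
  reason. For a path \<open>w\<close> let \<open>W(w)\<close> be the space of coefficient vectors at \<open>w\<close> of those elements
  of \<open>N\<close> that only involve paths of the form \<open>wu\<close>. Multiplication by paths from the left shows that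
  \<open>W(w)\<close> grows when \<open>w\<close> is prolonged to \<open>w'w\<close>. A generator of type \<open>q\<close> of \<open>N\<close> is needed for each
  new dimension of \<open>W(q)\<close>. The generators map the direct sum of the modules \<open>Aq\<close> to \<open>N\<close>, and the
  comparison of terms of lowest length shows that this map is injective and surjective.
\<close>

lemma vector_space_pointwise: "vector_space (\<lambda>(c :: 'k::field) (f :: 'j \<Rightarrow> 'k) j. c * f j)"
  by standard (auto simp: fun_eq_iff algebra_simps)

global_interpretation coeff_vs: vector_space "\<lambda>(c :: 'k::field) (f :: 'j \<Rightarrow> 'k) j. c * f j"
  by (rule vector_space_pointwise)

locale monomial_kernel = monomial_algebra A \<eta> B T cf
  for A :: "('a, 'r) ring_scheme" (structure) and \<eta> :: "'k::field \<Rightarrow> 'a" and B :: "('v \<times> 'e list) set"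
    and T :: "'v \<Rightarrow> 'e list \<Rightarrow> 'v" and cf :: "'a \<Rightarrow> 'v \<times> 'e list \<Rightarrow> 'k" +
  fixes J :: "'j set" and GG :: "('j \<Rightarrow> 'a) set"
  assumes finite_J: "finite J" and GG_closed: "\<lbrakk>G \<in> GG; j \<in> J\<rbrakk> \<Longrightarrow> G j \<in> carrier A"
begin

definition N :: "('j \<Rightarrow> 'a) set" where
  "N = {x \<in> J \<rightarrow>\<^sub>E carrier A. \<forall>G\<in>GG. (\<Oplus>j\<in>J. x j \<otimes> G j) = \<zero>}"

lemma N_closed: "x \<in> N \<Longrightarrow> j \<in> J \<Longrightarrow> x j \<in> carrier A"
  by (auto simp: N_def)

lemma N_zero: "(\<lambda>j\<in>J. \<zero>) \<in> N"
proof -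
  have "(\<Oplus>j\<in>J. (\<lambda>j\<in>J. \<zero>) j \<otimes> G j) = (\<Oplus>j\<in>J. \<zero>)" if "G \<in> GG" for G
    by (intro finsum_cong') (use GG_closed[OF that] in auto)
  then show ?thesis by (auto simp: N_def)
qed

lemma N_add: assumes x: "x \<in> N" and y: "y \<in> N" shows "(\<lambda>j\<in>J. x j \<oplus> y j) \<in> N"
proof -
  have "(\<Oplus>j\<in>J. (\<lambda>j\<in>J. x j \<oplus> y j) j \<otimes> G j) = \<zero>" if G: "G \<in> GG" for G
  proof -
    have "(\<Oplus>j\<in>J. (\<lambda>j\<in>J. x j \<oplus> y j) j \<otimes> G j) = (\<Oplus>j\<in>J. x j \<otimes> G j \<oplus> y j \<otimes> G j)"
      by (intro finsum_cong') (use GG_closed[OF G] N_closed[OF x] N_closed[OF y] in \<open>auto simp: l_distr\<close>)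
    also have "\<dots> = (\<Oplus>j\<in>J. x j \<otimes> G j) \<oplus> (\<Oplus>j\<in>J. y j \<otimes> G j)"
      by (intro finsum_addf) (use GG_closed[OF G] N_closed[OF x] N_closed[OF y] in auto)
    finally show ?thesis using x y G by (simp add: N_def)
  qed
  then show ?thesis using N_closed[OF x] N_closed[OF y] by (auto simp: N_def)
qed

lemma N_smult: assumes a: "a \<in> carrier A" and x: "x \<in> N" shows "(\<lambda>j\<in>J. a \<otimes> x j) \<in> N"
proof -
  have "(\<Oplus>j\<in>J. (\<lambda>j\<in>J. a \<otimes> x j) j \<otimes> G j) = \<zero>" if G: "G \<in> GG" for G
  proof -
    have "(\<Oplus>j\<in>J. (\<lambda>j\<in>J. a \<otimes> x j) j \<otimes> G j) = (\<Oplus>j\<in>J. a \<otimes> (x j \<otimes> G j))"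
      by (intro finsum_cong') (use GG_closed[OF G] N_closed[OF x] a in \<open>auto simp: m_assoc\<close>)
    also have "\<dots> = a \<otimes> (\<Oplus>j\<in>J. x j \<otimes> G j)"
      by (intro finsum_rdistr[symmetric] finite_J a) (use GG_closed[OF G] N_closed[OF x] in auto)
    finally show ?thesis using x G a by (simp add: N_def)
  qed
  then show ?thesis using N_closed[OF x] a by (auto simp: N_def)
qed

lemma N_finsum:
  assumes "finite S" "\<And>g. g \<in> S \<Longrightarrow> (\<lambda>j\<in>J. h g j) \<in> N"
  shows "(\<lambda>j\<in>J. \<Oplus>g\<in>S. h g j) \<in> N"
  using assms
proof (induction S)
  case empty
  show ?case using N_zero by (simp only: finsum_empty)
next
  case (insert g S)
  have c: "h i j \<in> carrier A" if "i \<in> insert g S" "j \<in> J" for i j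
    using N_closed[OF insert.prems[OF that(1)] that(2)] that(2) by simp
  have "(\<lambda>j\<in>J. (\<lambda>j\<in>J. h g j) j \<oplus> (\<lambda>j\<in>J. \<Oplus>g\<in>S. h g j) j) \<in> N"
    by (rule N_add) (use insert in auto)
  also have "(\<lambda>j\<in>J. (\<lambda>j\<in>J. h g j) j \<oplus> (\<lambda>j\<in>J. \<Oplus>g\<in>S. h g j) j) = (\<lambda>j\<in>J. \<Oplus>g\<in>insert g S. h g j)"
    using insert.hyps c by (intro restrict_ext) (simp add: Pi_def)
  finally show ?case .
qed

lemma left_module_N: "left_module A ((prod_mod J (\<lambda>_. regular_module A))\<lparr>carrier := N\<rparr>)"
  by (rule left_module_submodule[OF left_module_free[OF ring_axioms]])
    (use N_zero N_add N_smult in \<open>auto simp: N_def\<close>)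

text \<open>
  \<open>w\<close> is a left factor of \<open>r\<close>, which is the final part of the list of arrows.
\<close>

definition suffix_of :: "'v \<times> 'e list \<Rightarrow> 'v \<times> 'e list \<Rightarrow> bool" where
  "suffix_of w r \<longleftrightarrow> (\<exists>as. snd r = as @ snd w \<and> T (fst r) as = fst w)"

definition coeffs :: "('j \<Rightarrow> 'a) \<Rightarrow> 'v \<times> 'e list \<Rightarrow> 'j \<Rightarrow> 'k" where
  "coeffs x w = (\<lambda>j. if j \<in> J then cf (x j) w else 0)"

definition W :: "'v \<times> 'e list \<Rightarrow> ('j \<Rightarrow> 'k) set" where
  "W w = {coeffs x w | x. x \<in> N \<and> (\<forall>j\<in>J. \<forall>r. cf (x j) r \<noteq> 0 \<longrightarrow> suffix_of w r)}"

lemma W_prolong: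
  assumes w: "(fst w, snd w @ bs) \<in> B"
  shows "W w \<subseteq> W (fst w, snd w @ bs)"
proof
  fix t assume "t \<in> W w"
  then obtain x where x: "x \<in> N" "\<And>j r. j \<in> J \<Longrightarrow> cf (x j) r \<noteq> 0 \<Longrightarrow> suffix_of w r" "t = coeffs x w"
    by (auto simp: W_def)
  define y where "y = (\<lambda>j\<in>J. pv (tgt w, bs) \<otimes> x j)"
  have yN: "y \<in> N" unfolding y_def by (rule N_smult[OF pv_closed x(1)])
  have suf: "suffix_of (fst w, snd w @ bs) r" if j: "j \<in> J" and r: "cf (y j) r \<noteq> 0" for j r
  proof -
    have "\<exists>as. snd r = as @ bs \<and> T (fst r) as = tgt w"
      using cf_pv_mult_eq_0[OF N_closed[OF x(1) j], of "snd r" "(tgt w, bs)" "fst r"] r j by (auto simp: y_def)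
    then obtain as where as: "snd r = as @ bs" "T (fst r) as = tgt w" by blast
    have rB: "(fst r, as @ bs) \<in> B" using r cf_notin[of r] as by (metis prod.collapse)
    have "cf (x j) (fst r, as) \<noteq> 0"
      using r j as cf_pv_mult[OF N_closed[OF x(1) j], of "fst r" as "(tgt w, bs)"] rB
      by (simp add: y_def) (metis prod.collapse)
    then have "suffix_of w (fst r, as)" by (rule x(2)[OF j])
    then obtain cs where "as = cs @ snd w" "T (fst r) cs = fst w"
      by (auto simp: suffix_of_def)
    then show ?thesis using as by (auto simp: suffix_of_def)
  qed
  have "coeffs y (fst w, snd w @ bs) = t"
  proof
    fix j
    have "cf (y j) (fst w, snd w @ bs) = cf (x j) w" if j: "j \<in> J"
    proof -
      have "cf (pv (tgt w, bs) \<otimes> x j) (fst w, snd w @ snd (tgt w, bs)) = cf (x j) (fst w, snd w)"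
        by (rule cf_pv_mult[OF N_closed[OF x(1) j]]) (simp_all add: w tgt_def)
      then show ?thesis using j by (simp only: y_def restrict_apply' snd_conv prod.collapse)
    qed
    then show "coeffs y (fst w, snd w @ bs) j = t j" by (simp add: coeffs_def x(3))
  qed
  then show "t \<in> W (fst w, snd w @ bs)" unfolding W_def using yN suf by blast
qed

text \<open>
  The basis of \<open>W(w)\<close> extends the one for the path without the last arrow of \<open>w\<close>. The recursion
  is on the reversed list since the arrow added to prolong a path is the last one of its list.
\<close>

definition extended_basis :: "('j \<Rightarrow> 'k) set \<Rightarrow> ('j \<Rightarrow> 'k) set \<Rightarrow> ('j \<Rightarrow> 'k) set" where
  "extended_basis S V = (SOME D. S \<subseteq> D \<and> D \<subseteq> V \<and> coeff_vs.independent D \<and> V \<subseteq> coeff_vs.span D)"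

lemma extended_basis:
  assumes "S \<subseteq> V" "coeff_vs.independent S"
  shows "S \<subseteq> extended_basis S V \<and> extended_basis S V \<subseteq> V \<and> coeff_vs.independent (extended_basis S V) \<and>
    V \<subseteq> coeff_vs.span (extended_basis S V)"
proof -
  obtain D where D: "S \<subseteq> D" "D \<subseteq> V" "coeff_vs.independent D" "V \<subseteq> coeff_vs.span D"
    by (rule coeff_vs.maximal_independent_subset_extend[OF assms])
  show ?thesis unfolding extended_basis_def by (rule someI[of _ D]) (intro conjI D)
qed

primrec basis_rev :: "'v \<Rightarrow> 'e list \<Rightarrow> ('j \<Rightarrow> 'k) set" where
  "basis_rev v [] = extended_basis {} (W (v, []))"
| "basis_rev v (a # as) = extended_basis (basis_rev v as) (W (v, rev (a # as)))"

definition D :: "'v \<times> 'e list \<Rightarrow> ('j \<Rightarrow> 'k) set" where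
  "D w = basis_rev (fst w) (rev (snd w))"

lemma D_basis_rev:
  "(v, rev as) \<in> B \<Longrightarrow> basis_rev v as \<subseteq> W (v, rev as) \<and> coeff_vs.independent (basis_rev v as) \<and>
     W (v, rev as) \<subseteq> coeff_vs.span (basis_rev v as)"
proof (induction as)
  case Nil
  then show ?case using extended_basis[of "{}" "W (v, [])"] coeff_vs.independent_empty by auto
next
  case (Cons a as)
  have "(v, rev as) \<in> B" using B_append[of v "rev as" "[a]"] Cons.prems by simp
  then have IH: "basis_rev v as \<subseteq> W (v, rev as)" "coeff_vs.independent (basis_rev v as)" using Cons.IH by auto
  have "basis_rev v as \<subseteq> W (v, rev (a # as))"
    using IH(1) W_prolong[of "(v, rev as)" "[a]"] Cons.prems by auto
  then show ?case using extended_basis[of "basis_rev v as" "W (v, rev (a # as))"] IH(2) by auto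
qed

lemma D_props:
  assumes "w \<in> B"
  shows "D w \<subseteq> W w" "coeff_vs.independent (D w)" "W w \<subseteq> coeff_vs.span (D w)"
  using D_basis_rev[of "fst w" "rev (snd w)"] assms by (auto simp: D_def)

lemma D_snoc: assumes "(v, as @ [a]) \<in> B" shows "D (v, as) \<subseteq> D (v, as @ [a])"
proof -
  have "(v, as) \<in> B" using B_append assms by blast
  then have b: "basis_rev v (rev as) \<subseteq> W (v, as)" "coeff_vs.independent (basis_rev v (rev as))"
    using D_basis_rev[of v "rev as"] by auto
  have "basis_rev v (rev as) \<subseteq> W (v, as @ [a])"
    using b(1) W_prolong[of "(v, as)" "[a]"] assms by auto
  then show ?thesis using extended_basis[OF _ b(2)] by (auto simp: D_def)
qed

lemma D_mono: "(v, as @ bs) \<in> B \<Longrightarrow> D (v, as) \<subseteq> D (v, as @ bs)"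
proof (induction bs rule: rev_induct)
  case (snoc b bs)
  then have "(v, as @ bs) \<in> B" using B_append[of v "as @ bs" "[b]"] by simp
  then show ?case using snoc D_snoc[of v "as @ bs" b] by auto
qed simp

lemma D_outside: "w \<in> B \<Longrightarrow> t \<in> D w \<Longrightarrow> j \<notin> J \<Longrightarrow> t j = 0"
proof -
  assume w: "w \<in> B" "t \<in> D w" and j: "j \<notin> J"
  have "t \<in> W w" using D_props(1)[OF w(1)] w(2) by (rule subsetD)
  then show ?thesis using j by (auto simp: W_def coeffs_def)
qed

lemma finite_D: assumes w: "w \<in> B" shows "finite (D w)"
proof -
  let ?e = "\<lambda>j i. if i = j then 1 else (0 :: 'k)"
  have "t \<in> coeff_vs.span (?e ` J)" if "t \<in> D w" for t
  proof -
    have "(\<Sum>j\<in>J. (\<lambda>i. t j * ?e j i)) \<in> coeff_vs.span (?e ` J)"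
      by (intro coeff_vs.span_sum coeff_vs.span_scale coeff_vs.span_base) auto
    moreover have "(\<Sum>j\<in>S. (\<lambda>i. t j * ?e j i)) i = (\<Sum>j\<in>S. t j * ?e j i)" for S i
      by (induction S rule: infinite_finite_induct) auto
    then have "(\<Sum>j\<in>J. (\<lambda>i. t j * ?e j i)) = t"
      using finite_J D_outside[OF w that] by (auto simp: fun_eq_iff if_distrib cong: if_cong)
    ultimately show ?thesis by simp
  qed
  then show ?thesis
    using coeff_vs.independent_span_bound[of "?e ` J" "D w"] finite_J D_props(2)[OF w] by blast
qed

text \<open>
  The types of the generators: a basis vector together with a path at which it is added. The same
  vector can be added at different paths, so the vector alone does not identify the generator.
\<close>

definition \<Gamma> :: "(('v \<times> 'e list) \<times> ('j \<Rightarrow> 'k)) set" where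
  "\<Gamma> = {(q, t). q \<in> B \<and> t \<in> D q \<and> (snd q = [] \<or> t \<notin> D (fst q, butlast (snd q)))}"

lemma finite_\<Gamma>: "finite \<Gamma>"
proof -
  have "\<Gamma> \<subseteq> (SIGMA q:B. D q)" by (auto simp: \<Gamma>_def)
  then show ?thesis using finite_B finite_D by (meson finite_SigmaI finite_subset)
qed

text \<open>
  The generators of those types \<open>q\<close> for which \<open>w\<close> lies in \<open>Aq\<close>.
\<close>

definition above :: "'v \<times> 'e list \<Rightarrow> (('v \<times> 'e list) \<times> ('j \<Rightarrow> 'k)) set" where
  "above w = {g \<in> \<Gamma>. \<exists>bs. w = (fst (fst g), snd (fst g) @ bs)}"

lemma above_surj: "(v, as) \<in> B \<Longrightarrow> t \<in> D (v, as) \<Longrightarrow> t \<in> snd ` above (v, as)"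
proof (induction as rule: rev_induct)
  case Nil
  then have "((v, []), t) \<in> above (v, [])" by (auto simp: above_def \<Gamma>_def)
  then show ?case by force
next
  case (snoc a as)
  show ?case
  proof (cases "t \<in> D (v, as)")
    case True
    have "(v, as) \<in> B" using B_append snoc.prems by blast
    then obtain g where g: "g \<in> above (v, as)" "t = snd g" using snoc.IH True by blast
    then have "g \<in> above (v, as @ [a])" by (auto simp: above_def)
    then show ?thesis using g by blast
  next
    case False
    then have "((v, as @ [a]), t) \<in> above (v, as @ [a])" using snoc.prems by (auto simp: above_def \<Gamma>_def)
    then show ?thesis by force
  qed
qed

text \<open>
  Since the bases grow, a basis vector for \<open>w\<close> was added once on the way from the trivial path to \<open>w\<close>.
\<close>

lemma bij_betw_above: assumes w: "w \<in> B" shows "bij_betw snd (above w) (D w)"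
proof -
  have no: False if g: "((v, as), t) \<in> \<Gamma>" "((v, as @ b # bs), t) \<in> \<Gamma>" for v as b bs t
  proof -
    have bl: "butlast (as @ b # bs) = as @ butlast (b # bs)" by (simp add: butlast_append)
    have "(v, butlast (as @ b # bs)) \<in> B"
    proof -
      have "(v, butlast (as @ b # bs) @ [last (as @ b # bs)]) \<in> B"
        using g(2) append_butlast_last_id[of "as @ b # bs"] by (simp add: \<Gamma>_def del: last_appendR butlast_append)
      then show ?thesis using B_append by blast
    qed
    then have "D (v, as) \<subseteq> D (v, butlast (as @ b # bs))" using D_mono[of v as "butlast (b # bs)"] bl by metis
    then show False using g by (auto simp: \<Gamma>_def)
  qed
  have "inj_on snd (above w)"
  proof
    fix g h assume g: "g \<in> above w" and h: "h \<in> above w" and eq: "snd g = snd h"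
    obtain v as t where g': "g = ((v, as), t)" by (metis prod.collapse)
    obtain v' as' where h': "h = ((v', as'), t)" using eq g' by (metis prod.collapse snd_conv)
    obtain bs where "w = (v, as @ bs)" using g g' by (auto simp: above_def)
    moreover obtain bs' where "w = (v', as' @ bs')" using h h' by (auto simp: above_def)
    ultimately have v: "v = v'" and "as @ bs = as' @ bs'" by auto
    then obtain us where us: "as = as' @ us \<or> as' = as @ us" unfolding append_eq_append_conv2 by metis
    have 1: "us = []" if "as = as' @ us"
      using no[of v as' t "hd us" "tl us"] g h g' h' v that by (cases us) (auto simp: above_def)
    have 2: "us = []" if "as' = as @ us"
      using no[of v as t "hd us" "tl us"] g h g' h' v that by (cases us) (auto simp: above_def)
    have "as = as'" using us 1 2 append_Nil2 by metis
    then show "g = h" using g' h' v by simp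
  qed
  moreover have "snd ` above w = D w"
  proof
    show "snd ` above w \<subseteq> D w"
    proof
      fix t assume "t \<in> snd ` above w"
      then obtain q bs where "q \<in> B" "t \<in> D q" "w = (fst q, snd q @ bs)" by (auto simp: above_def \<Gamma>_def)
      then show "t \<in> D w" using D_mono[of "fst q" "snd q" bs] w by auto
    qed
    show "D w \<subseteq> snd ` above w" using above_surj[of "fst w" "snd w"] w by auto
  qed
  ultimately show ?thesis by (simp add: bij_betw_def)
qed

lemma sum_above:
  assumes w: "w \<in> B"
  shows "(\<Sum>g\<in>above w. c (snd g) * snd g j) = (\<Sum>t\<in>D w. c t * t j)"
  using sum.reindex_bij_betw[OF bij_betw_above[OF w], of "\<lambda>t. c t * t j"] by simp

lemma generators_exist:
  "\<exists>X. \<forall>g\<in>\<Gamma>. X g \<in> N \<and> (\<forall>j\<in>J. \<forall>r. cf (X g j) r \<noteq> 0 \<longrightarrow> suffix_of (fst g) r) \<and> snd g = coeffs (X g) (fst g)"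
proof -
  have "\<exists>x. x \<in> N \<and> (\<forall>j\<in>J. \<forall>r. cf (x j) r \<noteq> 0 \<longrightarrow> suffix_of (fst g) r) \<and> snd g = coeffs x (fst g)"
    if "g \<in> \<Gamma>" for g
  proof -
    have "snd g \<in> W (fst g)" using that D_props(1)[of "fst g"] by (auto simp: \<Gamma>_def)
    then show ?thesis unfolding W_def by blast
  qed
  then show ?thesis by metis
qed

definition X :: "('v \<times> 'e list) \<times> ('j \<Rightarrow> 'k) \<Rightarrow> 'j \<Rightarrow> 'a" where
  "X = (SOME X. \<forall>g\<in>\<Gamma>. X g \<in> N \<and> (\<forall>j\<in>J. \<forall>r. cf (X g j) r \<noteq> 0 \<longrightarrow> suffix_of (fst g) r) \<and>
     snd g = coeffs (X g) (fst g))"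

lemma X:
  assumes "g \<in> \<Gamma>"
  shows "X g \<in> N" "\<And>j r. j \<in> J \<Longrightarrow> cf (X g j) r \<noteq> 0 \<Longrightarrow> suffix_of (fst g) r" "snd g = coeffs (X g) (fst g)"
  using someI_ex[OF generators_exist] assms unfolding X_def[symmetric] by blast+

text \<open>
  The left factor \<open>q\<close> of a generator of type \<open>q\<close> is split off: the generator is \<open>q Z\<close>, so right
  multiplication by the components of \<open>Z\<close> maps \<open>Aq\<close> to \<open>N\<close>.
\<close>

definition Z :: "('v \<times> 'e list) \<times> ('j \<Rightarrow> 'k) \<Rightarrow> 'j \<Rightarrow> 'a" where
  "Z g j = mk (\<lambda>r. if tgt r = fst (fst g) then cf (X g j) (fst r, snd r @ snd (fst g)) else 0)"

lemma Z_closed [simp]: "Z g j \<in> carrier A" by (simp add: Z_def)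

lemma pv_mult_Z: assumes g: "g \<in> \<Gamma>" and j: "j \<in> J" shows "pv (fst g) \<otimes> Z g j = X g j"
proof (rule cf_eqI)
  show "X g j \<in> carrier A" by (rule N_closed[OF X(1)[OF g] j])
  fix r assume r: "r \<in> B"
  show "cf (pv (fst g) \<otimes> Z g j) r = cf (X g j) r"
  proof (cases "suffix_of (fst g) r")
    case True
    then obtain as where as: "snd r = as @ snd (fst g)" "T (fst r) as = fst (fst g)" by (auto simp: suffix_of_def)
    have r': "r = (fst r, as @ snd (fst g))" using as(1) by (metis prod.collapse)
    then have rB: "(fst r, as @ snd (fst g)) \<in> B" using r by simp
    have "cf (pv (fst g) \<otimes> Z g j) r = cf (Z g j) (fst r, as)"
      by (subst r') (rule cf_pv_mult[OF Z_closed rB as(2)])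
    also have "\<dots> = cf (X g j) r" using B_append[OF rB] as r' by (simp add: Z_def cf_mk tgt_def)
    finally show ?thesis .
  next
    case False
    have "cf (pv (fst g) \<otimes> Z g j) (fst r, snd r) = 0"
      by (rule cf_pv_mult_eq_0) (use False in \<open>auto simp: suffix_of_def\<close>)
    then show ?thesis using X(2)[OF g j, of r] False by auto
  qed
qed simp

lemma cf_Z_start: assumes g: "g \<in> \<Gamma>" and j: "j \<in> J" shows "cf (Z g j) (fst (fst g), []) = snd g j"
proof -
  have "fst g \<in> B" using g by (auto simp: \<Gamma>_def)
  then have "(fst (fst g), []) \<in> B" using B_Nil(2)[of "fst (fst g)" "snd (fst g)"] by simp
  then show ?thesis unfolding X(3)[OF g] using j by (simp add: Z_def cf_mk tgt_def coeffs_def)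
qed

abbreviation PM :: "('a, ('v \<times> 'e list) \<times> ('j \<Rightarrow> 'k) \<Rightarrow> 'a) module" where
  "PM \<equiv> prod_mod \<Gamma> (\<lambda>g. path_mod (fst g))"

definition \<Phi> :: "(('v \<times> 'e list) \<times> ('j \<Rightarrow> 'k) \<Rightarrow> 'a) \<Rightarrow> 'j \<Rightarrow> 'a" where
  "\<Phi> f = (\<lambda>j\<in>J. \<Oplus>g\<in>\<Gamma>. f g \<otimes> Z g j)"

lemma PM_mem: "f \<in> carrier PM \<Longrightarrow> g \<in> \<Gamma> \<Longrightarrow> f g \<in> carrier (path_mod (fst g))"
  unfolding prod_mod_simps by (rule PiE_mem)

lemma PM_closed: "f \<in> carrier PM \<Longrightarrow> g \<in> \<Gamma> \<Longrightarrow> f g \<in> carrier A"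
  by (rule path_mod_closed[OF PM_mem])

lemma left_module_PM: "left_module A PM"
  by (rule left_module_prod_mod[OF ring_axioms left_module_path_mod])

lemma \<Phi>_in_N: assumes f: "f \<in> carrier PM" shows "\<Phi> f \<in> N"
  unfolding \<Phi>_def
proof (rule N_finsum[OF finite_\<Gamma>])
  fix g assume g: "g \<in> \<Gamma>"
  let ?a = "strip (fst g) (f g)"
  have "(\<lambda>j\<in>J. f g \<otimes> Z g j) = (\<lambda>j\<in>J. ?a \<otimes> X g j)"
  proof (rule restrict_ext)
    fix j assume j: "j \<in> J"
    have "f g \<otimes> Z g j = (?a \<otimes> pv (fst g)) \<otimes> Z g j" by (simp only: strip_mult_pv[OF PM_mem[OF f g]])
    also have "\<dots> = ?a \<otimes> X g j" by (simp add: m_assoc pv_mult_Z[OF g j])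
    finally show "f g \<otimes> Z g j = ?a \<otimes> X g j" .
  qed
  then show "(\<lambda>j\<in>J. f g \<otimes> Z g j) \<in> N" using N_smult[OF strip_closed X(1)[OF g]] by simp
qed

lemma \<Phi>_add:
  assumes f: "f \<in> carrier PM" and h: "h \<in> carrier PM"
  shows "\<Phi> (\<lambda>g\<in>\<Gamma>. f g \<oplus> h g) = (\<lambda>j\<in>J. \<Phi> f j \<oplus> \<Phi> h j)"
  unfolding \<Phi>_def
proof (rule restrict_ext)
  fix j assume j: "j \<in> J"
  have "(\<Oplus>g\<in>\<Gamma>. (\<lambda>g\<in>\<Gamma>. f g \<oplus> h g) g \<otimes> Z g j) = (\<Oplus>g\<in>\<Gamma>. f g \<otimes> Z g j \<oplus> h g \<otimes> Z g j)"
    using PM_closed[OF f] PM_closed[OF h] by (intro finsum_cong') (auto simp: l_distr)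
  also have "\<dots> = (\<Oplus>g\<in>\<Gamma>. f g \<otimes> Z g j) \<oplus> (\<Oplus>g\<in>\<Gamma>. h g \<otimes> Z g j)"
    using PM_closed[OF f] PM_closed[OF h] by (intro finsum_addf) auto
  finally show "(\<Oplus>g\<in>\<Gamma>. (\<lambda>g\<in>\<Gamma>. f g \<oplus> h g) g \<otimes> Z g j) =
      (\<lambda>j\<in>J. \<Oplus>g\<in>\<Gamma>. f g \<otimes> Z g j) j \<oplus> (\<lambda>j\<in>J. \<Oplus>g\<in>\<Gamma>. h g \<otimes> Z g j) j" using j by simp
qed

lemma \<Phi>_smult:
  assumes f: "f \<in> carrier PM" and a: "a \<in> carrier A"
  shows "\<Phi> (\<lambda>g\<in>\<Gamma>. a \<otimes> f g) = (\<lambda>j\<in>J. a \<otimes> \<Phi> f j)"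
  unfolding \<Phi>_def
proof (rule restrict_ext)
  fix j assume j: "j \<in> J"
  have "(\<Oplus>g\<in>\<Gamma>. (\<lambda>g\<in>\<Gamma>. a \<otimes> f g) g \<otimes> Z g j) = (\<Oplus>g\<in>\<Gamma>. a \<otimes> (f g \<otimes> Z g j))"
    using PM_closed[OF f] a by (intro finsum_cong') (auto simp: m_assoc)
  also have "\<dots> = a \<otimes> (\<Oplus>g\<in>\<Gamma>. f g \<otimes> Z g j)"
    using PM_closed[OF f] by (intro finsum_rdistr[symmetric] finite_\<Gamma> a) auto
  finally show "(\<Oplus>g\<in>\<Gamma>. (\<lambda>g\<in>\<Gamma>. a \<otimes> f g) g \<otimes> Z g j) = a \<otimes> (\<lambda>j\<in>J. \<Oplus>g\<in>\<Gamma>. f g \<otimes> Z g j) j"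
    using j by simp
qed

text \<open>
  At the lowest length that occurs in \<open>f\<close>, only the trivial path of the cofactors \<open>Z\<close> contributes, and
  its coefficients are the basis vectors.
\<close>

lemma cf_\<Phi>:
  assumes f: "f \<in> carrier PM" and j: "j \<in> J" and low: "\<And>g r. g \<in> \<Gamma> \<Longrightarrow> cf (f g) r \<noteq> 0 \<Longrightarrow> n \<le> length (snd r)"
    and w: "w \<in> B" "length (snd w) \<le> n"
  shows "cf (\<Phi> f j) w = (\<Sum>g\<in>above w. cf (f g) w * snd g j)"
proof -
  have cl: "(\<lambda>g. f g \<otimes> Z g j) \<in> \<Gamma> \<rightarrow> carrier A" using PM_closed[OF f] by auto
  have "cf (f g \<otimes> Z g j) w = (if g \<in> above w then cf (f g) w * snd g j else 0)" if g: "g \<in> \<Gamma>" for g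
  proof -
    have fA: "f g \<in> carrier A" by (rule PM_closed[OF f g])
    obtain v as where vas: "w = (v, as)" by (cases w)
    have "cf (f g) (T v (take k as), drop k as) * cf (Z g j) (v, take k as) =
        (if k = 0 then cf (f g) w * cf (Z g j) (v, []) else 0)" if "k \<le> length as" for k
    proof (cases "k = 0")
      case False
      then have "length (drop k as) < n" using that w(2) vas by auto
      then have "cf (f g) (T v (take k as), drop k as) = 0" using low[OF g] by fastforce
      then show ?thesis using False by simp
    qed (simp add: vas)
    then have 1: "cf (f g \<otimes> Z g j) w = cf (f g) w * cf (Z g j) (v, [])"
      using w(1) unfolding vas by (subst cf_mult[OF fA Z_closed]) (auto simp: vas)
    show ?thesis
    proof (cases "g \<in> above w")
      case True
      then have "v = fst (fst g)" by (auto simp: above_def vas)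
      then show ?thesis using 1 True cf_Z_start[OF g j] by simp
    next
      case False
      then have "cf (f g) w = 0"
        using PM_mem[OF f g] g unfolding path_mod_iff above_def by blast
      then show ?thesis using 1 False by simp
    qed
  qed
  then have "(\<Sum>g\<in>\<Gamma>. cf (f g \<otimes> Z g j) w) = (\<Sum>g\<in>\<Gamma>. if g \<in> above w then cf (f g) w * snd g j else 0)"
    by (intro sum.cong) auto
  also have "\<dots> = (\<Sum>g\<in>above w. cf (f g) w * snd g j)"
    using finite_\<Gamma> by (simp add: sum.If_cases above_def Int_def)
  finally show ?thesis using j by (simp add: \<Phi>_def cf_finsum[OF finite_\<Gamma> cl])
qed

lemma sum_fun_eval: "(\<Sum>t\<in>S. (\<lambda>i. c t * t i)) j = (\<Sum>t\<in>S. (c t :: 'k) * t j)"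
  by (induction S rule: infinite_finite_induct) auto

text \<open>
  A nonzero coefficient of lowest length would give a nontrivial relation between the basis vectors
  at its path.
\<close>

lemma \<Phi>_eq_0:
  assumes f: "f \<in> carrier PM" and 0: "\<And>j. j \<in> J \<Longrightarrow> \<Phi> f j = \<zero>" and g: "g \<in> \<Gamma>"
  shows "f g = \<zero>"
proof (rule ccontr)
  assume "f g \<noteq> \<zero>"
  then obtain r where "r \<in> B" "cf (f g) r \<noteq> 0" using cf_eqI[OF PM_closed[OF f g] zero_closed] by auto
  then have "\<exists>h. (\<lambda>(g, r). g \<in> \<Gamma> \<and> cf (f g) r \<noteq> 0) h" using g by blast
  then obtain h where h: "(\<lambda>(g, r). g \<in> \<Gamma> \<and> cf (f g) r \<noteq> 0) h"
    "\<And>h'. (\<lambda>(g, r). g \<in> \<Gamma> \<and> cf (f g) r \<noteq> 0) h' \<Longrightarrow> length (snd (snd h)) \<le> length (snd (snd h'))"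
    using ex_has_least_nat[of "\<lambda>(g, r). g \<in> \<Gamma> \<and> cf (f g) r \<noteq> 0" _ "\<lambda>h. length (snd (snd h))"] by blast
  obtain g0 w where gw: "h = (g0, w)" by (cases h)
  have g0: "g0 \<in> \<Gamma>" and c0: "cf (f g0) w \<noteq> 0" using h(1) gw by auto
  have w: "w \<in> B" using c0 cf_notin by blast
  have low: "length (snd w) \<le> length (snd r)" if "g \<in> \<Gamma>" "cf (f g) r \<noteq> 0" for g r
    using h(2)[of "(g, r)"] that gw by simp
  have above: "g0 \<in> above w" using PM_mem[OF f g0] g0 c0 unfolding path_mod_iff above_def by blast
  define i where "i = inv_into (above w) snd"
  have i: "i (snd g) = g" if "g \<in> above w" for g
    using bij_betw_above[OF w] that by (simp add: i_def bij_betw_def)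
  have "(\<Sum>t\<in>D w. cf (f (i t)) w * t j) = 0" for j
  proof (cases "j \<in> J")
    case True
    have "(\<Sum>t\<in>D w. cf (f (i t)) w * t j) = (\<Sum>g\<in>above w. cf (f (i (snd g))) w * snd g j)"
      using sum_above[OF w, of "\<lambda>t. cf (f (i t)) w" j] by simp
    also have "\<dots> = (\<Sum>g\<in>above w. cf (f g) w * snd g j)" by (rule sum.cong) (simp_all add: i)
    also have "\<dots> = cf (\<Phi> f j) w" using cf_\<Phi>[OF f True low w] by simp
    finally show ?thesis using 0[OF True] by simp
  next
    case False
    then show ?thesis by (intro sum.neutral) (simp add: D_outside[OF w])
  qed
  then have "(\<Sum>t\<in>D w. (\<lambda>j. cf (f (i t)) w * t j)) = 0"
    by (auto simp: fun_eq_iff sum_fun_eval)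
  then have "cf (f (i (snd g0))) w = 0"
    using coeff_vs.independentD[OF D_props(2)[OF w] finite_D[OF w] subset_refl, of "\<lambda>t. cf (f (i t)) w" "snd g0"]
      bij_betw_above[OF w] above by (auto simp: bij_betw_def)
  then show False using c0 i[OF above] by simp
qed

text \<open>
  The lowest terms of an element of \<open>N\<close> can be separated according to their path \<open>w\<close>: paths \<open>w'u'\<close>
  and \<open>wu\<close> with different \<open>w\<close>, \<open>w'\<close> of the same length cannot be equal, so the relations that
  define \<open>N\<close> hold separately for the part of an element that involves the paths \<open>wu\<close>.
\<close>

lemma restrict_suffix_in_N:
  assumes x: "x \<in> N" and low: "\<And>j r. j \<in> J \<Longrightarrow> cf (x j) r \<noteq> 0 \<Longrightarrow> length (snd w) \<le> length (snd r)"
  shows "(\<lambda>j\<in>J. mk (\<lambda>r. if suffix_of w r then cf (x j) r else 0)) \<in> N"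
proof -
  define y where "y j = mk (\<lambda>r. if suffix_of w r then cf (x j) r else 0)" for j
  have y: "y j \<in> carrier A" for j by (simp add: y_def)
  have cfy: "cf (y j) r = (if suffix_of w r then cf (x j) r else 0)" for j r
    using cf_notin[of r] by (simp add: y_def cf_mk)
  have "(\<Oplus>j\<in>J. (\<lambda>j\<in>J. y j) j \<otimes> G j) = \<zero>" if G: "G \<in> GG" for G
  proof (rule cf_eqI)
    show "(\<Oplus>j\<in>J. (\<lambda>j\<in>J. y j) j \<otimes> G j) \<in> carrier A" using y GG_closed[OF G] by (intro finsum_closed) auto
    fix r assume r: "r \<in> B"
    obtain v as where vas: "r = (v, as)" by (cases r)
    have coeff: "cf (y j) (T v (take k as), drop k as) =
        (if suffix_of w r then cf (x j) (T v (take k as), drop k as) else 0)" if j: "j \<in> J" for j k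
    proof (cases "cf (x j) (T v (take k as), drop k as) = 0")
      case False
      then have len: "length (snd w) \<le> length (drop k as)" using low[OF j] by fastforce
      have "suffix_of w (T v (take k as), drop k as) \<longleftrightarrow> suffix_of w r"
      proof
        assume "suffix_of w (T v (take k as), drop k as)"
        then obtain cs where cs: "drop k as = cs @ snd w" "T (T v (take k as)) cs = fst w"
          by (auto simp: suffix_of_def)
        have "as = (take k as @ cs) @ snd w" using cs(1) append_take_drop_id[of k as] by simp
        moreover have "T v (take k as @ cs) = fst w" using cs(2) by simp
        ultimately show "suffix_of w r" unfolding suffix_of_def vas fst_conv snd_conv by blast
      next
        assume "suffix_of w r"
        then obtain cs where cs: "as = cs @ snd w" "T v cs = fst w" by (auto simp: suffix_of_def vas)
        show "suffix_of w (T v (take k as), drop k as)"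
        proof (cases "k \<le> length cs")
          case True
          then have "T (T v (take k as)) (drop k cs) = fst w"
            using cs T_append[of v "take k cs" "drop k cs"] by simp
          then show ?thesis using True cs(1) by (auto simp: suffix_of_def)
        next
          case False
          then have "length cs + length (snd w) \<le> length cs" if "snd w \<noteq> []"
            using len cs(1) that by (cases "k \<le> length as") auto
          then have "snd w = []" by auto
          then show ?thesis using cs False by (auto simp: suffix_of_def)
        qed
      qed
      then show ?thesis by (simp add: cfy)
    qed (simp add: cfy)
    have "cf (y j \<otimes> G j) r = (if suffix_of w r then cf (x j \<otimes> G j) r else 0)" if j: "j \<in> J" for j
      using r y GG_closed[OF G j] N_closed[OF x j] unfolding vas
      by (simp add: cf_mult coeff[OF j, unfolded vas] cong: sum.cong)
    moreover have "cf (\<Oplus>j\<in>J. (\<lambda>j\<in>J. y j) j \<otimes> G j) r = (\<Sum>j\<in>J. cf (y j \<otimes> G j) r)"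
      using y GG_closed[OF G] by (subst cf_finsum[OF finite_J]) (auto intro!: sum.cong)
    ultimately have "cf (\<Oplus>j\<in>J. (\<lambda>j\<in>J. y j) j \<otimes> G j) r =
        (if suffix_of w r then (\<Sum>j\<in>J. cf (x j \<otimes> G j) r) else 0)" by simp
    also have "(\<Sum>j\<in>J. cf (x j \<otimes> G j) r) = cf (\<Oplus>j\<in>J. x j \<otimes> G j) r"
      using N_closed[OF x] GG_closed[OF G] by (subst cf_finsum[OF finite_J]) auto
    also have "(\<Oplus>j\<in>J. x j \<otimes> G j) = \<zero>" using x G by (simp add: N_def)
    finally show "cf (\<Oplus>j\<in>J. (\<lambda>j\<in>J. y j) j \<otimes> G j) r = cf \<zero> r" by simp
  qed simp
  then show ?thesis using y by (auto simp: N_def y_def)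
qed

text \<open>
  By descending induction on the lowest length that occurs: the lowest terms are combinations of the
  basis vectors, hence are hit by an element of the direct sum, and subtracting its image raises
  the lowest length, which is bounded.
\<close>

lemma \<Phi>_surj:
  assumes "x \<in> N" "\<And>j r. j \<in> J \<Longrightarrow> cf (x j) r \<noteq> 0 \<Longrightarrow> n \<le> length (snd r)"
  shows "x \<in> \<Phi> ` carrier PM"
proof -
  obtain M where M: "\<And>r. r \<in> B \<Longrightarrow> length (snd r) < M" using finite_length_bound by blast
  interpret PM: left_module A PM by (rule left_module_PM)
  show ?thesis using assms
  proof (induction "M - n" arbitrary: n x rule: less_induct)
    case less
    note x = less.prems(1) and low = less.prems(2)
    show ?case
    proof (cases "n < M")
      case False
      have "x j = \<zero>" if j: "j \<in> J" for j
      proof (rule cf_eqI[OF N_closed[OF x j] zero_closed])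
        fix r assume "r \<in> B"
        then show "cf (x j) r = cf \<zero> r" using low[OF j, of r] M[of r] False by auto
      qed
      moreover have z: "\<zero>\<^bsub>PM\<^esub> \<in> carrier PM" by (rule PM.M.zero_closed)
      have "\<Phi> \<zero>\<^bsub>PM\<^esub> j = \<zero>" if "j \<in> J" for j
      proof -
        have "(\<Oplus>g\<in>\<Gamma>. \<zero>\<^bsub>PM\<^esub> g \<otimes> Z g j) = (\<Oplus>g\<in>\<Gamma>. \<zero>)" by (intro finsum_cong') auto
        then show ?thesis using that by (simp add: \<Phi>_def)
      qed
      ultimately have "x = \<Phi> \<zero>\<^bsub>PM\<^esub>"
        using x by (intro PiE_ext[of _ J "\<lambda>_. carrier A"]) (auto simp: N_def \<Phi>_def)
      then show ?thesis using z by blast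
    next
      case True
      have cW: "coeffs x w \<in> W w" if w: "w \<in> B" "length (snd w) = n" for w
      proof -
        let ?y = "\<lambda>j\<in>J. mk (\<lambda>r. if suffix_of w r then cf (x j) r else 0)"
        have "?y \<in> N" using restrict_suffix_in_N[OF x, of w] low w(2) by simp
        moreover have "suffix_of w r" if "j \<in> J" "cf (?y j) r \<noteq> 0" for j r
          using that by (auto simp: cf_mk split: if_splits)
        moreover have "suffix_of w w" unfolding suffix_of_def by (intro exI[of _ "[]"]) simp
        then have "coeffs x w = coeffs ?y w" using w(1) by (auto simp: coeffs_def cf_mk fun_eq_iff)
        ultimately show ?thesis unfolding W_def by blast
      qed
      have span: "coeffs x w \<in> coeff_vs.span (D w)" if "w \<in> B" "length (snd w) = n" for w
        by (rule subsetD[OF D_props(3)[OF that(1)] cW[OF that]])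
      have "\<forall>w\<in>{w \<in> B. length (snd w) = n}. \<exists>u. coeffs x w = (\<Sum>t\<in>D w. (\<lambda>j. u t * t j))"
      proof
        fix w assume "w \<in> {w \<in> B. length (snd w) = n}"
        then have w: "w \<in> B" "length (snd w) = n" by auto
        show "\<exists>u. coeffs x w = (\<Sum>t\<in>D w. (\<lambda>j. u t * t j))"
          using span[OF w] unfolding coeff_vs.span_finite[OF finite_D[OF w(1)]] by (rule imageE) (rule exI)
      qed
      from bchoice[OF this] obtain u where
        u: "\<And>w. w \<in> B \<Longrightarrow> length (snd w) = n \<Longrightarrow> coeffs x w = (\<Sum>t\<in>D w. (\<lambda>j. u w t * t j))"
        by auto
      define f where "f = (\<lambda>g\<in>\<Gamma>. mk (\<lambda>w. if length (snd w) = n \<and> g \<in> above w then u w (snd g) else 0))"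
      have cff: "cf (f g) w = (if w \<in> B \<and> length (snd w) = n \<and> g \<in> above w then u w (snd g) else 0)"
        if "g \<in> \<Gamma>" for g w using that by (simp add: f_def cf_mk)
      have f: "f \<in> carrier PM"
      proof -
        have "f g \<in> carrier (path_mod (fst g))" if g: "g \<in> \<Gamma>" for g
          unfolding path_mod_iff
        proof (intro conjI allI impI)
          fix r assume "cf (f g) r \<noteq> 0"
          then have "g \<in> above r" using cff[OF g, of r] by (auto split: if_splits)
          then show "\<exists>bs. r = (fst (fst g), snd (fst g) @ bs)" by (auto simp: above_def)
        qed (use g in \<open>simp add: f_def\<close>)
        then show ?thesis by (auto simp: f_def simp del: left_ideal_gen_simps)
      qed
      have flow: "n \<le> length (snd r)" if "g \<in> \<Gamma>" "cf (f g) r \<noteq> 0" for g r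
        using that cff[OF that(1), of r] by (auto split: if_splits)
      have eq: "cf (\<Phi> f j) w = cf (x j) w" if j: "j \<in> J" and w: "w \<in> B" "length (snd w) = n" for j w
      proof -
        have "cf (\<Phi> f j) w = (\<Sum>g\<in>above w. cf (f g) w * snd g j)" using cf_\<Phi>[OF f j flow w(1)] w(2) by simp
        also have "\<dots> = (\<Sum>g\<in>above w. u w (snd g) * snd g j)"
          using w by (intro sum.cong) (auto simp: cff above_def)
        also have "\<dots> = (\<Sum>t\<in>D w. u w t * t j)" by (rule sum_above[OF w(1)])
        also have "\<dots> = coeffs x w j" unfolding u[OF w] by (simp add: sum_fun_eval)
        finally show ?thesis using j by (simp add: coeffs_def)
      qed
      have fN: "\<Phi> f \<in> N" by (rule \<Phi>_in_N[OF f])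
      define y where "y = (\<lambda>j\<in>J. x j \<oplus> (\<lambda>j\<in>J. (\<ominus> \<one>) \<otimes> \<Phi> f j) j)"
      have y: "y \<in> N" unfolding y_def by (rule N_add[OF x N_smult[OF _ fN]]) simp
      have yj: "y j = x j \<ominus> \<Phi> f j" if "j \<in> J" for j
        using that N_closed[OF fN that] by (simp add: y_def l_minus a_minus_def)
      have ylow: "Suc n \<le> length (snd r)" if j: "j \<in> J" and r: "cf (y j) r \<noteq> 0" for j r
      proof (rule ccontr)
        assume "\<not> Suc n \<le> length (snd r)"
        then have len: "length (snd r) \<le> n" by simp
        have rB: "r \<in> B" using r cf_notin by blast
        have "cf (y j) r = cf (x j) r - cf (\<Phi> f j) r"
          unfolding yj[OF j] by (rule cf_minus[OF N_closed[OF x j] N_closed[OF fN j]])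
        moreover have "cf (x j) r = cf (\<Phi> f j) r"
        proof (cases "length (snd r) = n")
          case False
          then have l: "length (snd r) < n" using len by simp
          then have "cf (x j) r = 0" using low[OF j, of r] by fastforce
          moreover have "cf (f g) r = 0" if "g \<in> above r" for g
            using that l by (auto simp: cff above_def)
          then have "cf (\<Phi> f j) r = 0" using cf_\<Phi>[OF f j flow rB len] by simp
          ultimately show ?thesis by simp
        qed (use eq[OF j rB] in simp)
        ultimately show False using r by simp
      qed
      have "y \<in> \<Phi> ` carrier PM" by (rule less.hyps[OF _ y ylow]) (use True in auto)
      then obtain h where h: "h \<in> carrier PM" "y = \<Phi> h" by blast
      have "x = (\<lambda>j\<in>J. \<Phi> h j \<oplus> \<Phi> f j)"
      proof (rule PiE_ext[of _ J "\<lambda>_. carrier A"])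
        show "x \<in> J \<rightarrow>\<^sub>E carrier A" using x by (simp add: N_def)
        show "(\<lambda>j\<in>J. \<Phi> h j \<oplus> \<Phi> f j) \<in> J \<rightarrow>\<^sub>E carrier A" using N_closed[OF fN] N_closed[OF y] h by auto
        fix j assume j: "j \<in> J"
        have "x j = (x j \<ominus> \<Phi> f j) \<oplus> \<Phi> f j"
          using N_closed[OF fN j] N_closed[OF x j] by (simp add: a_minus_def a_assoc l_neg)
        also have "x j \<ominus> \<Phi> f j = \<Phi> h j" unfolding yj[OF j, symmetric] h(2) ..
        finally show "x j = (\<lambda>j\<in>J. \<Phi> h j \<oplus> \<Phi> f j) j" using j by simp
      qed
      also have "\<dots> = \<Phi> (\<lambda>g\<in>\<Gamma>. h g \<oplus> f g)" by (rule \<Phi>_add[OF h(1) f, symmetric])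
      finally show ?thesis
        using PM.M.a_closed[OF h(1) f] by auto
    qed
  qed
qed

theorem kernel_decomposition:
  "liso A PM ((prod_mod J (\<lambda>_. regular_module A))\<lparr>carrier := N\<rparr>)"
proof -
  let ?N = "(prod_mod J (\<lambda>_. regular_module A))\<lparr>carrier := N\<rparr>"
  interpret PM: left_module A PM by (rule left_module_PM)
  have hom: "(\<lambda>f\<in>carrier PM. \<Phi> f) \<in> lhom A PM ?N"
  proof (rule lhom_restrictI[OF left_module_PM])
    fix f assume f: "f \<in> carrier PM"
    show "\<Phi> f \<in> carrier ?N" using \<Phi>_in_N[OF f] by simp
    show "\<Phi> (f \<oplus>\<^bsub>PM\<^esub> h) = \<Phi> f \<oplus>\<^bsub>?N\<^esub> \<Phi> h" if h: "h \<in> carrier PM" for h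
      using \<Phi>_add[OF f h] by simp
    show "\<Phi> (a \<odot>\<^bsub>PM\<^esub> f) = a \<odot>\<^bsub>?N\<^esub> \<Phi> f" if a: "a \<in> carrier A" for a
      using \<Phi>_smult[OF f a] by simp
  qed
  have "inj_on \<Phi> (carrier PM)"
  proof
    fix f h assume f: "f \<in> carrier PM" and h: "h \<in> carrier PM" and eq: "\<Phi> f = \<Phi> h"
    define d where "d = (\<lambda>g\<in>\<Gamma>. f g \<oplus> (\<lambda>g\<in>\<Gamma>. (\<ominus> \<one>) \<otimes> h g) g)"
    have h': "(\<lambda>g\<in>\<Gamma>. (\<ominus> \<one>) \<otimes> h g) \<in> carrier PM"
      using PM.smult_closed[of "\<ominus> \<one>" h] h by simp
    have d: "d \<in> carrier PM" unfolding d_def using PM.M.a_closed[OF f h'] by simp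
    have "\<Phi> d j = \<zero>" if j: "j \<in> J" for j
    proof -
      have "\<Phi> d = (\<lambda>j\<in>J. \<Phi> f j \<oplus> (\<lambda>j\<in>J. (\<ominus> \<one>) \<otimes> \<Phi> h j) j)"
        unfolding d_def by (simp only: \<Phi>_add[OF f h'] \<Phi>_smult[OF h a_inv_closed[OF one_closed]])
      then show ?thesis using j N_closed[OF \<Phi>_in_N[OF h] j] by (simp add: eq l_minus r_neg)
    qed
    then have d0: "d g = \<zero>" if "g \<in> \<Gamma>" for g using \<Phi>_eq_0[OF d] that by blast
    have "f g = h g" if "g \<in> \<Gamma>" for g
    proof -
      have "f g \<oplus> \<ominus> h g = \<zero>"
        using d0[OF that] that PM_closed[OF h that] by (simp add: d_def l_minus)
      then show ?thesis
        using PM_closed[OF f that] PM_closed[OF h that] by (metis minus_equality minus_minus a_inv_closed)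
    qed
    then show "f = h" using f h by (intro PiE_ext[of f \<Gamma> "\<lambda>g. carrier (path_mod (fst g))"]) auto
  qed
  moreover have "\<Phi> ` carrier PM = N" using \<Phi>_in_N \<Phi>_surj[of _ 0] by blast
  ultimately have "bij_betw (\<lambda>f\<in>carrier PM. \<Phi> f) (carrier PM) (carrier ?N)"
    by (simp add: bij_betw_def inj_on_restrict_eq del: prod_mod_simps)
  then show ?thesis unfolding liso_def using hom by blast
qed

end

context monomial_algebra
begin

text \<open>
  With dual bases of \<open>P\<close> and \<open>P'\<close> the kernel becomes a submodule of a free module that is cut out by
  right multiplications, as treated above.
\<close>

theorem kernel_of_projectives_decomposition:
  assumes P: "left_module A P" and P': "left_module A P'"
    and id: "id_hom P \<in> finite_rank_homs A P P" and id': "id_hom P' \<in> finite_rank_homs A P' P'"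
    and d: "d \<in> lhom A P P'"
  obtains \<Gamma> :: "(('v \<times> 'e list) \<times> (nat \<Rightarrow> 'k)) set" where "finite \<Gamma>" "\<And>g. g \<in> \<Gamma> \<Longrightarrow> fst g \<in> B"
    "liso A (prod_mod \<Gamma> (\<lambda>g. path_mod (fst g))) (kernel_module P P' d)"
proof -
  interpret P: left_module A P by fact
  interpret P': left_module A P' by fact
  note R = left_module_regular[OF ring_axioms]
  obtain n :: nat and \<phi> b where \<phi>: "\<And>i. i < n \<Longrightarrow> \<phi> i \<in> lhom A P (regular_module A)"
    and b: "\<And>i. i < n \<Longrightarrow> b i \<in> carrier P"
    and \<phi>b: "\<And>x. x \<in> carrier P \<Longrightarrow> id_hom P x = (\<Oplus>\<^bsub>P\<^esub>i\<in>{..<n}. \<phi> i x \<odot>\<^bsub>P\<^esub> b i)"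
    using finite_rank_explicit[OF P P id] by blast
  obtain n' :: nat and \<phi>' b' where \<phi>': "\<And>i. i < n' \<Longrightarrow> \<phi>' i \<in> lhom A P' (regular_module A)"
    and b': "\<And>i. i < n' \<Longrightarrow> b' i \<in> carrier P'"
    and \<phi>b': "\<And>x. x \<in> carrier P' \<Longrightarrow> id_hom P' x = (\<Oplus>\<^bsub>P'\<^esub>i\<in>{..<n'}. \<phi>' i x \<odot>\<^bsub>P'\<^esub> b' i)"
    using finite_rank_explicit[OF P' P' id'] by blast
  have \<phi>c: "\<phi> i x \<in> carrier A" if "i < n" "x \<in> carrier P" for i x using lhom_closed[OF \<phi>[OF that(1)] that(2)] by simp
  have \<phi>c': "\<phi>' i x \<in> carrier A" if "i < n'" "x \<in> carrier P'" for i x using lhom_closed[OF \<phi>'[OF that(1)] that(2)] by simp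
  note dc = lhom_closed[OF d]
  (* The coordinate vectors of elements of P are the solutions a of the relations G1, which say that
     a i is the i-th coordinate of the combination of the b k with coefficients a k; the relations
     G2 say that d kills this combination. *)
  define G1 where "G1 i = (\<lambda>k. \<phi> i (b k) \<oplus> (if i = k then \<ominus> \<one> else \<zero>))" for i
  define G2 where "G2 l = (\<lambda>k. \<phi>' l (d (b k)))" for l
  define GG where "GG = G1 ` {..<n} \<union> G2 ` {..<n'}"
  interpret K: monomial_kernel A \<eta> B T cf "{..<n}" GG
    by unfold_locales (auto simp: GG_def G1_def G2_def intro!: \<phi>c \<phi>c' b dc)
  let ?F = "prod_mod {..<n} (\<lambda>_. regular_module A)"
  let ?N = "?F\<lparr>carrier := K.N\<rparr>"
  let ?Z = "kernel_module P P' d"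
  define s where "s a = (\<Oplus>\<^bsub>P\<^esub>k\<in>{..<n}. a k \<odot>\<^bsub>P\<^esub> b k)" for a
  have ac: "a k \<in> carrier A" if "a \<in> {..<n} \<rightarrow>\<^sub>E carrier A" "k < n" for a k using that by auto
  have scl: "(\<lambda>k. a k \<odot>\<^bsub>P\<^esub> b k) \<in> {..<n} \<rightarrow> carrier P" if "a \<in> {..<n} \<rightarrow>\<^sub>E carrier A" for a
    using ac[OF that] b by auto
  have sc: "s a \<in> carrier P" if "a \<in> {..<n} \<rightarrow>\<^sub>E carrier A" for a
    unfolding s_def using scl[OF that] by (rule P.finsum_closed)
  have lin: "f (s a) = (\<Oplus>k\<in>{..<n}. a k \<otimes> f (b k))"
    if a: "a \<in> {..<n} \<rightarrow>\<^sub>E carrier A" and f: "f \<in> lhom A P (regular_module A)" for a f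
  proof -
    have "f (s a) = (\<Oplus>\<^bsub>regular_module A\<^esub>k\<in>{..<n}. f (a k \<odot>\<^bsub>P\<^esub> b k))"
      unfolding s_def by (rule lhom_finsum[OF P R f finite_lessThan scl[OF a]])
    also have "\<dots> = (\<Oplus>k\<in>{..<n}. a k \<otimes> f (b k))"
      unfolding finsum_regular_module
      using lhom_closed[OF f b] ac[OF a] lhom_smult[OF f ac[OF a] b] by (intro finsum_cong') auto
    finally show ?thesis .
  qed
  have lin1: "(\<Oplus>k\<in>{..<n}. a k \<otimes> G1 i k) = \<phi> i (s a) \<oplus> \<ominus> a i" if a: "a \<in> {..<n} \<rightarrow>\<^sub>E carrier A" and i: "i < n" for a i
  proof -
    have "(\<Oplus>k\<in>{..<n}. a k \<otimes> G1 i k) = (\<Oplus>k\<in>{..<n}. a k \<otimes> \<phi> i (b k) \<oplus> (if i = k then \<ominus> a k else \<zero>))"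
      using ac[OF a] \<phi>c[OF i b] by (intro finsum_cong') (auto simp: G1_def r_distr r_minus)
    also have "\<dots> = (\<Oplus>k\<in>{..<n}. a k \<otimes> \<phi> i (b k)) \<oplus> (\<Oplus>k\<in>{..<n}. if i = k then \<ominus> a k else \<zero>)"
      using ac[OF a] \<phi>c[OF i b] by (intro finsum_addf) auto
    also have "(\<Oplus>k\<in>{..<n}. if i = k then \<ominus> a k else \<zero>) = \<ominus> a i"
      using ac[OF a] i by (intro add.finprod_singleton) auto
    finally show ?thesis using lin[OF a \<phi>[OF i]] by simp
  qed
  have lin2: "(\<Oplus>k\<in>{..<n}. a k \<otimes> G2 l k) = \<phi>' l (d (s a))" if a: "a \<in> {..<n} \<rightarrow>\<^sub>E carrier A" and l: "l < n'" for a l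
  proof -
    have "compose (carrier P) (\<phi>' l) d (s a) = (\<Oplus>k\<in>{..<n}. a k \<otimes> compose (carrier P) (\<phi>' l) d (b k))"
      by (rule lin[OF a lhom_compose[OF d \<phi>'[OF l] P]])
    also have "\<dots> = (\<Oplus>k\<in>{..<n}. a k \<otimes> G2 l k)"
      using ac[OF a] b \<phi>c'[OF l dc[OF b]] by (intro finsum_cong') (auto simp: compose_def G2_def)
    finally show ?thesis using sc[OF a] by (simp add: compose_def)
  qed
  have \<phi>'_zero: "x = \<zero>\<^bsub>P'\<^esub> \<longleftrightarrow> (\<forall>l<n'. \<phi>' l x = \<zero>)" if x: "x \<in> carrier P'" for x
  proof
    assume "x = \<zero>\<^bsub>P'\<^esub>"
    then show "\<forall>l<n'. \<phi>' l x = \<zero>" using lhom_zero[OF P' R \<phi>'] by simp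
  next
    assume *: "\<forall>l<n'. \<phi>' l x = \<zero>"
    have "x = (\<Oplus>\<^bsub>P'\<^esub>i\<in>{..<n'}. \<phi>' i x \<odot>\<^bsub>P'\<^esub> b' i)" using \<phi>b'[OF x] x by (simp add: id_hom_def)
    also have "\<dots> = (\<Oplus>\<^bsub>P'\<^esub>i\<in>{..<n'}. \<zero>\<^bsub>P'\<^esub>)" using * b' by (intro P'.finsum_cong') auto
    finally show "x = \<zero>\<^bsub>P'\<^esub>" by simp
  qed
  have N_iff: "a \<in> K.N \<longleftrightarrow> a \<in> {..<n} \<rightarrow>\<^sub>E carrier A \<and> (\<forall>i<n. \<phi> i (s a) = a i) \<and> d (s a) = \<zero>\<^bsub>P'\<^esub>" for a
  proof (cases "a \<in> {..<n} \<rightarrow>\<^sub>E carrier A")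
    case True
    have "\<phi> i (s a) \<oplus> \<ominus> a i = \<zero> \<longleftrightarrow> \<phi> i (s a) = a i" if i: "i < n" for i
      using \<phi>c[OF i sc[OF True]] ac[OF True i] by (metis minus_equality minus_minus a_inv_closed r_neg)
    then have "(\<forall>G\<in>G1 ` {..<n}. (\<Oplus>k\<in>{..<n}. a k \<otimes> G k) = \<zero>) \<longleftrightarrow> (\<forall>i<n. \<phi> i (s a) = a i)"
      using lin1[OF True] by auto
    moreover have "(\<forall>G\<in>G2 ` {..<n'}. (\<Oplus>k\<in>{..<n}. a k \<otimes> G k) = \<zero>) \<longleftrightarrow> d (s a) = \<zero>\<^bsub>P'\<^esub>"
      using lin2[OF True] \<phi>'_zero[OF dc[OF sc[OF True]]] by auto
    moreover have "a \<in> K.N \<longleftrightarrow> (\<forall>G\<in>GG. (\<Oplus>k\<in>{..<n}. a k \<otimes> G k) = \<zero>)"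
      using True by (simp add: K.N_def)
    moreover have "\<dots> \<longleftrightarrow> (\<forall>G\<in>G1 ` {..<n}. (\<Oplus>k\<in>{..<n}. a k \<otimes> G k) = \<zero>) \<and>
        (\<forall>G\<in>G2 ` {..<n'}. (\<Oplus>k\<in>{..<n}. a k \<otimes> G k) = \<zero>)" unfolding GG_def by (rule ball_Un)
    ultimately show ?thesis using True by (simp only: simp_thms)
  qed (simp add: K.N_def)
  have Zl: "left_module A ?Z" by (rule left_module_kernel[OF P P' d])
  have s\<phi>: "s (\<lambda>i\<in>{..<n}. \<phi> i x) = x" if x: "x \<in> carrier P" for x
  proof -
    have "s (\<lambda>i\<in>{..<n}. \<phi> i x) = (\<Oplus>\<^bsub>P\<^esub>i\<in>{..<n}. \<phi> i x \<odot>\<^bsub>P\<^esub> b i)"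
      unfolding s_def using \<phi>c[OF _ x] b by (intro P.finsum_cong') auto
    then show ?thesis using \<phi>b[OF x] x by (simp add: id_hom_def)
  qed
  define e where "e = (\<lambda>x\<in>carrier ?Z. \<lambda>i\<in>{..<n}. \<phi> i x)"
  have e: "e \<in> lhom A ?Z ?N"
    unfolding e_def
  proof (rule lhom_restrictI[OF Zl])
    fix x assume "x \<in> carrier ?Z"
    then have x: "x \<in> carrier P" "d x = \<zero>\<^bsub>P'\<^esub>" by auto
    show "(\<lambda>i\<in>{..<n}. \<phi> i x) \<in> carrier ?N"
      using \<phi>c[OF _ x(1)] x(2) by (simp add: N_iff s\<phi>[OF x(1)])
    show "(\<lambda>i\<in>{..<n}. \<phi> i (x \<oplus>\<^bsub>?Z\<^esub> y)) = (\<lambda>i\<in>{..<n}. \<phi> i x) \<oplus>\<^bsub>?N\<^esub> (\<lambda>i\<in>{..<n}. \<phi> i y)"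
      if "y \<in> carrier ?Z" for y
      using that x(1) by (auto simp: lhom_add[OF \<phi>] intro!: restrict_ext)
    show "(\<lambda>i\<in>{..<n}. \<phi> i (a \<odot>\<^bsub>?Z\<^esub> x)) = a \<odot>\<^bsub>?N\<^esub> (\<lambda>i\<in>{..<n}. \<phi> i x)" if "a \<in> carrier A" for a
      using that x(1) by (auto simp: lhom_smult[OF \<phi>] intro!: restrict_ext)
  qed
  have "bij_betw e (carrier ?Z) (carrier ?N)"
  proof (rule bij_betw_byWitness[where f' = s])
    show "\<forall>x\<in>carrier ?Z. s (e x) = x" using s\<phi> by (auto simp: e_def)
    show "e ` carrier ?Z \<subseteq> carrier ?N" using lhom_closed[OF e] by blast
    show "s ` carrier ?N \<subseteq> carrier ?Z" using sc by (auto simp: N_iff)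
    show "\<forall>a\<in>carrier ?N. e (s a) = a"
    proof
      fix a assume "a \<in> carrier ?N"
      then have a: "a \<in> {..<n} \<rightarrow>\<^sub>E carrier A" "\<And>i. i < n \<Longrightarrow> \<phi> i (s a) = a i" "d (s a) = \<zero>\<^bsub>P'\<^esub>"
        by (auto simp: N_iff)
      have "e (s a) = (\<lambda>i\<in>{..<n}. \<phi> i (s a))" using sc[OF a(1)] a(3) by (simp add: e_def)
      also have "\<dots> = (\<lambda>i\<in>{..<n}. a i)" by (rule restrict_ext) (simp add: a(2))
      also have "\<dots> = a" using a(1) by (auto simp: PiE_def extensional_def fun_eq_iff)
      finally show "e (s a) = a" .
    qed
  qed
  then have "liso A ?Z ?N" unfolding liso_def using e by blast
  then have "liso A K.PM ?Z"
    by (rule liso_trans[OF K.left_module_PM K.kernel_decomposition liso_sym[OF Zl K.left_module_N]])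
  moreover have "fst g \<in> B" if "g \<in> K.\<Gamma>" for g using that by (auto simp: K.\<Gamma>_def)
  ultimately show ?thesis using that K.finite_\<Gamma> by blast
qed

section \<open>Perfect pairs from Gorenstein-projective modules\<close>

text \<open>The left annihilator of \<open>q\<close> in \<open>Ae\<close>, where \<open>e\<close> is the trivial path at \<open>t(q)\<close>.\<close>

definition ann :: "'v \<times> 'e list \<Rightarrow> 'a set" where
  "ann q = {a \<in> carrier A. \<forall>r. cf a r \<noteq> 0 \<longrightarrow> (\<exists>bs. r = (tgt q, bs) \<and> dead q bs)}"

abbreviation ann_mod :: "'v \<times> 'e list \<Rightarrow> ('a, 'a) module" where
  "ann_mod q \<equiv> (regular_module A)\<lparr>carrier := ann q\<rparr>"

abbreviation e_tgt :: "'v \<times> 'e list \<Rightarrow> 'v \<times> 'e list" where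
  "e_tgt q \<equiv> (tgt q, [])"

lemma ann_iff: "a \<in> ann q \<longleftrightarrow> a \<in> carrier (path_mod (e_tgt q)) \<and> a \<otimes> pv q = \<zero>"
proof (cases "a \<in> carrier A")
  case True
  show ?thesis unfolding path_mod_iff mult_pv_eq_0_iff[OF True] ann_def using True by auto
next
  case False
  then show ?thesis unfolding path_mod_iff ann_def by blast
qed

lemma ann_closed: "a \<in> ann q \<Longrightarrow> a \<in> carrier A"
  by (simp add: ann_def)

lemma ann_smult: "\<lbrakk>a \<in> carrier A; x \<in> ann q\<rbrakk> \<Longrightarrow> a \<otimes> x \<in> ann q"
  using left_module_smult_closed[OF left_module_path_mod, of a x "e_tgt q"] ann_closed[of x q]
  by (simp add: ann_iff m_assoc)

lemma left_module_ann: "left_module A (ann_mod q)"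
proof (rule left_module_submodule[OF left_module_regular[OF ring_axioms]])
  show "ann q \<subseteq> carrier (regular_module A)" using ann_closed[of _ q] by auto
  show "\<zero>\<^bsub>regular_module A\<^esub> \<in> ann q" by (simp add: ann_def)
  show "x \<oplus>\<^bsub>regular_module A\<^esub> y \<in> ann q" if "x \<in> ann q" "y \<in> ann q" for x y
    using that left_module_add_closed[OF left_module_path_mod, of x "e_tgt q" y] ann_closed[of x q] ann_closed[of y q]
    by (simp add: ann_iff l_distr)
qed (simp add: ann_smult)

lemma e_tgt_idem: "q \<in> B \<Longrightarrow> pv (e_tgt q) \<otimes> pv (e_tgt q) = pv (e_tgt q)"
  using pv_tgt_mult[OF B_tgt] by (simp add: tgt_def)

lemma mult_e_tgt: "q \<in> B \<Longrightarrow> a \<in> carrier (path_mod (e_tgt q)) \<Longrightarrow> a \<otimes> pv (e_tgt q) = a"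
  using e_tgt_idem[of q] by (auto simp: m_assoc)

text \<open>
  The vanishing of \<open>Ext\<^sup>1(Aq, A)\<close>: every homomorphism to \<open>A\<close> from the first syzygy of \<open>Aq\<close> extends to
  the projective cover and hence is the multiplication by an element from the right.
\<close>

definition ext_vanishing :: "'v \<times> 'e list \<Rightarrow> bool" where
  "ext_vanishing q \<longleftrightarrow> (\<forall>\<phi>\<in>lhom A (ann_mod q) (regular_module A). \<exists>b\<in>carrier A. \<forall>a\<in>ann q. \<phi> a = a \<otimes> b)"

text \<open>
  A dead path without a proper dead right factor. These paths generate the annihilator as a left
  ideal.
\<close>

definition min_dead :: "'v \<times> 'e list \<Rightarrow> 'e list \<Rightarrow> bool" where
  "min_dead q us \<longleftrightarrow> dead q us \<and> (\<forall>cs ds. us = cs @ ds \<and> dead q cs \<longrightarrow> ds = [])"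

lemma dead_imp_min_dead:
  assumes "dead q us"
  shows "\<exists>cs ds. us = cs @ ds \<and> min_dead q cs"
proof -
  obtain cs where cs: "\<exists>ds. us = cs @ ds" "dead q cs"
    "\<And>cs'. (\<exists>ds. us = cs' @ ds) \<and> dead q cs' \<Longrightarrow> length cs \<le> length cs'"
    using ex_has_least_nat[of "\<lambda>cs. (\<exists>ds. us = cs @ ds) \<and> dead q cs" us length] assms by auto
  have "ds = []" if "cs = cs' @ ds" "dead q cs'" for cs' ds
    using cs(1) cs(3)[of cs'] that by auto
  then show ?thesis using cs(1,2) unfolding min_dead_def by blast
qed

lemma dead_append: "\<lbrakk>dead q us; (tgt q, us @ bs) \<in> B\<rbrakk> \<Longrightarrow> dead q (us @ bs)"
  using B_append[of "fst q" "snd q @ us" bs] by (auto simp: dead_def)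

lemma dead_not_Nil: "q \<in> B \<Longrightarrow> dead q us \<Longrightarrow> us \<noteq> []"
  by (auto simp: dead_def)

text \<open>
  Under the vanishing of the extension group the syzygy of \<open>Aq\<close> is cyclic: cutting an element of the
  annihilator down to the paths that begin with a given minimal one is a homomorphism, and a right
  multiplication cannot treat two minimal paths with the same starting vertex differently.
\<close>

lemma ext_vanishing_min_dead_unique:
  assumes q: "q \<in> B" and E: "ext_vanishing q" and u: "min_dead q us" and v: "min_dead q vs"
  shows "us = vs"
proof (rule ccontr)
  assume ne: "us \<noteq> vs"
  (* The cut-off is A-linear: a path of the annihilator that is a right factor of a path beginning with us
     either already contains us or is a dead proper part of us, which is excluded by minimality. *)
  define \<rho> where "\<rho> x = mk (\<lambda>r. if \<exists>ds. r = (tgt q, us @ ds) then cf x r else 0)" for x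
  have \<rho>c: "\<rho> x \<in> carrier A" for x by (simp add: \<rho>_def)
  have cf\<rho>: "cf (\<rho> x) r = (if \<exists>ds. r = (tgt q, us @ ds) then cf x r else 0)" for x r
    using cf_notin[of r x] unfolding \<rho>_def cf_mk by auto
  have hom: "(\<lambda>x\<in>carrier (ann_mod q). \<rho> x) \<in> lhom A (ann_mod q) (regular_module A)"
  proof (rule lhom_restrictI[OF left_module_ann])
    fix x assume "x \<in> carrier (ann_mod q)"
    then have x: "x \<in> ann q" by simp
    note xA = ann_closed[OF x]
    show "\<rho> x \<in> carrier (regular_module A)" by (simp add: \<rho>c)
    show "\<rho> (x \<oplus>\<^bsub>ann_mod q\<^esub> y) = \<rho> x \<oplus>\<^bsub>regular_module A\<^esub> \<rho> y" if "y \<in> carrier (ann_mod q)" for y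
    proof -
      have yA: "y \<in> carrier A" using that ann_closed by simp
      show ?thesis by (rule cf_eqI) (auto simp: \<rho>c xA yA cf\<rho> cf_add)
    qed
    fix a assume a: "a \<in> carrier A"
    have "\<rho> (a \<otimes> x) = a \<otimes> \<rho> x"
    proof (rule cf_eqI)
      fix r assume r: "r \<in> B"
      obtain w as where was: "r = (w, as)" by (cases r)
      have *: "cf a z * cf (\<rho> x) (w, take k as) =
          (if \<exists>ds. r = (tgt q, us @ ds) then cf a z * cf x (w, take k as) else 0)" for k z
      proof (cases "cf x (w, take k as) = 0")
        case True
        then have "cf (\<rho> x) (w, take k as) = 0" unfolding cf\<rho> by (simp only: if_cancel)
        then show ?thesis using True by simp
      next
        case False
        then have d: "w = tgt q" "dead q (take k as)" using x by (auto simp: ann_def)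
        have "(\<exists>ds. (w, take k as) = (tgt q, us @ ds)) \<longleftrightarrow> (\<exists>ds. r = (tgt q, us @ ds))"
        proof
          assume "\<exists>ds. (w, take k as) = (tgt q, us @ ds)"
          then obtain ds where "take k as = us @ ds" by auto
          then have "as = us @ ds @ drop k as" by (metis append_assoc append_take_drop_id)
          then show "\<exists>ds. r = (tgt q, us @ ds)" using was d(1) by blast
        next
          assume "\<exists>ds. r = (tgt q, us @ ds)"
          then obtain ds where ds: "as = us @ ds" using was by auto
          show "\<exists>ds. (w, take k as) = (tgt q, us @ ds)"
          proof (cases "length us \<le> k")
            case True
            then show ?thesis using ds d(1) by auto
          next
            case False
            then have "us = take k as @ drop k us" using ds by simp
            then have "drop k us = []" using u d(2) unfolding min_dead_def by blast
            then show ?thesis using False by simp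
          qed
        qed
        then show ?thesis by (simp add: cf\<rho>)
      qed
      have "cf (a \<otimes> \<rho> x) (w, as) = (if \<exists>ds. r = (tgt q, us @ ds) then cf (a \<otimes> x) (w, as) else 0)"
        unfolding cf_mult[OF a \<rho>c r[unfolded was]] cf_mult[OF a xA r[unfolded was]] *
        by (cases "\<exists>ds. r = (tgt q, us @ ds)") (simp_all only: if_True if_False sum.neutral_const)
      then have "cf (a \<otimes> \<rho> x) r = (if \<exists>ds. r = (tgt q, us @ ds) then cf (a \<otimes> x) r else 0)"
        by (simp only: was)
      then show "cf (\<rho> (a \<otimes> x)) r = cf (a \<otimes> \<rho> x) r" by (simp add: cf\<rho>)
    qed (use a xA \<rho>c in simp_all)
    then show "\<rho> (a \<odot>\<^bsub>ann_mod q\<^esub> x) = a \<odot>\<^bsub>regular_module A\<^esub> \<rho> x" by simp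
  qed
  obtain b where b: "b \<in> carrier A" "\<And>a. a \<in> ann q \<Longrightarrow> \<rho> a = a \<otimes> b"
    using E hom unfolding ext_vanishing_def by fastforce
  \<comment> \<open>The coefficient of b at the trivial path would have to be 1 because of us and 0 because of vs.\<close>
  have mem: "pv (tgt q, ws) \<in> ann q" "(tgt q, ws) \<in> B" if "min_dead q ws" for ws
    using that by (auto simp: ann_def min_dead_def cf_pv dead_def)
  have "cf (pv (tgt q, us) \<otimes> b) (tgt q, us) = cf (\<rho> (pv (tgt q, us))) (tgt q, us)"
    using b(2)[OF mem(1)[OF u]] by simp
  also have "\<dots> = 1" using mem(2)[OF u] by (simp add: cf\<rho> cf_pv)
  finally have "cf b (tgt q, []) = 1" using cf_pv_mult_start[OF b(1) mem(2)[OF u]] by simp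
  moreover have "cf (\<rho> (pv (tgt q, vs))) (tgt q, vs) = 0"
  proof -
    have "\<not> (\<exists>ds. vs = us @ ds)" using u v ne unfolding min_dead_def by fastforce
    then show ?thesis by (simp add: cf\<rho>)
  qed
  then have "cf b (tgt q, []) = 0" using cf_pv_mult_start[OF b(1) mem(2)[OF v]] b(2)[OF mem(1)[OF v]] by simp
  ultimately show False by simp
qed

text \<open>
  Both conditions on a path are expressed by its end point and its dead paths.
\<close>

lemma ext_vanishing_similar: "similar p q \<Longrightarrow> ext_vanishing q \<Longrightarrow> ext_vanishing p"
proof -
  assume "similar p q" "ext_vanishing q"
  moreover from this have "ann p = ann q" by (simp add: ann_def similar_def)
  ultimately show ?thesis by (simp add: ext_vanishing_def)
qed

lemma ann_eq_path_mod:
  assumes q: "q \<in> B" and E: "ext_vanishing q" and u: "min_dead q us"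
  shows "ann q = carrier (path_mod (tgt q, us))"
proof -
  have "dead q bs \<longleftrightarrow> (\<exists>cs. bs = us @ cs) \<and> (tgt q, bs) \<in> B" for bs
  proof
    assume d: "dead q bs"
    then obtain cs ds where "bs = cs @ ds" "min_dead q cs" using dead_imp_min_dead by blast
    then show "(\<exists>cs. bs = us @ cs) \<and> (tgt q, bs) \<in> B"
      using ext_vanishing_min_dead_unique[OF q E u] d by (auto simp: dead_def)
  next
    assume "(\<exists>cs. bs = us @ cs) \<and> (tgt q, bs) \<in> B"
    then show "dead q bs" using u dead_append[of q us] by (auto simp: min_dead_def)
  qed
  then show ?thesis
    unfolding ann_def set_eq_iff path_mod_iff using cf_notin by auto (metis cf_notin)+
qed

lemma finsum_submodule:
  assumes M: "left_module A M" and S: "left_module A (M\<lparr>carrier := S\<rparr>)" and sub: "S \<subseteq> carrier M"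
    and fin: "finite I" and f: "f \<in> I \<rightarrow> S"
  shows "(\<Oplus>\<^bsub>M\<lparr>carrier := S\<rparr>\<^esub>i\<in>I. f i) = (\<Oplus>\<^bsub>M\<^esub>i\<in>I. f i)"
proof -
  interpret M: left_module A M by fact
  interpret S: left_module A "M\<lparr>carrier := S\<rparr>" by fact
  show ?thesis using fin f
  proof (induction I)
    case empty
    show ?case using M.finsum_empty S.finsum_empty by simp
  next
    case (insert i I)
    then have "f \<in> I \<rightarrow> carrier M" "f i \<in> carrier M" using sub by auto
    then show ?case using insert S.finsum_insert[of I i f] M.finsum_insert[of I i f] by simp
  qed
qed

lemma element_expansion:
  assumes x: "x \<in> carrier A" and S: "S \<subseteq> B" "\<And>r. cf x r \<noteq> 0 \<Longrightarrow> r \<in> S"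
  shows "x = (\<Oplus>r\<in>S. \<eta> (cf x r) \<otimes> pv r)"
proof -
  have fin: "finite S" using S(1) finite_B finite_subset by blast
  have eta: "\<eta> c \<otimes> pv p = mk (\<lambda>r. if r = p then c else 0)" if p: "p \<in> B" for c p
  proof (rule cf_eqI)
    fix r assume r: "r \<in> B"
    show "cf (\<eta> c \<otimes> pv p) r = cf (mk (\<lambda>r. if r = p then c else 0)) r"
    proof (cases "\<exists>bs. r = (fst p, snd p @ bs)")
      case True
      then obtain bs where bs: "r = (fst p, snd p @ bs)" by blast
      have "cf (\<eta> c \<otimes> pv p) r = (if bs = [] then c else 0)"
        using bs r B_tgt[OF p] by (simp add: cf_mult_pv scalar_in_carrier cf_scalar)
      moreover have "bs = [] \<longleftrightarrow> r = p" unfolding bs by (auto simp: prod_eq_iff)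
      ultimately show ?thesis using r by (simp add: cf_mk)
    next
      case False
      then have "r \<noteq> p" by (metis append_Nil2 prod.collapse)
      then show ?thesis using False by (simp add: cf_mult_pv_eq_0 scalar_in_carrier cf_mk)
    qed
  qed (simp_all add: scalar_in_carrier)
  show ?thesis
  proof (rule cf_eqI[OF x])
    show "(\<Oplus>r\<in>S. \<eta> (cf x r) \<otimes> pv r) \<in> carrier A" by (intro finsum_closed) (auto simp: scalar_in_carrier)
    fix r assume r: "r \<in> B"
    have "cf (\<Oplus>p\<in>S. \<eta> (cf x p) \<otimes> pv p) r = (\<Sum>p\<in>S. cf (\<eta> (cf x p) \<otimes> pv p) r)"
      by (intro cf_finsum[OF fin]) (auto simp: scalar_in_carrier)
    also have "\<dots> = (\<Sum>p\<in>S. if r = p then cf x p else 0)"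
      using r S(1) by (intro sum.cong) (auto simp: eta cf_mk)
    also have "\<dots> = cf x r" using fin S(2)[of r] by auto
    finally show "cf x r = cf (\<Oplus>r\<in>S. \<eta> (cf x r) \<otimes> pv r) r" by simp
  qed
qed

text \<open>
  The situation for one step of a totally acyclic complex: \<open>P\<close> is projective, \<open>\<delta>\<close> maps it onto a
  direct sum of modules \<open>Aq\<close>, and homomorphisms from the kernel to \<open>A\<close> extend to \<open>P\<close>.
\<close>

context
  fixes P :: "('a, 'm) module" and \<Gamma> :: "'i set" and q :: "'i \<Rightarrow> 'v \<times> 'e list" and \<delta> :: "'m \<Rightarrow> 'i \<Rightarrow> 'a"
  assumes P: "left_module A P" and idP: "id_hom P \<in> finite_rank_homs A P P"
    and fin: "finite \<Gamma>" and qB: "\<And>g. g \<in> \<Gamma> \<Longrightarrow> q g \<in> B"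
    and \<delta>: "\<delta> \<in> lhom A P (prod_mod \<Gamma> (\<lambda>g. path_mod (q g)))"
    and surj: "carrier (prod_mod \<Gamma> (\<lambda>g. path_mod (q g))) \<subseteq> \<delta> ` carrier P"
    and extend: "\<And>\<phi>. \<phi> \<in> lhom A (kernel_module P (prod_mod \<Gamma> (\<lambda>g. path_mod (q g))) \<delta>) (regular_module A) \<Longrightarrow>
      \<exists>\<psi>\<in>lhom A P (regular_module A).
        \<forall>x\<in>carrier (kernel_module P (prod_mod \<Gamma> (\<lambda>g. path_mod (q g))) \<delta>). \<psi> x = \<phi> x"
begin

lemma left_module_PMq: "left_module A (prod_mod \<Gamma> (\<lambda>g. path_mod (q g)))"
  by (rule left_module_prod_mod[OF ring_axioms left_module_path_mod])

text \<open>
  The coordinate maps \<open>P \<rightarrow> Aq\<close> lift along the projective cover \<open>Ae \<rightarrow> Aq\<close>, \<open>a \<mapsto> aq\<close>, since \<open>P\<close> is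
  projective.
\<close>

lemma lift_coordinate:
  assumes g: "g \<in> \<Gamma>"
  obtains h where "h \<in> lhom A P (path_mod (e_tgt (q g)))" "\<And>x. x \<in> carrier P \<Longrightarrow> h x \<otimes> pv (q g) = \<delta> x g"
proof -
  let ?e = "path_mod (e_tgt (q g))" and ?q = "path_mod (q g)"
  let ?pr = "proj_hom \<Gamma> (\<lambda>g. path_mod (q g)) g"
  have pr: "?pr \<in> lhom A (prod_mod \<Gamma> (\<lambda>g. path_mod (q g))) ?q"
    by (rule lhom_proj_hom[OF ring_axioms left_module_path_mod g])
  have f: "compose (carrier P) ?pr \<delta> \<in> lhom A P ?q" by (rule lhom_compose[OF \<delta> pr P])
  have "compose (carrier P) (compose (carrier P) ?pr \<delta>) (id_hom P) = compose (carrier P) ?pr \<delta>"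
    by (rule compose_id_right[OF f])
  then have fr: "compose (carrier P) ?pr \<delta> \<in> finite_rank_homs A P ?q"
    using finite_rank_comp_left[OF P P left_module_path_mod idP f] by (simp only:)
  have m: "(\<lambda>a\<in>carrier ?e. a \<otimes> pv (q g)) \<in> lhom A ?e ?q"
    by (rule lhom_restrictI[OF left_module_path_mod]) (auto simp: path_mod_closed l_distr m_assoc)
  have "carrier ?q \<subseteq> (\<lambda>a\<in>carrier ?e. a \<otimes> pv (q g)) ` carrier ?e"
  proof
    fix y assume "y \<in> carrier ?q"
    then obtain a where a: "a \<in> carrier A" "y = a \<otimes> pv (q g)" by auto
    have "a \<otimes> pv (e_tgt (q g)) \<in> carrier ?e" using a by auto
    moreover have "y = (a \<otimes> pv (e_tgt (q g))) \<otimes> pv (q g)"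
      using a pv_tgt_mult[OF qB[OF g]] by (simp add: m_assoc)
    ultimately show "y \<in> (\<lambda>a\<in>carrier ?e. a \<otimes> pv (q g)) ` carrier ?e"
      by (intro image_eqI[of _ _ "a \<otimes> pv (e_tgt (q g))"]) (simp_all del: left_ideal_gen_simps)
  qed
  then obtain h where h: "h \<in> finite_rank_homs A P ?e"
    "compose (carrier P) (\<lambda>a\<in>carrier ?e. a \<otimes> pv (q g)) h = compose (carrier P) ?pr \<delta>"
    using finite_rank_lift[OF P left_module_path_mod left_module_path_mod fr m] by blast
  have hl: "h \<in> lhom A P ?e" by (rule finite_rank_lhom[OF P left_module_path_mod h(1)])
  have "h x \<otimes> pv (q g) = \<delta> x g" if x: "x \<in> carrier P" for x
    using fun_cong[OF h(2), of x] x lhom_closed[OF hl x] lhom_closed[OF \<delta> x]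
    by (simp add: compose_def proj_hom_def del: left_ideal_gen_simps prod_mod_simps)
  then show ?thesis using that hl by blast
qed

text \<open>
  Conversely \<open>Ae\<close> maps to \<open>P\<close> over \<open>Aq\<close>: choose a preimage of \<open>q\<close> and multiply it by \<open>e\<close>.
\<close>

lemma lift_generator:
  assumes g: "g \<in> \<Gamma>"
  obtains x where "x \<in> carrier P" "pv (e_tgt (q g)) \<odot>\<^bsub>P\<^esub> x = x"
    "\<delta> x = inj_hom \<Gamma> (\<lambda>g. path_mod (q g)) g (pv (q g))"
proof -
  interpret P: left_module A P by (rule P)
  let ?i = "inj_hom \<Gamma> (\<lambda>g. path_mod (q g)) g"
  have inj: "?i \<in> lhom A (path_mod (q g)) (prod_mod \<Gamma> (\<lambda>g. path_mod (q g)))"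
    by (rule lhom_inj_hom[OF left_module_path_mod g])
  obtain x where x: "x \<in> carrier P" "?i (pv (q g)) = \<delta> x"
    using surj lhom_closed[OF inj pv_in_path_mod] by blast
  let ?x = "pv (e_tgt (q g)) \<odot>\<^bsub>P\<^esub> x"
  have "\<delta> ?x = pv (e_tgt (q g)) \<odot>\<^bsub>prod_mod \<Gamma> (\<lambda>g. path_mod (q g))\<^esub> ?i (pv (q g))"
    unfolding x(2) by (rule lhom_smult[OF \<delta> pv_closed x(1)])
  also have "\<dots> = ?i (pv (e_tgt (q g)) \<odot>\<^bsub>path_mod (q g)\<^esub> pv (q g))"
    by (rule lhom_smult[OF inj pv_closed pv_in_path_mod, symmetric])
  also have "\<dots> = ?i (pv (q g))" using pv_tgt_mult[OF qB[OF g]] by simp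
  finally have "\<delta> ?x = ?i (pv (q g))" .
  moreover have "pv (e_tgt (q g)) \<odot>\<^bsub>P\<^esub> ?x = ?x"
    using x(1) e_tgt_idem[OF qB[OF g]] by (simp flip: P.smult_assoc)
  moreover have "?x \<in> carrier P" using x by simp
  ultimately show ?thesis using that by blast
qed

lemma ann_smult_generator:
  assumes g: "g \<in> \<Gamma>" and x: "x \<in> carrier P" "\<delta> x = inj_hom \<Gamma> (\<lambda>g. path_mod (q g)) g (pv (q g))"
    and a: "a \<in> ann (q g)"
  shows "a \<odot>\<^bsub>P\<^esub> x \<in> carrier (kernel_module P (prod_mod \<Gamma> (\<lambda>g. path_mod (q g))) \<delta>)"
proof -
  interpret P: left_module A P by (rule P)
  have inj: "inj_hom \<Gamma> (\<lambda>g. path_mod (q g)) g \<in> lhom A (path_mod (q g)) (prod_mod \<Gamma> (\<lambda>g. path_mod (q g)))"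
    by (rule lhom_inj_hom[OF left_module_path_mod g])
  note aA = ann_closed[OF a]
  have "\<delta> (a \<odot>\<^bsub>P\<^esub> x) = inj_hom \<Gamma> (\<lambda>g. path_mod (q g)) g (a \<odot>\<^bsub>path_mod (q g)\<^esub> pv (q g))"
    unfolding lhom_smult[OF \<delta> aA x(1)] x(2) lhom_smult[OF inj aA pv_in_path_mod] ..
  also have "a \<odot>\<^bsub>path_mod (q g)\<^esub> pv (q g) = \<zero>\<^bsub>path_mod (q g)\<^esub>" using a by (simp add: ann_iff)
  also have "inj_hom \<Gamma> (\<lambda>g. path_mod (q g)) g \<zero>\<^bsub>path_mod (q g)\<^esub> = \<zero>\<^bsub>prod_mod \<Gamma> (\<lambda>g. path_mod (q g))\<^esub>"
    by (rule lhom_zero[OF left_module_path_mod left_module_PMq inj])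
  finally have "\<delta> (a \<odot>\<^bsub>P\<^esub> x) = \<zero>\<^bsub>prod_mod \<Gamma> (\<lambda>g. path_mod (q g))\<^esub>" .
  moreover have "a \<odot>\<^bsub>P\<^esub> x \<in> carrier P" using aA x(1) by simp
  ultimately show ?thesis unfolding kernel_module_simps by blast
qed

text \<open>
  The map \<open>h: P \<rightarrow> Ae\<close> restricts to a map from the kernel to the annihilator of \<open>q\<close>. A linear form on the
  annihilator is thus pulled back to the kernel, extended to \<open>P\<close>, and restricted along \<open>Ae \<rightarrow> P\<close>. The
  composition \<open>Ae \<rightarrow> P \<rightarrow> Ae\<close> is the identity only up to the annihilator, which is corrected for.
\<close>

lemma step_ext_vanishing:
  assumes g: "g \<in> \<Gamma>"
  shows "ext_vanishing (q g)"
  unfolding ext_vanishing_def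
proof
  interpret P: left_module A P by (rule P)
  let ?K = "kernel_module P (prod_mod \<Gamma> (\<lambda>g. path_mod (q g))) \<delta>"
  note R = left_module_regular[OF ring_axioms]
  have K: "left_module A ?K" by (rule left_module_kernel[OF P left_module_PMq \<delta>])
  obtain h where h: "h \<in> lhom A P (path_mod (e_tgt (q g)))" "\<And>x. x \<in> carrier P \<Longrightarrow> h x \<otimes> pv (q g) = \<delta> x g"
    using lift_coordinate[OF g] by blast
  obtain x where x: "x \<in> carrier P" "pv (e_tgt (q g)) \<odot>\<^bsub>P\<^esub> x = x"
    "\<delta> x = inj_hom \<Gamma> (\<lambda>g. path_mod (q g)) g (pv (q g))"
    using lift_generator[OF g] by blast
  fix \<phi> assume \<phi>: "\<phi> \<in> lhom A (ann_mod (q g)) (regular_module A)"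
  have hann: "h u \<in> ann (q g)" if "u \<in> carrier ?K" for u
    using that h(2)[of u] lhom_closed[OF h(1), of u] g by (simp add: ann_iff del: left_ideal_gen_simps(1))
  have "\<exists>\<psi>\<in>lhom A P (regular_module A). \<forall>u\<in>carrier ?K. \<psi> u = (\<lambda>u\<in>carrier ?K. \<phi> (h u)) u"
  proof (rule extend)
    show "(\<lambda>u\<in>carrier ?K. \<phi> (h u)) \<in> lhom A ?K (regular_module A)"
    proof (rule lhom_restrictI[OF K])
      fix u assume u: "u \<in> carrier ?K"
      then have uP: "u \<in> carrier P" by simp
      show "\<phi> (h u) \<in> carrier (regular_module A)" using lhom_closed[OF \<phi>, of "h u"] hann[OF u] by simp
      show "\<phi> (h (u \<oplus>\<^bsub>?K\<^esub> v)) = \<phi> (h u) \<oplus>\<^bsub>regular_module A\<^esub> \<phi> (h v)" if v: "v \<in> carrier ?K" for v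
        using lhom_add[OF h(1) uP, of v] lhom_add[OF \<phi>, of "h u" "h v"] hann[OF u] hann[OF v] v by simp
      show "\<phi> (h (a \<odot>\<^bsub>?K\<^esub> u)) = a \<odot>\<^bsub>regular_module A\<^esub> \<phi> (h u)" if a: "a \<in> carrier A" for a
        using lhom_smult[OF h(1) a uP] lhom_smult[OF \<phi> a, of "h u"] hann[OF u] by simp
    qed
  qed
  then obtain \<psi> where \<psi>: "\<psi> \<in> lhom A P (regular_module A)" "\<And>u. u \<in> carrier ?K \<Longrightarrow> \<psi> u = \<phi> (h u)"
    by auto
  let ?e = "pv (e_tgt (q g))"
  \<comment> \<open>Both h x and e are mapped to q, so their difference c annihilates q.\<close>
  define c where "c = h x \<ominus> ?e"
  have hx: "h x \<in> carrier (path_mod (e_tgt (q g)))" by (rule lhom_closed[OF h(1) x(1)])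
  note hxA = path_mod_closed[OF hx]
  have hxq: "h x \<otimes> pv (q g) = pv (q g)"
    using h(2)[OF x(1)] g by (simp add: x(3) inj_hom_def del: left_ideal_gen_simps(1))
  have c: "c \<in> ann (q g)"
    unfolding ann_iff
  proof
    interpret E: left_module A "path_mod (e_tgt (q g))" by (rule left_module_path_mod)
    have "c = h x \<oplus> (\<ominus> \<one>) \<otimes> ?e" using hxA by (simp add: c_def a_minus_def l_minus)
    then show "c \<in> carrier (path_mod (e_tgt (q g)))"
      using E.M.a_closed[OF hx E.smult_closed[of "\<ominus> \<one>" ?e]] pv_in_path_mod by (simp del: left_ideal_gen_simps(1))
    show "c \<otimes> pv (q g) = \<zero>"
      using hxA hxq pv_tgt_mult[OF qB[OF g]] by (simp add: c_def a_minus_def l_distr l_minus r_neg)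
  qed
  note cA = ann_closed[OF c]
  have hx_eq: "h x = c \<oplus> ?e" using hxA by (simp add: c_def a_minus_def a_assoc l_neg)
  have "\<phi> a = a \<otimes> (\<psi> x \<ominus> \<phi> c)" if a: "a \<in> ann (q g)" for a
  proof -
    note aA = ann_closed[OF a]
    have ax: "a \<odot>\<^bsub>P\<^esub> x \<in> carrier ?K" by (rule ann_smult_generator[OF g x(1,3) a])
    have \<phi>c: "\<phi> c \<in> carrier A" "\<phi> a \<in> carrier A" using lhom_closed[OF \<phi>] a c by auto
    have \<psi>x: "\<psi> x \<in> carrier A" using lhom_closed[OF \<psi>(1) x(1)] by simp
    have "a \<otimes> \<psi> x = \<psi> (a \<odot>\<^bsub>P\<^esub> x)" using lhom_smult[OF \<psi>(1) aA x(1)] by simp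
    also have "\<dots> = \<phi> (a \<otimes> h x)" using \<psi>(2)[OF ax] lhom_smult[OF h(1) aA x(1)] by simp
    also have "a \<otimes> h x = a \<otimes> c \<oplus> a"
      using aA cA a mult_e_tgt[OF qB[OF g], of a] unfolding ann_iff by (simp add: hx_eq r_distr del: left_ideal_gen_simps(1))
    also have "\<phi> (a \<otimes> c \<oplus> a) = \<phi> (a \<otimes> c) \<oplus> \<phi> a"
      using lhom_add[OF \<phi>, of "a \<otimes> c" a] ann_smult[OF aA c] a by simp
    also have "\<phi> (a \<otimes> c) = a \<otimes> \<phi> c" using lhom_smult[OF \<phi> aA, of c] c by simp
    finally have *: "a \<otimes> \<psi> x = a \<otimes> \<phi> c \<oplus> \<phi> a" .
    have "a \<otimes> (\<psi> x \<ominus> \<phi> c) = (a \<otimes> \<phi> c \<oplus> \<phi> a) \<ominus> a \<otimes> \<phi> c"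
      unfolding *[symmetric] using aA \<phi>c \<psi>x by (simp add: a_minus_def r_distr r_minus)
    also have "\<dots> = \<phi> a" using aA \<phi>c by (simp add: a_minus_def a_ac r_neg)
    finally show ?thesis by simp
  qed
  moreover have "\<psi> x \<ominus> \<phi> c \<in> carrier A"
    using lhom_closed[OF \<psi>(1) x(1)] lhom_closed[OF \<phi>, of c] c by simp
  ultimately show "\<exists>b\<in>carrier A. \<forall>a\<in>ann (q g). \<phi> a = a \<otimes> b" by blast
qed

text \<open>
  A nonprojective summand \<open>Ap\<close> of the kernel is isomorphic to a summand of the first syzygy of the
  image. Indeed, the identity of \<open>P\<close> minus a composition \<open>P \<rightarrow> \<Oplus> Ae \<rightarrow> P\<close> over the image has values in
  the kernel, and by \<open>finite_rank_cf_generator\<close> this difference does not contribute to the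
  coefficient of \<open>p\<close> at the generator.
\<close>

lemma step_summand:
  assumes fin0: "finite \<Gamma>0" and p0: "g0 \<in> \<Gamma>0" "q0 g0 \<in> B"
    and iso: "liso A (prod_mod \<Gamma>0 (\<lambda>g. path_mod (q0 g))) (kernel_module P (prod_mod \<Gamma> (\<lambda>g. path_mod (q g))) \<delta>)"
    and dead: "dead (q0 g0) bs"
  shows "\<exists>g\<in>\<Gamma>. \<exists>us. min_dead (q g) us \<and> similar (tgt (q g), us) (q0 g0)"
proof -
  interpret P: left_module A P by (rule P)
  define p where "p = q0 g0"
  have p: "p \<in> B" using p0 by (simp add: p_def)
  let ?PM = "prod_mod \<Gamma> (\<lambda>g. path_mod (q g))"
  let ?K = "kernel_module P ?PM \<delta>"
  let ?QM = "prod_mod \<Gamma>0 (\<lambda>g. path_mod (q0 g))"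
  have K: "left_module A ?K" by (rule left_module_kernel[OF P left_module_PMq \<delta>])
  interpret K: left_module A ?K by (rule K)
  have PM0: "left_module A ?QM" by (rule left_module_prod_mod[OF ring_axioms left_module_path_mod])
  obtain \<zeta> \<zeta>' where \<zeta>: "\<zeta> \<in> lhom A ?QM ?K" "\<zeta>' \<in> lhom A ?K ?QM" "\<And>y. y \<in> carrier ?QM \<Longrightarrow> \<zeta>' (\<zeta> y) = y"
    using iso unfolding liso_iff_inverse[OF PM0] by blast
  let ?i = "inj_hom \<Gamma>0 (\<lambda>g. path_mod (q0 g)) g0" and ?pr = "proj_hom \<Gamma>0 (\<lambda>g. path_mod (q0 g)) g0"
  have i: "?i \<in> lhom A (path_mod p) ?QM" unfolding p_def by (rule lhom_inj_hom[OF left_module_path_mod p0(1)])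
  have pr: "?pr \<in> lhom A ?QM (path_mod p)" unfolding p_def by (rule lhom_proj_hom[OF ring_axioms left_module_path_mod p0(1)])
  define \<xi> where "\<xi> = compose (carrier (path_mod p)) \<zeta> ?i"
  define \<pi> where "\<pi> = compose (carrier ?K) ?pr \<zeta>'"
  have \<xi>: "\<xi> \<in> lhom A (path_mod p) ?K" unfolding \<xi>_def by (rule lhom_compose[OF i \<zeta>(1) left_module_path_mod])
  have \<pi>: "\<pi> \<in> lhom A ?K (path_mod p)" unfolding \<pi>_def by (rule lhom_compose[OF \<zeta>(2) pr K])
  define x where "x = \<xi> (pv p)"
  have xK: "x \<in> carrier ?K" unfolding x_def by (rule lhom_closed[OF \<xi> pv_in_path_mod])
  then have x: "x \<in> carrier P" by simp
  have \<pi>x: "\<pi> x = pv p"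
  proof -
    note ip = lhom_closed[OF i pv_in_path_mod]
    have "\<pi> x = ?pr (\<zeta>' (\<zeta> (?i (pv p))))"
      using xK lhom_closed[OF \<zeta>(1) ip] pv_in_path_mod[of p]
      by (simp add: \<pi>_def x_def \<xi>_def compose_def del: left_ideal_gen_simps prod_mod_simps kernel_module_simps)
    also have "\<dots> = ?pr (?i (pv p))" by (simp only: \<zeta>(3)[OF ip])
    also have "\<dots> = ?i (pv p) g0" using ip unfolding proj_hom_def by (simp del: prod_mod_simps left_ideal_gen_simps)
    also have "\<dots> = pv p" using pv_in_path_mod[of p] p0(1) by (simp add: inj_hom_def p_def del: left_ideal_gen_simps)
    finally show ?thesis .
  qed
  have x_dead: "pv (tgt p, ws) \<odot>\<^bsub>P\<^esub> x = \<zero>\<^bsub>P\<^esub>" if "dead p ws" for ws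
  proof -
    have "pv (tgt p, ws) \<otimes> pv p = \<zero>"
      using that by (subst mult_pv_eq_0_iff) (auto simp: cf_pv split: if_splits)
    then show ?thesis
      using lhom_smult[OF \<xi> pv_closed pv_in_path_mod, of "(tgt p, ws)"]
        lhom_zero[OF left_module_path_mod K \<xi>] by (simp add: x_def)
  qed
  have "\<exists>h y. h \<in> lhom A P (path_mod (e_tgt (q g))) \<and> (\<forall>x\<in>carrier P. h x \<otimes> pv (q g) = \<delta> x g) \<and>
      y \<in> carrier P \<and> \<delta> y = inj_hom \<Gamma> (\<lambda>g. path_mod (q g)) g (pv (q g))" if "g \<in> \<Gamma>" for g
    using lift_coordinate[OF that] lift_generator[OF that] by metis
  then obtain h y where h: "\<And>g. g \<in> \<Gamma> \<Longrightarrow> h g \<in> lhom A P (path_mod (e_tgt (q g)))"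
    and hq: "\<And>g x. g \<in> \<Gamma> \<Longrightarrow> x \<in> carrier P \<Longrightarrow> h g x \<otimes> pv (q g) = \<delta> x g"
    and y: "\<And>g. g \<in> \<Gamma> \<Longrightarrow> y g \<in> carrier P"
    and \<delta>y: "\<And>g. g \<in> \<Gamma> \<Longrightarrow> \<delta> (y g) = inj_hom \<Gamma> (\<lambda>g. path_mod (q g)) g (pv (q g))"
    by metis
  have hc: "h g u \<in> carrier A" if "g \<in> \<Gamma>" "u \<in> carrier P" for g u
    by (rule path_mod_closed[OF lhom_closed[OF h[OF that(1)] that(2)]])
  have hyc: "(\<lambda>g. h g u \<odot>\<^bsub>P\<^esub> y g) \<in> \<Gamma> \<rightarrow> carrier P" if "u \<in> carrier P" for u using hc[OF _ that] y by auto
  (* A map from P to the direct sum of the modules Ae, composed with a map back to P; both lie over the direct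
     sum of the modules Aq, so the composition does not change the value of the map onto it. *)
  define \<Sigma> where "\<Sigma> u = (\<Oplus>\<^bsub>P\<^esub>g\<in>\<Gamma>. h g u \<odot>\<^bsub>P\<^esub> y g)" for u
  have \<Sigma>c: "\<Sigma> u \<in> carrier P" if "u \<in> carrier P" for u unfolding \<Sigma>_def by (rule P.finsum_closed[OF hyc[OF that]])
  have \<delta>\<Sigma>: "\<delta> (\<Sigma> u) = \<delta> u" if u: "u \<in> carrier P" for u
  proof -
    have inj: "inj_hom \<Gamma> (\<lambda>g. path_mod (q g)) g \<in> lhom A (path_mod (q g)) ?PM" if "g \<in> \<Gamma>" for g
      by (rule lhom_inj_hom[OF left_module_path_mod that])
    interpret PM: left_module A ?PM by (rule left_module_PMq)
    have "\<delta> (\<Sigma> u) = (\<Oplus>\<^bsub>?PM\<^esub>g\<in>\<Gamma>. \<delta> (h g u \<odot>\<^bsub>P\<^esub> y g))"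
      unfolding \<Sigma>_def by (rule lhom_finsum[OF P left_module_PMq \<delta> fin hyc[OF u]])
    also have "\<dots> = (\<Oplus>\<^bsub>?PM\<^esub>g\<in>\<Gamma>. inj_hom \<Gamma> (\<lambda>g. path_mod (q g)) g (\<delta> u g))"
    proof (rule PM.finsum_cong'[OF refl])
      have \<delta>m: "\<delta> u g \<in> carrier (path_mod (q g))" if "g \<in> \<Gamma>" for g
        using lhom_closed[OF \<delta> u] that unfolding prod_mod_simps by (rule PiE_mem)
      show "(\<lambda>g. inj_hom \<Gamma> (\<lambda>g. path_mod (q g)) g (\<delta> u g)) \<in> \<Gamma> \<rightarrow> carrier ?PM"
        by (intro Pi_I lhom_closed[OF inj] \<delta>m)
      fix g assume g: "g \<in> \<Gamma>"
      have "\<delta> (h g u \<odot>\<^bsub>P\<^esub> y g) = inj_hom \<Gamma> (\<lambda>g. path_mod (q g)) g (h g u \<odot>\<^bsub>path_mod (q g)\<^esub> pv (q g))"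
        unfolding lhom_smult[OF \<delta> hc[OF g u] y[OF g]] \<delta>y[OF g] lhom_smult[OF inj[OF g] hc[OF g u] pv_in_path_mod] ..
      then show "\<delta> (h g u \<odot>\<^bsub>P\<^esub> y g) = inj_hom \<Gamma> (\<lambda>g. path_mod (q g)) g (\<delta> u g)"
        using hq[OF g u] by simp
    qed
    also have "\<dots> = \<delta> u"
      by (rule prod_mod_decomp[OF ring_axioms left_module_path_mod fin lhom_closed[OF \<delta> u], symmetric])
    finally show ?thesis .
  qed
  have diff: "u \<ominus>\<^bsub>P\<^esub> \<Sigma> u \<in> carrier ?K" if u: "u \<in> carrier P" for u
  proof -
    interpret PM: left_module A ?PM by (rule left_module_PMq)
    have "\<delta> (u \<ominus>\<^bsub>P\<^esub> \<Sigma> u) = \<delta> u \<ominus>\<^bsub>?PM\<^esub> \<delta> u"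
      using lhom_diff[OF P left_module_PMq \<delta> u \<Sigma>c[OF u]] \<delta>\<Sigma>[OF u] by (simp only:)
    also have "\<dots> = \<zero>\<^bsub>?PM\<^esub>" using lhom_closed[OF \<delta> u] by (simp only: a_minus_def PM.M.r_neg)
    finally have "\<delta> (u \<ominus>\<^bsub>P\<^esub> \<Sigma> u) = \<zero>\<^bsub>?PM\<^esub>" .
    moreover have "u \<ominus>\<^bsub>P\<^esub> \<Sigma> u \<in> carrier P" using u \<Sigma>c[OF u] by simp
    ultimately show ?thesis unfolding kernel_module_simps by blast
  qed
  define \<Delta> where "\<Delta> = (\<lambda>u\<in>carrier P. u \<ominus>\<^bsub>P\<^esub> \<Sigma> u)"
  have "\<Delta> \<in> lhom A P ?K"
    unfolding \<Delta>_def
  proof (rule lhom_restrictI[OF P diff])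
    fix u v assume u: "u \<in> carrier P" and v: "v \<in> carrier P"
    have "\<Sigma> (u \<oplus>\<^bsub>P\<^esub> v) = (\<Oplus>\<^bsub>P\<^esub>g\<in>\<Gamma>. h g u \<odot>\<^bsub>P\<^esub> y g \<oplus>\<^bsub>P\<^esub> h g v \<odot>\<^bsub>P\<^esub> y g)"
      unfolding \<Sigma>_def using hc u v y lhom_add[OF h u v] by (intro P.finsum_cong') (auto simp: P.smult_l_distr)
    also have "\<dots> = \<Sigma> u \<oplus>\<^bsub>P\<^esub> \<Sigma> v" unfolding \<Sigma>_def by (rule P.finsum_addf[OF hyc[OF u] hyc[OF v]])
    finally show "(u \<oplus>\<^bsub>P\<^esub> v) \<ominus>\<^bsub>P\<^esub> \<Sigma> (u \<oplus>\<^bsub>P\<^esub> v) = (u \<ominus>\<^bsub>P\<^esub> \<Sigma> u) \<oplus>\<^bsub>?K\<^esub> (v \<ominus>\<^bsub>P\<^esub> \<Sigma> v)"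
      using u v \<Sigma>c[OF u] \<Sigma>c[OF v] by (simp add: a_minus_def P.minus_add P.M.a_ac)
  next
    fix a u assume a: "a \<in> carrier A" and u: "u \<in> carrier P"
    have "\<Sigma> (a \<odot>\<^bsub>P\<^esub> u) = (\<Oplus>\<^bsub>P\<^esub>g\<in>\<Gamma>. a \<odot>\<^bsub>P\<^esub> (h g u \<odot>\<^bsub>P\<^esub> y g))"
      unfolding \<Sigma>_def using hc u a y lhom_smult[OF h a u] by (intro P.finsum_cong') (auto simp: P.smult_assoc)
    also have "\<dots> = a \<odot>\<^bsub>P\<^esub> \<Sigma> u" unfolding \<Sigma>_def by (rule P.smult_finsum[OF fin a hyc[OF u], symmetric])
    finally show "(a \<odot>\<^bsub>P\<^esub> u) \<ominus>\<^bsub>P\<^esub> \<Sigma> (a \<odot>\<^bsub>P\<^esub> u) = a \<odot>\<^bsub>?K\<^esub> (u \<ominus>\<^bsub>P\<^esub> \<Sigma> u)"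
      using a u \<Sigma>c[OF u] by (simp add: a_minus_def P.smult_r_distr P.smult_r_minus)
  qed
  then have \<pi>\<Delta>: "compose (carrier P) \<pi> \<Delta> \<in> lhom A P (path_mod p)" by (rule lhom_compose[OF _ \<pi> P])
  have "compose (carrier P) \<pi> \<Delta> \<in> finite_rank_homs A P (path_mod p)"
    using finite_rank_comp_left[OF P P left_module_path_mod idP \<pi>\<Delta>] unfolding compose_id_right[OF \<pi>\<Delta>] .
  then have "cf (compose (carrier P) \<pi> \<Delta> x) p = 0"
    using dead by (intro finite_rank_cf_generator[OF P p _ x, of _ bs]) (auto simp: p_def[symmetric] x_dead dead_def)
  then have \<pi>\<Delta>x: "cf (\<pi> (x \<ominus>\<^bsub>P\<^esub> \<Sigma> x)) p = 0" using x by (simp add: compose_def \<Delta>_def)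
  have hann: "h g x \<in> ann (q g)" if g: "g \<in> \<Gamma>" for g
    unfolding ann_iff using lhom_closed[OF h[OF g] x] hq[OF g x] xK g by simp
  have hyK: "h g x \<odot>\<^bsub>P\<^esub> y g \<in> carrier ?K" if g: "g \<in> \<Gamma>" for g
    by (rule ann_smult_generator[OF g y[OF g] \<delta>y[OF g] hann[OF g]])
  have \<Sigma>xK: "(\<Oplus>\<^bsub>?K\<^esub>g\<in>\<Gamma>. h g x \<odot>\<^bsub>P\<^esub> y g) = \<Sigma> x"
    unfolding \<Sigma>_def kernel_module_def
    by (rule finsum_submodule[OF P K[unfolded kernel_module_def] _ fin]) (use hyK in auto)
  have \<Sigma>x_mem: "\<Sigma> x \<in> carrier ?K" unfolding \<Sigma>xK[symmetric] using hyK by (intro K.finsum_closed) blast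
  have \<pi>c: "\<pi> u \<in> carrier A" if "u \<in> carrier ?K" for u by (rule path_mod_closed[OF lhom_closed[OF \<pi> that]])
  have "\<exists>g\<in>\<Gamma>. cf (\<pi> (h g x \<odot>\<^bsub>P\<^esub> y g)) p \<noteq> 0"
  proof (rule ccontr)
    assume no: "\<not> ?thesis"
    have "\<pi> (\<Sigma> x) = (\<Oplus>\<^bsub>path_mod p\<^esub>g\<in>\<Gamma>. \<pi> (h g x \<odot>\<^bsub>P\<^esub> y g))"
      unfolding \<Sigma>xK[symmetric] by (rule lhom_finsum[OF K left_module_path_mod \<pi> fin]) (use hyK in blast)
    also have "\<dots> = (\<Oplus>g\<in>\<Gamma>. \<pi> (h g x \<odot>\<^bsub>P\<^esub> y g))"
      unfolding left_ideal_gen_def finsum_regular_module[symmetric]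
      by (rule finsum_submodule[OF left_module_regular[OF ring_axioms] left_module_path_mod[unfolded left_ideal_gen_def] _ fin])
        (use lhom_closed[OF \<pi> hyK] in auto)
    finally have "cf (\<pi> (\<Sigma> x)) p = (\<Sum>g\<in>\<Gamma>. cf (\<pi> (h g x \<odot>\<^bsub>P\<^esub> y g)) p)"
      using \<pi>c[OF hyK] by (simp add: cf_finsum[OF fin])
    then have 0: "cf (\<pi> (\<Sigma> x)) p = 0" using no by simp
    have "x \<ominus>\<^bsub>P\<^esub> \<Sigma> x = x \<oplus>\<^bsub>?K\<^esub> (\<ominus> \<one>) \<odot>\<^bsub>?K\<^esub> \<Sigma> x"
      using x \<Sigma>c[OF x] by (simp add: a_minus_def P.smult_l_minus)
    then have "\<pi> (x \<ominus>\<^bsub>P\<^esub> \<Sigma> x) = \<pi> x \<oplus> (\<ominus> \<one>) \<otimes> \<pi> (\<Sigma> x)"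
      using lhom_add[OF \<pi> xK K.smult_closed[OF a_inv_closed[OF one_closed] \<Sigma>x_mem]]
        lhom_smult[OF \<pi> a_inv_closed[OF one_closed] \<Sigma>x_mem] by simp
    then have "cf (\<pi> (x \<ominus>\<^bsub>P\<^esub> \<Sigma> x)) p = cf (\<pi> x) p - cf (\<pi> (\<Sigma> x)) p"
      using \<pi>c[OF xK] \<pi>c[OF \<Sigma>x_mem] by (simp add: l_minus cf_add cf_uminus)
    then show False using \<pi>\<Delta>x 0 \<pi>x p by (simp add: cf_pv)
  qed
  then obtain g where g: "g \<in> \<Gamma>" and c: "cf (\<pi> (h g x \<odot>\<^bsub>P\<^esub> y g)) p \<noteq> 0" by blast
  \<comment> \<open>The map from the syzygy of A(q g) to Ap: embed the annihilator into the kernel and project.\<close>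
  define \<theta> where "\<theta> = (\<lambda>a\<in>carrier (ann_mod (q g)). \<pi> (a \<odot>\<^bsub>P\<^esub> y g))"
  note yg = y[OF g]
  have ayK: "a \<odot>\<^bsub>P\<^esub> y g \<in> carrier ?K" if "a \<in> ann (q g)" for a
    by (rule ann_smult_generator[OF g yg \<delta>y[OF g] that])
  have \<theta>: "\<theta> \<in> lhom A (ann_mod (q g)) (path_mod p)"
    unfolding \<theta>_def
  proof (rule lhom_restrictI[OF left_module_ann])
    fix a assume "a \<in> carrier (ann_mod (q g))"
    then have a: "a \<in> ann (q g)" by simp
    show "\<pi> (a \<odot>\<^bsub>P\<^esub> y g) \<in> carrier (path_mod p)" by (rule lhom_closed[OF \<pi> ayK[OF a]])
    show "\<pi> ((a \<oplus>\<^bsub>ann_mod (q g)\<^esub> b) \<odot>\<^bsub>P\<^esub> y g) = \<pi> (a \<odot>\<^bsub>P\<^esub> y g) \<oplus>\<^bsub>path_mod p\<^esub> \<pi> (b \<odot>\<^bsub>P\<^esub> y g)"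
      if "b \<in> carrier (ann_mod (q g))" for b
      using that a lhom_add[OF \<pi> ayK[OF a] ayK[of b]] yg
      by (simp add: P.smult_l_distr ann_closed)
    show "\<pi> ((b \<odot>\<^bsub>ann_mod (q g)\<^esub> a) \<odot>\<^bsub>P\<^esub> y g) = b \<odot>\<^bsub>path_mod p\<^esub> \<pi> (a \<odot>\<^bsub>P\<^esub> y g)" if b: "b \<in> carrier A" for b
      using lhom_smult[OF \<pi> b ayK[OF a]] a b yg by (simp add: P.smult_assoc ann_closed)
  qed
  define a where "a = h g x"
  have a: "a \<in> ann (q g)" unfolding a_def by (rule hann[OF g])
  note aA = ann_closed[OF a]
  have \<theta>a: "cf (\<theta> a) p \<noteq> 0" using c a by (simp add: \<theta>_def a_def)
  (* Some path r that occurs in a is sent by the map to an element that involves p. This r is the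
     path that is looked for. *)
  define S where "S = {r \<in> B. cf a r \<noteq> 0}"
  have finS: "finite S" using finite_B by (simp add: S_def)
  have pvS: "pv r \<in> ann (q g)" if "r \<in> S" for r
    using a that unfolding ann_def S_def by (auto simp: cf_pv)
  have a_exp: "a = (\<Oplus>r\<in>S. \<eta> (cf a r) \<otimes> pv r)"
    by (rule element_expansion[OF aA]) (auto simp: S_def, metis cf_notin)
  have cl: "(\<lambda>r. \<eta> (cf a r) \<otimes> pv r) \<in> S \<rightarrow> ann (q g)" using pvS ann_smult scalar_in_carrier by blast
  have "\<exists>r\<in>S. cf (\<theta> (pv r)) p \<noteq> 0"
  proof (rule ccontr)
    assume no: "\<not> ?thesis"
    have "a = (\<Oplus>\<^bsub>ann_mod (q g)\<^esub>r\<in>S. \<eta> (cf a r) \<otimes> pv r)"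
      by (subst finsum_submodule[OF left_module_regular[OF ring_axioms] left_module_ann _ finS cl])
        (use a_exp ann_closed[of _ "q g"] in \<open>auto simp: finsum_regular_module\<close>)
    then have "\<theta> a = \<theta> (\<Oplus>\<^bsub>ann_mod (q g)\<^esub>r\<in>S. \<eta> (cf a r) \<otimes> pv r)" by (rule arg_cong)
    also have "\<dots> = (\<Oplus>\<^bsub>path_mod p\<^esub>r\<in>S. \<theta> (\<eta> (cf a r) \<otimes> pv r))"
      by (rule lhom_finsum[OF left_module_ann left_module_path_mod \<theta> finS]) (use cl in simp)
    also have "\<dots> = (\<Oplus>r\<in>S. \<theta> (\<eta> (cf a r) \<otimes> pv r))"
      unfolding left_ideal_gen_def finsum_regular_module[symmetric]
      by (rule finsum_submodule[OF left_module_regular[OF ring_axioms] left_module_path_mod[unfolded left_ideal_gen_def] _ finS])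
        (use lhom_closed[OF \<theta>] cl in \<open>auto simp: Pi_iff\<close>)
    finally have \<theta>_sum: "\<theta> a = (\<Oplus>r\<in>S. \<theta> (\<eta> (cf a r) \<otimes> pv r))" .
    have "\<theta> (\<eta> (cf a r) \<otimes> pv r) \<in> carrier A" if "r \<in> S" for r
      using path_mod_closed[OF lhom_closed[OF \<theta>, of "\<eta> (cf a r) \<otimes> pv r"]] cl that by auto
    then have "cf (\<theta> a) p = (\<Sum>r\<in>S. cf (\<theta> (\<eta> (cf a r) \<otimes> pv r)) p)"
      unfolding \<theta>_sum by (intro cf_finsum[OF finS]) blast
    also have "\<dots> = (\<Sum>r\<in>S. 0)"
    proof (rule sum.cong[OF refl])
      fix r assume r: "r \<in> S"
      have m: "\<theta> (pv r) \<in> carrier (path_mod p)" using lhom_closed[OF \<theta>, of "pv r"] pvS[OF r] by simp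
      have "\<theta> (\<eta> (cf a r) \<otimes> pv r) = \<eta> (cf a r) \<otimes> \<theta> (pv r)"
        using lhom_smult[OF \<theta> scalar_in_carrier, of "pv r"] pvS[OF r] by simp
      then show "cf (\<theta> (\<eta> (cf a r) \<otimes> pv r)) p = 0"
        using cf_mult_at_generator[OF scalar_in_carrier m p] no r by simp
    qed
    finally show False using \<theta>a by simp
  qed
  then obtain r where r: "r \<in> S" and \<theta>r: "cf (\<theta> (pv r)) p \<noteq> 0" by blast
  obtain us where us: "r = (tgt (q g), us)" "dead (q g) us" using a r unfolding ann_def S_def by blast
  have rB: "r \<in> B" and ar: "cf a r \<noteq> 0" using r by (auto simp: S_def)
  have \<theta>_mult: "\<theta> (b \<otimes> z) = b \<otimes> \<theta> z" if "b \<in> carrier A" "z \<in> ann (q g)" for b z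
    using lhom_smult[OF \<theta> that(1), of z] that(2) by simp
  have \<theta>_mem: "\<theta> z \<in> carrier (path_mod p)" if "z \<in> ann (q g)" for z using lhom_closed[OF \<theta>, of z] that by simp
  (* If r = wu with u dead for q g, then the image of r is w times an element of Ap, which involves p
     only if w is trivial. *)
  have min: "min_dead (q g) us"
    unfolding min_dead_def
  proof (intro conjI allI impI us(2))
    fix cs ds assume csds: "us = cs @ ds \<and> dead (q g) cs"
    let ?w = "(T (tgt (q g)) cs, ds)" and ?u = "(tgt (q g), cs)"
    have uA: "pv ?u \<in> ann (q g)" using csds by (auto simp: ann_def cf_pv dead_def)
    have uB: "(tgt (q g), cs @ ds) \<in> B" using rB us csds by simp
    have "pv ?w \<otimes> pv ?u = pv r"
    proof (rule cf_eqI)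
      fix r' assume r': "r' \<in> B"
      show "cf (pv ?w \<otimes> pv ?u) r' = cf (pv r) r'"
      proof (cases "\<exists>bs. r' = (fst ?u, snd ?u @ bs)")
        case True
        then obtain bs where bs: "r' = (fst ?u, snd ?u @ bs)" by blast
        have "cf (pv ?w \<otimes> pv ?u) r' = cf (pv ?w) (tgt ?u, bs)"
          unfolding bs by (rule cf_mult_pv[OF pv_closed]) (use r' bs in simp)
        also have "\<dots> = cf (pv r) r'"
          using rB B_append[OF uB] bs us csds by (auto simp: cf_pv tgt_def)
        finally show ?thesis .
      next
        case False
        then have "r' \<noteq> r" using us csds by auto
        then show ?thesis using False by (simp add: cf_mult_pv_eq_0 cf_pv)
      qed
    qed simp_all
    then have "\<theta> (pv r) = pv ?w \<otimes> \<theta> (pv ?u)" using \<theta>_mult[OF pv_closed uA, of ?w] by simp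
    then have "cf (pv ?w) (tgt p, []) \<noteq> 0"
      using \<theta>r cf_mult_at_generator[OF pv_closed \<theta>_mem[OF uA] p, of ?w] by auto
    then show "ds = []" by (auto simp: cf_pv split: if_splits)
  qed
  have rA: "pv r \<in> ann (q g)" by (rule pvS[OF r])
  have tr: "tgt r = tgt p"
  proof -
    have "\<theta> (pv r) = pv (e_tgt r) \<otimes> \<theta> (pv r)" using \<theta>_mult[OF pv_closed rA, of "e_tgt r"] pv_tgt_mult[OF rB] by simp
    then have "cf (pv (e_tgt r)) (tgt p, []) \<noteq> 0"
      using \<theta>r cf_mult_at_generator[OF pv_closed \<theta>_mem[OF rA] p, of "e_tgt r"] by auto
    then show ?thesis by (auto simp: cf_pv split: if_splits)
  qed
  (* A path that kills r kills its image, which involves p. A path that kills p kills the image a of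
     x, which involves r. *)
  have "dead r ws \<longleftrightarrow> dead p ws" for ws
  proof
    assume d: "dead r ws"
    have "pv (tgt r, ws) \<otimes> pv r = \<zero>" using d by (subst mult_pv_eq_0_iff) (auto simp: cf_pv split: if_splits)
    then have 0: "pv (tgt p, ws) \<otimes> \<theta> (pv r) = \<zero>"
      using \<theta>_mult[OF pv_closed rA, of "(tgt r, ws)"] lhom_zero[OF left_module_ann left_module_path_mod \<theta>] tr by simp
    have "(fst p, snd p @ ws) \<notin> B"
    proof
      assume B: "(fst p, snd p @ ws) \<in> B"
      have "cf (pv (tgt p, ws) \<otimes> \<theta> (pv r)) (fst p, snd p @ snd (tgt p, ws)) = cf (\<theta> (pv r)) (fst p, snd p)"
        by (rule cf_pv_mult[OF path_mod_closed[OF \<theta>_mem[OF rA]]]) (use B in \<open>simp_all add: tgt_def\<close>)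
      then show False using 0 \<theta>r by simp
    qed
    then show "dead p ws" using d tr by (simp add: dead_def)
  next
    assume d: "dead p ws"
    have "pv (tgt p, ws) \<otimes> a = \<zero>"
      using lhom_smult[OF h[OF g] pv_closed x, of "(tgt p, ws)"] x_dead[OF d]
        lhom_zero[OF P left_module_path_mod h[OF g]] by (simp add: a_def)
    moreover have "(fst r, snd r @ ws) \<notin> B" if 0: "pv (tgt p, ws) \<otimes> a = \<zero>"
    proof
      assume B: "(fst r, snd r @ ws) \<in> B"
      have "cf (pv (tgt p, ws) \<otimes> a) (fst r, snd r @ snd (tgt p, ws)) = cf a (fst r, snd r)"
        by (rule cf_pv_mult[OF aA]) (use B tr in \<open>simp_all add: tgt_def\<close>)
      then show False using 0 ar by simp
    qed
    ultimately show "dead r ws" using d tr by (simp add: dead_def)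
  qed
  then have "similar r p" using rB p tr by (simp add: similar_def)
  then show ?thesis using g min us(1) by (auto simp: p_def)
qed

end

end

context monomial_algebra
begin

text \<open>
  Perfect pairs and perfect paths in terms of the set \<open>B\<close> alone; see \<open>perfect_pair_iff\<close> for the comparison.
\<close>

definition ppair :: "'v \<times> 'e list \<Rightarrow> 'v \<times> 'e list \<Rightarrow> bool" where
  "ppair p q \<longleftrightarrow> p \<in> B \<and> q \<in> B \<and> snd p \<noteq> [] \<and> snd q \<noteq> [] \<and> fst p = tgt q \<and> (fst q, snd q @ snd p) \<notin> B \<and>
    (\<forall>q'\<in>B. tgt q' = fst p \<and> (fst q', snd q' @ snd p) \<notin> B \<longrightarrow>
      (\<exists>as. q' = (fst q', as @ snd q) \<and> T (fst q') as = fst q)) \<and>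
    (\<forall>p'\<in>B. fst p' = tgt q \<and> (fst q, snd q @ snd p') \<notin> B \<longrightarrow> (\<exists>bs. snd p' = snd p @ bs))"

definition perfect :: "'v \<times> 'e list \<Rightarrow> bool" where
  "perfect p \<longleftrightarrow> (\<exists>(n :: nat) ps. n \<ge> 1 \<and> ps 1 = p \<and> ps (n + 1) = p \<and> (\<forall>i\<in>{1..n}. ppair (ps i) (ps (i + 1))))"

lemma ppair_left_unique: "ppair p q \<Longrightarrow> ppair p' q \<Longrightarrow> p = p'"
proof -
  assume pq: "ppair p q" and pq': "ppair p' q"
  have "\<exists>bs. snd p = snd p' @ bs" using pq pq' unfolding ppair_def by metis
  moreover have "\<exists>bs. snd p' = snd p @ bs" using pq pq' unfolding ppair_def by metis
  ultimately have "snd p = snd p'" by auto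
  moreover have "fst p = fst p'" using pq pq' unfolding ppair_def by simp
  ultimately show ?thesis by (simp add: prod_eq_iff)
qed

lemma ppair_right_unique: "ppair p q \<Longrightarrow> ppair p q' \<Longrightarrow> q = q'"
proof -
  assume pq: "ppair p q" and pq': "ppair p q'"
  have "\<exists>as. q = (fst q, as @ snd q') \<and> T (fst q) as = fst q'" using pq pq' unfolding ppair_def by metis
  then obtain as where as: "snd q = as @ snd q'" "T (fst q) as = fst q'" by (metis snd_conv)
  have "\<exists>as. q' = (fst q', as @ snd q) \<and> T (fst q') as = fst q" using pq pq' unfolding ppair_def by metis
  then obtain bs where bs: "snd q' = bs @ snd q" by (metis snd_conv)
  have "as = []" using as(1) bs by simp
  then show ?thesis using as by (simp add: prod_eq_iff)
qed

text \<open>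
  The minimality of \<open>p\<close> in terms of modules: \<open>Ap\<close> is the first syzygy of \<open>Aq\<close>.
\<close>

lemma ppair_ann: assumes "ppair p q" shows "ann q = carrier (path_mod p)"
proof -
  have d: "dead q bs \<longleftrightarrow> (tgt q, bs) \<in> B \<and> (\<exists>cs. bs = snd p @ cs)" for bs
  proof
    assume d: "dead q bs"
    then have "(tgt q, bs) \<in> B" "(fst q, snd q @ bs) \<notin> B" by (auto simp: dead_def)
    then show "(tgt q, bs) \<in> B \<and> (\<exists>cs. bs = snd p @ cs)" using assms unfolding ppair_def by force
  next
    assume bs: "(tgt q, bs) \<in> B \<and> (\<exists>cs. bs = snd p @ cs)"
    then obtain cs where "bs = snd p @ cs" by blast
    then show "dead q bs" using assms bs B_append[of "fst q" "snd q @ snd p" cs] by (auto simp: ppair_def dead_def)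
  qed
  show ?thesis
  proof (rule Set.set_eqI)
    fix x
    have "(\<exists>bs. r = (tgt q, bs) \<and> dead q bs) \<longleftrightarrow> (\<exists>bs. r = (fst p, snd p @ bs))" if "cf x r \<noteq> 0" for r
    proof -
      have "r \<in> B" using that cf_notin by blast
      then show ?thesis using assms unfolding d ppair_def by auto
    qed
    then show "x \<in> ann q \<longleftrightarrow> x \<in> carrier (path_mod p)"
      unfolding path_mod_iff ann_def by blast
  qed
qed

lemma ppair_dead: "ppair p q \<Longrightarrow> dead q (snd p)"
  by (auto simp: ppair_def dead_def) (metis prod.collapse)

text \<open>
  The minimality of \<open>p\<close> holds because the annihilator of \<open>q\<close> is generated by one path \<open>p\<close>. That of \<open>q\<close> uses
  the vanishing for \<open>r\<close>: if \<open>pq' = 0\<close>, then \<open>q \<mapsto> q'\<close> defines a homomorphism on \<open>Aq\<close>, which is the syzygy of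
  \<open>Ar\<close>. So it is a right multiplication \<open>q' = qb\<close>, and \<open>q\<close> is a left factor of \<open>q'\<close>.
\<close>

lemma ppair_if_ext_vanishing:
  assumes q: "q \<in> B" and Eq: "ext_vanishing q" and u: "min_dead q us"
    and r: "r \<in> B" and Er: "ext_vanishing r" and v: "min_dead r vs" and qr: "q = (tgt r, vs)"
  shows "ppair (tgt q, us) q"
proof -
  have du: "dead q us" using u by (simp add: min_dead_def)
  have dv: "dead r vs" using v by (simp add: min_dead_def)
  have dq: "\<exists>cs. bs = us @ cs" if "dead q bs" for bs
    using dead_imp_min_dead[OF that] ext_vanishing_min_dead_unique[OF q Eq u] by auto
  have P2: "\<exists>as. q' = (fst q', as @ snd q) \<and> T (fst q') as = fst q"
    if q': "q' \<in> B" and t: "tgt q' = tgt q" and z: "(fst q', snd q' @ us) \<notin> B" for q'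
  proof -
    have "\<exists>f\<in>lhom A (path_mod q) (regular_module A). \<forall>a\<in>carrier A. f (a \<otimes> pv q) = a \<odot>\<^bsub>regular_module A\<^esub> pv q'"
    proof (rule cyclic_hom[OF pv_closed left_module_regular[OF ring_axioms]])
      fix a assume a: "a \<in> carrier A" "a \<otimes> pv q = \<zero>"
      have "dead q' bs" if "cf a (tgt q', bs) \<noteq> 0" for bs
      proof -
        have "dead q bs" using a(2) that t unfolding mult_pv_eq_0_iff[OF a(1)] by simp
        then obtain cs where "bs = us @ cs" using dq by blast
        then have "(fst q', snd q' @ bs) \<notin> B" using z B_append[of "fst q'" "snd q' @ us" cs] by auto
        then show ?thesis using that cf_notin by (auto simp: dead_def)
      qed
      then have "a \<otimes> pv q' = \<zero>" unfolding mult_pv_eq_0_iff[OF a(1)] by blast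
      then show "a \<odot>\<^bsub>regular_module A\<^esub> pv q' = \<zero>\<^bsub>regular_module A\<^esub>" by simp
    qed simp
    then obtain f where f: "f \<in> lhom A (path_mod q) (regular_module A)"
      "\<And>a. a \<in> carrier A \<Longrightarrow> f (a \<otimes> pv q) = a \<otimes> pv q'" by auto
    have an: "ann r = carrier (path_mod q)" using ann_eq_path_mod[OF r Er v] qr by simp
    then have "ann_mod r = path_mod q" by (simp add: left_ideal_gen_def)
    then obtain b where b: "b \<in> carrier A" "\<And>a. a \<in> ann r \<Longrightarrow> f a = a \<otimes> b"
      using Er f(1) unfolding ext_vanishing_def by metis
    have "pv q \<otimes> b = f (pv q)" using b(2)[of "pv q"] pv_in_path_mod[of q] unfolding an by simp
    also have "\<dots> = f (pv (e_tgt q) \<otimes> pv q)" using pv_tgt_mult[OF q] by simp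
    also have "\<dots> = pv (e_tgt q') \<otimes> pv q'" using f(2)[OF pv_closed, of "e_tgt q"] t by simp
    also have "\<dots> = pv q'" by (rule pv_tgt_mult[OF q'])
    finally have "cf (pv q \<otimes> b) (fst q', snd q') \<noteq> 0" using q' by (simp add: cf_pv)
    then obtain as where "snd q' = as @ snd q" "T (fst q') as = fst q"
      using cf_pv_mult_eq_0[OF b(1)] by metis
    then show ?thesis by (metis prod.collapse)
  qed
  show ?thesis
    unfolding ppair_def
  proof (intro conjI ballI impI)
    show "(tgt q, us) \<in> B" "(fst q, snd q @ snd (tgt q, us)) \<notin> B" using du by (auto simp: dead_def)
    show "q \<in> B" by (rule q)
    show "snd (tgt q, us) \<noteq> []" using dead_not_Nil[OF q du] by simp
    show "snd q \<noteq> []" using dead_not_Nil[OF r dv] qr by simp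
    show "fst (tgt q, us) = tgt q" by simp
    show "\<exists>as. q' = (fst q', as @ snd q) \<and> T (fst q') as = fst q"
      if "q' \<in> B" "tgt q' = fst (tgt q, us) \<and> (fst q', snd q' @ snd (tgt q, us)) \<notin> B" for q'
      using P2[OF that(1)] that(2) by simp
    show "\<exists>bs. snd p' = snd (tgt q, us) @ bs" if "p' \<in> B" "fst p' = tgt q \<and> (fst q, snd q @ snd p') \<notin> B" for p'
      using dq[of "snd p'"] that by (auto simp: dead_def) (metis prod.collapse)
  qed
qed

text \<open>
  The chain of perfect pairs obtained from an infinite coresolution is periodic since there are only
  finitely many nonzero paths and each entry of a perfect pair determines the other one.
\<close>

lemma perfect_if_infinite_chain:
  assumes f: "\<And>i. ppair (f i) (f (Suc i))"
  shows "perfect (f 0)"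
proof -
  have "range f \<subseteq> B" using f unfolding ppair_def by blast
  then have "\<not> inj f" using finite_B finite_subset finite_imageD infinite_UNIV_nat by metis
  then obtain i j where ij: "i < j" "f i = f j" unfolding inj_def by (metis linorder_neqE_nat)
  have "f (i - k) = f (j - k)" if "k \<le> i" for k
    using that
  proof (induction k)
    case (Suc k)
    have "ppair (f (i - Suc k)) (f (i - k))" using f[of "i - Suc k"] Suc.prems by (simp add: Suc_diff_Suc)
    moreover have "ppair (f (j - Suc k)) (f (j - k))" using f[of "j - Suc k"] Suc.prems ij(1) by (simp add: Suc_diff_Suc)
    ultimately show ?case using ppair_left_unique Suc by simp
  qed (use ij in simp)
  from this[of i] have 0: "f 0 = f (j - i)" by simp
  show ?thesis
    unfolding perfect_def
    \<comment> \<open>The cycles of perfect paths are indexed from 1.\<close>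
    by (rule exI[of _ "j - i"], rule exI[of _ "\<lambda>k. f (k - 1)"]) (use ij(1) 0 f in \<open>auto simp: Suc_diff_le\<close>, metis Suc_pred f less_eq_Suc_le One_nat_def)
qed

text \<open>
  \<open>Qs i\<close> contains the types of the summands of the \<open>i\<close>-th cocycle. The summands are only known up to
  similarity, so the chain does not use them directly but the generators of their syzygies, which
  similar paths have in common.
\<close>

lemma perfect_if_chain_of_summands:
  assumes B: "\<And>i q. q \<in> Qs i \<Longrightarrow> q \<in> B" and E: "\<And>i q. q \<in> Qs (Suc i) \<Longrightarrow> ext_vanishing q"
    and succ: "\<And>i p bs. p \<in> Qs i \<Longrightarrow> dead p bs \<Longrightarrow> \<exists>q\<in>Qs (Suc i). \<exists>us. min_dead q us \<and> similar (tgt q, us) p"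
    and p: "p \<in> Qs 0" "dead p bs"
  shows "\<exists>p'. perfect p' \<and> similar p' p"
proof -
  (* The property R places x among these generators at stage i, and L is the relation between
     consecutive entries of the chain. *)
  define R where "R i x \<longleftrightarrow> (\<exists>q\<in>Qs (Suc i). \<exists>us. min_dead q us \<and> x = (tgt q, us))" for i x
  define L where "L x y \<longleftrightarrow> (\<exists>us. min_dead y us \<and> x = (tgt y, us) \<and> y \<in> B \<and> ext_vanishing y)" for x y
  obtain q us where q: "q \<in> Qs (Suc 0)" "min_dead q us" "similar (tgt q, us) p" using succ[OF p] by blast
  have "\<exists>f. \<forall>n. R n (f n) \<and> (n = 0 \<longrightarrow> f n = (tgt q, us)) \<and> L (f n) (f (Suc n))"
  proof -
    have step: "\<exists>y. R (Suc n) y \<and> L x y" if Rn: "R n x" for n x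
    proof -
      obtain q us where q: "q \<in> Qs (Suc n)" "min_dead q us" "x = (tgt q, us)" using Rn unfolding R_def by blast
      then have "dead q us" by (simp add: min_dead_def)
      then obtain q' vs where q': "q' \<in> Qs (Suc (Suc n))" "min_dead q' vs" "similar (tgt q', vs) q"
        using succ[OF q(1)] by blast
      have same: "dead (tgt q', vs) = dead q" using q'(3) unfolding similar_def by blast
      have "min_dead (tgt q', vs) us" using q(2) unfolding min_dead_def same .
      moreover have "ext_vanishing (tgt q', vs)" by (rule ext_vanishing_similar[OF q'(3) E[OF q(1)]])
      moreover have "tgt (tgt q', vs) = tgt q" "(tgt q', vs) \<in> B" using q'(3) by (auto simp: similar_def)
      ultimately have "L x (tgt q', vs)" unfolding L_def using q(3) by simp
      moreover have "R (Suc n) (tgt q', vs)" unfolding R_def using q'(1,2) by blast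
      ultimately show ?thesis by blast
    qed
    have "R 0 (tgt q, us)" unfolding R_def using q by blast
    then show ?thesis
      using dependent_nat_choice[of "\<lambda>n x. R n x \<and> (n = 0 \<longrightarrow> x = (tgt q, us))" "\<lambda>n x y. L x y"] step by blast
  qed
  then obtain f where f0: "f 0 = (tgt q, us)" and L: "\<And>n. L (f n) (f (Suc n))" by blast
  have "ppair (f n) (f (Suc n))" for n
  proof -
    obtain us where 1: "min_dead (f (Suc n)) us" "f n = (tgt (f (Suc n)), us)" "f (Suc n) \<in> B" "ext_vanishing (f (Suc n))"
      using L[of n] by (auto simp: L_def)
    obtain vs where 2: "min_dead (f (Suc (Suc n))) vs" "f (Suc n) = (tgt (f (Suc (Suc n))), vs)"
      "f (Suc (Suc n)) \<in> B" "ext_vanishing (f (Suc (Suc n)))"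
      using L[of "Suc n"] by (auto simp: L_def)
    show ?thesis unfolding 1(2) by (rule ppair_if_ext_vanishing[OF 1(3,4,1) 2(3,4,1,2)])
  qed
  then have "perfect (f 0)" by (rule perfect_if_infinite_chain)
  then show ?thesis using q(3) f0 by auto
qed

text \<open>
  A map on the kernel, composed with the surjection from the previous term, is a cocycle of the
  \<open>Hom\<close> complex, hence a coboundary.
\<close>

lemma acyclic_hom_extend:
  assumes ac: "acyclic_complex A P d" and hac: "Hom_acyclic A P d N" and lm: "\<And>j. left_module A (P j)"
    and N: "left_module A N" and \<phi>: "\<phi> \<in> lhom A (kernel_module (P j) (P (j + 1)) (d j)) N"
  shows "\<exists>\<psi>\<in>lhom A (P j) N. \<forall>x\<in>carrier (kernel_module (P j) (P (j + 1)) (d j)). \<psi> x = \<phi> x"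
proof -
  \<comment> \<open>The indices are shifted so that the terms involved are the literal ones of the definition of acyclicity.\<close>
  obtain i where j: "j = i + 2" by (metis add.commute add_diff_cancel_left' add_diff_eq)
  have e: "i + 1 + 1 = i + 2" "i + 2 + 1 = i + 3" "i + 1 + 2 = i + 3" by simp_all
  let ?K = "kernel_module (P (i + 2)) (P (i + 3)) (d (i + 2))"
  have \<phi>': "\<phi> \<in> lhom A ?K N" using \<phi> by (simp only: j e)
  have d: "d l \<in> lhom A (P l) (P (l + 1))" for l using ac by (simp add: acyclic_complex_def)
  have exact: "d l ` carrier (P l) = {x \<in> carrier (P (l + 1)). d (l + 1) x = \<zero>\<^bsub>P (l + 2)\<^esub>}" for l
    using ac by (simp add: acyclic_complex_def)
  have img: "d (i + 1) ` carrier (P (i + 1)) = carrier ?K" using exact[of "i + 1"] by (simp only: e kernel_module_simps)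
  have dK: "d (i + 1) \<in> lhom A (P (i + 1)) ?K"
  proof (rule lhomI)
    have d1: "d (i + 1) \<in> lhom A (P (i + 1)) (P (i + 2))" using d[of "i + 1"] by (simp only: e)
    show "d (i + 1) x \<in> carrier ?K" if "x \<in> carrier (P (i + 1))" for x using img that by blast
    show "d (i + 1) (x \<oplus>\<^bsub>P (i + 1)\<^esub> y) = d (i + 1) x \<oplus>\<^bsub>?K\<^esub> d (i + 1) y"
      if "x \<in> carrier (P (i + 1))" "y \<in> carrier (P (i + 1))" for x y
      using lhom_add[OF d1 that] by simp
    show "d (i + 1) (a \<odot>\<^bsub>P (i + 1)\<^esub> x) = a \<odot>\<^bsub>?K\<^esub> d (i + 1) x"
      if "a \<in> carrier A" "x \<in> carrier (P (i + 1))" for a x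
      using lhom_smult[OF d1 that] by simp
    show "d (i + 1) x = undefined" if "x \<notin> carrier (P (i + 1))" for x by (rule lhom_undefined[OF d1 that])
  qed
  define f where "f = compose (carrier (P (i + 1))) \<phi> (d (i + 1))"
  have f: "f \<in> lhom A (P (i + 1)) N" unfolding f_def by (rule lhom_compose[OF dK \<phi>' lm])
  have d2: "d (i + 2) \<in> lhom A (P (i + 2)) (P (i + 3))" using d[of "i + 2"] by (simp only: e)
  have K: "left_module A ?K" by (rule left_module_kernel[OF lm lm d2])
  have "compose (carrier (P i)) f (d i) = zero_hom (P i) N"
  proof (rule ext)
    fix x
    show "compose (carrier (P i)) f (d i) x = zero_hom (P i) N x"
    proof (cases "x \<in> carrier (P i)")
      case True
      then have "d i x \<in> d i ` carrier (P i)" by blast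
      then have "d i x \<in> carrier (P (i + 1))" "d (i + 1) (d i x) = \<zero>\<^bsub>?K\<^esub>" unfolding exact by auto
      then show ?thesis using True lhom_zero[OF K N \<phi>'] by (simp add: f_def compose_def zero_hom_def)
    qed (simp add: compose_def zero_hom_def)
  qed
  then have "f \<in> (\<lambda>g. compose (carrier (P (i + 1))) g (d (i + 1))) ` lhom A (P (i + 2)) N"
    using f hac unfolding Hom_acyclic_def by blast
  then obtain g where g: "g \<in> lhom A (P (i + 2)) N" "f = compose (carrier (P (i + 1))) g (d (i + 1))" by blast
  have "g x = \<phi> x" if x: "x \<in> carrier ?K" for x
  proof -
    have "x \<in> d (i + 1) ` carrier (P (i + 1))" unfolding img by (rule x)
    then obtain y where y: "y \<in> carrier (P (i + 1))" "x = d (i + 1) y" by (rule imageE)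
    then show ?thesis using fun_cong[OF g(2), of y] by (simp add: f_def compose_def)
  qed
  then show ?thesis using g(1) by (auto simp only: j e)
qed

text \<open>
  All cocycles of the complex that defines \<open>M\<close> decompose. The two lemmas on one step apply to each map
  onto the next cocycle, and the summands at the nonnegative places feed the chain argument.
\<close>

theorem gorenstein_projective_decomposition:
  assumes M: "gorenstein_projective A \<eta> M"
  obtains \<Gamma> :: "(('v \<times> 'e list) \<times> (nat \<Rightarrow> 'k)) set" where "finite \<Gamma>" "\<And>g. g \<in> \<Gamma> \<Longrightarrow> fst g \<in> B"
    "liso A (prod_mod \<Gamma> (\<lambda>g. path_mod (fst g))) M"
    "\<And>g bs. g \<in> \<Gamma> \<Longrightarrow> dead (fst g) bs \<Longrightarrow> \<exists>p. perfect p \<and> similar p (fst g)"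
proof -
  obtain P :: "int \<Rightarrow> ('a, 'k) fmod" and d where P: "\<And>j. projective A \<eta> (P j)" and ac: "acyclic_complex A P d"
    and hac: "Hom_acyclic A P d (regular_module A)" and iso: "liso A M (kernel_module (P 0) (P 1) (d 0))"
    using gorenstein_projectiveE[OF M] by blast
  have lm: "left_module A (P j)" for j by (rule fd_module_left_module[OF projective_fd_module[OF P]])
  have idP: "id_hom (P j) \<in> finite_rank_homs A (P j) (P j)" for j by (rule finite_rank_id_if_projective[OF P])
  have d: "d l \<in> lhom A (P l) (P (l + 1))" for l using ac by (simp add: acyclic_complex_def)
  have exact: "d l ` carrier (P l) = {x \<in> carrier (P (l + 1)). d (l + 1) x = \<zero>\<^bsub>P (l + 2)\<^esub>}" for l
    using ac by (simp add: acyclic_complex_def)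
  let ?Z = "\<lambda>j. kernel_module (P j) (P (j + 1)) (d j)"
  have "\<exists>\<Gamma> :: (('v \<times> 'e list) \<times> (nat \<Rightarrow> 'k)) set. finite \<Gamma> \<and> (\<forall>g\<in>\<Gamma>. fst g \<in> B) \<and>
      liso A (prod_mod \<Gamma> (\<lambda>g. path_mod (fst g))) (?Z j)" for j
    using kernel_of_projectives_decomposition[OF lm lm idP idP d, of j] by metis
  then obtain \<Gamma> :: "int \<Rightarrow> (('v \<times> 'e list) \<times> (nat \<Rightarrow> 'k)) set" where fin: "\<And>j. finite (\<Gamma> j)"
    and \<Gamma>B: "\<And>j g. g \<in> \<Gamma> j \<Longrightarrow> fst g \<in> B"
    and isoZ: "\<And>j. liso A (prod_mod (\<Gamma> j) (\<lambda>g. path_mod (fst g))) (?Z j)"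
    by metis
  let ?PM = "\<lambda>j. prod_mod (\<Gamma> j) (\<lambda>g. path_mod (fst g))"
  have PM: "left_module A (?PM j)" for j by (rule left_module_prod_mod[OF ring_axioms left_module_path_mod])
  have Z: "left_module A (?Z j)" for j by (rule left_module_kernel[OF lm lm d])
  have step: "(\<forall>g\<in>\<Gamma> (j + 1). ext_vanishing (fst g)) \<and>
    (\<forall>g0\<in>\<Gamma> j. \<forall>bs. dead (fst g0) bs \<longrightarrow> (\<exists>g\<in>\<Gamma> (j + 1). \<exists>us. min_dead (fst g) us \<and> similar (tgt (fst g), us) (fst g0)))" for j
  proof -
    obtain u v where u: "u \<in> lhom A (?PM (j + 1)) (?Z (j + 1))" and v: "v \<in> lhom A (?Z (j + 1)) (?PM (j + 1))"
      and vu: "\<And>x. x \<in> carrier (?PM (j + 1)) \<Longrightarrow> v (u x) = x" and uv: "\<And>y. y \<in> carrier (?Z (j + 1)) \<Longrightarrow> u (v y) = y"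
      using isoZ[of "j + 1"] unfolding liso_iff_inverse[OF PM] by blast
    have e: "j + 1 + 1 = j + 2" by simp
    have img: "d j ` carrier (P j) = carrier (?Z (j + 1))" unfolding exact kernel_module_simps e ..
    have dZ: "d j \<in> lhom A (P j) (?Z (j + 1))"
    proof (rule lhomI)
      show "d j x \<in> carrier (?Z (j + 1))" if "x \<in> carrier (P j)" for x using img that by blast
      show "d j (x \<oplus>\<^bsub>P j\<^esub> y) = d j x \<oplus>\<^bsub>?Z (j + 1)\<^esub> d j y" if "x \<in> carrier (P j)" "y \<in> carrier (P j)" for x y
        using lhom_add[OF d that] by simp
      show "d j (a \<odot>\<^bsub>P j\<^esub> x) = a \<odot>\<^bsub>?Z (j + 1)\<^esub> d j x" if "a \<in> carrier A" "x \<in> carrier (P j)" for a x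
        using lhom_smult[OF d that] by simp
      show "d j x = undefined" if "x \<notin> carrier (P j)" for x by (rule lhom_undefined[OF d that])
    qed
    define \<delta> where "\<delta> = compose (carrier (P j)) v (d j)"
    have \<delta>: "\<delta> \<in> lhom A (P j) (?PM (j + 1))" unfolding \<delta>_def by (rule lhom_compose[OF dZ v lm])
    have surj: "carrier (?PM (j + 1)) \<subseteq> \<delta> ` carrier (P j)"
    proof
      fix y assume y: "y \<in> carrier (?PM (j + 1))"
      obtain x where x: "x \<in> carrier (P j)" "u y = d j x" using lhom_closed[OF u y] img by blast
      have "\<delta> x = y" using x vu[OF y] by (simp add: \<delta>_def compose_def)
      then show "y \<in> \<delta> ` carrier (P j)" using x(1) by blast
    qed
    have "\<delta> x = \<zero>\<^bsub>?PM (j + 1)\<^esub> \<longleftrightarrow> d j x = \<zero>\<^bsub>P (j + 1)\<^esub>" if x: "x \<in> carrier (P j)" for x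
    proof -
      note dx = lhom_closed[OF dZ x]
      have "\<delta> x = v (d j x)" using x by (simp add: \<delta>_def compose_def)
      then show ?thesis
        using uv[OF dx] lhom_zero[OF PM Z u] lhom_zero[OF Z PM v] by (metis kernel_module_simps(2))
    qed
    then have ker: "kernel_module (P j) (?PM (j + 1)) \<delta> = ?Z j"
      unfolding kernel_module_def by (auto intro!: arg_cong[where f = "\<lambda>S. P j\<lparr>carrier := S\<rparr>"])
    have ext: "\<exists>\<psi>\<in>lhom A (P j) (regular_module A). \<forall>x\<in>carrier (kernel_module (P j) (?PM (j + 1)) \<delta>). \<psi> x = \<phi> x"
      if "\<phi> \<in> lhom A (kernel_module (P j) (?PM (j + 1)) \<delta>) (regular_module A)" for \<phi>
      unfolding ker by (rule acyclic_hom_extend[OF ac hac lm left_module_regular[OF ring_axioms] that[unfolded ker]])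
    note hyps = lm[of j] idP[of j] fin[of "j + 1"] \<Gamma>B[of _ "j + 1"] \<delta> surj ext
    show ?thesis
    proof (intro conjI ballI allI impI)
      show "ext_vanishing (fst g)" if "g \<in> \<Gamma> (j + 1)" for g
        by (rule step_ext_vanishing[where q = fst and \<Gamma> = "\<Gamma> (j + 1)", OF hyps that])
      fix g0 bs assume g0: "g0 \<in> \<Gamma> j" "dead (fst g0) bs"
      show "\<exists>g\<in>\<Gamma> (j + 1). \<exists>us. min_dead (fst g) us \<and> similar (tgt (fst g), us) (fst g0)"
        by (rule step_summand[where q = fst and \<Gamma> = "\<Gamma> (j + 1)" and ?q0.0 = fst and ?\<Gamma>0.0 = "\<Gamma> j", OF hyps fin[of j] g0(1) \<Gamma>B[OF g0(1)] isoZ[of j, folded ker] g0(2)])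
    qed
  qed
  define Qs where "Qs i = fst ` \<Gamma> (int i)" for i
  have "\<exists>p. perfect p \<and> similar p (fst g)" if g: "g \<in> \<Gamma> 0" "dead (fst g) bs" for g bs
  proof (rule perfect_if_chain_of_summands[of Qs])
    show "q \<in> B" if "q \<in> Qs i" for i q using that \<Gamma>B by (auto simp: Qs_def)
    have e: "int (Suc i) = int i + 1" for i by simp
    show "ext_vanishing q" if "q \<in> Qs (Suc i)" for i q
      using that step[of "int i"] unfolding Qs_def e by blast
    show "\<exists>q\<in>Qs (Suc i). \<exists>us. min_dead q us \<and> similar (tgt q, us) p" if "p \<in> Qs i" "dead p bs" for i p bs
      using that step[of "int i"] unfolding Qs_def e by blast
    show "fst g \<in> Qs 0" using g by (simp add: Qs_def)
    show "dead (fst g) bs" by (rule g(2))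
  qed
  moreover have "liso A (?PM 0) M"
  proof -
    have "liso A (?Z 0) M" using liso_sym[OF fd_module_left_module[OF gorenstein_projective_fd_module[OF M]] Z, of 0] iso by simp
    then show ?thesis by (rule liso_trans[OF PM isoZ])
  qed
  ultimately show ?thesis using that[of "\<Gamma> 0"] fin \<Gamma>B by blast
qed

end

context monomial_algebra
begin

section \<open>Gorenstein-projective modules from perfect paths\<close>

text \<open>
  The minimality of \<open>q\<close> in terms of elements; it is the exactness of the \<open>Hom\<close> complex below.
\<close>

lemma ppair_right_annihilator:
  assumes pq: "ppair p q" and y: "y \<in> carrier A" and start: "pv (fst p, []) \<otimes> y = y" and 0: "pv p \<otimes> y = \<zero>"
  shows "\<exists>z\<in>carrier A. y = pv q \<otimes> z"
proof -
  have suf: "\<exists>as. snd r = as @ snd q \<and> T (fst r) as = fst q" if r: "cf y r \<noteq> 0" for r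
  proof -
    have rB: "r \<in> B" using r cf_notin by blast
    have "\<exists>as. snd r = as @ snd (fst p, []) \<and> T (fst r) as = fst (fst p, [])"
      using cf_pv_mult_eq_0[OF y, of "snd r" "(fst p, [])" "fst r"] start r by auto
    then have t: "tgt r = fst p" by (auto simp: tgt_def)
    have "(fst r, snd r @ snd p) \<notin> B"
    proof
      assume "(fst r, snd r @ snd p) \<in> B"
      then have "cf (pv p \<otimes> y) (fst r, snd r @ snd p) = cf y (fst r, snd r)"
        using t by (intro cf_pv_mult[OF y]) (simp_all add: tgt_def)
      then show False using 0 r by simp
    qed
    then have "\<exists>as. r = (fst r, as @ snd q) \<and> T (fst r) as = fst q"
      using pq rB t unfolding ppair_def by blast
    then show ?thesis by (metis snd_conv)
  qed
  define z where "z = mk (\<lambda>s. if tgt s = fst q then cf y (fst s, snd s @ snd q) else 0)"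
  have "pv q \<otimes> z = y"
  proof (rule cf_eqI)
    show "pv q \<otimes> z \<in> carrier A" by (simp add: z_def)
    fix r assume r: "r \<in> B"
    show "cf (pv q \<otimes> z) r = cf y r"
    proof (cases "\<exists>as. snd r = as @ snd q \<and> T (fst r) as = fst q")
      case True
      then obtain as where as: "snd r = as @ snd q" "T (fst r) as = fst q" by blast
      have r': "r = (fst r, as @ snd q)" using as(1) by (metis prod.collapse)
      then have rB: "(fst r, as @ snd q) \<in> B" using r by simp
      have "cf (pv q \<otimes> z) r = cf z (fst r, as)"
        by (subst r') (rule cf_pv_mult[OF _ rB as(2)], simp add: z_def)
      also have "\<dots> = cf y r" using B_append[OF rB] as r' by (simp add: z_def cf_mk tgt_def)
      finally show ?thesis .
    next
      case False
      have "cf (pv q \<otimes> z) (fst r, snd r) = 0"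
        by (rule cf_pv_mult_eq_0) (use False in \<open>auto simp: z_def\<close>)
      then show ?thesis using suf[of r] False by auto
    qed
  qed (rule y)
  then show ?thesis by (intro bexI[of _ z]) (simp_all add: z_def)
qed

lemma path_mod_subset: "x \<in> carrier (path_mod p) \<Longrightarrow> x \<in> carrier (path_mod (fst p, []))"
  unfolding path_mod_iff by auto

lemma path_mod_eq_update: "path_mod p = (regular_module A)\<lparr>carrier := carrier (path_mod p)\<rparr>"
  by (simp add: left_ideal_gen_def)

text \<open>
  The cycle of a perfect path, read off modulo its length.
\<close>

lemma perfect_bi_infinite_chain:
  assumes "perfect p"
  obtains f :: "int \<Rightarrow> 'v \<times> 'e list" where "f 0 = p" "\<And>j. ppair (f j) (f (j + 1))"
proof -
  obtain n :: nat and ps where n: "n \<ge> 1" "ps 1 = p" "ps (n + 1) = p" "\<And>i. i \<in> {1..n} \<Longrightarrow> ppair (ps i) (ps (i + 1))"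
    using assms unfolding perfect_def by blast
  define f where "f j = ps (1 + nat (j mod int n))" for j
  have "ppair (f j) (f (j + 1))" for j
  proof -
    let ?k = "nat (j mod int n)"
    have k: "?k < n" using n(1) by (simp add: nat_less_iff)
    have pair: "ppair (ps (1 + ?k)) (ps (1 + ?k + 1))" by (rule n(4)) (use k in auto)
    have "f (j + 1) = ps (1 + ?k + 1)"
    proof (cases "?k + 1 < n")
      case True
      have "(j + 1) mod int n = (j mod int n + 1) mod int n" by (simp add: mod_add_left_eq)
      also have "\<dots> = j mod int n + 1" using True n(1) by (intro mod_pos_pos_trivial) auto
      finally have "nat ((j + 1) mod int n) = ?k + 1" using n(1) by (simp add: nat_add_distrib)
      then show ?thesis by (simp add: f_def)
    next
      case False
      then have k': "?k + 1 = n" using k by simp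
      then have "j mod int n + 1 = int n" using n(1) by (metis Euclidean_Rings.pos_mod_sign int_nat_eq of_nat_0_less_iff of_nat_1 of_nat_add less_le_trans zero_less_one)
      then have "(j + 1) mod int n = 0" by (metis mod_add_left_eq mod_self)
      then have "f (j + 1) = p" by (simp add: f_def n(2)[symmetric])
      then show ?thesis using k' n(3) by (simp add: add.commute)
    qed
    then show ?thesis using pair by (simp add: f_def)
  qed
  moreover have "f 0 = p" by (simp add: f_def n(2)[symmetric])
  ultimately show ?thesis using that by blast
qed

text \<open>
  The complex with terms \<open>Ae\<close> for the end points of the paths of the cycle and right multiplication by these
  paths. It is exact since \<open>Ap\<close> is the annihilator of \<open>q\<close> for every pair \<open>(p, q)\<close>; a linear form on \<open>Ae\<close> is
  an element of \<open>eA\<close>, so exactness of the dual complex is the statement about elements killed by \<open>p\<close>.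
\<close>

theorem perfect_gorenstein_projective:
  assumes "perfect p"
  shows "gorenstein_projective A \<eta> (path_mod p)"
proof -
  obtain f :: "int \<Rightarrow> 'v \<times> 'e list" where f0: "f 0 = p" and pair: "\<And>j. ppair (f j) (f (j + 1))"
    using perfect_bi_infinite_chain[OF assms] by blast
  have fB: "f j \<in> B" for j using pair[of j] by (simp add: ppair_def)
  have ft: "fst (f j) = tgt (f (j + 1))" for j using pair[of j] by (simp add: ppair_def)
  define P where "P j = path_mod (e_tgt (f j))" for j
  define d where "d j = (\<lambda>a\<in>carrier (P j). a \<otimes> pv (f j))" for j
  let ?R = "regular_module A"
  have lm: "left_module A (P j)" for j unfolding P_def by (rule left_module_path_mod)
  have PA: "a \<in> carrier A" if "a \<in> carrier (P j)" for a j using that unfolding P_def by (rule path_mod_closed)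
  have P0: "\<zero>\<^bsub>P j\<^esub> = \<zero>" "add (P j) = add A" "module.smult (P j) = monoid.mult A" for j by (simp_all add: P_def)
  have e: "pv (e_tgt (f j)) \<in> carrier (P j)" for j unfolding P_def by (rule pv_in_path_mod)
  have ae: "a \<otimes> pv (e_tgt (f j)) = a" if "a \<in> carrier (P j)" for a j
    using mult_e_tgt[OF fB] that unfolding P_def .
  have img: "(\<lambda>a. a \<otimes> pv (f j)) ` carrier (P j) = carrier (path_mod (f j))" for j
  proof (intro subset_antisym subsetI)
    fix y assume "y \<in> carrier (path_mod (f j))"
    then obtain a where a: "a \<in> carrier A" "y = a \<otimes> pv (f j)" by auto
    have "a \<otimes> pv (e_tgt (f j)) \<in> carrier (P j)" using a by (auto simp: P_def)
    moreover have "y = (a \<otimes> pv (e_tgt (f j))) \<otimes> pv (f j)" using a pv_tgt_mult[OF fB] by (simp add: m_assoc)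
    ultimately show "y \<in> (\<lambda>a. a \<otimes> pv (f j)) ` carrier (P j)" by blast
  next
    fix y assume "y \<in> (\<lambda>a. a \<otimes> pv (f j)) ` carrier (P j)"
    then show "y \<in> carrier (path_mod (f j))" using PA by auto
  qed
  have d_img: "d j ` carrier (P j) = carrier (path_mod (f j))" for j using img[of j] by (simp add: d_def)
  have d: "d j \<in> lhom A (P j) (P (j + 1))" for j
    unfolding d_def
  proof (rule lhom_restrictI[OF lm])
    fix a assume a: "a \<in> carrier (P j)"
    have "a \<otimes> pv (f j) \<in> carrier (path_mod (f j))" using img[of j] a by blast
    then show "a \<otimes> pv (f j) \<in> carrier (P (j + 1))" unfolding P_def ft[symmetric] by (rule path_mod_subset)
    show "(a \<oplus>\<^bsub>P j\<^esub> b) \<otimes> pv (f j) = a \<otimes> pv (f j) \<oplus>\<^bsub>P (j + 1)\<^esub> b \<otimes> pv (f j)" if "b \<in> carrier (P j)" for b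
      using PA[OF a] PA[OF that] by (simp add: P0 l_distr)
    show "(b \<odot>\<^bsub>P j\<^esub> a) \<otimes> pv (f j) = b \<odot>\<^bsub>P (j + 1)\<^esub> (a \<otimes> pv (f j))" if "b \<in> carrier A" for b
      using PA[OF a] that by (simp add: P0 m_assoc)
  qed
  have ker: "{x \<in> carrier (P (j + 1)). d (j + 1) x = \<zero>} = carrier (path_mod (f j))" for j
  proof -
    have "{x \<in> carrier (P (j + 1)). d (j + 1) x = \<zero>} = ann (f (j + 1))"
      by (intro Set.set_eqI) (simp add: ann_iff d_def P_def del: left_ideal_gen_simps(1))
    then show ?thesis using ppair_ann[OF pair[of j]] by simp
  qed
  have acyclic: "acyclic_complex A P d"
    unfolding acyclic_complex_def by (intro conjI allI d) (simp add: d_img ker P0 del: left_ideal_gen_simps(1))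
  have two: "j + 1 + 1 = j + 2" for j :: int by simp
  have hom_acyclic: "Hom_acyclic A P d ?R"
    unfolding Hom_acyclic_def
  proof (intro allI subset_antisym subsetI)
    fix j h assume "h \<in> (\<lambda>g. compose (carrier (P (j + 1))) g (d (j + 1))) ` lhom A (P (j + 2)) ?R"
    then obtain g where g: "g \<in> lhom A (P (j + 2)) ?R" "h = compose (carrier (P (j + 1))) g (d (j + 1))" by blast
    have "d (j + 1) \<in> lhom A (P (j + 1)) (P (j + 2))" using d[of "j + 1"] by (simp only: two)
    then have h: "h \<in> lhom A (P (j + 1)) ?R" unfolding g(2) by (rule lhom_compose[OF _ g(1) lm])
    moreover have "compose (carrier (P j)) h (d j) = zero_hom (P j) ?R"
    proof (rule ext)
      fix x
      show "compose (carrier (P j)) h (d j) x = zero_hom (P j) ?R x"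
      proof (cases "x \<in> carrier (P j)")
        case True
        have "d j x \<in> {x \<in> carrier (P (j + 1)). d (j + 1) x = \<zero>}" using True d_img unfolding ker by blast
        then show ?thesis
          using True lhom_zero[OF lm left_module_regular[OF ring_axioms] g(1)]
          by (simp add: g(2) compose_def zero_hom_def P0)
      qed (simp add: compose_def zero_hom_def)
    qed
    ultimately show "h \<in> {h \<in> lhom A (P (j + 1)) ?R. compose (carrier (P j)) h (d j) = zero_hom (P j) ?R}" by blast
  next
    fix j h assume "h \<in> {h \<in> lhom A (P (j + 1)) ?R. compose (carrier (P j)) h (d j) = zero_hom (P j) ?R}"
    then have h: "h \<in> lhom A (P (j + 1)) ?R" and h0: "compose (carrier (P j)) h (d j) = zero_hom (P j) ?R" by auto
    define y where "y = h (pv (e_tgt (f (j + 1))))"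
    have y: "y \<in> carrier A" using lhom_closed[OF h e] by (simp add: y_def)
    have hy: "h a = a \<otimes> y" if "a \<in> carrier (P (j + 1))" for a
      using lhom_smult[OF h PA[OF that] e] ae[OF that] by (simp add: y_def P0)
    have "pv (e_tgt (f (j + 1))) \<otimes> y = y" using hy[OF e] by (simp add: y_def)
    moreover have "pv (f j) \<otimes> y = \<zero>"
    proof -
      have "d j (pv (e_tgt (f j))) = pv (f j)" using e pv_tgt_mult[OF fB] by (simp add: d_def)
      then have "h (pv (f j)) = \<zero>" using fun_cong[OF h0, of "pv (e_tgt (f j))"] e by (simp add: compose_def zero_hom_def)
      moreover have "pv (f j) \<in> carrier (P (j + 1))"
        unfolding P_def ft[symmetric] by (rule path_mod_subset[OF pv_in_path_mod])
      ultimately show ?thesis using hy by simp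
    qed
    ultimately obtain z where z: "z \<in> carrier A" "y = pv (f (j + 1)) \<otimes> z"
      using ppair_right_annihilator[OF pair y] ft by metis
    define g where "g = (\<lambda>a\<in>carrier (P (j + 2)). a \<otimes> z)"
    have g: "g \<in> lhom A (P (j + 2)) ?R"
      unfolding g_def by (rule lhom_restrictI[OF lm]) (use PA z(1) in \<open>auto simp: P0 l_distr m_assoc\<close>)
    have "h = compose (carrier (P (j + 1))) g (d (j + 1))"
    proof (rule ext)
      fix a
      show "h a = compose (carrier (P (j + 1))) g (d (j + 1)) a"
      proof (cases "a \<in> carrier (P (j + 1))")
        case True
        have "d (j + 1) a \<in> carrier (P (j + 2))" using lhom_closed[OF d True] by (simp only: two)
        then show ?thesis using True hy[OF True] PA[OF True] z by (simp add: g_def d_def compose_def m_assoc)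
      qed (simp add: compose_def lhom_undefined[OF h])
    qed
    then show "h \<in> (\<lambda>g. compose (carrier (P (j + 1))) g (d (j + 1))) ` lhom A (P (j + 2)) ?R" using g by blast
  qed
  have proj: "projective A \<eta> (P j)" for j
    unfolding P_def
  proof (rule projective_if_finite_rank_id[OF fd_module_path_mod finite_rank_id_path_mod])
    show "e_tgt (f j) \<in> B" by (rule B_tgt[OF fB])
    show "\<not> dead (e_tgt (f j)) bs" for bs by (simp add: dead_def tgt_def)
  qed
  have "kernel_module (P 1) (P (1 + 1)) (d 1) = path_mod p"
    unfolding kernel_module_def using ker[of 0] f0 path_mod_eq_update[of p]
    by (simp add: P0 P_def left_ideal_gen_def)
  then have "liso A (path_mod p) (kernel_module (P 1) (P (1 + 1)) (d 1))"
    using liso_refl[OF left_module_path_mod] by simp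
  then show ?thesis
    by (rule gorenstein_projectiveI[OF fd_module_path_mod proj acyclic hom_acyclic])
qed

lemma perfect_in_B: "perfect p \<Longrightarrow> p \<in> B"
  using perfect_bi_infinite_chain[of p] unfolding ppair_def by metis

lemma perfect_predecessor: assumes "perfect p" obtains p' where "ppair p' p"
  using perfect_bi_infinite_chain[OF assms] by (metis diff_add_cancel add.left_neutral)

lemma perfect_dead: "perfect p \<Longrightarrow> \<exists>bs. dead p bs"
  using perfect_predecessor[of p] ppair_dead by metis

section \<open>Endomorphisms of cyclic modules\<close>

text \<open>
  A path that kills \<open>p\<close> kills the image of \<open>p\<close>, which involves \<open>q\<close>.
\<close>

lemma hom_dead:
  assumes p: "p \<in> B" and f: "f \<in> lhom A (path_mod p) (path_mod q)" and c: "cf (f (pv p)) q \<noteq> 0"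
    and t: "tgt p = tgt q" and d: "dead p ws"
  shows "dead q ws"
proof -
  have fpA: "f (pv p) \<in> carrier A" by (rule path_mod_closed[OF lhom_closed[OF f pv_in_path_mod]])
  have "pv (tgt p, ws) \<otimes> pv p = \<zero>" using d by (subst mult_pv_eq_0_iff) (auto simp: cf_pv split: if_splits)
  then have 0: "pv (tgt q, ws) \<otimes> f (pv p) = \<zero>"
    using lhom_smult[OF f pv_closed pv_in_path_mod, of "(tgt p, ws)"]
      lhom_zero[OF left_module_path_mod left_module_path_mod f] t by simp
  have "(fst q, snd q @ ws) \<notin> B"
  proof
    assume B: "(fst q, snd q @ ws) \<in> B"
    have "cf (pv (tgt q, ws) \<otimes> f (pv p)) (fst q, snd q @ snd (tgt q, ws)) = cf (f (pv p)) (fst q, snd q)"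
      by (rule cf_pv_mult[OF fpA]) (use B in \<open>simp_all add: tgt_def\<close>)
    then show False using 0 c by simp
  qed
  then show ?thesis using d t by (simp add: dead_def)
qed

text \<open>
  The composition of the two maps differs from the identity by a map that does not contribute to the
  coefficient of \<open>p\<close> at \<open>p\<close>. As this coefficient is the product of the coefficients of the two maps at
  the generators, both are nonzero.
\<close>

lemma stable_iso_similar:
  assumes p: "p \<in> B" "dead p bs" and q: "q \<in> B" and iso: "stable_iso A \<eta> (path_mod p) (path_mod q)"
  shows "similar p q"
proof -
  note X = left_module_path_mod
  obtain f g where f: "f \<in> lhom A (path_mod p) (path_mod q)" and g: "g \<in> lhom A (path_mod q) (path_mod p)"
    and eq: "stable_eq A \<eta> (path_mod p) (path_mod p) (compose (carrier (path_mod p)) g f) (id_hom (path_mod p))"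
    using iso unfolding stable_iso_def by blast
  obtain r where r: "r \<in> finite_rank_homs A (path_mod p) (path_mod p)"
    "\<And>x. x \<in> carrier (path_mod p) \<Longrightarrow> compose (carrier (path_mod p)) g f x = id_hom (path_mod p) x \<oplus>\<^bsub>path_mod p\<^esub> r x"
    using stable_eqE[OF X X eq] by blast
  have rl: "r \<in> lhom A (path_mod p) (path_mod p)" by (rule finite_rank_lhom[OF X X r(1)])
  have "pv (tgt p, bs) \<otimes> pv p = \<zero>" using p(2) by (subst mult_pv_eq_0_iff) (auto simp: cf_pv split: if_splits)
  then have r0: "cf (r (pv p)) p = 0"
    using p(2) by (intro finite_rank_cf_generator[OF X p(1) r(1) pv_in_path_mod, of bs]) (auto simp: dead_def)
  have "g (f (pv p)) = pv p \<oplus> r (pv p)"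
    using r(2)[OF pv_in_path_mod] pv_in_path_mod[of p] by (simp add: compose_def id_hom_def del: left_ideal_gen_simps(1))
  then have c1: "cf (g (f (pv p))) p = 1"
    using r0 p(1) path_mod_closed[OF lhom_closed[OF rl pv_in_path_mod]] by (simp add: cf_add cf_pv)
  note fp = lhom_closed[OF f pv_in_path_mod] and gq = lhom_closed[OF g pv_in_path_mod]
  have "g (f (pv p)) = g (strip q (f (pv p)) \<otimes> pv q)" by (simp only: strip_mult_pv[OF fp])
  also have "\<dots> = strip q (f (pv p)) \<otimes> g (pv q)" using lhom_smult[OF g strip_closed pv_in_path_mod] by simp
  finally have "cf (strip q (f (pv p))) (tgt p, []) * cf (g (pv q)) p = 1"
    using c1 cf_mult_at_generator[OF strip_closed gq p(1)] by simp
  then have 1: "cf (strip q (f (pv p))) (tgt p, []) \<noteq> 0" and 2: "cf (g (pv q)) p \<noteq> 0" by auto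
  have t: "tgt p = tgt q" and 3: "cf (f (pv p)) q \<noteq> 0" using 1 by (auto simp: cf_strip split: if_splits)
  have "dead p ws \<longleftrightarrow> dead q ws" for ws
    using hom_dead[OF p(1) f 3 t] hom_dead[OF q g 2 t[symmetric]] by blast
  then show ?thesis using p q t by (simp add: similar_def)
qed

text \<open>
  The predecessors of similar perfect paths generate the same left ideal, hence agree, and a perfect pair
  is determined by its left entry.
\<close>

lemma perfect_similar_eq:
  assumes p: "perfect p" and q: "perfect q" and sim: "similar p q"
  shows "p = q"
proof -
  obtain p1 where p1: "ppair p1 p" using perfect_predecessor[OF p] by blast
  obtain q1 where q1: "ppair q1 q" using perfect_predecessor[OF q] by blast
  have "ann p = ann q" using sim by (simp add: ann_def similar_def)
  then have eq: "carrier (path_mod p1) = carrier (path_mod q1)" using ppair_ann[OF p1] ppair_ann[OF q1] by simp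
  have B: "p1 \<in> B" "q1 \<in> B" using p1 q1 by (auto simp: ppair_def)
  have "\<exists>bs. p1 = (fst q1, snd q1 @ bs)"
  proof -
    have "cf (pv p1) p1 \<noteq> 0" using B(1) by (simp add: cf_pv)
    then show ?thesis using pv_in_path_mod[of p1] unfolding eq path_mod_iff by blast
  qed
  moreover have "\<exists>bs. q1 = (fst p1, snd p1 @ bs)"
  proof -
    have "cf (pv q1) q1 \<noteq> 0" using B(2) by (simp add: cf_pv)
    then show ?thesis using pv_in_path_mod[of q1] unfolding eq[symmetric] path_mod_iff by blast
  qed
  ultimately have "p1 = q1" by (auto simp: prod_eq_iff)
  then show ?thesis using ppair_right_unique p1 q1 by blast
qed

text \<open>
  One of the components of \<open>p\<close> involves \<open>p\<close> and thus generates \<open>Ap\<close>.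
\<close>

lemma indecomposable_path_mod:
  assumes p: "p \<in> B"
  shows "indecomposable_module A (path_mod p)"
  unfolding indecomposable_module_def
proof (intro conjI allI impI)
  have pv0: "pv p \<noteq> \<zero>" using cf_pv[of p p] p by auto
  show "carrier (path_mod p) \<noteq> {\<zero>\<^bsub>path_mod p\<^esub>}" using pv_in_path_mod[of p] pv0 by auto
  fix X Y
  assume *: "submodule X A (path_mod p) \<and> submodule Y A (path_mod p) \<and> X \<inter> Y = {\<zero>\<^bsub>path_mod p\<^esub>} \<and>
    X <+>\<^bsub>path_mod p\<^esub> Y = carrier (path_mod p)"
  have all: "U = carrier (path_mod p)"
    if U: "submodule U A (path_mod p)" and x: "x \<in> U" and c: "cf x p \<noteq> 0" for U x
  proof
    show sub: "U \<subseteq> carrier (path_mod p)" using subgroup.subset[OF submodule.axioms(1)[OF U]] by simp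
    show "carrier (path_mod p) \<subseteq> U"
    proof
      fix z assume "z \<in> carrier (path_mod p)"
      then obtain a where a: "a \<in> carrier A" "z = a \<otimes> x"
        using generator_mult_surj[OF p subsetD[OF sub x] c] by blast
      then show "z \<in> U" using submodule.smult_closed[OF U a(1) x] by simp
    qed
  qed
  have "pv p \<in> X <+>\<^bsub>path_mod p\<^esub> Y" using * pv_in_path_mod[of p] by (simp del: left_ideal_gen_simps(1))
  then obtain x y where xy: "x \<in> X" "y \<in> Y" "pv p = x \<oplus> y" by (auto simp: set_add_def')
  have sub: "X \<subseteq> carrier (path_mod p)" "Y \<subseteq> carrier (path_mod p)"
    using subgroup.subset[OF submodule.axioms(1)[of X A "path_mod p"]]
      subgroup.subset[OF submodule.axioms(1)[of Y A "path_mod p"]] * by auto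
  have "cf x p + cf y p = 1"
    using xy(3) cf_add[OF path_mod_closed[OF subsetD[OF sub(1) xy(1)]] path_mod_closed[OF subsetD[OF sub(2) xy(2)]], of p] p
    by (simp add: cf_pv flip: xy(3))
  then have "cf x p \<noteq> 0 \<or> cf y p \<noteq> 0" by auto
  then show "X = {\<zero>\<^bsub>path_mod p\<^esub>} \<or> Y = {\<zero>\<^bsub>path_mod p\<^esub>}"
  proof
    assume "cf x p \<noteq> 0"
    then have "X = carrier (path_mod p)" using all[of X x] xy(1) * by blast
    then show ?thesis using * sub(2) by blast
  next
    assume "cf y p \<noteq> 0"
    then have "Y = carrier (path_mod p)" using all[of Y y] xy(2) * by blast
    then show ?thesis using * sub(1) by blast
  qed
qed

lemma finite_rank_stable_eq:
  assumes X: "left_module A X" and Y: "left_module A Y" and eq: "stable_eq A \<eta> X Y f g" and f: "f \<in> finite_rank_homs A X Y"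
  shows "g \<in> finite_rank_homs A X Y"
proof -
  interpret Y: left_module A Y by fact
  obtain r where r: "f \<in> lhom A X Y" "g \<in> lhom A X Y" "r \<in> finite_rank_homs A X Y"
    "\<And>x. x \<in> carrier X \<Longrightarrow> f x = g x \<oplus>\<^bsub>Y\<^esub> r x" using stable_eqE[OF X Y eq] by blast
  have rl: "r \<in> lhom A X Y" by (rule finite_rank_lhom[OF X Y r(3)])
  have fr: "(\<lambda>x\<in>carrier X. f x \<oplus>\<^bsub>Y\<^esub> (\<lambda>x\<in>carrier X. \<ominus>\<^bsub>Y\<^esub> r x) x) \<in> finite_rank_homs A X Y"
    by (rule finite_rank_add[OF X Y f finite_rank_uminus[OF X Y r(3)]])
  have "g = (\<lambda>x\<in>carrier X. f x \<oplus>\<^bsub>Y\<^esub> (\<lambda>x\<in>carrier X. \<ominus>\<^bsub>Y\<^esub> r x) x)"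
  proof (rule lhom_eqI[OF r(2) finite_rank_lhom[OF X Y fr]])
    fix x assume x: "x \<in> carrier X"
    show "g x = (\<lambda>x\<in>carrier X. f x \<oplus>\<^bsub>Y\<^esub> (\<lambda>x\<in>carrier X. \<ominus>\<^bsub>Y\<^esub> r x) x) x"
      using x lhom_closed[OF r(2) x] lhom_closed[OF rl x] by (simp add: r(4) Y.a_assoc Y.r_neg)
  qed
  then show ?thesis using fr by simp
qed

lemma finite_rank_stable_eq_zero:
  assumes X: "left_module A X" and Y: "left_module A Y" and eq: "stable_eq A \<eta> X Y f (zero_hom X Y)"
  shows "f \<in> finite_rank_homs A X Y"
  by (rule finite_rank_stable_eq[OF X Y stable_eq_sym[OF X Y eq] finite_rank_homs.zero])

text \<open>
  In a decomposition of \<open>Ap\<close> in the stable category one of the two idempotents is an isomorphism of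
  modules, because their sum involves \<open>p\<close> at \<open>p\<close>; the inclusion of the other summand then vanishes.
\<close>

lemma stable_summand_zero:
  assumes p: "p \<in> B" and Y: "left_module A Y" and Z: "left_module A Z"
    and i: "i \<in> lhom A Y (path_mod p)" and j: "j \<in> lhom A Z (path_mod p)"
    and u: "u \<in> lhom A (path_mod p) Y" and q: "q \<in> lhom A (path_mod p) Z"
    and uj: "stable_eq A \<eta> Z Y (compose (carrier Z) u j) (zero_hom Z Y)"
    and qj: "stable_eq A \<eta> Z Z (compose (carrier Z) q j) (id_hom Z)"
    and c: "cf (i (u (pv p))) p \<noteq> 0"
  shows "stable_zero A \<eta> Z"
proof -
  note X = left_module_path_mod[of p]
  let ?X = "path_mod p"
  define \<alpha> where "\<alpha> = compose (carrier ?X) i u"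
  have \<alpha>: "\<alpha> \<in> lhom A ?X ?X" unfolding \<alpha>_def by (rule lhom_compose[OF u i X])
  have "cf (\<alpha> (pv p)) p \<noteq> 0" using c pv_in_path_mod[of p] by (simp add: \<alpha>_def compose_def del: left_ideal_gen_simps(1))
  then have bij: "bij_betw \<alpha> (carrier ?X) (carrier ?X)" by (rule bij_betw_mult_generator[OF p \<alpha>])
  then obtain \<beta> where \<beta>: "\<beta> \<in> lhom A ?X ?X" "\<And>x. x \<in> carrier ?X \<Longrightarrow> \<beta> (\<alpha> x) = x"
  proof -
    assume thesis_rule: "\<And>\<beta>. \<beta> \<in> lhom A ?X ?X \<Longrightarrow> (\<And>x. x \<in> carrier ?X \<Longrightarrow> \<beta> (\<alpha> x) = x) \<Longrightarrow> thesis"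
    define \<beta> where "\<beta> = (\<lambda>y\<in>carrier ?X. inv_into (carrier ?X) \<alpha> y)"
    have \<beta>c: "\<beta> y \<in> carrier ?X" "\<alpha> (\<beta> y) = y" if "y \<in> carrier ?X" for y
      using that bij unfolding \<beta>_def restrict_apply'[OF that]
      by (simp_all only: bij_betw_inv_into_right) (metis bij_betw_def inv_into_into)
    have \<beta>\<alpha>: "\<beta> (\<alpha> x) = x" if "x \<in> carrier ?X" for x
      using that bij lhom_closed[OF \<alpha> that] unfolding \<beta>_def by (simp only: restrict_apply' bij_betw_inv_into_left)
    have "\<beta> \<in> lhom A ?X ?X"
    proof (rule lhomI)
      show "\<beta> (x \<oplus>\<^bsub>?X\<^esub> y) = \<beta> x \<oplus>\<^bsub>?X\<^esub> \<beta> y" if "x \<in> carrier ?X" "y \<in> carrier ?X" for x y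
        using \<beta>\<alpha>[OF left_module_add_closed[OF X \<beta>c(1)[OF that(1)] \<beta>c(1)[OF that(2)]]]
          lhom_add[OF \<alpha> \<beta>c(1)[OF that(1)] \<beta>c(1)[OF that(2)]] \<beta>c(2)[OF that(1)] \<beta>c(2)[OF that(2)] by simp
      show "\<beta> (a \<odot>\<^bsub>?X\<^esub> x) = a \<odot>\<^bsub>?X\<^esub> \<beta> x" if "a \<in> carrier A" "x \<in> carrier ?X" for a x
        using \<beta>\<alpha>[OF left_module_smult_closed[OF X that(1) \<beta>c(1)[OF that(2)]]]
          lhom_smult[OF \<alpha> that(1) \<beta>c(1)[OF that(2)]] \<beta>c(2)[OF that(2)] by simp
    qed (use \<beta>c in blast, simp only: \<beta>_def restrict_apply if_False)
    then show thesis using thesis_rule \<beta>\<alpha> by blast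
  qed
  have "compose (carrier Z) i (compose (carrier Z) u j) \<in> finite_rank_homs A Z ?X"
    by (rule finite_rank_comp_left[OF Z Y X finite_rank_stable_eq_zero[OF Z Y uj] i])
  then have "compose (carrier Z) \<beta> (compose (carrier Z) i (compose (carrier Z) u j)) \<in> finite_rank_homs A Z ?X"
    by (rule finite_rank_comp_left[OF Z X X _ \<beta>(1)])
  moreover have "compose (carrier Z) \<beta> (compose (carrier Z) i (compose (carrier Z) u j)) = j"
  proof (rule ext)
    fix z
    show "compose (carrier Z) \<beta> (compose (carrier Z) i (compose (carrier Z) u j)) z = j z"
      using \<beta>(2)[OF lhom_closed[OF j, of z]] lhom_closed[OF j, of z] lhom_undefined[OF j, of z]
      by (cases "z \<in> carrier Z") (simp_all add: compose_def \<alpha>_def del: left_ideal_gen_simps(1))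
  qed
  ultimately have "j \<in> finite_rank_homs A Z ?X" by simp
  then have "compose (carrier Z) q j \<in> finite_rank_homs A Z Z" by (rule finite_rank_comp_left[OF Z X Z _ q])
  then show ?thesis
    unfolding stable_zero_iff[OF Z] by (rule finite_rank_stable_eq[OF Z Z qj])
qed

text \<open>
  Modulo maps of finite rank the two idempotents add up to the identity, so one of them has a nonzero
  coefficient of \<open>p\<close> at \<open>p\<close>.
\<close>

lemma stable_indecomposable_path_mod:
  assumes p: "p \<in> B" "dead p bs"
  shows "stable_indecomposable A \<eta> (path_mod p)"
  unfolding stable_indecomposable_def
proof (intro conjI allI impI)
  note X = left_module_path_mod[of p]
  let ?X = "path_mod p"
  show "\<not> stable_zero A \<eta> ?X" unfolding stable_zero_iff[OF X] by (rule not_finite_rank_id_path_mod[OF p])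
  fix Y Z :: "('a, 'k) fmod"
  assume *: "gorenstein_projective A \<eta> Y \<and> gorenstein_projective A \<eta> Z \<and> stable_direct_sum A \<eta> ?X Y Z"
  have Y: "left_module A Y" and Z: "left_module A Z"
    using * by (auto intro: fd_module_left_module[OF gorenstein_projective_fd_module])
  obtain i j u q where i: "i \<in> lhom A Y ?X" and j: "j \<in> lhom A Z ?X" and u: "u \<in> lhom A ?X Y" and q: "q \<in> lhom A ?X Z"
    and ui: "stable_eq A \<eta> Y Y (compose (carrier Y) u i) (id_hom Y)"
    and qj: "stable_eq A \<eta> Z Z (compose (carrier Z) q j) (id_hom Z)"
    and uj: "stable_eq A \<eta> Z Y (compose (carrier Z) u j) (zero_hom Z Y)"
    and qi: "stable_eq A \<eta> Y Z (compose (carrier Y) q i) (zero_hom Y Z)"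
    and sum: "stable_eq A \<eta> ?X ?X (add_hom ?X ?X (compose (carrier ?X) i u) (compose (carrier ?X) j q)) (id_hom ?X)"
    using * unfolding stable_direct_sum_def by blast
  obtain r where r: "r \<in> finite_rank_homs A ?X ?X"
    "\<And>x. x \<in> carrier ?X \<Longrightarrow> add_hom ?X ?X (compose (carrier ?X) i u) (compose (carrier ?X) j q) x = id_hom ?X x \<oplus>\<^bsub>?X\<^esub> r x"
    using stable_eqE[OF X X sum] by blast
  have "pv (tgt p, bs) \<otimes> pv p = \<zero>" using p(2) by (subst mult_pv_eq_0_iff) (auto simp: cf_pv split: if_splits)
  then have r0: "cf (r (pv p)) p = 0"
    using p(2) by (intro finite_rank_cf_generator[OF X p(1) r(1) pv_in_path_mod, of bs]) (auto simp: dead_def)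
  have "i (u (pv p)) \<oplus> j (q (pv p)) = pv p \<oplus> r (pv p)"
    using r(2)[OF pv_in_path_mod] pv_in_path_mod[of p]
    by (simp add: add_hom_def compose_def id_hom_def del: left_ideal_gen_simps(1))
  moreover have "i (u (pv p)) \<in> carrier A" "j (q (pv p)) \<in> carrier A" "r (pv p) \<in> carrier A"
    by (rule path_mod_closed[OF lhom_closed[OF i lhom_closed[OF u pv_in_path_mod]]]
        path_mod_closed[OF lhom_closed[OF j lhom_closed[OF q pv_in_path_mod]]]
        path_mod_closed[OF lhom_closed[OF finite_rank_lhom[OF X X r(1)] pv_in_path_mod]])+
  ultimately have "cf (i (u (pv p))) p + cf (j (q (pv p))) p = 1"
    using r0 p(1) cf_add[of "i (u (pv p))" "j (q (pv p))" p] cf_add[of "pv p" "r (pv p)" p] by (simp add: cf_pv)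
  then have "cf (i (u (pv p))) p \<noteq> 0 \<or> cf (j (q (pv p))) p \<noteq> 0" by auto
  then show "stable_zero A \<eta> Y \<or> stable_zero A \<eta> Z"
    using stable_summand_zero[OF p(1) Y Z i j u q uj qj] stable_summand_zero[OF p(1) Z Y j i q u qi ui] by blast
qed

end

section \<open>Direct sum decompositions\<close>

lemma liso_prod_mod_singleton:
  assumes A: "ring A" and M: "left_module A (M k)"
  shows "liso A (prod_mod {k} M) (M k)"
proof -
  have lm: "left_module A (M j)" if "j \<in> {k}" for j using that M by simp
  have pr: "proj_hom {k} M k \<in> lhom A (prod_mod {k} M) (M k)" by (rule lhom_proj_hom[OF A lm]) simp_all
  have ij: "inj_hom {k} M k \<in> lhom A (M k) (prod_mod {k} M)" by (rule lhom_inj_hom[OF lm]) simp_all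
  have P: "left_module A (prod_mod {k} M)" by (rule left_module_prod_mod[OF A lm])
  show ?thesis
    unfolding liso_iff_inverse[OF P]
  proof (intro bexI[OF _ pr] bexI[OF _ ij] conjI ballI)
    fix f assume f: "f \<in> carrier (prod_mod {k} M)"
    then have fk: "f k \<in> carrier (M k)" by auto
    show "inj_hom {k} M k (proj_hom {k} M k f) = f"
      using f fk by (auto simp: inj_hom_def proj_hom_def PiE_def extensional_def fun_eq_iff)
  next
    fix x assume x: "x \<in> carrier (M k)"
    then show "proj_hom {k} M k (inj_hom {k} M k x) = x"
      using lhom_closed[OF ij x] by (simp add: proj_hom_def del: prod_mod_simps) (simp add: inj_hom_def)
  qed
qed

text \<open>
  One summand and the sum of the others are complementary submodules.
\<close>

lemma prod_mod_indecomposable_singleton: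
  assumes A: "ring A" and lm: "\<And>j. j \<in> J \<Longrightarrow> left_module A (M j)"
    and nz: "\<And>j. j \<in> J \<Longrightarrow> carrier (M j) \<noteq> {\<zero>\<^bsub>M j\<^esub>}" and ind: "indecomposable_module A (prod_mod J M)"
  shows "\<exists>k. J = {k}"
proof -
  have J: "J \<noteq> {}" using ind by (auto simp: indecomposable_module_def)
  then obtain k where k: "k \<in> J" by blast
  let ?P = "prod_mod J M"
  have P: "left_module A ?P" by (rule left_module_prod_mod[OF A lm])
  interpret P: left_module A ?P by (rule P)
  note cl = left_module_zero_closed[OF lm] left_module_add_closed[OF lm] left_module_smult_closed[OF lm]
  define S where "S D = {f \<in> carrier ?P. \<forall>j\<in>J - D. f j = \<zero>\<^bsub>M j\<^esub>}" for D
  have zero_add: "\<zero>\<^bsub>M j\<^esub> \<oplus>\<^bsub>M j\<^esub> x = x" "x \<oplus>\<^bsub>M j\<^esub> \<zero>\<^bsub>M j\<^esub> = x" if "j \<in> J" "x \<in> carrier (M j)" for j x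
    using left_module_abelian_group[OF lm[OF that(1)]] that(2)
    by (simp_all add: abelian_group.axioms(1) abelian_monoid.l_zero abelian_monoid.r_zero)
  have S: "submodule (S D) A ?P" for D
  proof (intro submodule.intro submodule_axioms.intro subgroup.intro)
    show "S D \<subseteq> carrier (add_monoid ?P)" by (auto simp: S_def)
    show "\<one>\<^bsub>add_monoid ?P\<^esub> \<in> S D" using P.M.zero_closed by (simp add: S_def)
    show "x \<otimes>\<^bsub>add_monoid ?P\<^esub> y \<in> S D" if "x \<in> S D" "y \<in> S D" for x y
      using that P.M.a_closed[of x y] cl(1) zero_add by (auto simp: S_def)
    show smult: "a \<odot>\<^bsub>?P\<^esub> x \<in> S D" if "a \<in> carrier A" "x \<in> S D" for a x
      using that P.smult_closed[of a x] left_module.smult_r_null[OF lm] by (auto simp: S_def)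
    show "inv\<^bsub>add_monoid ?P\<^esub> x \<in> S D" if x: "x \<in> S D" for x
    proof -
      have xc: "x \<in> carrier ?P" using x by (simp add: S_def)
      have "(\<ominus>\<^bsub>A\<^esub> \<one>\<^bsub>A\<^esub>) \<odot>\<^bsub>?P\<^esub> x = \<ominus>\<^bsub>?P\<^esub> x"
        using P.smult_l_minus[OF P.R.one_closed xc] P.smult_one[OF xc] by (simp only:)
      moreover have "(\<ominus>\<^bsub>A\<^esub> \<one>\<^bsub>A\<^esub>) \<odot>\<^bsub>?P\<^esub> x \<in> S D" by (rule smult[OF _ x]) simp
      ultimately show ?thesis by (simp only: a_inv_def)
    qed
  qed
  have "S {k} \<inter> S (J - {k}) = {\<zero>\<^bsub>?P\<^esub>}"
  proof (intro subset_antisym subsetI)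
    fix f assume f: "f \<in> S {k} \<inter> S (J - {k})"
    have "f = \<zero>\<^bsub>?P\<^esub>"
      by (rule PiE_ext[of _ J "\<lambda>j. carrier (M j)"]) (use f k cl(1) in \<open>auto simp: S_def\<close>)
    then show "f \<in> {\<zero>\<^bsub>?P\<^esub>}" by simp
  next
    fix f assume "f \<in> {\<zero>\<^bsub>?P\<^esub>}"
    then show "f \<in> S {k} \<inter> S (J - {k})" using P.M.zero_closed by (auto simp: S_def)
  qed
  moreover have "S {k} <+>\<^bsub>?P\<^esub> S (J - {k}) = carrier ?P"
  proof (intro subset_antisym subsetI)
    fix f assume "f \<in> S {k} <+>\<^bsub>?P\<^esub> S (J - {k})"
    then obtain g h where "g \<in> carrier ?P" "h \<in> carrier ?P" "f = g \<oplus>\<^bsub>?P\<^esub> h" unfolding set_add_def' S_def by blast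
    then show "f \<in> carrier ?P" using P.M.a_closed by blast
  next
    fix f assume f: "f \<in> carrier ?P"
    then have fc: "f j \<in> carrier (M j)" if "j \<in> J" for j using that by auto
    let ?g = "\<lambda>j\<in>J. if j = k then f j else \<zero>\<^bsub>M j\<^esub>" and ?h = "\<lambda>j\<in>J. if j = k then \<zero>\<^bsub>M j\<^esub> else f j"
    have "?g \<in> S {k}" "?h \<in> S (J - {k})" using fc cl(1) by (auto simp: S_def)
    moreover have "f = ?g \<oplus>\<^bsub>?P\<^esub> ?h"
      by (rule PiE_ext[of _ J "\<lambda>j. carrier (M j)"]) (use f fc zero_add cl in auto)
    ultimately show "f \<in> S {k} <+>\<^bsub>?P\<^esub> S (J - {k})" unfolding set_add_def' by blast
  qed
  ultimately have cases: "S {k} = {\<zero>\<^bsub>?P\<^esub>} \<or> S (J - {k}) = {\<zero>\<^bsub>?P\<^esub>}"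
    using ind S unfolding indecomposable_module_def by blast
  have nz_S: False if j: "j \<in> J" "j \<in> D" and D: "S D = {\<zero>\<^bsub>?P\<^esub>}" for j D
  proof -
    obtain x where x: "x \<in> carrier (M j)" "x \<noteq> \<zero>\<^bsub>M j\<^esub>" using nz[OF j(1)] cl(1)[OF j(1)] by blast
    have "(\<lambda>i\<in>J. if i = j then x else \<zero>\<^bsub>M i\<^esub>) \<in> S D" using x(1) j cl(1) by (auto simp: S_def)
    then have "(\<lambda>i\<in>J. if i = j then x else \<zero>\<^bsub>M i\<^esub>) = \<zero>\<^bsub>?P\<^esub>" unfolding D by blast
    from fun_cong[OF this, of j] show False using x(2) j(1) by simp
  qed
  from cases have "j \<notin> J - {k}" for j
  proof
    assume "S {k} = {\<zero>\<^bsub>?P\<^esub>}"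
    then have False by (rule nz_S[OF k singletonI])
    then show ?thesis by simp
  next
    assume *: "S (J - {k}) = {\<zero>\<^bsub>?P\<^esub>}"
    show ?thesis using nz_S[OF _ _ *, of j] by (metis DiffD1)
  qed
  then have "J \<subseteq> {k}" by blast
  then have "J = {k}" using k by blast
  then show ?thesis ..
qed

text \<open>
  Summands with an identity of finite rank are invisible in the stable category.
\<close>

lemma (in fd_algebra) stable_direct_sum_prod_mod:
  assumes fin: "finite J" and lm: "\<And>j. j \<in> J \<Longrightarrow> left_module A (M j)" and D: "D1 \<subseteq> J" "D2 \<subseteq> J" "D1 \<inter> D2 = {}"
    and id: "\<And>j. j \<in> J - (D1 \<union> D2) \<Longrightarrow> id_hom (M j) \<in> finite_rank_homs A (M j) (M j)"
  shows "stable_direct_sum A \<eta> (prod_mod J M) (prod_mod D1 M) (prod_mod D2 M)"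
proof -
  note cl = left_module_zero_closed[OF lm]
  have zero_add: "\<zero>\<^bsub>M j\<^esub> \<oplus>\<^bsub>M j\<^esub> x = x" "x \<oplus>\<^bsub>M j\<^esub> \<zero>\<^bsub>M j\<^esub> = x" if "j \<in> J" "x \<in> carrier (M j)" for j x
    using left_module_abelian_group[OF lm[OF that(1)]] that(2)
    by (simp_all add: abelian_group.axioms(1) abelian_monoid.l_zero abelian_monoid.r_zero)
  have PJ: "left_module A (prod_mod D M)" if "D \<subseteq> J" for D
    by (rule left_module_prod_mod[OF ring_axioms lm]) (use that in blast)
  define inc where "inc D = (\<lambda>f\<in>carrier (prod_mod D M). \<lambda>j\<in>J. if j \<in> D then f j else \<zero>\<^bsub>M j\<^esub>)" for D
  define res where "res D = (\<lambda>f\<in>carrier (prod_mod J M). \<lambda>j\<in>D. f j)" for D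
  have inc: "inc D \<in> lhom A (prod_mod D M) (prod_mod J M)" if "D \<subseteq> J" for D
    unfolding inc_def
    by (rule lhom_restrictI[OF PJ[OF that]])
      (use that cl zero_add left_module.smult_r_null[OF lm] in \<open>auto intro!: restrict_ext\<close>)
  have res: "res D \<in> lhom A (prod_mod J M) (prod_mod D M)" if "D \<subseteq> J" for D
    unfolding res_def
    by (rule lhom_restrictI[OF PJ[OF subset_refl]])
      (use that in \<open>auto intro!: restrict_ext simp: Int_absorb1 subsetD\<close>)
  have res_inc: "compose (carrier (prod_mod D M)) (res D) (inc D) = id_hom (prod_mod D M)" if "D \<subseteq> J" for D
  proof (rule ext)
    fix f
    show "compose (carrier (prod_mod D M)) (res D) (inc D) f = id_hom (prod_mod D M) f"
    proof (cases "f \<in> carrier (prod_mod D M)")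
      case True
      have "(\<lambda>j\<in>D. inc D f j) = f"
        using True that by (auto simp: inc_def PiE_def extensional_def fun_eq_iff)
      then show ?thesis
        using True lhom_closed[OF inc[OF that] True] by (simp add: compose_def res_def id_hom_def del: prod_mod_simps)
    qed (simp add: compose_def id_hom_def del: prod_mod_simps)
  qed
  have res_inc0: "compose (carrier (prod_mod D' M)) (res D) (inc D') = zero_hom (prod_mod D' M) (prod_mod D M)"
    if "D \<subseteq> J" "D' \<subseteq> J" "D \<inter> D' = {}" for D D'
  proof (rule ext)
    fix f
    show "compose (carrier (prod_mod D' M)) (res D) (inc D') f = zero_hom (prod_mod D' M) (prod_mod D M) f"
    proof (cases "f \<in> carrier (prod_mod D' M)")
      case True
      have "(\<lambda>j\<in>D. inc D' f j) = (\<lambda>j\<in>D. \<zero>\<^bsub>M j\<^esub>)"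
        using True that by (intro restrict_ext) (auto simp: inc_def)
      then show ?thesis
        using True lhom_closed[OF inc[OF that(2)] True]
        by (simp add: compose_def res_def zero_hom_def del: prod_mod_simps(1))
    qed (simp add: compose_def zero_hom_def del: prod_mod_simps)
  qed
  let ?P = "prod_mod J M"
  let ?s = "add_hom ?P ?P (compose (carrier ?P) (inc D1) (res D1)) (compose (carrier ?P) (inc D2) (res D2))"
  note P = PJ[OF subset_refl]
  have s: "?s \<in> lhom A ?P ?P"
    by (rule lhom_add_hom[OF P P lhom_compose[OF res[OF D(1)] inc[OF D(1)] P] lhom_compose[OF res[OF D(2)] inc[OF D(2)] P]])
  have "stable_eq A \<eta> ?P ?P (id_hom ?P) ?s"
  proof (rule stable_eqI[OF P P lhom_id[OF P] s finite_rank_partial_id_prod_mod[OF ring_axioms lm fin, where D = "J - (D1 \<union> D2)"]])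
    show "J - (D1 \<union> D2) \<subseteq> J" by blast
    fix f assume f: "f \<in> carrier ?P"
    then have fc: "f j \<in> carrier (M j)" if "j \<in> J" for j using that by auto
    have r: "res D1 f \<in> carrier (prod_mod D1 M)" "res D2 f \<in> carrier (prod_mod D2 M)"
      using lhom_closed[OF res[OF D(1)] f] lhom_closed[OF res[OF D(2)] f] by blast+
    show "id_hom ?P f = ?s f \<oplus>\<^bsub>?P\<^esub> (\<lambda>f\<in>carrier ?P. \<lambda>j\<in>J. if j \<in> J - (D1 \<union> D2) then f j else \<zero>\<^bsub>M j\<^esub>) f"
    proof (rule PiE_ext[of _ J "\<lambda>j. carrier (M j)"])
      show "id_hom ?P f \<in> (\<Pi>\<^sub>E j\<in>J. carrier (M j))" using f by (simp add: id_hom_def)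
      show "?s f \<oplus>\<^bsub>?P\<^esub> (\<lambda>f\<in>carrier ?P. \<lambda>j\<in>J. if j \<in> J - (D1 \<union> D2) then f j else \<zero>\<^bsub>M j\<^esub>) f \<in> (\<Pi>\<^sub>E j\<in>J. carrier (M j))"
      proof -
        have "(\<lambda>f\<in>carrier ?P. \<lambda>j\<in>J. if j \<in> J - (D1 \<union> D2) then f j else \<zero>\<^bsub>M j\<^esub>) f \<in> carrier ?P"
          using f fc cl by auto
        from left_module_add_closed[OF P lhom_closed[OF s f] this] show ?thesis by (simp only: prod_mod_simps(1))
      qed
      fix j assume j: "j \<in> J"
      have i1: "inc D1 (res D1 f) j = (if j \<in> D1 then f j else \<zero>\<^bsub>M j\<^esub>)"
        using r(1) j f unfolding inc_def by (simp del: prod_mod_simps) (simp add: res_def del: prod_mod_simps)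
      have i2: "inc D2 (res D2 f) j = (if j \<in> D2 then f j else \<zero>\<^bsub>M j\<^esub>)"
        using r(2) j f unfolding inc_def by (simp del: prod_mod_simps) (simp add: res_def del: prod_mod_simps)
      have s_app: "?s f j = inc D1 (res D1 f) j \<oplus>\<^bsub>M j\<^esub> inc D2 (res D2 f) j"
        using f j by (simp add: add_hom_def compose_def)
      show "id_hom ?P f j = (?s f \<oplus>\<^bsub>?P\<^esub> (\<lambda>f\<in>carrier ?P. \<lambda>j\<in>J. if j \<in> J - (D1 \<union> D2) then f j else \<zero>\<^bsub>M j\<^esub>) f) j"
        using f j D(3) fc[OF j] cl[OF j] zero_add[OF j] unfolding prod_mod_simps(3) restrict_apply'[OF j] s_app i1 i2
        by (auto simp: id_hom_def)
    qed
  qed (assumption, erule id)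
  then have "stable_eq A \<eta> ?P ?P ?s (id_hom ?P)" by (rule stable_eq_sym[OF P P])
  moreover have "D2 \<inter> D1 = {}" using D(3) by blast
  ultimately show ?thesis
    unfolding stable_direct_sum_def
    using inc[OF D(1)] inc[OF D(2)] res[OF D(1)] res[OF D(2)] res_inc[OF D(1)] res_inc[OF D(2)]
      res_inc0[OF D] res_inc0[OF D(2,1)]
      stable_eq_refl[OF PJ[OF D(1)] PJ[OF D(1)] lhom_id[OF PJ[OF D(1)]]]
      stable_eq_refl[OF PJ[OF D(2)] PJ[OF D(2)] lhom_id[OF PJ[OF D(2)]]]
      stable_eq_refl[OF PJ[OF D(1)] PJ[OF D(2)] lhom_zero_hom[OF PJ[OF D(1)] PJ[OF D(2)]]]
      stable_eq_refl[OF PJ[OF D(2)] PJ[OF D(1)] lhom_zero_hom[OF PJ[OF D(2)] PJ[OF D(1)]]]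
    by (intro bexI[of _ "inc D1"] bexI[of _ "inc D2"] bexI[of _ "res D1"] bexI[of _ "res D2"]) (simp_all only: simp_thms)
qed

section \<open>The classification over a monomial algebra\<close>

context monomial_algebra
begin

text \<open>
  \<open>Ap\<close> is not on the carrier type of the isomorphism classes, but a copy of it is.
\<close>

lemma path_mod_copy:
  obtains N :: "('a, 'k) fmod" where "left_module A N" "fd_module A \<eta> N" "liso A (path_mod p) N" "liso A N (path_mod p)"
proof -
  obtain N :: "('a, 'k) fmod" where N: "left_module A N" "liso A (path_mod p) N"
    using fd_module_copy[OF fd_module_path_mod] by blast
  show ?thesis
    by (rule that[OF N(1) fd_module_liso[OF fd_module_path_mod N] N(2) liso_sym[OF left_module_path_mod N]])
qed

lemma iso_class_eq:
  assumes X: "left_module A X" and Y: "left_module A Y" and iso: "liso A X Y"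
  shows "iso_class A \<eta> X = iso_class A \<eta> Y"
  unfolding iso_class_def using liso_trans[OF X iso] liso_trans[OF Y liso_sym[OF X Y iso]] by blast

lemma stable_class_eq:
  assumes X: "left_module A X" and Y: "left_module A Y" and iso: "stable_iso A \<eta> X Y"
  shows "stable_class A \<eta> X = stable_class A \<eta> Y"
proof -
  have lm: "left_module A N" if "gorenstein_projective A \<eta> N" for N :: "('a, 'k) fmod"
    by (rule fd_module_left_module[OF gorenstein_projective_fd_module[OF that]])
  show ?thesis
    unfolding stable_class_def
    using stable_iso_trans[OF X Y lm iso] stable_iso_trans[OF Y X lm stable_iso_sym[OF iso]] by blast
qed

lemma perfect_eq_if_stable_iso:
  assumes p: "perfect p" and q: "perfect q" and iso: "stable_iso A \<eta> (path_mod p) (path_mod q)"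
  shows "p = q"
proof -
  obtain bs where bs: "dead p bs" using perfect_dead[OF p] by blast
  show ?thesis
    by (rule perfect_similar_eq[OF p q stable_iso_similar[OF perfect_in_B[OF p] bs perfect_in_B[OF q] iso]])
qed

lemma finite_rank_id_prod_path_mod:
  assumes "finite \<Gamma>" "\<And>g. g \<in> \<Gamma> \<Longrightarrow> fst g \<in> B" "\<And>g bs. g \<in> \<Gamma> \<Longrightarrow> \<not> dead (fst g) bs"
  shows "id_hom (prod_mod \<Gamma> (\<lambda>g. path_mod (fst g))) \<in>
    finite_rank_homs A (prod_mod \<Gamma> (\<lambda>g. path_mod (fst g))) (prod_mod \<Gamma> (\<lambda>g. path_mod (fst g)))"
  by (rule finite_rank_id_prod_mod[OF ring_axioms left_module_path_mod assms(1) finite_rank_id_path_mod[OF assms(2,3)]])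

text \<open>
  For surjectivity, an indecomposable module is a single summand of its decomposition; this summand is not
  projective, hence is given by a perfect path.
\<close>

theorem perfect_paths_iso_classes:
  "bij_betw (\<lambda>p. iso_class A \<eta> (path_mod p)) {p. perfect p} (ind_nonproj_Gproj A \<eta>)"
  unfolding bij_betw_def
proof
  show "inj_on (\<lambda>p. iso_class A \<eta> (path_mod p)) {p. perfect p}"
  proof (rule inj_onI)
    fix p q assume pq: "p \<in> {p. perfect p}" "q \<in> {p. perfect p}" "iso_class A \<eta> (path_mod p) = iso_class A \<eta> (path_mod q)"
    obtain N :: "('a, 'k) fmod" where N: "left_module A N" "fd_module A \<eta> N" "liso A (path_mod p) N"
      using path_mod_copy by blast
    then have "N \<in> iso_class A \<eta> (path_mod q)" unfolding pq(3)[symmetric] by (simp add: iso_class_def)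
    then have "liso A (path_mod q) N" by (simp add: iso_class_def)
    then have "liso A (path_mod p) (path_mod q)"
      using liso_trans[OF left_module_path_mod N(3) liso_sym[OF left_module_path_mod N(1)]] by blast
    then show "p = q"
      using perfect_eq_if_stable_iso stable_iso_liso[OF left_module_path_mod left_module_path_mod] pq(1,2) by blast
  qed
  show "(\<lambda>p. iso_class A \<eta> (path_mod p)) ` {p. perfect p} = ind_nonproj_Gproj A \<eta>"
  proof (intro subset_antisym subsetI)
    fix c assume "c \<in> (\<lambda>p. iso_class A \<eta> (path_mod p)) ` {p. perfect p}"
    then obtain p where p: "perfect p" "c = iso_class A \<eta> (path_mod p)" by blast
    note pB = perfect_in_B[OF p(1)]
    obtain N :: "('a, 'k) fmod" where N: "left_module A N" "fd_module A \<eta> N" "liso A (path_mod p) N" "liso A N (path_mod p)"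
      using path_mod_copy by blast
    have "gorenstein_projective A \<eta> N"
      by (rule gorenstein_projective_liso[OF perfect_gorenstein_projective[OF p(1)] N(2,4)])
    moreover have "indecomposable_module A N"
      by (rule indecomposable_module_liso[OF left_module_path_mod N(1,3) indecomposable_path_mod[OF pB]])
    moreover have "\<not> projective A \<eta> N"
    proof
      assume "projective A \<eta> N"
      then have "id_hom (path_mod p) \<in> finite_rank_homs A (path_mod p) (path_mod p)"
        by (rule finite_rank_id_liso[OF N(1) left_module_path_mod N(4) finite_rank_id_if_projective])
      then show False using not_finite_rank_id_path_mod[OF pB] perfect_dead[OF p(1)] by blast
    qed
    moreover have "c = iso_class A \<eta> N" unfolding p(2) by (rule iso_class_eq[OF left_module_path_mod N(1,3)])
    ultimately show "c \<in> ind_nonproj_Gproj A \<eta>" unfolding ind_nonproj_Gproj_def by blast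
  next
    fix c assume "c \<in> ind_nonproj_Gproj A \<eta>"
    then obtain M :: "('a, 'k) fmod" where M: "gorenstein_projective A \<eta> M" "indecomposable_module A M"
      "\<not> projective A \<eta> M" "c = iso_class A \<eta> M" unfolding ind_nonproj_Gproj_def by blast
    note fdM = gorenstein_projective_fd_module[OF M(1)]
    note lmM = fd_module_left_module[OF fdM]
    obtain \<Gamma> :: "(('v \<times> 'e list) \<times> (nat \<Rightarrow> 'k)) set" where \<Gamma>: "finite \<Gamma>" "\<And>g. g \<in> \<Gamma> \<Longrightarrow> fst g \<in> B"
      "liso A (prod_mod \<Gamma> (\<lambda>g. path_mod (fst g))) M"
      "\<And>g bs. g \<in> \<Gamma> \<Longrightarrow> dead (fst g) bs \<Longrightarrow> \<exists>p. perfect p \<and> similar p (fst g)"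
      using gorenstein_projective_decomposition[OF M(1)] by blast
    let ?PM = "prod_mod \<Gamma> (\<lambda>g. path_mod (fst g))"
    have PM: "left_module A ?PM" by (rule left_module_prod_mod[OF ring_axioms left_module_path_mod])
    have "indecomposable_module A ?PM"
      by (rule indecomposable_module_liso[OF lmM PM liso_sym[OF PM lmM \<Gamma>(3)] M(2)])
    moreover have "carrier (path_mod (fst g)) \<noteq> {\<zero>\<^bsub>path_mod (fst g)\<^esub>}" if "g \<in> \<Gamma>" for g
      using indecomposable_path_mod[OF \<Gamma>(2)[OF that]] unfolding indecomposable_module_def by blast
    ultimately obtain k where k: "\<Gamma> = {k}"
      using prod_mod_indecomposable_singleton[OF ring_axioms, of \<Gamma> "\<lambda>g. path_mod (fst g)"] left_module_path_mod by blast
    have "\<exists>bs. dead (fst k) bs"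
    proof (rule ccontr)
      assume "\<not> ?thesis"
      then have "id_hom ?PM \<in> finite_rank_homs A ?PM ?PM"
        using finite_rank_id_prod_path_mod[OF \<Gamma>(1,2)] k by blast
      then have "projective A \<eta> M"
        by (intro projective_if_finite_rank_id[OF fdM] finite_rank_id_liso[OF PM lmM \<Gamma>(3)])
      then show False using M(3) by blast
    qed
    then obtain p where p: "perfect p" "similar p (fst k)" using \<Gamma>(4)[of k] k by blast
    have "liso A ?PM (path_mod (fst k))" unfolding k
      by (rule liso_prod_mod_singleton[of A "\<lambda>g. path_mod (fst g)", OF ring_axioms left_module_path_mod])
    then have "liso A (path_mod (fst k)) M"
      using liso_trans[OF left_module_path_mod liso_sym[OF PM left_module_path_mod] \<Gamma>(3)] by blast
    then have "liso A (path_mod p) M" by (rule liso_trans[OF left_module_path_mod similar_liso[OF p(2)]])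
    then have "c = iso_class A \<eta> (path_mod p)" unfolding M(4) by (rule iso_class_eq[OF left_module_path_mod lmM, symmetric])
    then show "c \<in> (\<lambda>p. iso_class A \<eta> (path_mod p)) ` {p. perfect p}" using p(1) by blast
  qed
qed

text \<open>
  For surjectivity, projective summands are dropped, one of the remaining summands is split off, and the complement
  must be trivial in the stable category. Both parts are Gorenstein-projective as products of modules
  \<open>Ap\<close> with \<open>p\<close> perfect.
\<close>

theorem perfect_paths_stable_classes:
  "bij_betw (\<lambda>p. stable_class A \<eta> (path_mod p)) {p. perfect p} (ind_stable_Gproj A \<eta>)"
  unfolding bij_betw_def
proof
  show "inj_on (\<lambda>p. stable_class A \<eta> (path_mod p)) {p. perfect p}"
  proof (rule inj_onI)
    fix p q assume pq: "p \<in> {p. perfect p}" "q \<in> {p. perfect p}" "stable_class A \<eta> (path_mod p) = stable_class A \<eta> (path_mod q)"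
    obtain N :: "('a, 'k) fmod" where N: "left_module A N" "fd_module A \<eta> N" "liso A (path_mod p) N" "liso A N (path_mod p)"
      using path_mod_copy by blast
    have pN: "stable_iso A \<eta> (path_mod p) N" by (rule stable_iso_liso[OF left_module_path_mod N(1,3)])
    have "gorenstein_projective A \<eta> N"
      using gorenstein_projective_liso[OF perfect_gorenstein_projective N(2,4)] pq(1) by blast
    then have "N \<in> stable_class A \<eta> (path_mod q)" using pN unfolding pq(3)[symmetric] by (simp add: stable_class_def)
    then have "stable_iso A \<eta> (path_mod q) N" by (simp add: stable_class_def)
    then have "stable_iso A \<eta> (path_mod p) (path_mod q)"
      by (rule stable_iso_trans[OF left_module_path_mod N(1) left_module_path_mod pN stable_iso_sym])
    then show "p = q" using perfect_eq_if_stable_iso pq(1,2) by blast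
  qed
  show "(\<lambda>p. stable_class A \<eta> (path_mod p)) ` {p. perfect p} = ind_stable_Gproj A \<eta>"
  proof (intro subset_antisym subsetI)
    fix c assume "c \<in> (\<lambda>p. stable_class A \<eta> (path_mod p)) ` {p. perfect p}"
    then obtain p where p: "perfect p" "c = stable_class A \<eta> (path_mod p)" by blast
    obtain bs where bs: "dead p bs" using perfect_dead[OF p(1)] by blast
    obtain N :: "('a, 'k) fmod" where N: "left_module A N" "fd_module A \<eta> N" "liso A (path_mod p) N" "liso A N (path_mod p)"
      using path_mod_copy by blast
    have "gorenstein_projective A \<eta> N"
      by (rule gorenstein_projective_liso[OF perfect_gorenstein_projective[OF p(1)] N(2,4)])
    moreover have "stable_indecomposable A \<eta> N"
      by (rule stable_indecomposable_liso[OF left_module_path_mod N(1,3) stable_indecomposable_path_mod[OF perfect_in_B[OF p(1)] bs]])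
    moreover have "c = stable_class A \<eta> N" unfolding p(2)
      by (rule stable_class_eq[OF left_module_path_mod N(1) stable_iso_liso[OF left_module_path_mod N(1,3)]])
    ultimately show "c \<in> ind_stable_Gproj A \<eta>" unfolding ind_stable_Gproj_def by blast
  next
    fix c assume "c \<in> ind_stable_Gproj A \<eta>"
    then obtain M :: "('a, 'k) fmod" where M: "gorenstein_projective A \<eta> M" "stable_indecomposable A \<eta> M"
      "c = stable_class A \<eta> M" unfolding ind_stable_Gproj_def by blast
    note lmM = fd_module_left_module[OF gorenstein_projective_fd_module[OF M(1)]]
    obtain \<Gamma> :: "(('v \<times> 'e list) \<times> (nat \<Rightarrow> 'k)) set" where \<Gamma>: "finite \<Gamma>" "\<And>g. g \<in> \<Gamma> \<Longrightarrow> fst g \<in> B"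
      "liso A (prod_mod \<Gamma> (\<lambda>g. path_mod (fst g))) M"
      "\<And>g bs. g \<in> \<Gamma> \<Longrightarrow> dead (fst g) bs \<Longrightarrow> \<exists>p. perfect p \<and> similar p (fst g)"
      using gorenstein_projective_decomposition[OF M(1)] by blast
    let ?PM = "\<lambda>D. prod_mod D (\<lambda>g. path_mod (fst g))"
    have PM: "left_module A (?PM D)" for D by (rule left_module_prod_mod[OF ring_axioms left_module_path_mod])
    define D where "D = {g \<in> \<Gamma>. \<exists>bs. dead (fst g) bs}"
    have "D \<noteq> {}"
    proof
      assume "D = {}"
      then have "id_hom (?PM \<Gamma>) \<in> finite_rank_homs A (?PM \<Gamma>) (?PM \<Gamma>)"
        using finite_rank_id_prod_path_mod[OF \<Gamma>(1,2)] unfolding D_def by blast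
      then have "stable_zero A \<eta> M"
        unfolding stable_zero_iff[OF lmM] by (rule finite_rank_id_liso[OF PM lmM \<Gamma>(3)])
      then show False using M(2) unfolding stable_indecomposable_def by blast
    qed
    then obtain k where k: "k \<in> D" by blast
    have gp: "gorenstein_projective A \<eta> (path_mod (fst g))" if "g \<in> D" for g
    proof -
      obtain p where p: "perfect p" "similar p (fst g)" using \<Gamma>(4) \<open>g \<in> D\<close> unfolding D_def by blast
      show ?thesis
        by (rule gorenstein_projective_liso[OF perfect_gorenstein_projective[OF p(1)] fd_module_path_mod
              liso_sym[OF left_module_path_mod left_module_path_mod similar_liso[OF p(2)]]])
    qed
    have finD: "finite D" using \<Gamma>(1) unfolding D_def by simp
    have gpY: "gorenstein_projective A \<eta> (?PM {k})"
      by (rule gorenstein_projective_prod_mod) (use gp k in auto)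
    have gpZ: "gorenstein_projective A \<eta> (?PM (D - {k}))"
      by (rule gorenstein_projective_prod_mod) (use gp finD in auto)
    obtain Y :: "('a, 'k) fmod" where Y: "left_module A Y" "liso A (?PM {k}) Y"
      using fd_module_copy[OF gorenstein_projective_fd_module[OF gpY]] by blast
    obtain Z :: "('a, 'k) fmod" where Z: "left_module A Z" "liso A (?PM (D - {k})) Z"
      using fd_module_copy[OF gorenstein_projective_fd_module[OF gpZ]] by blast
    have GY: "gorenstein_projective A \<eta> Y"
      by (rule gorenstein_projective_liso[OF gpY fd_module_liso[OF gorenstein_projective_fd_module[OF gpY] Y] liso_sym[OF PM Y]])
    have GZ: "gorenstein_projective A \<eta> Z"
      by (rule gorenstein_projective_liso[OF gpZ fd_module_liso[OF gorenstein_projective_fd_module[OF gpZ] Z] liso_sym[OF PM Z]])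
    have "stable_direct_sum A \<eta> (?PM \<Gamma>) (?PM {k}) (?PM (D - {k}))"
    proof (rule stable_direct_sum_prod_mod[OF \<Gamma>(1) left_module_path_mod])
      show "{k} \<subseteq> \<Gamma>" "D - {k} \<subseteq> \<Gamma>" "{k} \<inter> (D - {k}) = {}" using k by (auto simp: D_def)
      show "id_hom (path_mod (fst g)) \<in> finite_rank_homs A (path_mod (fst g)) (path_mod (fst g))"
        if "g \<in> \<Gamma> - ({k} \<union> (D - {k}))" for g
        by (rule finite_rank_id_path_mod) (use that \<Gamma>(2) k in \<open>auto simp: D_def\<close>)
    qed
    then have sum: "stable_direct_sum A \<eta> M Y Z"
      by (rule stable_direct_sum_liso[OF PM PM PM lmM Y(1) Z(1) \<Gamma>(3) Y(2) Z(2)])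
    obtain p where p: "perfect p" "similar p (fst k)" using \<Gamma>(4) k unfolding D_def by blast
    have "liso A (path_mod (fst k)) Y"
      by (rule liso_trans[OF left_module_path_mod liso_sym[OF PM left_module_path_mod
            liso_prod_mod_singleton[of A "\<lambda>g. path_mod (fst g)", OF ring_axioms left_module_path_mod]] Y(2)])
    then have pY: "liso A (path_mod p) Y" by (rule liso_trans[OF left_module_path_mod similar_liso[OF p(2)]])
    have "\<not> stable_zero A \<eta> Y"
    proof
      assume "stable_zero A \<eta> Y"
      then have "stable_zero A \<eta> (path_mod p)"
        by (rule stable_zero_liso[OF Y(1) left_module_path_mod liso_sym[OF left_module_path_mod Y(1) pY]])
      then show False
        using not_finite_rank_id_path_mod[OF perfect_in_B[OF p(1)]] perfect_dead[OF p(1)]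
        unfolding stable_zero_iff[OF left_module_path_mod] by blast
    qed
    then have "stable_zero A \<eta> Z" using M(2) GY GZ sum unfolding stable_indecomposable_def by blast
    then have "stable_iso A \<eta> Y M" by (rule stable_direct_sum_zero[OF lmM Y(1) Z(1) sum])
    then have "stable_iso A \<eta> (path_mod p) M"
      by (rule stable_iso_trans[OF left_module_path_mod Y(1) lmM stable_iso_liso[OF left_module_path_mod Y(1) pY]])
    then have "c = stable_class A \<eta> (path_mod p)"
      unfolding M(3) by (rule stable_class_eq[OF left_module_path_mod lmM, symmetric])
    then show "c \<in> (\<lambda>p. stable_class A \<eta> (path_mod p)) ` {p. perfect p}" using p(1) by blast
  qed
qed

end

section \<open>Quivers with monomial relations\<close>

locale monomial_quiver_algebra = fin_digraph Q + ideal I "path_algebra Q"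
  for Q :: "('v, 'e) pre_digraph" and I :: "(('v, 'e) qpath \<Rightarrow> 'k::field) set" +
  fixes S :: "('v, 'e) qpath set" and d :: nat
  assumes S_paths: "S \<subseteq> qpaths Q" and I_generated: "I = Idl\<^bsub>path_algebra Q\<^esub> (path_vec ` S)"
    and nilpotent: "arrow_ideal Q [^]\<^bsub>ideals_set (path_algebra Q)\<^esub> d \<subseteq> I"
begin

abbreviation end_vertex :: "'v \<Rightarrow> 'e list \<Rightarrow> 'v" where
  "end_vertex v as \<equiv> ptgt Q (v, as)"

abbreviation K :: "(('v, 'e) qpath \<Rightarrow> 'k) ring" where
  "K \<equiv> path_algebra Q"

lemma end_vertex_Nil: "end_vertex v [] = v" by (simp add: ptgt_def)

lemma end_vertex_append: "end_vertex v (as @ bs) = end_vertex (end_vertex v as) bs"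
  by (simp add: ptgt_def awalk_verts_conv)

lemma qpaths_append: "(v, as @ bs) \<in> qpaths Q \<longleftrightarrow> (v, as) \<in> qpaths Q \<and> (end_vertex v as, bs) \<in> qpaths Q"
  unfolding qpaths_def psrc_def mem_Collect_eq fst_conv snd_conv end_vertex_append awalk_append_iff
  by (simp add: ptgt_def)

lemma qpaths_take: "(v, as) \<in> qpaths Q \<Longrightarrow> (v, take k as) \<in> qpaths Q"
  using qpaths_append[of v "take k as" "drop k as"] by simp

lemma qpaths_drop: "(v, as) \<in> qpaths Q \<Longrightarrow> (end_vertex v (take k as), drop k as) \<in> qpaths Q"
  using qpaths_append[of v "take k as" "drop k as"] by simp

lemma K_carrier: "f \<in> carrier K \<longleftrightarrow> finite {p. f p \<noteq> 0} \<and> (\<forall>p. f p \<noteq> 0 \<longrightarrow> p \<in> qpaths Q)"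
  by (auto simp: path_algebra_def)

lemma K_add: "f \<oplus>\<^bsub>K\<^esub> g = (\<lambda>p. f p + g p)" by (simp add: path_algebra_def)

lemma K_zero: "\<zero>\<^bsub>K\<^esub> = (\<lambda>p. 0)" by (simp add: path_algebra_def)

lemma K_one: "\<one>\<^bsub>K\<^esub> p = (if p \<in> qpaths Q \<and> snd p = [] then 1 else 0)"
  by (simp add: path_algebra_def plength_def)

lemma K_uminus: "f \<in> carrier K \<Longrightarrow> (\<ominus>\<^bsub>K\<^esub> f) p = - f p"
  using fun_cong[OF l_neg[of f], of p] by (simp add: K_add K_zero eq_neg_iff_add_eq_0)

lemma K_mult_eq_0: "r \<notin> qpaths Q \<Longrightarrow> (f \<otimes>\<^bsub>K\<^esub> g) r = 0"
proof -
  assume r: "r \<notin> qpaths Q"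
  have "{(p, q). p \<in> qpaths Q \<and> q \<in> qpaths Q \<and> psrc p = ptgt Q q \<and> pcomp p q = r} = {}"
    using r qpaths_append by (auto simp: pcomp_def psrc_def)
  then show ?thesis by (simp only: path_algebra_def monoid.simps sum.empty)
qed

text \<open>A factorisation of a path is determined by the length of its right factor.\<close>

lemma K_mult:
  assumes r: "(v, as) \<in> qpaths Q"
  shows "(f \<otimes>\<^bsub>K\<^esub> g) (v, as) =
    (\<Sum>k\<le>length as. f (end_vertex v (take k as), drop k as) * g (v, take k as))"
proof -
  let ?h = "\<lambda>k. ((end_vertex v (take k as), drop k as), (v, take k as))"
  have "{(p, q). p \<in> qpaths Q \<and> q \<in> qpaths Q \<and> psrc p = ptgt Q q \<and> pcomp p q = (v, as)} = ?h ` {..length as}"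
  proof (intro subset_antisym subsetI)
    fix x assume "x \<in> {(p, q). p \<in> qpaths Q \<and> q \<in> qpaths Q \<and> psrc p = ptgt Q q \<and> pcomp p q = (v, as)}"
    then obtain p q where x: "x = (p, q)" "fst p = ptgt Q q" "fst q = v" "snd q @ snd p = as"
      by (auto simp: pcomp_def psrc_def)
    then have "x = ?h (length (snd q))" by (auto simp: prod_eq_iff)
    then show "x \<in> ?h ` {..length as}" using x(4) by auto
  next
    fix x assume "x \<in> ?h ` {..length as}"
    then show "x \<in> {(p, q). p \<in> qpaths Q \<and> q \<in> qpaths Q \<and> psrc p = ptgt Q q \<and> pcomp p q = (v, as)}"
      using qpaths_take[OF r] qpaths_drop[OF r] by (auto simp: pcomp_def psrc_def)
  qed
  moreover have "inj_on ?h {..length as}"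
    by (rule inj_onI) (metis atMost_iff length_take min.absorb2 prod.inject)
  ultimately show ?thesis
    by (simp add: path_algebra_def sum.reindex)
qed

lemma path_vec_closed: "p \<in> qpaths Q \<Longrightarrow> path_vec p \<in> carrier K"
  by (auto simp: K_carrier path_vec_def)

lemma path_vec_mult:
  assumes r: "(v, as @ bs) \<in> qpaths Q"
  shows "path_vec (end_vertex v as, bs) \<otimes>\<^bsub>K\<^esub> path_vec (v, as) = (path_vec (v, as @ bs) :: _ \<Rightarrow> 'k)"
proof
  fix s :: "('v, 'e) qpath"
  obtain w cs where s: "s = (w, cs)" by (cases s)
  show "(path_vec (end_vertex v as, bs) \<otimes>\<^bsub>K\<^esub> path_vec (v, as)) s = (path_vec (v, as @ bs) s :: 'k)"
  proof (cases "s \<in> qpaths Q")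
    case True
    have "path_vec (end_vertex v as, bs) (end_vertex w (take k cs), drop k cs) * path_vec (v, as) (w, take k cs) =
        (if k = length as then if s = (v, as @ bs) then 1 else 0 else 0 :: 'k)" if "k \<le> length cs" for k
    proof (cases "k = length as \<and> take k cs = as \<and> drop k cs = bs \<and> w = v")
      case True
      then have "cs = as @ bs" by (metis append_take_drop_id)
      then show ?thesis using True by (simp add: path_vec_def s)
    next
      case False
      then have "\<not> (k = length as \<and> s = (v, as @ bs))" by (auto simp: s)
      then have rhs: "(if k = length as then if s = (v, as @ bs) then 1 else 0 else 0 :: 'k) = 0" by simp
      have "take k cs = as \<Longrightarrow> k = length as" using that by auto
      then have "(w, take k cs) \<noteq> (v, as) \<or> (end_vertex w (take k cs), drop k cs) \<noteq> (end_vertex v as, bs)"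
        using False by blast
      then show ?thesis unfolding rhs unfolding path_vec_def by (elim disjE) (simp_all only: if_False mult_zero_left mult_zero_right)
    qed
    then have "(\<Sum>k\<le>length cs. path_vec (end_vertex v as, bs) (end_vertex w (take k cs), drop k cs) * path_vec (v, as) (w, take k cs)) =
        (\<Sum>k\<le>length cs. if k = length as then if s = (v, as @ bs) then 1 else 0 else 0 :: 'k)"
      by (intro sum.cong) auto
    then show ?thesis using True unfolding s by (subst K_mult) (auto simp: path_vec_def)
  next
    case False
    then show ?thesis using r by (auto simp: K_mult_eq_0 path_vec_def)
  qed
qed

lemma scaled_one_closed: "(\<lambda>p. c * \<one>\<^bsub>K\<^esub> p) \<in> carrier K"
  using one_closed unfolding K_carrier by (auto elim: rev_finite_subset)

lemma scaled_one_mult: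
  assumes f: "f \<in> carrier K"
  shows "(\<lambda>p. c * \<one>\<^bsub>K\<^esub> p) \<otimes>\<^bsub>K\<^esub> f = (\<lambda>p. c * f p)"
proof
  fix s :: "('v, 'e) qpath"
  obtain v as where s: "s = (v, as)" by (cases s)
  show "((\<lambda>p. c * \<one>\<^bsub>K\<^esub> p) \<otimes>\<^bsub>K\<^esub> f) s = c * f s"
  proof (cases "s \<in> qpaths Q")
    case True
    have "c * \<one>\<^bsub>K\<^esub> (end_vertex v (take k as), drop k as) * f (v, take k as) =
        (if k = length as then c * f s else 0)" if "k \<le> length as" for k
      using that True qpaths_drop[of v as k] by (auto simp: K_one s)
    then have "(\<Sum>k\<le>length as. c * \<one>\<^bsub>K\<^esub> (end_vertex v (take k as), drop k as) * f (v, take k as)) =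
        (\<Sum>k\<le>length as. if k = length as then c * f s else 0)"
      by (intro sum.cong) auto
    then show ?thesis using True unfolding s by (subst K_mult) auto
  next
    case False
    then have "f s = 0" using f unfolding K_carrier by blast
    then show ?thesis using False by (simp add: K_mult_eq_0)
  qed
qed

text \<open>
  The longer path is a product in the path algebra.
\<close>

lemma path_vec_in_I_left: "(v, as @ bs) \<in> qpaths Q \<Longrightarrow> path_vec (v, as) \<in> I \<Longrightarrow> path_vec (v, as @ bs) \<in> I"
  unfolding path_vec_mult[symmetric] by (intro I_l_closed path_vec_closed) (simp_all add: qpaths_append)

lemma path_vec_in_I_right:
  "(v, as @ bs) \<in> qpaths Q \<Longrightarrow> path_vec (end_vertex v as, bs) \<in> I \<Longrightarrow> path_vec (v, as @ bs) \<in> I"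
  unfolding path_vec_mult[symmetric] by (intro I_r_closed path_vec_closed) (simp_all add: qpaths_append)

lemma scaled_in_I: "f \<in> I \<Longrightarrow> (\<lambda>p. c * f p) \<in> I"
  using I_l_closed[OF _ scaled_one_closed, of f c] by (simp add: scaled_one_mult)

lemma in_I_if_supported:
  assumes "finite F" "\<And>r. r \<in> F \<Longrightarrow> path_vec r \<in> I" "{r. f r \<noteq> 0} \<subseteq> F"
  shows "f \<in> I"
  using assms
proof (induction F arbitrary: f rule: finite_induct)
  case empty
  then have "f = \<zero>\<^bsub>K\<^esub>" by (auto simp: K_zero)
  then show ?case using additive_subgroup.zero_closed[OF additive_subgroup_axioms] by simp
next
  case (insert r F)
  have "(\<lambda>s. if s = r then 0 else f s) \<in> I"
  proof (rule insert.IH)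
    show "path_vec s \<in> I" if "s \<in> F" for s using insert.prems(1) that by blast
    show "{s. (if s = r then 0 else f s) \<noteq> 0} \<subseteq> F" using insert.prems(2) by (auto split: if_splits)
  qed
  moreover have "(\<lambda>s. f r * path_vec r s) \<in> I" by (rule scaled_in_I[OF insert.prems(1)]) simp
  ultimately have "(\<lambda>s. if s = r then 0 else f s) \<oplus>\<^bsub>K\<^esub> (\<lambda>s. f r * path_vec r s) \<in> I"
    by (rule additive_subgroup.a_closed[OF additive_subgroup_axioms])
  moreover have "(\<lambda>s. if s = r then 0 else f s) \<oplus>\<^bsub>K\<^esub> (\<lambda>s. f r * path_vec r s) = f"
    by (auto simp: K_add path_vec_def)
  ultimately show ?case by simp
qed

text \<open>
  An ideal generated by paths is spanned by the paths in it: the elements all of whose paths lie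
  in \<open>I\<close> form an ideal containing the generators.
\<close>

theorem I_iff_supported: "f \<in> I \<longleftrightarrow> f \<in> carrier K \<and> (\<forall>r. f r \<noteq> 0 \<longrightarrow> path_vec r \<in> I)"
proof
  let ?J = "{f \<in> carrier K. \<forall>r. f r \<noteq> 0 \<longrightarrow> path_vec r \<in> I}"
  have J: "ideal ?J K"
  proof (rule idealI[OF ring_axioms], intro subgroup.intro)
    show "?J \<subseteq> carrier (add_monoid K)" by auto
    show "\<one>\<^bsub>add_monoid K\<^esub> \<in> ?J" using zero_closed by (simp add: K_zero)
    fix f g assume f: "f \<in> ?J"
    show "f \<otimes>\<^bsub>add_monoid K\<^esub> g \<in> ?J" if "g \<in> ?J"
    proof -
      have "path_vec r \<in> I" if "f r + g r \<noteq> 0" for r 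
      proof (cases "f r = 0")
        case True
        then have "g r \<noteq> 0" using that by simp
        then show ?thesis using \<open>g \<in> ?J\<close> by blast
      qed (use f in blast)
      moreover have "f \<oplus>\<^bsub>K\<^esub> g \<in> carrier K" using f that by (intro a_closed) auto
      ultimately show ?thesis by (simp add: K_add)
    qed
    have "\<ominus>\<^bsub>K\<^esub> f \<in> ?J" using f by (simp add: K_uminus)
    then show "inv\<^bsub>add_monoid K\<^esub> f \<in> ?J" by (simp add: a_inv_def)
  next
    fix f g assume f: "f \<in> ?J" and g: "g \<in> carrier K"
    have "path_vec r \<in> I" if nz: "(g \<otimes>\<^bsub>K\<^esub> f) r \<noteq> 0" for r
    proof -
      obtain v as where r: "r = (v, as)" by (cases r)
      have rQ: "(v, as) \<in> qpaths Q" using nz K_mult_eq_0 unfolding r by blast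
      obtain k where "f (v, take k as) \<noteq> 0" using nz unfolding r K_mult[OF rQ]
        by (metis (no_types, lifting) mult_zero_right sum.neutral)
      then have "path_vec (v, take k as) \<in> I" using f by blast
      then show ?thesis using path_vec_in_I_left[of v "take k as" "drop k as"] rQ unfolding r by simp
    qed
    then show "g \<otimes>\<^bsub>K\<^esub> f \<in> ?J" using f g by auto
    have "path_vec r \<in> I" if nz: "(f \<otimes>\<^bsub>K\<^esub> g) r \<noteq> 0" for r
    proof -
      obtain v as where r: "r = (v, as)" by (cases r)
      have rQ: "(v, as) \<in> qpaths Q" using nz K_mult_eq_0 unfolding r by blast
      obtain k where "f (end_vertex v (take k as), drop k as) \<noteq> 0" using nz unfolding r K_mult[OF rQ]
        by (metis (no_types, lifting) mult_zero_left sum.neutral)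
      then have "path_vec (end_vertex v (take k as), drop k as) \<in> I" using f by blast
      then show ?thesis using path_vec_in_I_right[of v "take k as" "drop k as"] rQ unfolding r by simp
    qed
    then show "f \<otimes>\<^bsub>K\<^esub> g \<in> ?J" using f g by auto
  qed
  have "path_vec ` S \<subseteq> carrier K" using S_paths path_vec_closed by blast
  then have "path_vec ` S \<subseteq> I" unfolding I_generated by (rule genideal_self)
  then have "path_vec ` S \<subseteq> ?J" using S_paths path_vec_closed by (auto simp: path_vec_def[abs_def] split: if_splits)
  then have "I \<subseteq> ?J" unfolding I_generated by (intro genideal_minimal J[unfolded I_generated])
  then show "f \<in> carrier K \<and> (\<forall>r. f r \<noteq> 0 \<longrightarrow> path_vec r \<in> I)" if "f \<in> I" using that by blast
next
  assume "f \<in> carrier K \<and> (\<forall>r. f r \<noteq> 0 \<longrightarrow> path_vec r \<in> I)"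
  then show "f \<in> I" using in_I_if_supported[of "{r. f r \<noteq> 0}" f] by (auto simp: K_carrier)
qed

text \<open>
  A path of length \<open>n\<close> is a product of \<open>n\<close> arrows.
\<close>

lemma arrow_ideal_pow:
  "(v, as) \<in> qpaths Q \<Longrightarrow>
    (path_vec (v, as) :: _ \<Rightarrow> 'k) \<in> arrow_ideal Q [^]\<^bsub>ideals_set K\<^esub> length as"
proof (induction as arbitrary: v)
  case Nil
  then show ?case using path_vec_closed by (simp add: ideals_set_def)
next
  case (Cons a as)
  have *: "(v, [a]) \<in> qpaths Q" "(end_vertex v [a], as) \<in> qpaths Q"
    using Cons.prems qpaths_append[of v "[a]" as] by simp_all
  have va: "a \<in> arcs Q" "v = tail Q a"
    using *(1) by (simp_all add: qpaths_def psrc_def awalk_Cons_iff)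
  have "{path_vec (tail Q a, [a]) | a. a \<in> arcs Q} \<subseteq> carrier K"
    by (auto simp: K_carrier path_vec_def qpaths_def psrc_def ptgt_def awalk_Cons_iff awalk_Nil_iff split: if_splits)
  then have "(path_vec (v, [a]) :: _ \<Rightarrow> 'k) \<in> arrow_ideal Q"
    unfolding arrow_ideal_def using genideal_self va by blast
  then have "path_vec (end_vertex v [a], as) \<otimes>\<^bsub>K\<^esub> path_vec (v, [a]) \<in>
      arrow_ideal Q [^]\<^bsub>ideals_set K\<^esub> length (a # as)"
    using ideal_prod.prod[OF Cons.IH[OF *(2)]] by (simp add: ideals_set_def)
  then show ?case using path_vec_mult[of v "[a]" as] Cons.prems by simp
qed

lemma long_path_in_I: "(v, as) \<in> qpaths Q \<Longrightarrow> d \<le> length as \<Longrightarrow> path_vec (v, as) \<in> I"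
  using path_vec_in_I_left[of v "take d as" "drop d as"] arrow_ideal_pow[OF qpaths_take, of v as d] nilpotent
  by auto

definition nonzero_paths :: "('v, 'e) qpath set" where
  "nonzero_paths = {r. nonzero_path Q I r}"

text \<open>
  The coefficient is read off from an arbitrary representative of the coset; at a nonzero path all representatives
  agree since elements of \<open>I\<close> do not involve it.
\<close>

definition coeff :: "(('v, 'e) qpath \<Rightarrow> 'k) set \<Rightarrow> ('v, 'e) qpath \<Rightarrow> 'k" where
  "coeff x r = (if r \<in> nonzero_paths then (SOME f. f \<in> x) r else 0)"

lemma finite_nonzero_paths: "finite nonzero_paths"
proof (rule finite_subset)
  show "nonzero_paths \<subseteq> verts Q \<times> {as. set as \<subseteq> arcs Q \<and> length as \<le> d}"
  proof
    fix r assume "r \<in> nonzero_paths"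
    then have r: "(fst r, snd r) \<in> qpaths Q" "path_vec (fst r, snd r) \<notin> I" by (simp_all add: nonzero_paths_def nonzero_path_def)
    then have "length (snd r) \<le> d" using long_path_in_I[of "fst r" "snd r"] by linarith
    moreover have "fst r \<in> verts Q" "set (snd r) \<subseteq> arcs Q" using r(1) by (auto simp: qpaths_def psrc_def awalk_def)
    ultimately show "r \<in> verts Q \<times> {as. set as \<subseteq> arcs Q \<and> length as \<le> d}" by (simp add: mem_Times_iff)
  qed
qed (simp add: finite_lists_length_le)

lemma nonzero_paths_append:
  "(v, as @ bs) \<in> nonzero_paths \<Longrightarrow> (v, as) \<in> nonzero_paths \<and> (end_vertex v as, bs) \<in> nonzero_paths"
  using qpaths_append path_vec_in_I_left path_vec_in_I_right
  unfolding nonzero_paths_def nonzero_path_def mem_Collect_eq by blast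

lemma coeff_coset:
  assumes f: "f \<in> carrier K"
  shows "coeff (I +>\<^bsub>K\<^esub> f) r = (if r \<in> nonzero_paths then f r else 0)"
proof -
  have "f \<in> I +>\<^bsub>K\<^esub> f" by (rule a_rcos_self[OF f])
  then have "(SOME g. g \<in> I +>\<^bsub>K\<^esub> f) \<in> I +>\<^bsub>K\<^esub> f" by (rule someI[of "\<lambda>g. g \<in> I +>\<^bsub>K\<^esub> f"])
  then obtain i where i: "i \<in> I" "(SOME g. g \<in> I +>\<^bsub>K\<^esub> f) = (\<lambda>p. i p + f p)"
    by (auto simp: a_r_coset_def' K_add)
  have "i r = 0" if "r \<in> nonzero_paths"
    using i(1) that unfolding I_iff_supported[of i] nonzero_paths_def nonzero_path_def by blast
  then show ?thesis by (simp add: coeff_def i(2))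
qed

lemma carrier_quiver_algebra: "carrier (quiver_algebra Q I) = (\<lambda>f. I +>\<^bsub>K\<^esub> f) ` carrier K"
  by (auto simp: quiver_algebra_def FactRing_def A_RCOSETS_def')

text \<open>
  The classes of the nonzero paths are a basis of the quotient: two elements with the same coefficients
  at the nonzero paths differ by an element supported on paths of \<open>I\<close>.
\<close>

sublocale mono: monomial_algebra "quiver_algebra Q I" "quiver_algebra_scalar Q I" nonzero_paths end_vertex coeff
proof (intro monomial_algebra.intro monomial_algebra_axioms.intro)
  let ?A = "quiver_algebra Q I"
  show "ring ?A" unfolding quiver_algebra_def by (rule quotient_is_ring)
  show "finite nonzero_paths" by (rule finite_nonzero_paths)
  show "end_vertex v [] = v" for v by (rule end_vertex_Nil)
  show "end_vertex v (as @ bs) = end_vertex (end_vertex v as) bs" for v as bs by (rule end_vertex_append)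
  show "(v, as) \<in> nonzero_paths \<and> (end_vertex v as, bs) \<in> nonzero_paths" if "(v, as @ bs) \<in> nonzero_paths" for v as bs
    by (rule nonzero_paths_append[OF that])
  show "coeff x r = 0" if "r \<notin> nonzero_paths" for x r using that by (simp add: coeff_def)
  show "x = y" if x: "x \<in> carrier ?A" and y: "y \<in> carrier ?A" and eq: "coeff x = coeff y" for x y
  proof -
    obtain f g where f: "f \<in> carrier K" "x = I +>\<^bsub>K\<^esub> f" and g: "g \<in> carrier K" "y = I +>\<^bsub>K\<^esub> g"
      using x y unfolding carrier_quiver_algebra by blast
    have "f r = g r" if "r \<in> nonzero_paths" for r
      using fun_cong[OF eq, of r] that f g by (simp add: coeff_coset)
    moreover have "(f \<ominus>\<^bsub>K\<^esub> g) r = f r - g r" for r using g(1) by (simp add: a_minus_def K_add K_uminus)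
    ultimately have "(f \<ominus>\<^bsub>K\<^esub> g) r \<noteq> 0 \<Longrightarrow> r \<notin> nonzero_paths" for r by fastforce
    moreover have "(f \<ominus>\<^bsub>K\<^esub> g) r \<noteq> 0 \<Longrightarrow> r \<in> qpaths Q" for r using minus_closed[OF f(1) g(1)] unfolding K_carrier by blast
    ultimately have "f \<ominus>\<^bsub>K\<^esub> g \<in> I"
      unfolding I_iff_supported[of "f \<ominus>\<^bsub>K\<^esub> g"] nonzero_paths_def nonzero_path_def
      using minus_closed[OF f(1) g(1)] by blast
    then show ?thesis using quotient_eq_iff_same_a_r_cos[OF is_ideal f(1) g(1)] f(2) g(2) by simp
  qed
  show "\<exists>x\<in>carrier ?A. coeff x = g" if g: "\<And>r. r \<notin> nonzero_paths \<Longrightarrow> g r = 0" for g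
  proof -
    have "{r. g r \<noteq> 0} \<subseteq> nonzero_paths" using g by blast
    then have gK: "g \<in> carrier K"
      using finite_subset[OF _ finite_nonzero_paths] by (auto simp: K_carrier nonzero_paths_def nonzero_path_def)
    then have "coeff (I +>\<^bsub>K\<^esub> g) = g" using g by (auto simp: coeff_coset fun_eq_iff)
    then show ?thesis using gK carrier_quiver_algebra by blast
  qed
  show "coeff (x \<oplus>\<^bsub>?A\<^esub> y) r = coeff x r + coeff y r" if x: "x \<in> carrier ?A" and y: "y \<in> carrier ?A" for x y r
  proof -
    obtain f g where f: "f \<in> carrier K" "x = I +>\<^bsub>K\<^esub> f" and g: "g \<in> carrier K" "y = I +>\<^bsub>K\<^esub> g"
      using x y unfolding carrier_quiver_algebra by blast
    have "x \<oplus>\<^bsub>?A\<^esub> y = I +>\<^bsub>K\<^esub> (f \<oplus>\<^bsub>K\<^esub> g)"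
      unfolding f(2) g(2) by (simp add: quiver_algebra_def FactRing_def a_rcos_sum[OF f(1) g(1)])
    then show ?thesis using f g a_closed[OF f(1) g(1)] by (simp add: coeff_coset) (simp add: K_add)
  qed
  show "coeff (x \<otimes>\<^bsub>?A\<^esub> y) (v, as) = (\<Sum>k\<le>length as. coeff x (end_vertex v (take k as), drop k as) * coeff y (v, take k as))"
    if x: "x \<in> carrier ?A" and y: "y \<in> carrier ?A" and r: "(v, as) \<in> nonzero_paths" for x y v as
  proof -
    obtain f g where f: "f \<in> carrier K" "x = I +>\<^bsub>K\<^esub> f" and g: "g \<in> carrier K" "y = I +>\<^bsub>K\<^esub> g"
      using x y unfolding carrier_quiver_algebra by blast
    have "x \<otimes>\<^bsub>?A\<^esub> y = I +>\<^bsub>K\<^esub> (f \<otimes>\<^bsub>K\<^esub> g)"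
      unfolding f(2) g(2) by (simp add: quiver_algebra_def FactRing_def rcoset_mult_add[OF f(1) g(1)])
    moreover have "(v, take k as) \<in> nonzero_paths \<and> (end_vertex v (take k as), drop k as) \<in> nonzero_paths" for k
      using nonzero_paths_append[of v "take k as" "drop k as"] r by simp
    moreover have "(v, as) \<in> qpaths Q" using r by (simp add: nonzero_paths_def nonzero_path_def)
    ultimately show ?thesis using f g r m_closed[OF f(1) g(1)] by (simp add: coeff_coset K_mult)
  qed
  show "coeff \<one>\<^bsub>?A\<^esub> r = (if r \<in> nonzero_paths \<and> snd r = [] then 1 else 0)" for r
  proof -
    have "\<one>\<^bsub>?A\<^esub> = I +>\<^bsub>K\<^esub> \<one>\<^bsub>K\<^esub>" by (simp add: quiver_algebra_def FactRing_def)
    then show ?thesis by (auto simp: coeff_coset K_one nonzero_paths_def nonzero_path_def)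
  qed
  show "quiver_algebra_scalar Q I c \<in> carrier ?A" for c
    using scaled_one_closed by (simp add: quiver_algebra_scalar_def carrier_quiver_algebra)
  show "coeff (quiver_algebra_scalar Q I c) r = (if r \<in> nonzero_paths \<and> snd r = [] then c else 0)" for c r
    unfolding quiver_algebra_scalar_def coeff_coset[OF scaled_one_closed]
    by (auto simp: K_one nonzero_paths_def nonzero_path_def)
qed

lemma tgt_eq: "mono.tgt p = ptgt Q p" by (simp add: mono.tgt_def)

lemma path_class_eq: "p \<in> nonzero_paths \<Longrightarrow> path_class Q I p = mono.pv p"
proof (rule mono.cf_inj)
  assume p: "p \<in> nonzero_paths"
  then have pK: "path_vec p \<in> carrier K" by (intro path_vec_closed) (simp add: nonzero_paths_def nonzero_path_def)
  then show "path_class Q I p \<in> carrier (quiver_algebra Q I)" by (simp add: path_class_def carrier_quiver_algebra)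
  show "coeff (path_class Q I p) = coeff (mono.pv p)"
    unfolding path_class_def fun_eq_iff coeff_coset[OF pK] mono.cf_pv using p by (simp add: path_vec_def)
qed simp

lemma zero_path_pcomp_iff:
  assumes "p \<in> nonzero_paths" "q \<in> nonzero_paths" "psrc p = ptgt Q q"
  shows "zero_path Q I (pcomp p q) \<longleftrightarrow> (fst q, snd q @ snd p) \<notin> nonzero_paths"
proof -
  have "(fst q, snd q @ snd p) \<in> qpaths Q"
    using assms by (simp add: qpaths_append psrc_def nonzero_paths_def nonzero_path_def) (metis prod.collapse)
  then show ?thesis by (simp add: zero_path_def pcomp_def psrc_def nonzero_paths_def nonzero_path_def)
qed

lemma right_factor_iff:
  assumes "q' \<in> nonzero_paths"
  shows "(\<exists>q''\<in>qpaths Q. psrc q = ptgt Q q'' \<and> q' = pcomp q q'') \<longleftrightarrow>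
    (\<exists>as. q' = (fst q', as @ snd q) \<and> end_vertex (fst q') as = fst q)" (is "?L \<longleftrightarrow> ?R")
proof
  assume ?L
  then show ?R by (auto simp: psrc_def pcomp_def)
next
  assume ?R
  then obtain as where as: "q' = (fst q', as @ snd q)" "end_vertex (fst q') as = fst q" by blast
  moreover have "(fst q', as) \<in> qpaths Q"
    using assms as(1) nonzero_paths_append[of "fst q'" as "snd q"] by (simp add: nonzero_paths_def nonzero_path_def)
  ultimately show ?L by (intro bexI[of _ "(fst q', as)"]) (auto simp: psrc_def pcomp_def)
qed

lemma left_factor_iff:
  assumes "p' \<in> nonzero_paths" "fst p' = fst p"
  shows "(\<exists>p''\<in>qpaths Q. psrc p'' = ptgt Q p \<and> p' = pcomp p'' p) \<longleftrightarrow> (\<exists>bs. snd p' = snd p @ bs)" (is "?L \<longleftrightarrow> ?R")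
proof
  assume ?L
  then show ?R by (auto simp: pcomp_def)
next
  assume ?R
  then obtain bs where bs: "p' = (fst p, snd p @ bs)" using assms(2) by (metis prod.collapse)
  then have "(ptgt Q p, bs) \<in> qpaths Q"
    using assms(1) nonzero_paths_append[of "fst p" "snd p" bs] by (simp add: nonzero_paths_def nonzero_path_def)
  then show ?L using bs by (intro bexI[of _ "(ptgt Q p, bs)"]) (auto simp: psrc_def pcomp_def)
qed

lemma perfect_pair_iff: "perfect_pair Q I p q \<longleftrightarrow> mono.ppair p q"
proof (cases "p \<in> nonzero_paths \<and> q \<in> nonzero_paths \<and> psrc p = ptgt Q q")
  case True
  then have pq: "p \<in> nonzero_paths" "q \<in> nonzero_paths" "psrc p = ptgt Q q" "fst p = ptgt Q q"
    by (simp_all add: psrc_def)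
  have mem: "nonzero_path Q I r \<longleftrightarrow> r \<in> nonzero_paths" for r by (simp add: nonzero_paths_def)
  have right: "(nonzero_path Q I q' \<and> ptgt Q q' = psrc p \<and> zero_path Q I (pcomp p q') \<longrightarrow>
        (\<exists>q''\<in>qpaths Q. psrc q = ptgt Q q'' \<and> q' = pcomp q q'')) \<longleftrightarrow>
      (q' \<in> nonzero_paths \<longrightarrow> ptgt Q q' = fst p \<and> (fst q', snd q' @ snd p) \<notin> nonzero_paths \<longrightarrow>
        (\<exists>as. q' = (fst q', as @ snd q) \<and> end_vertex (fst q') as = fst q))" for q'
    using right_factor_iff[of q' q] zero_path_pcomp_iff[OF pq(1), of q'] unfolding mem by (auto simp: psrc_def)
  have left: "(nonzero_path Q I p' \<and> psrc p' = ptgt Q q \<and> zero_path Q I (pcomp p' q) \<longrightarrow>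
        (\<exists>p''\<in>qpaths Q. psrc p'' = ptgt Q p \<and> p' = pcomp p'' p)) \<longleftrightarrow>
      (p' \<in> nonzero_paths \<longrightarrow> fst p' = ptgt Q q \<and> (fst q, snd q @ snd p') \<notin> nonzero_paths \<longrightarrow>
        (\<exists>bs. snd p' = snd p @ bs))" for p'
    using left_factor_iff[of p' p] zero_path_pcomp_iff[OF _ pq(2), of p'] pq(4) unfolding mem by (auto simp: psrc_def)
  have len: "1 \<le> plength r \<longleftrightarrow> snd r \<noteq> []" for r :: "('v, 'e) qpath"
    by (cases "snd r") (simp_all add: plength_def)
  show ?thesis
    unfolding perfect_pair_def right left unfolding mono.ppair_def Ball_def tgt_eq len zero_path_pcomp_iff[OF pq(1-3)] mem
    using pq by simp
next
  case False
  have "\<not> perfect_pair Q I p q" using False unfolding perfect_pair_def nonzero_paths_def by blast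
  moreover have "\<not> mono.ppair p q" using False unfolding mono.ppair_def tgt_eq psrc_def by blast
  ultimately show ?thesis by blast
qed

lemma perfect_path_iff: "perfect_path Q I p \<longleftrightarrow> mono.perfect p"
proof
  show "mono.perfect p" if "perfect_path Q I p"
    using that unfolding perfect_path_def mono.perfect_def perfect_pair_iff by blast
  assume "mono.perfect p"
  then obtain n :: nat and ps where ps: "n \<ge> 1" "ps 1 = p" "ps (n + 1) = p" "\<forall>i\<in>{1..n}. mono.ppair (ps i) (ps (i + 1))"
    unfolding mono.perfect_def by blast
  have B: "nonzero_path Q I (ps i)" if "i \<in> {1..n}" for i
  proof -
    have "ps i \<in> nonzero_paths" using bspec[OF ps(4) that] unfolding mono.ppair_def by blast
    then show ?thesis by (simp add: nonzero_paths_def)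
  qed
  have p: "nonzero_path Q I p" using B[of 1] ps(1,2) by simp
  moreover have "nonzero_path Q I (ps i)" if "i \<in> {1..n + 1}" for i
    using that B p ps(3) by (cases "i = n + 1") auto
  ultimately show "perfect_path Q I p" unfolding perfect_path_def perfect_pair_iff using ps by blast
qed

lemma path_module_perfect: "perfect_path Q I p \<Longrightarrow> path_module Q I p = mono.path_mod p"
  using path_class_eq unfolding path_module_def perfect_path_def by (simp add: nonzero_paths_def)

theorem perfect_paths_classification:
  "bij_betw (\<lambda>p. stable_class (quiver_algebra Q I) (quiver_algebra_scalar Q I) (path_module Q I p))
     {p. perfect_path Q I p} (ind_stable_Gproj (quiver_algebra Q I) (quiver_algebra_scalar Q I))"
  "bij_betw (\<lambda>p. iso_class (quiver_algebra Q I) (quiver_algebra_scalar Q I) (path_module Q I p))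
     {p. perfect_path Q I p} (ind_nonproj_Gproj (quiver_algebra Q I) (quiver_algebra_scalar Q I))"
proof -
  have "bij_betw (\<lambda>p. F (path_module Q I p)) {p. perfect_path Q I p} X"
    if "bij_betw (\<lambda>p. F (mono.path_mod p)) {p. mono.perfect p} X" for F :: "_ \<Rightarrow> 'z" and X
    using that unfolding perfect_path_iff[symmetric]
    by (subst bij_betw_cong[of _ _ "\<lambda>p. F (mono.path_mod p)"]) (simp_all only: path_module_perfect mem_Collect_eq)
  from this[OF mono.perfect_paths_stable_classes] this[OF mono.perfect_paths_iso_classes] show
    "bij_betw (\<lambda>p. stable_class (quiver_algebra Q I) (quiver_algebra_scalar Q I) (path_module Q I p))
       {p. perfect_path Q I p} (ind_stable_Gproj (quiver_algebra Q I) (quiver_algebra_scalar Q I))"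
    "bij_betw (\<lambda>p. iso_class (quiver_algebra Q I) (quiver_algebra_scalar Q I) (path_module Q I p))
       {p. perfect_path Q I p} (ind_nonproj_Gproj (quiver_algebra Q I) (quiver_algebra_scalar Q I))"
    by simp_all
qed

end

theorem theorem4p1:
  fixes Q :: "('v, 'e) pre_digraph"
    and I :: "(('v, 'e) qpath \<Rightarrow> 'k::field) set"
  assumes "fin_digraph Q"
    and "monomial_ideal Q I"
  shows
    "bij_betw (\<lambda>p. stable_class (quiver_algebra Q I) (quiver_algebra_scalar Q I) (path_module Q I p))
       {p. perfect_path Q I p}
       (ind_stable_Gproj (quiver_algebra Q I) (quiver_algebra_scalar Q I)) \<and>
     bij_betw (\<lambda>p. iso_class (quiver_algebra Q I) (quiver_algebra_scalar Q I) (path_module Q I p))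
       {p. perfect_path Q I p}
       (ind_nonproj_Gproj (quiver_algebra Q I) (quiver_algebra_scalar Q I))"
proof -
  obtain S d where "S \<subseteq> qpaths Q" "I = Idl\<^bsub>path_algebra Q\<^esub> (path_vec ` S)" "ideal I (path_algebra Q)"
    "arrow_ideal Q [^]\<^bsub>ideals_set (path_algebra Q)\<^esub> (d :: nat) \<subseteq> I"
    using assms(2) unfolding monomial_ideal_def admissible_ideal_def by blast
  then interpret monomial_quiver_algebra Q I S d
    using assms(1) by (intro monomial_quiver_algebra.intro monomial_quiver_algebra_axioms.intro)
  show ?thesis using perfect_paths_classification by blast
qed

end
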